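(* Let $f=\frac PQe^{S/T}$ with associated data as in the context. For all sufficiently large $n$, define $$\nu_n:=\frac1{\deg B_n}\sum_{\substack{\zeta\in\mathbb C\setminus\Sigma\\ f^{(n)}(\zeta)=0}}\operatorname{mult}_\zeta(f^{(n)})\,\delta_\zeta,\qquad \mu_n:=\frac1{\deg B_n}\sum_{B_n(\zeta)=0}\operatorname{mult}_\zeta(B_n)\,\delta_\zeta .$$ Then $\nu_n=\mu_n$. Consequently, with $$\mu_{\mathrm{fix}}=\frac1\kappa\sum_{j=1}^{\check t}m_j\,\delta_{c_j}+\frac1{2\pi\kappa}\sum_{1\le i<j\le N}\frac{|a_i-a_j|}{|\cdot-a_i|\,|\cdot-a_j|}\,d\ell\big|_{E_{ij}}$$ ($d\ell$ is arclength; an empty edge contributes zero), $\nu_n$ converges vaguely on $\mathbb C$ to $\mu_{\mathrm{fix}}$; if $h=0$ then $\nu_n$ converges weakly on $\mathbb C$ to $\mu_{\mathrm{fix}}$; and if $h>0$ then $\nu_n$, regarded as measures on $\widehat{\mathbb C}$ with no mass at $\infty$, converge weakly on $\widehat{\mathbb C}$ to $\mu_{\mathrm{fix}}+\frac h\kappa\delta_\infty$.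
   Context: Hyperexponential setup. Let $P,Q,S,T\in\mathbb C[z]$ with $P,Q\ne0$, $\gcd(P,Q)=\gcd(S,T)=1$, $T$ nonconstant, and $f=\frac PQ\exp(S/T)$. Normalizations: $T$ is monic; $Q=1$ if $Q$ is constant and $Q$ is monic otherwise; either $P/Q\equiv1$ or $P/Q$ is nonconstant. $\mathcal Z(R)$ is the set of distinct finite zeros of a polynomial $R$. Write $E=S/T=H+M/T$ with $H,M$ polynomials and $\deg M<\deg T$; $h=\deg H$ if $H$ is nonconstant and $h=0$ otherwise. $T$ has distinct zeros $c_1,\dots,c_{\check t}$ with multiplicities $m_1,\dots,m_{\check t}$; $b_1,\dots,b_{\check q}$ are the distinct zeros of $Q$ that are not zeros of $T$. Put $P_T=\prod_j(z-c_j)^{\operatorname{ord}_{c_j}P}$, $P_\sharp=P/P_T$, $W=\prod_j(z-c_j)^{m_j+1}\prod_k(z-b_k)$, $d=\deg W$, $\kappa=d+h-1$, $\Sigma=\mathcal Z(T)\cup\mathcal Z(Q)=\{a_1,\dots,a_N\}$ with $a_1,\dots,a_N$ distinct, $\Lambda=E'+P_T'/P_T-Q'/Q$, $U=W\Lambda$ (a polynomial). Define $B_0=P_\sharp$, $B_{n+1}=WB_n'+(U-nW')B_n$; these are nonzero polynomials, $\deg B_n>0$ for all large $n$, and $f^{(n)}=\frac{P_TB_n}{QW^n}e^E$. Voronoi notation: $\mathcal V_i=\{z:|z-a_i|\le|z-a_j|\ \forall j\}$; $E_{ij}=\mathcal V_i\cap\mathcal V_j$ if this is one-dimensional, $E_{ij}=\varnothing$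 otherwise. Vague convergence on $\mathbb C$ means convergence against continuous compactly supported functions; weak convergence on $\mathbb C$ (resp. on the Riemann sphere $\widehat{\mathbb C}$) means convergence against bounded continuous functions (resp. continuous functions on $\widehat{\mathbb C}$). *)

theory Defs
  imports "HOL-Complex_Analysis.Complex_Analysis" "HOL-Computational_Algebra.Computational_Algebra"
begin

definition add_measure :: "'a measure \<Rightarrow> 'a measure \<Rightarrow> 'a measure" where
  "add_measure M M' = measure_of (space M) (sets M) (\<lambda>A. emeasure M A + emeasure M' A)"

text \<open>The second argument only supplies the space and the sigma-algebra.\<close>

definition sum_measure :: "'i set \<Rightarrow> 'a measure \<Rightarrow> ('i \<Rightarrow> 'a measure) \<Rightarrow> 'a measure" where
  "sum_measure I M0 M = measure_of (space M0) (sets M0) (\<lambda>A. \<Sum>i\<in>I. emeasure (M i) A)"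

lemma emeasure_add_measure:
  assumes "sets M' = sets M" "A \<in> sets M"
  shows "emeasure (add_measure M M') A = emeasure M A + emeasure M' A"
  unfolding add_measure_def
proof (rule emeasure_measure_of_sigma)
  show "countably_additive (sets M) (\<lambda>A. emeasure M A + emeasure M' A)"
  proof (rule countably_additiveI)
    fix X :: "nat \<Rightarrow> 'a set"
    assume X: "range X \<subseteq> sets M" "disjoint_family X"
    show "(\<Sum>i. emeasure M (X i) + emeasure M' (X i)) =
        emeasure M (\<Union>i. X i) + emeasure M' (\<Union>i. X i)"
      using X assms(1) by (simp add: suminf_add[symmetric] suminf_emeasure)
  qed
qed (auto simp: positive_def sets.sigma_algebra_axioms assms)

lemma emeasure_sum_measure:
  fixes M :: "'i \<Rightarrow> 'a measure"
  assumes "\<And>i. i \<in> I \<Longrightarrow> sets (M i) = sets M0" "A \<in> sets M0"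
  shows "emeasure (sum_measure I M0 M) A = (\<Sum>i\<in>I. emeasure (M i) A)"
  unfolding sum_measure_def
proof (rule emeasure_measure_of_sigma)
  show "countably_additive (sets M0) (\<lambda>A. \<Sum>i\<in>I. emeasure (M i) A)"
  proof (rule countably_additiveI)
    fix X :: "nat \<Rightarrow> 'a set"
    assume X: "range X \<subseteq> sets M0" "disjoint_family X"
    have "(\<Sum>n. \<Sum>i\<in>I. emeasure (M i) (X n)) = (\<Sum>i\<in>I. \<Sum>n. emeasure (M i) (X n))"
      by (rule suminf_sum) simp
    also have "\<dots> = (\<Sum>i\<in>I. emeasure (M i) (\<Union>n. X n))"
      using X assms(1) by (intro sum.cong refl suminf_emeasure) auto
    finally show "(\<Sum>n. \<Sum>i\<in>I. emeasure (M i) (X n)) = (\<Sum>i\<in>I. emeasure (M i) (\<Union>n. X n))" .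
  qed
qed (auto simp: positive_def sets.sigma_algebra_axioms assms)

text \<open>The measure \<open>\<Sum>z\<in>Z. w z \<cdot> \<delta>\<^sub>z\<close> on the sigma-algebra of \<open>M0\<close>.\<close>

definition atomic_measure :: "'a measure \<Rightarrow> 'a set \<Rightarrow> ('a \<Rightarrow> real) \<Rightarrow> 'a measure" where
  "atomic_measure M0 Z w = distr (point_measure Z (\<lambda>z. ennreal (w z))) M0 (\<lambda>z. z)"

text \<open>
  Arclength on the perpendicular bisector of two distinct points \<open>p\<close> and \<open>q\<close>: the image of
  Lebesgue measure under the unit-speed parametrization of that line.
\<close>

definition bisector_arclength :: "complex \<Rightarrow> complex \<Rightarrow> complex measure" where
  "bisector_arclength p q =
     distr lborel borel (\<lambda>t::real. (p + q) / 2 + of_real t * (\<i> * sgn (q - p)))"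

text \<open>
  The Bochner integral of a non-integrable function is 0; finiteness (on compact sets, in the vague
  case) is therefore part of the notions below, so that all test functions are integrable.
\<close>

definition vaguely_converges :: "(nat \<Rightarrow> complex measure) \<Rightarrow> complex measure \<Rightarrow> bool" where
  "vaguely_converges M M' \<longleftrightarrow>
     (\<forall>\<^sub>F n in sequentially. sets (M n) = sets borel \<and>
        (\<forall>K. compact K \<longrightarrow> emeasure (M n) K < \<infinity>)) \<and>
     sets M' = sets borel \<and> (\<forall>K. compact K \<longrightarrow> emeasure M' K < \<infinity>) \<and>
     (\<forall>g :: complex \<Rightarrow> real. continuous_on UNIV g \<longrightarrow> compact (closure {z. g z \<noteq> 0}) \<longrightarrow>
        (\<lambda>n. integral\<^sup>L (M n) g) \<longlonglongrightarrow> integral\<^sup>L M' g)"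

definition weakly_converges :: "(nat \<Rightarrow> complex measure) \<Rightarrow> complex measure \<Rightarrow> bool" where
  "weakly_converges M M' \<longleftrightarrow>
     (\<forall>\<^sub>F n in sequentially. sets (M n) = sets borel \<and> finite_measure (M n)) \<and>
     sets M' = sets borel \<and> finite_measure M' \<and>
     (\<forall>g :: complex \<Rightarrow> real. continuous_on UNIV g \<longrightarrow> bounded (range g) \<longrightarrow>
        (\<lambda>n. integral\<^sup>L (M n) g) \<longlonglongrightarrow> integral\<^sup>L M' g)"

text \<open>The Riemann sphere is the one-point compactification of the plane; \<open>None\<close> is infinity.\<close>

definition riemann_sphere :: "complex option topology" where
  "riemann_sphere = Alexandroff_compactification euclidean"

definition sphere_borel :: "complex option measure" where
  "sphere_borel = sigma (topspace riemann_sphere) {U. openin riemann_sphere U}"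

definition sphere_measure :: "complex measure \<Rightarrow> complex option measure" where
  "sphere_measure M = distr M sphere_borel Some"

definition sphere_weakly_converges ::
  "(nat \<Rightarrow> complex option measure) \<Rightarrow> complex option measure \<Rightarrow> bool" where
  "sphere_weakly_converges M M' \<longleftrightarrow>
     (\<forall>\<^sub>F n in sequentially. sets (M n) = sets sphere_borel \<and> finite_measure (M n)) \<and>
     sets M' = sets sphere_borel \<and> finite_measure M' \<and>
     (\<forall>g. continuous_map riemann_sphere euclideanreal g \<longrightarrow>
        (\<lambda>n. integral\<^sup>L (M n) g) \<longlonglongrightarrow> integral\<^sup>L M' g)"

lemma measurable_Some_sphere: "Some \<in> borel \<rightarrow>\<^sub>M sphere_borel"
  unfolding sphere_borel_def
proof (rule measurable_measure_of)
  show "{U. openin riemann_sphere U} \<subseteq> Pow (topspace riemann_sphere)"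
    by (auto dest: openin_subset)
  show "Some \<in> space borel \<rightarrow> topspace riemann_sphere"
    by (auto simp: riemann_sphere_def)
  fix V assume "V \<in> {U. openin riemann_sphere U}"
  then have "openin (Alexandroff_compactification euclidean) V"
    by (simp add: riemann_sphere_def)
  then have "open {z. Some z \<in> V}"
    by (auto simp: openin_Alexandroff_compactification image_iff Compl_eq[symmetric]
        compact_imp_closed open_Compl)
  then show "Some -` V \<inter> space borel \<in> sets borel" by (simp add: vimage_def)
qed

definition voronoi_cell :: "(nat \<Rightarrow> complex) \<Rightarrow> nat \<Rightarrow> nat \<Rightarrow> complex set" where
  "voronoi_cell a N i = {z. \<forall>j\<in>{1..N}. norm (z - a i) \<le> norm (z - a j)}"

definition voronoi_edge :: "(nat \<Rightarrow> complex) \<Rightarrow> nat \<Rightarrow> nat \<Rightarrow> nat \<Rightarrow> complex set" where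
  "voronoi_edge a N i j =
     (if aff_dim (voronoi_cell a N i \<inter> voronoi_cell a N j) = 1
      then voronoi_cell a N i \<inter> voronoi_cell a N j else {})"

text \<open>
  The edge lies on the perpendicular bisector of \<open>a i\<close> and \<open>a j\<close>, so restricting
  the arclength of that line to it gives the arclength of the edge.
\<close>

definition edge_measure :: "(nat \<Rightarrow> complex) \<Rightarrow> nat \<Rightarrow> nat \<Rightarrow> nat \<Rightarrow> complex measure" where
  "edge_measure a N i j = density (bisector_arclength (a i) (a j))
     (\<lambda>z. ennreal (norm (a i - a j) / (norm (z - a i) * norm (z - a j))) *
          indicator (voronoi_edge a N i j) z)"

definition zeros :: "complex poly \<Rightarrow> complex set" where
  "zeros R = {z. poly R z = 0}"

locale hyperexponential =
  fixes P Q S T :: "complex poly"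
  assumes P_nz: "P \<noteq> 0" and Q_nz: "Q \<noteq> 0"
    and coprime_PQ: "coprime P Q" and coprime_ST: "coprime S T"
    and T_nonconst: "degree T > 0"
    and T_monic: "lead_coeff T = 1"
    and Q_const: "degree Q = 0 \<Longrightarrow> Q = 1"
    and Q_monic: "degree Q > 0 \<Longrightarrow> lead_coeff Q = 1"
    and PQ_normalized: "P = Q \<or> \<not> (\<exists>c. P = smult c Q)"

definition hyp_f :: "complex poly \<Rightarrow> complex poly \<Rightarrow> complex poly \<Rightarrow> complex poly \<Rightarrow> complex \<Rightarrow> complex" where
  "hyp_f P Q S T z = poly P z / poly Q z * exp (poly S z / poly T z)"

definition sing :: "complex poly \<Rightarrow> complex poly \<Rightarrow> complex set" where
  "sing Q T = zeros T \<union> zeros Q"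

definition P_T :: "complex poly \<Rightarrow> complex poly \<Rightarrow> complex poly" where
  "P_T P T = (\<Prod>c\<in>zeros T. [:-c, 1:] ^ order c P)"

definition P_sharp :: "complex poly \<Rightarrow> complex poly \<Rightarrow> complex poly" where
  "P_sharp P T = P div P_T P T"

definition h_deg :: "complex poly \<Rightarrow> complex poly \<Rightarrow> nat" where
  "h_deg S T = degree (S div T)"

definition W_poly :: "complex poly \<Rightarrow> complex poly \<Rightarrow> complex poly" where
  "W_poly Q T = (\<Prod>c\<in>zeros T. [:-c, 1:] ^ (order c T + 1)) * (\<Prod>b\<in>zeros Q - zeros T. [:-b, 1:])"

text \<open>The subtraction is not truncated: \<open>degree W \<ge> 2\<close> since \<open>T\<close> is nonconstant.\<close>

definition kappa :: "complex poly \<Rightarrow> complex poly \<Rightarrow> complex poly \<Rightarrow> nat" where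
  "kappa Q S T = degree (W_poly Q T) + h_deg S T - 1"

definition Lam :: "complex poly \<Rightarrow> complex poly \<Rightarrow> complex poly \<Rightarrow> complex poly \<Rightarrow> complex \<Rightarrow> complex" where
  "Lam P Q S T z = deriv (\<lambda>w. poly S w / poly T w) z
     + poly (pderiv (P_T P T)) z / poly (P_T P T) z - poly (pderiv Q) z / poly Q z"

definition U_poly :: "complex poly \<Rightarrow> complex poly \<Rightarrow> complex poly \<Rightarrow> complex poly \<Rightarrow> complex poly" where
  "U_poly P Q S T = (THE U. \<forall>z. z \<notin> sing Q T \<longrightarrow> poly U z = poly (W_poly Q T) z * Lam P Q S T z)"

primrec B_poly :: "complex poly \<Rightarrow> complex poly \<Rightarrow> complex poly \<Rightarrow> complex poly \<Rightarrow> nat \<Rightarrow> complex poly" where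
  "B_poly P Q S T 0 = P_sharp P T"
| "B_poly P Q S T (Suc n) = W_poly Q T * pderiv (B_poly P Q S T n)
     + (U_poly P Q S T - of_nat n * pderiv (W_poly Q T)) * B_poly P Q S T n"

text \<open>
  \<open>hyp_f\<close> takes arbitrary values on \<open>sing Q T\<close> (division by zero), but the complement of that
  finite set is open, so the derivatives and zero orders taken there are unaffected.
\<close>

definition nu :: "complex poly \<Rightarrow> complex poly \<Rightarrow> complex poly \<Rightarrow> complex poly \<Rightarrow> nat \<Rightarrow> complex measure" where
  "nu P Q S T n = atomic_measure borel
     {\<zeta>. \<zeta> \<notin> sing Q T \<and> (deriv ^^ n) (hyp_f P Q S T) \<zeta> = 0}
     (\<lambda>\<zeta>. real_of_int (zorder ((deriv ^^ n) (hyp_f P Q S T)) \<zeta>) / real (degree (B_poly P Q S T n)))"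

definition mu :: "complex poly \<Rightarrow> complex poly \<Rightarrow> complex poly \<Rightarrow> complex poly \<Rightarrow> nat \<Rightarrow> complex measure" where
  "mu P Q S T n = atomic_measure borel (zeros (B_poly P Q S T n))
     (\<lambda>\<zeta>. real (order \<zeta> (B_poly P Q S T n)) / real (degree (B_poly P Q S T n)))"

definition mu_fix ::
  "complex poly \<Rightarrow> complex poly \<Rightarrow> complex poly \<Rightarrow> (nat \<Rightarrow> complex) \<Rightarrow> nat \<Rightarrow> complex measure" where
  "mu_fix Q S T a N = add_measure
     (atomic_measure borel (zeros T) (\<lambda>c. real (order c T) / real (kappa Q S T)))
     (scale_measure (ennreal (1 / (2 * pi * real (kappa Q S T))))
        (sum_measure {(i, j). 1 \<le> i \<and> i < j \<and> j \<le> N} borel (\<lambda>(i, j). edge_measure a N i j)))"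

definition mu_fix_sphere ::
  "complex poly \<Rightarrow> complex poly \<Rightarrow> complex poly \<Rightarrow> (nat \<Rightarrow> complex) \<Rightarrow> nat \<Rightarrow> complex option measure" where
  "mu_fix_sphere Q S T a N = add_measure (sphere_measure (mu_fix Q S T a N))
     (atomic_measure sphere_borel {None} (\<lambda>_. real (h_deg S T) / real (kappa Q S T)))"

text \<open>The polynomial \<open>W\<Lambda>\<close> exists and is unique, so \<open>U_poly\<close> is well defined.\<close>

lemma dvd_radical_mult_pderiv:
  assumes "p \<noteq> 0" "\<And>c. poly p c = 0 \<Longrightarrow> [:-c, 1:] dvd R"
  shows "p dvd R * pderiv (p :: complex poly)"
  using assms
proof (induction "degree p" arbitrary: p)
  case 0
  then show ?case by (metis dvd_mult is_unit_iff_degree unit_imp_dvd)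
next
  case (Suc n)
  then obtain c where c: "poly p c = 0"
    using fundamental_theorem_of_algebra[of p] constant_degree[of p] by auto
  then obtain q where p: "p = [:-c, 1:] * q" by (auto simp: poly_eq_0_iff_dvd)
  with Suc.prems have q0: "q \<noteq> 0" by auto
  have "degree p = Suc (degree q)" unfolding p using q0 by (subst degree_mult_eq) auto
  with Suc q0 p have "q dvd R * pderiv q" by auto
  then have "p dvd [:-c, 1:] * (R * pderiv q)" unfolding p by (intro mult_dvd_mono) auto
  moreover have "p dvd R * q" unfolding p using Suc.prems(2)[OF c] by (intro mult_dvd_mono) auto
  moreover have "R * pderiv p = [:-c, 1:] * (R * pderiv q) + R * q"
    unfolding p by (simp only: pderiv_mult) (simp add: pderiv_pCons algebra_simps)
  ultimately show ?case by (simp only: dvd_add)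
qed

lemma finite_zeros: "R \<noteq> 0 \<Longrightarrow> finite (zeros R)"
  by (simp add: zeros_def poly_roots_finite)

lemma U_poly_ex1:
  assumes "hyperexponential P Q S T"
  shows "\<exists>!U. \<forall>z. z \<notin> sing Q T \<longrightarrow> poly U z = poly (W_poly Q T) z * Lam P Q S T z"
proof -
  interpret hyperexponential P Q S T by fact
  have T0: "T \<noteq> 0" using T_nonconst by auto
  note fin = finite_zeros[OF T0] finite_zeros[OF Q_nz]
  define R where "R = (\<Prod>c\<in>zeros T. [:-c, 1:]) * (\<Prod>b\<in>zeros Q - zeros T. [:-b, 1:])"
  have Rdvd: "[:-c, 1:] dvd R" if "c \<in> sing Q T" for c
  proof (cases "c \<in> zeros T")
    case True
    then show ?thesis unfolding R_def using fin by (intro dvd_mult2 dvd_prodI) auto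
  next
    case False
    with that have "c \<in> zeros Q - zeros T" by (auto simp: sing_def)
    then show ?thesis unfolding R_def using fin by (intro dvd_mult dvd_prodI) auto
  qed
  have Tdec: "(\<Prod>c\<in>zeros T. [:-c, 1:] ^ order c T) = T"
    using complex_poly_decompose[of T] T_monic by (simp add: zeros_def)
  have W: "W_poly Q T = T * R"
    unfolding W_poly_def R_def power_add prod.distrib Tdec by (simp add: mult.assoc)
  have PT0: "P_T P T \<noteq> 0" unfolding P_T_def using fin by simp
  have PTz: "poly (P_T P T) c = 0 \<Longrightarrow> c \<in> sing Q T" for c
    unfolding P_T_def using fin by (auto simp: poly_prod sing_def)
  have "T dvd R * pderiv T"
    by (rule dvd_radical_mult_pderiv[OF T0]) (auto intro!: Rdvd simp: sing_def zeros_def)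
  then obtain A where A: "R * pderiv T = T * A" by (auto simp: dvd_def)
  have "P_T P T dvd R * pderiv (P_T P T)"
    by (rule dvd_radical_mult_pderiv[OF PT0]) (auto intro!: Rdvd dest: PTz)
  then obtain B where B: "R * pderiv (P_T P T) = P_T P T * B" by (auto simp: dvd_def)
  have "Q dvd R * pderiv Q"
    by (rule dvd_radical_mult_pderiv[OF Q_nz]) (auto intro!: Rdvd simp: sing_def zeros_def)
  then obtain C where C: "R * pderiv Q = Q * C" by (auto simp: dvd_def)
  define U where "U = R * pderiv S - S * A + T * B - T * C"
  have U: "poly U z = poly (W_poly Q T) z * Lam P Q S T z" if z: "z \<notin> sing Q T" for z
  proof -
    have nz: "poly T z \<noteq> 0" "poly Q z \<noteq> 0" "poly (P_T P T) z \<noteq> 0"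
      using z PTz[of z] by (auto simp: sing_def zeros_def)
    have "((\<lambda>w. poly S w / poly T w) has_field_derivative
        (poly (pderiv S) z * poly T z - poly S z * poly (pderiv T) z) / (poly T z * poly T z)) (at z)"
      by (rule DERIV_divide[OF poly_DERIV poly_DERIV nz(1)])
    then have D: "deriv (\<lambda>w. poly S w / poly T w) z =
        (poly (pderiv S) z * poly T z - poly S z * poly (pderiv T) z) / (poly T z * poly T z)"
      by (rule DERIV_imp_deriv)
    have a: "poly A z = poly R z * poly (pderiv T) z / poly T z"
      using arg_cong[OF A, of "\<lambda>p. poly p z"] nz by (simp add: field_simps)
    have b: "poly B z = poly R z * poly (pderiv (P_T P T)) z / poly (P_T P T) z"
      using arg_cong[OF B, of "\<lambda>p. poly p z"] nz by (simp add: field_simps)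
    have c: "poly C z = poly R z * poly (pderiv Q) z / poly Q z"
      using arg_cong[OF C, of "\<lambda>p. poly p z"] nz by (simp add: field_simps)
    show ?thesis unfolding U_def W Lam_def D using nz
      by (simp add: a b c divide_simps) (simp add: algebra_simps)
  qed
  have "V = U" if "\<forall>z. z \<notin> sing Q T \<longrightarrow> poly V z = poly (W_poly Q T) z * Lam P Q S T z" for V
  proof (rule ccontr)
    assume "V \<noteq> U"
    then have "finite (zeros (V - U))" by (intro finite_zeros) simp
    moreover have "- sing Q T \<subseteq> zeros (V - U)" using that U by (auto simp: zeros_def)
    ultimately have "finite (- sing Q T)" by (rule rev_finite_subset)
    moreover have "finite (sing Q T)" using fin by (simp add: sing_def)
    ultimately show False
      using infinite_UNIV_char_0[where 'a = complex] by (metis Compl_partition finite_UnI)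
  qed
  with U show ?thesis by blast
qed

end

theory Submission
  imports Defs "HOL-Real_Asymp.Real_Asymp"
begin

text \<open>
  Let \<open>u\<^sub>n = (ln \<bar>B\<^sub>n\<bar> - ln n!) / n\<close>. In the open Voronoi cell of \<open>a\<^sub>i\<close>, Cauchy's estimate on discs of
  radius \<open>\<bar>z - a\<^sub>i\<bar>\<close> bounds \<open>u\<^sub>n\<close> from above by \<open>v = ln \<bar>W\<bar> - ln \<bar>z - a\<^sub>i\<bar>\<close> up to \<open>o(1)\<close>. Since \<open>f\<close> does not
  extend across \<open>a\<^sub>i\<close>, some integral of \<open>f(w) (w - a\<^sub>i)\<^sup>k\<close> over a small circle about \<open>a\<^sub>i\<close> is nonzero, and
  integration by parts turns it into a matching lower bound for \<open>f\<^sup>(\<^sup>n\<^sup>)\<close> somewhere on that circle.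
  As \<open>v\<close> is harmonic in the punctured cell and \<open>u\<^sub>n\<close> is subharmonic, a Harnack chain gives \<open>u\<^sub>n \<rightarrow> v\<close> in mean
  on compact subsets of the cell, and a uniform \<open>L\<^sup>2\<close> bound carries this across the cell boundaries.

  Integrating against Laplacians of test functions turns potentials into measures, so it remains to
  find the Laplacian of \<open>v = (\<Sum>c. m\<^sub>c ln \<bar>z - c\<bar>) + ln (max\<^sub>i (\<Prod>j\<noteq>i. \<bar>z - a\<^sub>j\<bar>))\<close>. The maximum is the
  limit of \<open>p\<close>-norms, whose logarithms have a Laplacian that is a sum over pairs \<open>i < j\<close>; each summand
  concentrates on the edge between \<open>a\<^sub>i\<close> and \<open>a\<^sub>j\<close> as \<open>p \<rightarrow> \<infinity>\<close>.

  Comparing \<open>v\<close> with \<open>ln \<bar>z\<bar>\<close> at infinity shows that the limit measure has mass \<open>1 - h / \<kappa>\<close>. For \<open>h = 0\<close>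
  no mass escapes, and for \<open>h > 0\<close> the missing mass sits at \<open>\<infinity>\<close>.
\<close>

section \<open>Laplacians and Green's identity in the plane\<close>

text \<open>What shapes the argument is the scarcity of lower bounds: for each \<open>n\<close> the
  moment argument gives one good point on a circle, and that point moves with \<open>n\<close>. The
  potentials tend to -\<infinity> at the zeros of \<open>B n\<close>, where \<open>ln 0\<close> is a
  mere default value; so convergence is measured in L1, and upper bounds assume that the polynomial
  does not vanish. Means are taken against the polynomial density \<open>bump\<close> rather than
  over circles because its mean value inequality follows from Green's identity on the whole plane.

  The p-norm is the right smoothing of the maximum because its summands are squared moduli of
  polynomials: the Laplacian of \<open>ln (\<Sum>i. |F i|^2)\<close> is a weighted variance, which
  Lagrange's identity writes as a sum over pairs. Across an edge each summand tends to a logistic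
  profile, whose total mass is the weight \<open>|a i - a j| / (|z - a i| |z - a j|)\<close>.

  The mass count rests on \<open>degree W = degree T + N\<close>, so that
  \<open>\<kappa> = degree T + N - 1 + h\<close>, whereas \<open>v\<close> grows only like
  \<open>(degree T + N - 1) ln |z|\<close>.\<close>

lemma lborel_complex:
  "(lborel :: complex measure) = distr (lborel \<Otimes>\<^sub>M lborel) borel (\<lambda>(x, y). Complex x y)"
proof (rule lborel_eqI)
  have [measurable]: "(\<lambda>(x, y). Complex x y) \<in> borel_measurable (borel \<Otimes>\<^sub>M borel)"
    by (simp add: Complex_eq case_prod_unfold)
  fix l u :: complex assume le: "\<And>b. b \<in> Basis \<Longrightarrow> l \<bullet> b \<le> u \<bullet> b"
  then have le': "Re l \<le> Re u" "Im l \<le> Im u" using le[of 1] le[of \<i>] by (auto simp: Basis_complex_def)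
  have "(\<lambda>(x, y). Complex x y) -` box l u \<inter> space (lborel \<Otimes>\<^sub>M lborel)
      = {Re l<..<Re u} \<times> {Im l<..<Im u}" by (auto simp: box_def Basis_complex_def space_pair_measure)
  then show "emeasure (distr (lborel \<Otimes>\<^sub>M lborel) borel (\<lambda>(x, y). Complex x y)) (box l u)
      = ennreal (\<Prod>b\<in>Basis. (u - l) \<bullet> b)" using le' by (subst emeasure_distr)
      (simp_all add: lborel.emeasure_pair_measure_Times Basis_complex_def ennreal_mult complex_eq_iff)
qed simp

lemma nn_integral_complex:
  assumes [measurable]: "f \<in> borel_measurable borel"
  shows "(\<integral>\<^sup>+z. f z \<partial>lborel) = (\<integral>\<^sup>+x. \<integral>\<^sup>+y. f (Complex x y) \<partial>lborel \<partial>lborel)"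
    and "(\<integral>\<^sup>+z. f z \<partial>lborel) = (\<integral>\<^sup>+y. \<integral>\<^sup>+x. f (Complex x y) \<partial>lborel \<partial>lborel)"
proof -
  have [measurable]: "(\<lambda>(x, y). Complex x y) \<in> borel_measurable (borel \<Otimes>\<^sub>M borel)"
    by (simp add: Complex_eq case_prod_unfold)
  have "(\<integral>\<^sup>+z. f z \<partial>lborel) = (\<integral>\<^sup>+p. f (case p of (x, y) \<Rightarrow> Complex x y) \<partial>(lborel \<Otimes>\<^sub>M lborel))"
    by (subst lborel_complex, subst nn_integral_distr) auto
  also have "\<dots> = (\<integral>\<^sup>+p. f (Complex (fst p) (snd p)) \<partial>(lborel \<Otimes>\<^sub>M lborel))" by (simp add: case_prod_unfold)
  finally have *: "(\<integral>\<^sup>+z. f z \<partial>lborel) = \<dots>" .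
  have [measurable]: "(\<lambda>p. f (Complex (fst p) (snd p))) \<in> borel_measurable (lborel \<Otimes>\<^sub>M lborel)"
    unfolding Complex_eq by measurable
  show "(\<integral>\<^sup>+z. f z \<partial>lborel) = (\<integral>\<^sup>+x. \<integral>\<^sup>+y. f (Complex x y) \<partial>lborel \<partial>lborel)"
    unfolding * by (subst lborel.nn_integral_fst[symmetric]) auto
  show "(\<integral>\<^sup>+z. f z \<partial>lborel) = (\<integral>\<^sup>+y. \<integral>\<^sup>+x. f (Complex x y) \<partial>lborel \<partial>lborel)"
    unfolding * by (subst lborel_pair.nn_integral_snd[symmetric]) auto
qed

lemma integral_complex:
  fixes f :: "complex \<Rightarrow> real"
  assumes "integrable lborel f"
  shows "(LBINT z. f z) = (\<integral>x. \<integral>y. f (Complex x y) \<partial>lborel \<partial>lborel)"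
    and "(LBINT z. f z) = (\<integral>y. \<integral>x. f (Complex x y) \<partial>lborel \<partial>lborel)"
proof -
  have [measurable]: "f \<in> borel_measurable borel" using assms by auto
  have [measurable]: "(\<lambda>(x, y). Complex x y) \<in> borel_measurable (borel \<Otimes>\<^sub>M borel)"
    by (simp add: Complex_eq case_prod_unfold)
  have *: "(LBINT z. f z) = (\<integral>p. f (Complex (fst p) (snd p)) \<partial>(lborel \<Otimes>\<^sub>M lborel))"
    by (subst lborel_complex, subst integral_distr) (auto simp: case_prod_unfold)
  have "integrable (distr (lborel \<Otimes>\<^sub>M lborel) borel (\<lambda>(x, y). Complex x y)) f"
    using assms lborel_complex by simp
  then have **: "integrable (lborel \<Otimes>\<^sub>M lborel) (\<lambda>p. f (Complex (fst p) (snd p)))"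
    by (subst (asm) integrable_distr_eq) (auto simp: case_prod_unfold)
  show "(LBINT z. f z) = (\<integral>x. \<integral>y. f (Complex x y) \<partial>lborel \<partial>lborel)"
    unfolding * using lborel_pair.integral_fst'[OF **] by simp
  show "(LBINT z. f z) = (\<integral>y. \<integral>x. f (Complex x y) \<partial>lborel \<partial>lborel)"
    unfolding * using lborel_pair.integral_snd[of "\<lambda>x y. f (Complex x y)"] ** by (simp add: case_prod_unfold)
qed

text \<open>When the real part \<open>a\<close> of \<open>u\<close> is nonzero, the rotation is a
  change of the first coordinate followed by a change of the second, since
  \<open>b x + a y = (b / a) (a x - b y) + y / a\<close> by \<open>a^2 + b^2 = 1\<close>. Two
  one-dimensional affine substitutions then suffice, and their factors \<open>1 / |a|\<close> and
  \<open>|a|\<close> cancel.\<close>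

lemma distr_rotation_lborel:
  fixes u :: complex
  assumes "norm u = 1"
  shows "distr lborel borel (\<lambda>z. u * z) = lborel"
proof (rule measure_eqI)
  fix A :: "complex set" assume "A \<in> sets (distr lborel borel (\<lambda>z. u * z))"
  then have [measurable]: "A \<in> sets borel" by simp
  define a b where "a = Re u" and "b = Im u"
  have u: "u = Complex a b" by (simp add: a_def b_def)
  have ab: "a^2 + b^2 = 1" using assms by (simp add: u norm_complex_def)
  define f :: "real \<Rightarrow> real \<Rightarrow> ennreal" where "f x y = indicator A (Complex x y)" for x y
  have mf: "(\<lambda>p. f (fst p) (snd p)) \<in> borel_measurable (borel \<Otimes>\<^sub>M borel)"
    unfolding f_def Complex_eq by measurable
  have [measurable]: "(\<lambda>p. f (g p) (h p)) \<in> borel_measurable M"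
    if [measurable]: "g \<in> borel_measurable M" "h \<in> borel_measurable M" for g h and M :: "'z measure"
    using measurable_compose[OF _ mf, of "\<lambda>p. (g p, h p)" M] by simp
  have "emeasure (distr lborel borel (\<lambda>z. u * z)) A = (\<integral>\<^sup>+z. indicator A z \<partial>distr lborel borel (\<lambda>z. u * z))"
    by simp
  also have "\<dots> = (\<integral>\<^sup>+z. indicator A (u * z) \<partial>lborel)" by (rule nn_integral_distr) auto
  also have "\<dots> = (\<integral>\<^sup>+y. \<integral>\<^sup>+x. f (a * x - b * y) (b * x + a * y) \<partial>lborel \<partial>lborel)"
    by (subst nn_integral_complex(2)) (auto simp: f_def u complex_mult mult.commute)
  also have "\<dots> = (\<integral>\<^sup>+y. \<integral>\<^sup>+x. f x y \<partial>lborel \<partial>lborel)"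
  \<comment> \<open>The factorization fails for a quarter turn, which only reflects and swaps the
    coordinates.\<close>
  proof (cases "a = 0")
    case True
    then have b: "b = 1 \<or> b = - 1" using ab by (simp add: power2_eq_1_iff)
    then have b0: "b \<noteq> 0" by auto
    have aff: "(\<integral>\<^sup>+x. g (c * x) \<partial>lborel) = (\<integral>\<^sup>+x. g x \<partial>lborel)"
      if "g \<in> borel_measurable borel" "\<bar>c\<bar> = 1" for g :: "real \<Rightarrow> ennreal" and c
      using that nn_integral_real_affine[of g c 0] by fastforce
    have "(\<integral>\<^sup>+y. \<integral>\<^sup>+x. f (- b * y) (b * x) \<partial>lborel \<partial>lborel)
        = (\<integral>\<^sup>+y. \<integral>\<^sup>+x. f (- b * y) x \<partial>lborel \<partial>lborel)" by (intro nn_integral_cong aff) (use b in auto)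
    also have "\<dots> = (\<integral>\<^sup>+x. \<integral>\<^sup>+y. f (- b * y) x \<partial>lborel \<partial>lborel)" by (rule lborel_pair.Fubini') simp
    also have "\<dots> = (\<integral>\<^sup>+x. \<integral>\<^sup>+y. f y x \<partial>lborel \<partial>lborel)"
      by (intro nn_integral_cong aff[of "\<lambda>y. f y _"]) (use b in auto)
    finally have "(\<integral>\<^sup>+y. \<integral>\<^sup>+x. f (- b * y) (b * x) \<partial>lborel \<partial>lborel)
        = (\<integral>\<^sup>+y. \<integral>\<^sup>+x. f x y \<partial>lborel \<partial>lborel)" .
    moreover have "f (a * x - b * y) (b * x + a * y) = f (- b * y) (b * x)" for x y using True by simp
    ultimately show ?thesis by (simp only:)
  next
    case False
    have "(\<integral>\<^sup>+x. f (a * x - b * y) (b * x + a * y) \<partial>lborel)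
        = ennreal (1 / \<bar>a\<bar>) * (\<integral>\<^sup>+x. f x (b / a * x + 1 / a * y) \<partial>lborel)" for y
    proof -
      have lin: "b / a * (- b * y + a * x) + 1 / a * y = b * x + a * y" for x
      proof -
        have "b / a * (- b * y + a * x) + 1 / a * y = b * x + (1 - b\<^sup>2) / a * y"
          using False by (simp add: field_simps power2_eq_square)
        also have "1 - b\<^sup>2 = a * a" using ab by (simp add: power2_eq_square)
        finally show ?thesis using False by simp
      qed
      have "(\<integral>\<^sup>+x. f x (b / a * x + 1 / a * y) \<partial>lborel)
          = ennreal \<bar>a\<bar> * (\<integral>\<^sup>+x. f (- b * y + a * x) (b / a * (- b * y + a * x) + 1 / a * y) \<partial>lborel)"
        using False by (intro nn_integral_real_affine) auto
      also have "\<dots> = ennreal \<bar>a\<bar> * (\<integral>\<^sup>+x. f (a * x - b * y) (b * x + a * y) \<partial>lborel)" unfolding lin by simp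
      finally show ?thesis using False
        by (simp add: mult.assoc[symmetric] ennreal_mult[symmetric] algebra_simps)
    qed
    then have "(\<integral>\<^sup>+y. \<integral>\<^sup>+x. f (a * x - b * y) (b * x + a * y) \<partial>lborel \<partial>lborel)
        = ennreal (1 / \<bar>a\<bar>) * (\<integral>\<^sup>+y. \<integral>\<^sup>+x. f x (b / a * x + 1 / a * y) \<partial>lborel \<partial>lborel)"
      by (simp add: nn_integral_cmult)
    also have "(\<integral>\<^sup>+y. \<integral>\<^sup>+x. f x (b / a * x + 1 / a * y) \<partial>lborel \<partial>lborel)
        = (\<integral>\<^sup>+x. \<integral>\<^sup>+y. f x (b / a * x + 1 / a * y) \<partial>lborel \<partial>lborel)" by (rule lborel_pair.Fubini') simp
    also have "\<dots> = (\<integral>\<^sup>+x. ennreal \<bar>a\<bar> * (\<integral>\<^sup>+y. f x y \<partial>lborel) \<partial>lborel)"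
    proof (intro nn_integral_cong)
      fix x
      have "(\<integral>\<^sup>+y. f x y \<partial>lborel) = ennreal \<bar>1 / a\<bar> * (\<integral>\<^sup>+y. f x (b / a * x + 1 / a * y) \<partial>lborel)"
        using False by (intro nn_integral_real_affine) auto
      then show "(\<integral>\<^sup>+y. f x (b / a * x + 1 / a * y) \<partial>lborel) = ennreal \<bar>a\<bar> * (\<integral>\<^sup>+y. f x y \<partial>lborel)"
        using False by (simp add: mult.assoc[symmetric] ennreal_mult[symmetric])
    qed
    also have "\<dots> = ennreal \<bar>a\<bar> * (\<integral>\<^sup>+x. \<integral>\<^sup>+y. f x y \<partial>lborel \<partial>lborel)" by (simp add: nn_integral_cmult)
    also have "(\<integral>\<^sup>+x. \<integral>\<^sup>+y. f x y \<partial>lborel \<partial>lborel) = (\<integral>\<^sup>+y. \<integral>\<^sup>+x. f x y \<partial>lborel \<partial>lborel)"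
      by (rule lborel_pair.Fubini') simp
    finally show ?thesis using False by (simp add: mult.assoc[symmetric] ennreal_mult[symmetric])
  qed
  also have "\<dots> = emeasure lborel A"
    by (subst nn_integral_indicator[symmetric], simp, subst nn_integral_complex(2)) (auto simp: f_def)
  finally show "emeasure (distr lborel borel (\<lambda>z. u * z)) A = emeasure lborel A" .
qed simp

text \<open>The two scale factors are separate because near a Voronoi edge only the coordinate
  normal to the edge is rescaled; for the Poisson kernel and the mollifier they coincide.\<close>

lemma integral_complex_similarity:
  fixes f :: "complex \<Rightarrow> real" and u m :: complex and s t :: real
  assumes u: "norm u = 1" and s: "s > 0" and t: "t > 0" and [measurable]: "f \<in> borel_measurable borel"
  shows "(LBINT z. f z) = s * t * (LBINT w. f (m + u * Complex (s * Re w) (t * Im w)))"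
    and "integrable lborel f \<longleftrightarrow> integrable lborel (\<lambda>w. f (m + u * Complex (s * Re w) (t * Im w)))"
proof -
  define c :: "complex \<Rightarrow> real" where "c = (\<lambda>b. if b = 1 then s else t)"
  have nz: "\<And>j. j \<in> Basis \<Longrightarrow> c j \<noteq> 0" using s t by (auto simp: c_def)
  have T: "(\<lambda>x. 0 + (\<Sum>j\<in>Basis. (c j * (x \<bullet> j)) *\<^sub>R j)) = (\<lambda>w. Complex (s * Re w) (t * Im w))"
    by (auto simp: Basis_complex_def c_def fun_eq_iff complex_eq_iff)
  have pr: "(\<Prod>j\<in>Basis. \<bar>c j\<bar>) = s * t" using s t by (simp add: Basis_complex_def c_def complex_eq_iff)
  have L1: "lborel = density (distr lborel borel (\<lambda>w. Complex (s * Re w) (t * Im w))) (\<lambda>_. s * t)"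
    using lborel_affine_euclidean[where c = c and t = 0, OF nz] unfolding T pr by simp
  have L2: "lborel = distr lborel borel (\<lambda>z. m + z)" using lborel_distr_plus[of m] by simp
  have [measurable]: "(\<lambda>w. Complex (s * Re w) (t * Im w)) \<in> borel_measurable borel"
    unfolding Complex_eq by measurable
  have "(LBINT z. f z) = (LBINT z. f (m + z))" by (subst L2, subst integral_distr) auto
  also have "\<dots> = (LBINT z. f (m + u * z))"
    by (subst distr_rotation_lborel[OF u, symmetric], subst integral_distr) auto
  also have "\<dots> = s * t * (LBINT w. f (m + u * Complex (s * Re w) (t * Im w)))"
    using s t by (subst L1, subst integral_density) (auto simp: integral_distr)
  finally show "(LBINT z. f z) = s * t * (LBINT w. f (m + u * Complex (s * Re w) (t * Im w)))" .
  have "integrable lborel f \<longleftrightarrow> integrable lborel (\<lambda>z. f (m + z))" by (subst L2, subst integrable_distr_eq) auto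
  also have "\<dots> \<longleftrightarrow> integrable lborel (\<lambda>z. f (m + u * z))"
    by (subst distr_rotation_lborel[OF u, symmetric], subst integrable_distr_eq) auto
  also have "\<dots> \<longleftrightarrow> integrable lborel (\<lambda>w. f (m + u * Complex (s * Re w) (t * Im w)))"
    using s t by (subst L1, subst integrable_density) (auto simp: integrable_distr_eq)
  finally show "integrable lborel f \<longleftrightarrow> integrable lborel (\<lambda>w. f (m + u * Complex (s * Re w) (t * Im w)))" .
qed

lemma integrable_compact_support:
  fixes f :: "complex \<Rightarrow> real"
  assumes "continuous_on UNIV f" "\<And>z. R \<le> norm z \<Longrightarrow> f z = 0"
  shows "integrable lborel f"
proof -
  have "integrable lborel (\<lambda>x. indicator (cball 0 R) x *\<^sub>R f x)"
    by (intro borel_integrable_compact) (auto intro: continuous_on_subset[OF assms(1)])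
  also have "(\<lambda>x. indicator (cball 0 R) x *\<^sub>R f x) = f"
    using assms(2) by (auto simp: fun_eq_iff indicator_def)
  finally show ?thesis .
qed

section \<open>Functions with continuous second partials, and Green's identity\<close>

definition has_partials ::
  "(complex \<Rightarrow> real) \<Rightarrow> (complex \<Rightarrow> real) \<Rightarrow> (complex \<Rightarrow> real) \<Rightarrow> (complex \<Rightarrow> real) \<Rightarrow>
   (complex \<Rightarrow> real) \<Rightarrow> bool" where
  "has_partials g g1 g11 g2 g22 \<longleftrightarrow>
     continuous_on UNIV g \<and> continuous_on UNIV g1 \<and> continuous_on UNIV g11 \<and>
     continuous_on UNIV g2 \<and> continuous_on UNIV g22 \<and>
     (\<forall>x y. ((\<lambda>t. g (Complex t y)) has_real_derivative g1 (Complex x y)) (at x)) \<and>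
     (\<forall>x y. ((\<lambda>t. g1 (Complex t y)) has_real_derivative g11 (Complex x y)) (at x)) \<and>
     (\<forall>x y. ((\<lambda>t. g (Complex x t)) has_real_derivative g2 (Complex x y)) (at y)) \<and>
     (\<forall>x y. ((\<lambda>t. g2 (Complex x t)) has_real_derivative g22 (Complex x y)) (at y))"

definition has_laplacian :: "(complex \<Rightarrow> real) \<Rightarrow> (complex \<Rightarrow> real) \<Rightarrow> bool" where
  "has_laplacian g L \<longleftrightarrow>
     (\<exists>g1 g11 g2 g22. has_partials g g1 g11 g2 g22 \<and> L = (\<lambda>z. g11 z + g22 z))"

lemma has_partialsD:
  assumes "has_partials g g1 g11 g2 g22"
  shows "continuous_on UNIV g" "continuous_on UNIV g1" "continuous_on UNIV g11"
    "continuous_on UNIV g2" "continuous_on UNIV g22"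
    "((\<lambda>t. g (Complex t y)) has_real_derivative g1 (Complex x y)) (at x)"
    "((\<lambda>t. g1 (Complex t y)) has_real_derivative g11 (Complex x y)) (at x)"
    "((\<lambda>t. g (Complex x t)) has_real_derivative g2 (Complex x y)) (at y)"
    "((\<lambda>t. g2 (Complex x t)) has_real_derivative g22 (Complex x y)) (at y)"
  using assms unfolding has_partials_def by blast+

lemma has_laplacianI: "has_partials g g1 g11 g2 g22 \<Longrightarrow> has_laplacian g (\<lambda>z. g11 z + g22 z)"
  unfolding has_laplacian_def by blast

lemma has_laplacian_continuous: "has_laplacian g L \<Longrightarrow> continuous_on UNIV g"
  and has_laplacian_continuous': "has_laplacian g L \<Longrightarrow> continuous_on UNIV L"
  by (auto simp: has_laplacian_def dest: has_partialsD intro!: continuous_intros)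

lemma DERIV_zero_outside:
  fixes g :: "real \<Rightarrow> real"
  assumes "(g has_real_derivative D) (at x)" "\<And>t. t \<in> U \<Longrightarrow> g t = 0" "open U" "x \<in> U"
  shows "D = 0"
proof -
  have "((\<lambda>_. 0) has_real_derivative D) (at x)"
    by (rule has_field_derivative_transform_within_open[OF assms(1,3,4)]) (use assms(2) in auto)
  then show ?thesis using DERIV_unique[OF _ DERIV_const] by blast
qed

text \<open>Where \<open>g\<close> vanishes on an open set, so do its partials; this settles
  \<open>norm w > R\<close>. The boundary circle is reached by continuity of \<open>G\<close>, which
  keeps the same \<open>R\<close> for \<open>g\<close> and \<open>G\<close>.\<close>

lemma has_laplacian_vanishes:
  assumes g: "has_laplacian g G" and z: "\<And>z. R \<le> norm z \<Longrightarrow> g z = 0"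
  shows "R \<le> norm w \<Longrightarrow> G w = 0"
proof -
  from g obtain g1 g11 g2 g22 where pg: "has_partials g g1 g11 g2 g22"
    and G: "G = (\<lambda>z. g11 z + g22 z)" unfolding has_laplacian_def by blast
  note g = has_partialsD[OF pg]
  have op: "open {t. R < norm (Complex t y)}" "open {t. R < norm (Complex y t)}" for y
    unfolding Complex_eq by (auto intro!: open_Collect_less continuous_intros)
  have a: "g1 (Complex x y) = 0" "g2 (Complex x y) = 0" if "R < norm (Complex x y)" for x y
    using DERIV_zero_outside[OF g(6)[of y x] _ op(1)[of y]] DERIV_zero_outside[OF g(8)[of x y] _ op(2)[of x]]
      that z by simp_all
  have b: "g11 (Complex x y) = 0" "g22 (Complex x y) = 0" if "R < norm (Complex x y)" for x y
    using DERIV_zero_outside[OF g(7)[of y x] _ op(1)[of y]] DERIV_zero_outside[OF g(9)[of x y] _ op(2)[of x]]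
      that a by simp_all
  have c: "G w = 0" if "R < norm w" for w using b[of "Re w" "Im w"] that by (simp add: G)
  assume Rw: "R \<le> norm w"
  show "G w = 0"
  proof (cases "R < norm w")
    case False
    then have w: "R = norm w" using Rw by simp
    have "continuous_on UNIV G" unfolding G using g by (auto intro!: continuous_intros)
    then have iso: "isCont G w" by (simp add: continuous_on_eq_continuous_at)
    \<comment> \<open>An outward direction at \<open>w\<close>; if \<open>w = 0\<close>, then
      \<open>R = 0\<close> and every direction leads outward.\<close>
    define d where "d = (if w = 0 then 1 else w)"
    have "(\<lambda>n. w + of_real (1 / real (Suc n)) * d) \<longlonglongrightarrow> w + of_real 0 * d"
      by (intro tendsto_intros LIMSEQ_Suc[OF lim_1_over_n])
    then have "(\<lambda>n. G (w + of_real (1 / real (Suc n)) * d)) \<longlonglongrightarrow> G w"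
      by (intro isCont_tendsto_compose[OF iso]) simp
    moreover have "G (w + of_real (1 / real (Suc n)) * d) = 0" for n
    proof (cases "w = 0")
      case True then show ?thesis using w by (intro c) (simp add: d_def norm_divide del: of_nat_Suc)
    next
      case False
      have "w + of_real (1 / real (Suc n)) * d = of_real (1 + 1 / real (Suc n)) * w"
        using False by (simp add: d_def algebra_simps)
      also have "norm \<dots> = (1 + 1 / real (Suc n)) * norm w" unfolding norm_mult norm_of_real by simp
      finally have "norm w < norm (w + of_real (1 / real (Suc n)) * d)"
        using False by (simp add: algebra_simps)
      then show ?thesis using w by (intro c) simp
    qed
    ultimately show ?thesis using LIMSEQ_unique[OF _ tendsto_const] by fastforce
  qed (use c in auto)
qed

lemma integral_antideriv_compact_support:
  fixes F f :: "real \<Rightarrow> real"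
  assumes "\<And>x. (F has_real_derivative f x) (at x)" "continuous_on UNIV f" "\<And>x. R \<le> \<bar>x\<bar> \<Longrightarrow> F x = 0"
    "\<And>x. R \<le> \<bar>x\<bar> \<Longrightarrow> f x = 0"
  shows "(LBINT x. f x) = 0"
proof -
  have "(LBINT x. f x * indicator {- \<bar>R\<bar>..\<bar>R\<bar>} x) = F \<bar>R\<bar> - F (- \<bar>R\<bar>)"
    by (rule integral_FTC_Icc_real) (use assms in \<open>auto simp: continuous_on_eq_continuous_at\<close>)
  also have "\<dots> = 0" using assms(3)[of "\<bar>R\<bar>"] assms(3)[of "- \<bar>R\<bar>"] by simp
  also have "(\<lambda>x. f x * indicator {- \<bar>R\<bar>..\<bar>R\<bar>} x) = f"
  proof
    fix x show "f x * indicator {- \<bar>R\<bar>..\<bar>R\<bar>} x = f x"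
      using assms(4)[of x] by (cases "R \<le> \<bar>x\<bar>") (auto simp: indicator_def)
  qed
  finally show ?thesis .
qed

text \<open>On every horizontal or vertical line \<open>u g'' - u'' g\<close> is the derivative of
  \<open>u g' - u' g\<close>, so its integral is 0; Fubini adds the two directions. This is why
  \<open>has_partials\<close> records the second derivatives along the two axes. Compact support is
  asked of \<open>g\<close> only: \<open>u\<close> will be a regularized logarithm, a soft maximum
  or a constant.\<close>

proposition green_identity:
  assumes u: "has_laplacian u U" and g: "has_laplacian g G" and z: "\<And>z. R \<le> norm z \<Longrightarrow> g z = 0"
  shows "(LBINT z. u z * G z) = (LBINT z. U z * g z)"
proof -
  from g obtain g1 g11 g2 g22 where pg: "has_partials g g1 g11 g2 g22"
    and G: "G = (\<lambda>z. g11 z + g22 z)" unfolding has_laplacian_def by blast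
  note g = has_partialsD[OF pg]
  from u obtain u1 u11 u2 u22 where pu: "has_partials u u1 u11 u2 u22"
    and U: "U = (\<lambda>z. u11 z + u22 z)" unfolding has_laplacian_def by blast
  note u = has_partialsD[OF pu]
  have op: "open {t. R < norm (Complex t y)}" "open {t. R < norm (Complex y t)}" for y
    unfolding Complex_eq by (auto intro!: open_Collect_less continuous_intros)
  have a: "g1 (Complex x y) = 0" "g2 (Complex x y) = 0" if "R < norm (Complex x y)" for x y
    using DERIV_zero_outside[OF g(6)[of y x] _ op(1)[of y]] DERIV_zero_outside[OF g(8)[of x y] _ op(2)[of x]]
      that z by simp_all
  have b: "g11 (Complex x y) = 0" "g22 (Complex x y) = 0" if "R < norm (Complex x y)" for x y
    using DERIV_zero_outside[OF g(7)[of y x] _ op(1)[of y]] DERIV_zero_outside[OF g(9)[of x y] _ op(2)[of x]]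
      that a by simp_all
  \<comment> \<open>The first partials of \<open>g\<close> are known to vanish only for
    \<open>norm z > R\<close>; the margin makes this inequality strict from \<open>R'\<close>
    on.\<close>
  define R' where "R' = R + 1"
  have big: "R < norm (Complex x y)" if "R' \<le> \<bar>x\<bar> \<or> R' \<le> \<bar>y\<bar>" for x y
    using that abs_Re_le_cmod[of "Complex x y"] abs_Im_le_cmod[of "Complex x y"] unfolding R'_def by auto
  define A B where "A z = u z * g11 z - u11 z * g z" and "B z = u z * g22 z - u22 z * g z" for z
  have cA: "continuous_on UNIV A" and cB: "continuous_on UNIV B"
    unfolding A_def B_def using u g by (auto intro!: continuous_intros)
  have A0: "A z = 0" and B0: "B z = 0" if "R' \<le> norm z" for z
    using that b[of "Re z" "Im z"] \<open>\<And>z. R \<le> norm z \<Longrightarrow> g z = 0\<close>[of z] by (auto simp: A_def B_def R'_def)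
  have iA: "integrable lborel A" and iB: "integrable lborel B"
    using integrable_compact_support[OF cA A0] integrable_compact_support[OF cB B0] by auto
  have "(LBINT x. A (Complex x y)) = 0" for y
  proof (rule integral_antideriv_compact_support)
    show "((\<lambda>x. u (Complex x y) * g1 (Complex x y) - u1 (Complex x y) * g (Complex x y))
        has_real_derivative A (Complex x y)) (at x)" for x
      unfolding A_def by (rule derivative_eq_intros u g refl)+ (simp add: algebra_simps)
    show "continuous_on UNIV (\<lambda>x. A (Complex x y))"
      unfolding Complex_eq by (intro continuous_on_compose2[OF cA] continuous_intros) auto
    show "u (Complex x y) * g1 (Complex x y) - u1 (Complex x y) * g (Complex x y) = 0" if "R' \<le> \<bar>x\<bar>" for x
      using a[OF big, of x y] z[of "Complex x y"] big[of x y] that by simp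
    show "A (Complex x y) = 0" if "R' \<le> \<bar>x\<bar>" for x
      unfolding A_def using b[OF big, of x y] z[of "Complex x y"] big[of x y] that by simp
  qed
  then have IA: "(LBINT z. A z) = 0" by (simp add: integral_complex(2)[OF iA])
  have "(LBINT y. B (Complex x y)) = 0" for x
  proof (rule integral_antideriv_compact_support)
    show "((\<lambda>y. u (Complex x y) * g2 (Complex x y) - u2 (Complex x y) * g (Complex x y))
        has_real_derivative B (Complex x y)) (at y)" for y
      unfolding B_def by (rule derivative_eq_intros u g refl)+ (simp add: algebra_simps)
    show "continuous_on UNIV (\<lambda>y. B (Complex x y))"
      unfolding Complex_eq by (intro continuous_on_compose2[OF cB] continuous_intros) auto
    show "u (Complex x y) * g2 (Complex x y) - u2 (Complex x y) * g (Complex x y) = 0" if "R' \<le> \<bar>y\<bar>" for y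
      using a[OF big, of y x] z[of "Complex x y"] a[of x y] big[of x y] that by simp
    show "B (Complex x y) = 0" if "R' \<le> \<bar>y\<bar>" for y
      unfolding B_def using b[of x y] z[of "Complex x y"] big[of x y] that by simp
  qed
  then have IB: "(LBINT z. B z) = 0" by (simp add: integral_complex(1)[OF iB])
  have G0: "G z = 0" if "R \<le> norm z" for z using has_laplacian_vanishes[OF assms(2) z that] .
  have "integrable lborel (\<lambda>z. u z * G z)" "integrable lborel (\<lambda>z. U z * g z)"
    by (rule integrable_compact_support[of _ R], use u g z G0 has_laplacian_continuous'[OF assms(1)] has_laplacian_continuous'[OF assms(2)] in \<open>auto intro!: continuous_intros\<close>)+
  then have "(LBINT z. u z * G z) - (LBINT z. U z * g z) = (LBINT z. A z + B z)"
    by (subst Bochner_Integration.integral_diff[symmetric])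
      (auto simp: A_def B_def U G algebra_simps intro!: Bochner_Integration.integral_cong)
  also have "\<dots> = 0" using IA IB iA iB by simp
  finally show ?thesis by simp
qed

section \<open>Logarithmic potentials\<close>

text \<open>At 0 the difference quotient of the clamped function is either that of
  \<open>\<Psi>\<close> or 0, so \<open>\<Psi>' 0 = 0\<close> is what makes the clamp
  differentiable. The bound \<open>b\<close> serves profiles such as \<open>log_tail\<close>, which
  is singular at 1.\<close>

lemma DERIV_comp_max_0:
  fixes \<Psi> :: "real \<Rightarrow> real"
  assumes D: "\<And>y. 0 \<le> y \<Longrightarrow> y < b \<Longrightarrow> (\<Psi> has_real_derivative \<Psi>' y) (at y)"
    and 0: "\<Psi>' 0 = 0" and b: "b > 0" "t < b"
  shows "((\<lambda>t. \<Psi> (max 0 t)) has_real_derivative \<Psi>' (max 0 t)) (at t)"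
proof (cases t "0 :: real" rule: linorder_cases)
  case less
  have "((\<lambda>t. \<Psi> 0) has_real_derivative 0) (at t)" by simp
  then have "((\<lambda>t. \<Psi> (max 0 t)) has_real_derivative 0) (at t)"
    by (rule has_field_derivative_transform_within_open[of _ _ _ "{..<0}"]) (use less in auto)
  then show ?thesis using less 0 by simp
next
  case greater
  have "((\<lambda>t. \<Psi> (max 0 t)) has_real_derivative \<Psi>' t) (at t)"
    by (rule has_field_derivative_transform_within_open[OF D, of _ "{0<..}"]) (use greater b in auto)
  then show ?thesis using greater by simp
next
  case equal
  have "(\<lambda>h. (\<Psi> (0 + h) - \<Psi> 0) / h) \<midarrow>0\<rightarrow> 0" using D[of 0] b 0 by (simp add: DERIV_def)
  then have "(\<lambda>h. (\<Psi> (max 0 (0 + h)) - \<Psi> (max 0 0)) / h) \<midarrow>0\<rightarrow> 0" by (rule tendsto_0_le[where K = 1])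
       (intro always_eventually allI, auto simp: max_def divide_nonneg_neg divide_nonneg_neg[THEN le_imp_neg_le] divide_nonneg_neg)
  then show ?thesis using equal 0 by (simp add: DERIV_def)
qed

text \<open>The radial variable is the squared distance, a polynomial in the coordinates, so the
  centre is not exceptional; in this variable the radial Laplacian reads
  \<open>4 (\<phi>' + w \<phi>'')\<close>.\<close>

lemma has_laplacian_radial:
  assumes "\<And>w. 0 \<le> w \<Longrightarrow> (\<phi> has_real_derivative \<phi>' w) (at w)"
    and "\<And>w. 0 \<le> w \<Longrightarrow> (\<phi>' has_real_derivative \<phi>'' w) (at w)"
    and c: "continuous_on {0..} \<phi>''"
  shows "has_laplacian (\<lambda>z. \<phi> ((norm (z - c))^2))
    (\<lambda>z. 4 * (\<phi>' ((norm (z - c))^2) + (norm (z - c))^2 * \<phi>'' ((norm (z - c))^2)))"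
proof -
  define q where "q z = (Re z - Re c)^2 + (Im z - Im c)^2" for z
  have q: "(norm (z - c))^2 = q z" for z by (simp add: q_def cmod_power2)
  have q0: "0 \<le> q z" for z by (simp add: q_def)
  have cq: "continuous_on UNIV q" unfolding q_def by (intro continuous_intros)
  have "continuous_on {0..} \<phi>" "continuous_on {0..} \<phi>'"
    using assms(1,2) DERIV_isCont by (force intro!: continuous_at_imp_continuous_on)+
  note cc = this c
  have cc': "continuous_on UNIV (\<lambda>z. \<phi> (q z))" "continuous_on UNIV (\<lambda>z. \<phi>' (q z))"
     "continuous_on UNIV (\<lambda>z. \<phi>'' (q z))"
    using q0 by (auto intro!: continuous_on_compose2[OF cc(1) cq] continuous_on_compose2[OF cc(2) cq]
        continuous_on_compose2[OF cc(3) cq])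
  have dq: "((\<lambda>t. q (Complex t y)) has_real_derivative 2 * (x - Re c)) (at x)"
    "((\<lambda>t. q (Complex x t)) has_real_derivative 2 * (y - Im c)) (at y)" for x y
    unfolding q_def by (auto intro!: derivative_eq_intros)
  note ch = DERIV_chain2[OF assms(1)[OF q0] dq(1)] DERIV_chain2[OF assms(1)[OF q0] dq(2)]
     DERIV_chain2[OF assms(2)[OF q0] dq(1)] DERIV_chain2[OF assms(2)[OF q0] dq(2)]
  have "has_partials (\<lambda>z. \<phi> (q z)) (\<lambda>z. \<phi>' (q z) * (2 * (Re z - Re c)))
     (\<lambda>z. \<phi>'' (q z) * (2 * (Re z - Re c)) * (2 * (Re z - Re c)) + 2 * \<phi>' (q z))
     (\<lambda>z. \<phi>' (q z) * (2 * (Im z - Im c)))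
     (\<lambda>z. \<phi>'' (q z) * (2 * (Im z - Im c)) * (2 * (Im z - Im c)) + 2 * \<phi>' (q z))" unfolding has_partials_def
  proof (intro conjI allI)
    fix x y
    have lin: "((\<lambda>t. 2 * (t - d)) has_real_derivative 2) (at s)" for d s :: real
      by (auto intro!: derivative_eq_intros)
    show "((\<lambda>t. \<phi> (q (Complex t y))) has_real_derivative \<phi>' (q (Complex x y)) * (2 * (Re (Complex x y) - Re c))) (at x)"
      "((\<lambda>t. \<phi> (q (Complex x t))) has_real_derivative \<phi>' (q (Complex x y)) * (2 * (Im (Complex x y) - Im c))) (at y)"
      using ch(1)[of y x] ch(2)[of x y] by simp_all
    have "((\<lambda>t. \<phi>' (q (Complex t y)) * (2 * (t - Re c))) has_real_derivative
        \<phi>'' (q (Complex x y)) * (2 * (x - Re c)) * (2 * (x - Re c)) + 2 * \<phi>' (q (Complex x y))) (at x)"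
      by (rule DERIV_cong[OF DERIV_mult[OF ch(3) lin[of "Re c" x]]]) simp
    then show "((\<lambda>t. \<phi>' (q (Complex t y)) * (2 * (Re (Complex t y) - Re c))) has_real_derivative
        \<phi>'' (q (Complex x y)) * (2 * (Re (Complex x y) - Re c)) * (2 * (Re (Complex x y) - Re c)) + 2 * \<phi>' (q (Complex x y))) (at x)"
      by simp
    have "((\<lambda>t. \<phi>' (q (Complex x t)) * (2 * (t - Im c))) has_real_derivative
        \<phi>'' (q (Complex x y)) * (2 * (y - Im c)) * (2 * (y - Im c)) + 2 * \<phi>' (q (Complex x y))) (at y)"
      by (rule DERIV_cong[OF DERIV_mult[OF ch(4) lin[of "Im c" y]]]) simp
    then show "((\<lambda>t. \<phi>' (q (Complex x t)) * (2 * (Im (Complex x t) - Im c))) has_real_derivative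
        \<phi>'' (q (Complex x y)) * (2 * (Im (Complex x y) - Im c)) * (2 * (Im (Complex x y) - Im c)) + 2 * \<phi>' (q (Complex x y))) (at y)"
      by simp
  qed (intro cc' continuous_intros)+
  from has_laplacianI[OF this] show ?thesis unfolding q by (rule back_subst[of "has_laplacian _"])
      (auto simp: fun_eq_iff q_def power2_eq_square algebra_simps)
qed

text \<open>The Laplacian of the regularized logarithm \<open>ln (|z|^2 + e) / 2\<close>, and up to
  scaling the area density of the sphere in stereographic projection. Its total mass is
  \<open>2 pi\<close> for every \<open>e > 0\<close> and concentrates at 0 as \<open>e\<close> tends
  to 0.\<close>

definition poisson_kernel :: "real \<Rightarrow> complex \<Rightarrow> real" where
  "poisson_kernel e z = 2 * e / ((norm z)^2 + e)^2"

lemma poisson_kernel_nonneg: "e \<ge> 0 \<Longrightarrow> poisson_kernel e z \<ge> 0" by (simp add: poisson_kernel_def)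

lemma continuous_poisson_kernel: "e > 0 \<Longrightarrow> continuous_on A (\<lambda>z. poisson_kernel e (z - c))"
  unfolding poisson_kernel_def
  by (intro continuous_intros) (metis add_nonneg_pos less_irrefl power_eq_0_iff zero_le_power2)

lemma has_laplacian_log:
  assumes "e > 0"
  shows "has_laplacian (\<lambda>z. ln ((norm (z - c))^2 + e) / 2) (\<lambda>z. poisson_kernel e (z - c))"
proof -
  have "has_laplacian (\<lambda>z. ln ((norm (z - c))^2 + e) / 2)
    (\<lambda>z. 4 * (1 / (2 * ((norm (z - c))^2 + e)) + (norm (z - c))^2 * (- 1 / (2 * ((norm (z - c))^2 + e)^2))))"
  proof (rule has_laplacian_radial[where \<phi> = "\<lambda>w. ln (w + e) / 2"])
    fix w :: real assume "0 \<le> w"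
    then have pos: "0 < w + e" using assms by simp
    show "((\<lambda>w. ln (w + e) / 2) has_real_derivative 1 / (2 * (w + e))) (at w)"
      using pos by (auto intro!: derivative_eq_intros simp: field_simps)
    show "((\<lambda>w. 1 / (2 * (w + e))) has_real_derivative - 1 / (2 * (w + e)^2)) (at w)"
      using pos by (auto intro!: derivative_eq_intros simp: power2_eq_square divide_simps) (simp add: algebra_simps)
  next
    show "continuous_on {0..} (\<lambda>w. - 1 / (2 * (w + e)^2))"
      using assms by (intro continuous_intros) (auto simp: add_eq_0_iff)
  qed
  moreover have "4 * (1 / (2 * (w + e)) + w * (- 1 / (2 * (w + e)^2))) = 2 * e / (w + e)^2"
    if "w \<ge> 0" for w :: real
  proof -
    have "w + e > 0" using that assms by simp
    then show ?thesis by (simp add: divide_simps power2_eq_square) (simp add: algebra_simps)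
  qed
  ultimately show ?thesis by (simp add: poisson_kernel_def[abs_def])
qed

lemma has_bochner_integral_real_line:
  fixes F f :: "real \<Rightarrow> real"
  assumes "\<And>x. (F has_real_derivative f x) (at x)" "\<And>x. isCont f x" "\<And>x. 0 \<le> f x"
    "(F \<longlongrightarrow> A) at_bot" "(F \<longlongrightarrow> B) at_top"
  shows "has_bochner_integral lborel f (B - A)"
proof -
  have a: "set_integrable lborel (einterval (- \<infinity>) \<infinity>) f" by (rule interval_integral_FTC_nonneg[of _ _ F f A B])
      (use assms in \<open>auto simp: ereal_tendsto_simps\<close>)
  have "(LBINT x=-\<infinity>..\<infinity>. f x) = B - A"
    by (rule interval_integral_FTC_nonneg) (use assms in \<open>auto simp: ereal_tendsto_simps\<close>)
  with a show ?thesis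
    by (auto simp: has_bochner_integral_iff interval_lebesgue_integral_def set_integrable_def
        set_lebesgue_integral_def einterval_eq)
qed

text \<open>Iterated integration works because both layers have elementary primitives: with
  \<open>A = sqrt (1 + y^2)\<close> the inner integral of \<open>2 / (x^2 + A^2)^2\<close> is
  \<open>pi / A^3\<close>, and \<open>pi / A^3\<close> is the derivative of
  \<open>pi y / A\<close>.\<close>

lemma nn_integral_poisson_kernel: "(\<integral>\<^sup>+z. ennreal (poisson_kernel 1 z) \<partial>lborel) = ennreal (2 * pi)"
proof -
  have inner: "(\<integral>\<^sup>+x. ennreal (poisson_kernel 1 (Complex x y)) \<partial>lborel) = ennreal (pi / sqrt (1 + y^2) ^ 3)" for y
  proof -
    define A where "A = sqrt (1 + y^2)"
    have A: "A > 0" "A^2 = 1 + y^2" unfolding A_def by (auto simp: add_pos_nonneg)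
    have pk: "poisson_kernel 1 (Complex x y) = 2 / (x^2 + A^2)^2" for x
      by (simp add: poisson_kernel_def cmod_power2 A add_ac)
    have nz: "x^2 + A^2 \<noteq> 0" for x using A by (metis add_nonneg_pos less_irrefl zero_le_power2 zero_less_power)
    have "has_bochner_integral lborel (\<lambda>x. 2 / (x^2 + A^2)^2) (pi / 2 / A ^ 3 - (- (pi / 2) / A ^ 3))"
    proof (rule has_bochner_integral_real_line)
      show "((\<lambda>x. x / (A^2 * (x^2 + A^2)) + arctan (x / A) / A ^ 3) has_real_derivative 2 / (x^2 + A^2)^2) (at x)" for x
      proof -
        have "((\<lambda>x. x / (A^2 * (x^2 + A^2)) + arctan (x / A) / A ^ 3) has_real_derivative
           (A^2 * (x^2 + A^2) - x * (A^2 * (2 * x))) / (A^2 * (x^2 + A^2))^2 + inverse (1 + (x / A)^2) * (1 / A) / A ^ 3) (at x)"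
          unfolding power2_eq_square[of "A^2 * (x^2 + A^2)"]
        proof (intro DERIV_add)
          show "((\<lambda>x. x / (A^2 * (x^2 + A^2))) has_real_derivative
            (A^2 * (x^2 + A^2) - x * (A^2 * (2 * x))) / ((A^2 * (x^2 + A^2)) * (A^2 * (x^2 + A^2)))) (at x)"
            by (rule DERIV_cong, rule DERIV_divide[OF DERIV_ident, where g = "\<lambda>x. A^2 * (x^2 + A^2)" and E = "A^2 * (2 * x)"])
              (use A nz[of x] in \<open>auto intro!: derivative_eq_intros\<close>)
          show "((\<lambda>x. arctan (x / A) / A ^ 3) has_real_derivative inverse (1 + (x / A)^2) * (1 / A) / A ^ 3) (at x)"
            by (intro DERIV_cdivide DERIV_chain2[OF DERIV_arctan]) (auto intro!: derivative_eq_intros)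
        qed
        also have "inverse (1 + (x / A)^2) = A^2 / (x^2 + A^2)"
        proof -
          have "1 + (x / A)^2 = (x^2 + A^2) / A^2" using A(1) by (simp add: field_simps)
          then show ?thesis by simp
        qed
        also have "(A^2 * (x^2 + A^2) - x * (A^2 * (2 * x))) / (A^2 * (x^2 + A^2))^2 + A^2 / (x^2 + A^2) * (1 / A) / A ^ 3
          = 2 / (x^2 + A^2)^2"
        proof -
          have gen: "(B - C) / (B * (C + B)^2) + 1 / (B * (C + B)) = 2 / (C + B)^2"
            if "B \<noteq> 0" "C + B \<noteq> 0" for B C :: real using that by (simp add: divide_simps power2_eq_square)
          have "A^2 / (x^2 + A^2) * (1 / A) / A ^ 3 = 1 / (A^2 * (x^2 + A^2))"
            using A nz[of x] by (simp add: divide_simps power2_eq_square power3_eq_cube)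
          moreover have "(A^2 * (x^2 + A^2) - x * (A^2 * (2 * x))) / (A^2 * (x^2 + A^2))^2
             = (A^2 - x\<^sup>2) / (A^2 * (x^2 + A^2)^2)"
          proof -
            have "A^2 * (x^2 + A^2) - x * (A^2 * (2 * x)) = A^2 * (A^2 - x\<^sup>2)"
              by (simp add: algebra_simps power2_eq_square)
            then show ?thesis using A(1) by (simp add: power2_eq_square)
          qed
          ultimately show ?thesis using gen[of "A^2" "x^2"] A(1) nz[of x] by simp
        qed
        finally show ?thesis .
      qed
      have d: "filterlim (\<lambda>x. x / A) at_top at_top" "filterlim (\<lambda>x. x / A) at_bot at_bot"
        using A(1) by real_asymp+
      have e: "((\<lambda>x. x / (A^2 * (x^2 + A^2))) \<longlongrightarrow> 0) at_top" "((\<lambda>x. x / (A^2 * (x^2 + A^2))) \<longlongrightarrow> 0) at_bot"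
        using A(1) by real_asymp+
      show "((\<lambda>x. x / (A^2 * (x^2 + A^2)) + arctan (x / A) / A ^ 3) \<longlongrightarrow> pi / 2 / A ^ 3) at_top"
        by (rule tendsto_eq_intros e filterlim_compose[OF tendsto_arctan_at_top d(1)] refl)+ (use A in auto)
      show "((\<lambda>x. x / (A^2 * (x^2 + A^2)) + arctan (x / A) / A ^ 3) \<longlongrightarrow> - (pi / 2) / A ^ 3) at_bot"
        by (rule tendsto_eq_intros e filterlim_compose[OF tendsto_arctan_at_bot d(2)] refl)+ (use A in auto)
    qed (use nz in \<open>auto intro!: continuous_intros\<close>)
    then show ?thesis unfolding pk
      by (subst nn_integral_eq_integral) (auto simp: has_bochner_integral_iff A_def field_simps)
  qed
  have "has_bochner_integral lborel (\<lambda>y. pi / sqrt (1 + y^2) ^ 3) (pi - (- pi))"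
  proof (rule has_bochner_integral_real_line)
    show "((\<lambda>y. pi * y / sqrt (1 + y^2)) has_real_derivative pi / sqrt (1 + y^2) ^ 3) (at y)" for y :: real
    proof -
      have p: "1 + y^2 > 0" by (simp add: add_pos_nonneg)
      have "((\<lambda>y. pi * y / sqrt (1 + y^2)) has_real_derivative
         (pi * sqrt (1 + y^2) - pi * y * (2 * y * (inverse (sqrt (1 + y^2)) / 2))) / (sqrt (1 + y^2) * sqrt (1 + y^2))) (at y)"
        by (rule derivative_eq_intros refl | use p in simp)+
      also have "(pi * sqrt (1 + y^2) - pi * y * (2 * y * (inverse (sqrt (1 + y^2)) / 2))) / (sqrt (1 + y^2) * sqrt (1 + y^2))
         = pi / sqrt (1 + y^2) ^ 3"
      proof -
        define A where "A = sqrt (1 + y^2)"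
        have A: "A > 0" "A * A = 1 + y^2" unfolding A_def using p by auto
        have "(pi * A - pi * y * (2 * y * (inverse A / 2))) / (A * A) = pi * (A * A - y\<^sup>2) / A ^ 3"
          using A(1) by (simp add: field_simps power2_eq_square power3_eq_cube)
        then show ?thesis unfolding A_def[symmetric] using A(2) by simp
      qed
      finally show ?thesis .
    qed
    show "((\<lambda>y. pi * y / sqrt (1 + y^2)) \<longlongrightarrow> pi) at_top" by real_asymp
    show "((\<lambda>y. pi * y / sqrt (1 + y^2)) \<longlongrightarrow> - pi) at_bot" by real_asymp
    show "isCont (\<lambda>y. pi / sqrt (1 + y^2) ^ 3) y" for y :: real
      by (intro continuous_intros) (auto simp: add_nonneg_eq_0_iff)
  qed auto
  then have "(\<integral>\<^sup>+y. ennreal (pi / sqrt (1 + y^2) ^ 3) \<partial>lborel) = ennreal (2 * pi)"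
    by (subst nn_integral_eq_integral) (auto simp: has_bochner_integral_iff)
  moreover have "poisson_kernel 1 \<in> borel_measurable borel"
    using borel_measurable_continuous_onI[OF continuous_poisson_kernel[of 1 UNIV 0]] by simp
  ultimately show ?thesis by (subst nn_integral_complex(2)) (auto simp: inner)
qed

lemma integral_poisson_kernel: "has_bochner_integral lborel (poisson_kernel 1) (2 * pi)"
proof -
  have [measurable]: "poisson_kernel 1 \<in> borel_measurable borel"
    using borel_measurable_continuous_onI[OF continuous_poisson_kernel[of 1 UNIV 0]] by simp
  show ?thesis by (rule has_bochner_integral_nn_integral)
      (auto simp: nn_integral_poisson_kernel poisson_kernel_nonneg)
qed

text \<open>Substituting \<open>z = c + sqrt (e n) w\<close> turns the kernel into
  \<open>poisson_kernel 1\<close> for every \<open>n\<close>, and dominated convergence applies. The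
  functions \<open>h n\<close> vary with \<open>n\<close> because below they carry an
  \<open>n\<close>-dependent cutoff.\<close>

lemma poisson_kernel_approximate_identity:
  fixes h :: "nat \<Rightarrow> complex \<Rightarrow> real" and c :: complex
  assumes e: "\<And>n. e n > 0" and [measurable]: "\<And>n. h n \<in> borel_measurable borel"
    and M: "\<And>n z. \<bar>h n z\<bar> \<le> M"
    and lim: "\<And>w :: complex. (\<lambda>n. h n (c + of_real (sqrt (e n)) * w)) \<longlonglongrightarrow> L"
  shows "(\<lambda>n. \<integral>z. h n z * poisson_kernel (e n) (z - c) \<partial>lborel) \<longlonglongrightarrow> 2 * pi * L"
proof -
  have [measurable]: "poisson_kernel a \<in> borel_measurable borel" for a
    unfolding poisson_kernel_def by measurable
  have *: "(LBINT z. h n z * poisson_kernel (e n) (z - c))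
      = (LBINT w. h n (c + of_real (sqrt (e n)) * w) * poisson_kernel 1 w)" for n
  proof -
    have s: "sqrt (e n) > 0" using e by simp
    have cx: "Complex (sqrt (e n) * Re w) (sqrt (e n) * Im w) = of_real (sqrt (e n)) * w" for w
      by (simp add: complex_eq_iff)
    have pk: "e n * poisson_kernel (e n) (of_real (sqrt (e n)) * w) = poisson_kernel 1 w" for w
    proof -
      have "poisson_kernel (e n) (of_real (sqrt (e n)) * w) = 2 * e n / (e n * ((norm w)^2 + 1))^2"
        using e[of n] by (simp add: poisson_kernel_def norm_mult power_mult_distrib algebra_simps)
      then show ?thesis using e[of n]
        by (simp add: poisson_kernel_def power_mult_distrib) (simp add: power2_eq_square)
    qed
    have "(LBINT z. h n z * poisson_kernel (e n) (z - c))
       = sqrt (e n) * sqrt (e n) * (LBINT w. h n (c + of_real (sqrt (e n)) * w) * poisson_kernel (e n) (of_real (sqrt (e n)) * w))"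
      by (subst integral_complex_similarity(1)[of 1 "sqrt (e n)" "sqrt (e n)" _ c]) (use s in \<open>auto simp: cx\<close>)
    also have "\<dots> = (LBINT w. h n (c + of_real (sqrt (e n)) * w) * (e n * poisson_kernel (e n) (of_real (sqrt (e n)) * w)))"
      using e[of n] by (simp flip: Bochner_Integration.integral_mult_right_zero add: mult_ac)
    finally show ?thesis by (simp add: pk)
  qed
  have "(\<lambda>n. \<integral>w. h n (c + of_real (sqrt (e n)) * w) * poisson_kernel 1 w \<partial>lborel)
      \<longlonglongrightarrow> (LBINT w. L * poisson_kernel 1 w)"
  proof (rule integral_dominated_convergence[where w = "\<lambda>w. M * poisson_kernel 1 w"])
    show "integrable lborel (\<lambda>w. M * poisson_kernel 1 w)"
      using integral_poisson_kernel by (auto simp: has_bochner_integral_iff)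
    show "AE w in lborel. norm (h n (c + of_real (sqrt (e n)) * w) * poisson_kernel 1 w) \<le> M * poisson_kernel 1 w" for n
      using M by (auto simp: abs_mult poisson_kernel_nonneg intro!: mult_right_mono)
    show "AE w in lborel. (\<lambda>n. h n (c + of_real (sqrt (e n)) * w) * poisson_kernel 1 w) \<longlonglongrightarrow> L * poisson_kernel 1 w"
      using lim by (auto intro!: tendsto_intros)
  qed measurable
  also have "(LBINT w. L * poisson_kernel 1 w) = 2 * pi * L"
    using integral_poisson_kernel by (auto simp: has_bochner_integral_iff)
  finally show ?thesis by (simp add: *)
qed

section \<open>Local square integrability of the logarithm and its Laplacian as a point mass\<close>

lemma ln_sq_le:
  fixes x :: real assumes "0 < x" "x \<le> T" "T \<ge> 1" shows "(ln x)^2 \<le> 16 / sqrt x + (ln T)^2"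
proof (cases "x \<ge> 1")
  case True
  then have "(ln x)^2 \<le> (ln T)^2" using assms by (intro power_mono) auto
  then show ?thesis using assms by (simp add: add_increasing)
next
  case False
  \<comment> \<open>With the fourth root, \<open>- ln s \<le> 1 / s\<close> gives
    \<open>|ln x| \<le> 4 / s\<close>, and the square \<open>16 / sqrt x\<close> is still integrable
    in one real variable.\<close>
  define s where "s = sqrt (sqrt x)"
  have s: "0 < s" "s ^ 4 = x" proof -
    show "0 < s" using assms by (simp add: s_def)
    have "s ^ 4 = (s ^ 2) ^ 2" by (simp flip: power_mult)
    then show "s ^ 4 = x" using assms by (simp add: s_def)
  qed
  have "- ln s \<le> 1 / s" using ln_le_minus_one[of "1 / s"] s by (simp add: ln_div)
  moreover have "ln (s ^ 4) = 4 * ln s" using s(1) by (simp add: ln_realpow)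
  then have "ln x = 4 * ln s" unfolding s(2) .
  moreover have "ln x \<le> 0" using False assms by simp
  ultimately have "\<bar>ln x\<bar> \<le> 4 / s" by simp
  then have "\<bar>ln x\<bar>\<^sup>2 \<le> (4 / s)^2" by (intro power_mono) auto
  also have "\<dots> = 16 / sqrt x" using assms by (simp add: s_def power_divide)
  finally show ?thesis using zero_le_power2[of "ln T"] unfolding power2_abs by linarith
qed

lemma nn_integral_inverse_sqrt:
  "(\<integral>\<^sup>+x\<in>{- T..T}. ennreal (1 / sqrt \<bar>x\<bar>) \<partial>lborel) < \<infinity>"
proof (cases "T > 0")
  case True
  have "set_integrable lborel (einterval 0 (ereal T)) (\<lambda>x. 1 / sqrt x)"
  proof (rule interval_integral_FTC_nonneg[of _ _ "\<lambda>x. 2 * sqrt x" _ 0 "2 * sqrt T"])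
    show "((\<lambda>x. 2 * sqrt x) has_real_derivative 1 / sqrt x) (at x)" if "0 < ereal x" for x
      using that by (auto intro!: derivative_eq_intros simp: field_simps)
    show "isCont (\<lambda>x. 1 / sqrt x) x" if "0 < ereal x" for x using that by (auto intro!: continuous_intros)
    have "((\<lambda>x. 2 * sqrt x) \<longlongrightarrow> 2 * sqrt 0) (at_right 0)" "((\<lambda>x. 2 * sqrt x) \<longlongrightarrow> 2 * sqrt T) (at_left T)"
      by (intro tendsto_intros)+
    then show "(((\<lambda>x. 2 * sqrt x) \<circ> real_of_ereal) \<longlongrightarrow> 0) (at_right 0)"
       "(((\<lambda>x. 2 * sqrt x) \<circ> real_of_ereal) \<longlongrightarrow> 2 * sqrt T) (at_left (ereal T))"
      by (simp_all add: ereal_tendsto_simps zero_ereal_def)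
  qed (use True in auto)
  then have i: "integrable lborel (\<lambda>x. indicator {0<..<T} x * (1 / sqrt x))"
    unfolding set_integrable_def by (simp add: zero_ereal_def)
  then have fin: "(\<integral>\<^sup>+x. ennreal (indicator {0<..<T} x * (1 / sqrt x)) \<partial>lborel) < \<infinity>"
    by (subst nn_integral_eq_integral) (auto simp: indicator_def)
  have "(\<integral>\<^sup>+x\<in>{- T..T}. ennreal (1 / sqrt \<bar>x\<bar>) \<partial>lborel)
     = (\<integral>\<^sup>+x. ennreal (indicator {0<..<T} x * (1 / sqrt x)) + ennreal (indicator {0<..<T} (- x) * (1 / sqrt (- x))) \<partial>lborel)"
  proof (rule nn_integral_cong_AE)
    have "AE x in lborel. x \<noteq> (0 :: real)" "AE x in lborel. x \<noteq> T" "AE x in lborel. x \<noteq> - T"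
      by (rule AE_lborel_singleton)+
    then show "AE x in lborel. ennreal (1 / sqrt \<bar>x\<bar>) * indicator {- T..T} x =
       ennreal (indicator {0<..<T} x * (1 / sqrt x)) + ennreal (indicator {0<..<T} (- x) * (1 / sqrt (- x)))"
      by eventually_elim (auto simp: indicator_def split: if_splits)
  qed
  also have "\<dots> = (\<integral>\<^sup>+x. ennreal (indicator {0<..<T} x * (1 / sqrt x)) \<partial>lborel)
     + (\<integral>\<^sup>+x. ennreal (indicator {0<..<T} (- x) * (1 / sqrt (- x))) \<partial>lborel)" by (rule nn_integral_add) auto
  also have "(\<integral>\<^sup>+x. ennreal (indicator {0<..<T} (- x) * (1 / sqrt (- x))) \<partial>lborel)
     = (\<integral>\<^sup>+x. ennreal (indicator {0<..<T} x * (1 / sqrt x)) \<partial>lborel)"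
    using nn_integral_real_affine[of "\<lambda>x. ennreal (indicator {0<..<T} x * (1 / sqrt x))" "-1" 0] by simp
  finally show ?thesis using fin by simp
next
  case False
  then have *: "(\<lambda>x. ennreal (1 / sqrt \<bar>x\<bar>) * indicator {- T..T} x) = (\<lambda>_. 0)"
    by (auto simp: fun_eq_iff indicator_def)
  show ?thesis unfolding * by simp
qed

text \<open>In the singular term \<open>norm z\<close> is replaced by the smaller
  \<open>|Re z|\<close>. This spreads the singularity over a line, but \<open>1 / sqrt |x|\<close>
  is integrable in one variable, so Fubini replaces polar coordinates.\<close>

lemma nn_integral_ln_sq:
  "(\<integral>\<^sup>+z. ennreal ((ln (norm z))^2) * indicator (ball 0 T) (z :: complex) \<partial>lborel) < \<infinity>"
proof -
  define T' where "T' = max T 1"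
  have "(\<integral>\<^sup>+z. ennreal ((ln (norm z))^2) * indicator (ball 0 T) (z :: complex) \<partial>lborel)
     \<le> (\<integral>\<^sup>+z. (16 * (ennreal (1 / sqrt \<bar>Re z\<bar>) * indicator {- T'..T'} (Re z)) + ennreal ((ln T')^2) * indicator {- T'..T'} (Re z)) *
           indicator {- T'..T'} (Im z) \<partial>lborel)"
  proof (rule nn_integral_mono_AE)
    \<comment> \<open>On the line \<open>Re z = 0\<close> the majorant loses its singular term,
      because \<open>1 / 0 = 0\<close>.\<close>
    have "negligible {z :: complex. 1 \<bullet> z = 0}" by (rule negligible_hyperplane) simp
    then have "AE z in lebesgue. z \<notin> {z :: complex. Re z = 0}"
      by (intro AE_not_in) (simp add: negligible_iff_null_sets inner_complex_def)
    then have "AE z in lborel. z \<notin> {z :: complex. Re z = 0}" by (simp only: AE_completion_iff)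
    then show "AE z in lborel. ennreal ((ln (norm z))^2) * indicator (ball 0 T) z \<le>
        (16 * (ennreal (1 / sqrt \<bar>Re z\<bar>) * indicator {- T'..T'} (Re z)) + ennreal ((ln T')^2) * indicator {- T'..T'} (Re z)) * indicator {- T'..T'} (Im z)"
    proof eventually_elim
      fix z :: complex assume z: "z \<notin> {z. Re z = 0}"
      show "ennreal ((ln (norm z))^2) * indicator (ball 0 T) z \<le>
        (16 * (ennreal (1 / sqrt \<bar>Re z\<bar>) * indicator {- T'..T'} (Re z)) + ennreal ((ln T')^2) * indicator {- T'..T'} (Re z)) * indicator {- T'..T'} (Im z)"
      proof (cases "z \<in> ball 0 T")
        case True
        then have zT: "norm z \<le> T'" by (simp add: T'_def)
        have b: "\<bar>Re z\<bar> \<le> T'" "\<bar>Im z\<bar> \<le> T'" using abs_Re_le_cmod[of z] abs_Im_le_cmod[of z] zT by linarith+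
        have zp: "0 < norm z" using z by auto
        have "(ln (norm z))^2 \<le> 16 / sqrt (norm z) + (ln T')^2"
          by (rule ln_sq_le) (use zp zT in \<open>auto simp: T'_def\<close>)
        also have "16 / sqrt (norm z) \<le> 16 / sqrt \<bar>Re z\<bar>"
          using z zp abs_Re_le_cmod[of z] by (intro divide_left_mono mult_pos_pos) auto
        finally have "ennreal ((ln (norm z))^2) \<le> ennreal (16 * (1 / sqrt \<bar>Re z\<bar>) + (ln T')^2)"
          by (intro ennreal_leI) simp
        also have "\<dots> = 16 * ennreal (1 / sqrt \<bar>Re z\<bar>) + ennreal ((ln T')^2)"
          by (simp add: ennreal_mult[symmetric] ennreal_plus[symmetric] del: ennreal_plus flip: ennreal_numeral)
        finally show ?thesis using b True by (simp add: abs_le_iff)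
      qed simp
    qed
  qed
  also have "\<dots> = (\<integral>\<^sup>+y. (\<integral>\<^sup>+x. 16 * (ennreal (1 / sqrt \<bar>x\<bar>) * indicator {- T'..T'} x) + ennreal ((ln T')^2) * indicator {- T'..T'} x \<partial>lborel)
        * indicator {- T'..T'} y \<partial>lborel)" by (subst nn_integral_complex(2)) (auto simp: nn_integral_multc)
  also have "\<dots> = (16 * (\<integral>\<^sup>+x. (ennreal (1 / sqrt \<bar>x\<bar>) * indicator {- T'..T'} x) \<partial>lborel) + ennreal ((ln T')^2) * ennreal (2 * T')) * ennreal (2 * T')"
    by (subst nn_integral_add, simp, simp) (simp add: nn_integral_cmult nn_integral_cmult_indicator T'_def)
  also have "\<dots> < \<infinity>" using nn_integral_inverse_sqrt[of T'] by (auto simp: ennreal_mult_less_top)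
  finally show ?thesis .
qed

text \<open>The bound must not depend on \<open>\<zeta>\<close>, since it will be applied to zeros
  in unknown position. Seen from \<open>\<zeta>\<close>, the disc of radius \<open>R\<close> lies in
  a disc of radius \<open>2 R\<close>, and translation invariance gives one integral
  \<open>J\<close> for all \<open>\<zeta>\<close>.\<close>

lemma ln_sq_local_bound:
  "\<exists>M. \<forall>\<zeta>. norm \<zeta> \<le> R \<longrightarrow>
     integrable lborel (\<lambda>z. indicator (ball 0 R) z * (ln (norm (z - \<zeta>)))^2) \<and>
     (\<integral>z. indicator (ball 0 R) z * (ln (norm (z - \<zeta>)))^2 \<partial>(lborel :: complex measure)) \<le> M"
proof -
  have [measurable]: "ball 0 r \<in> sets (borel :: complex measure)" for r by simp
  define J where "J = (\<integral>\<^sup>+z. ennreal ((ln (norm z))^2) * indicator (ball 0 (2 * R)) (z :: complex) \<partial>lborel)"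
  have J: "J < \<infinity>" unfolding J_def by (rule nn_integral_ln_sq)
  have "integrable lborel (\<lambda>z. indicator (ball 0 R) z * (ln (norm (z - \<zeta>)))^2) \<and>
     (\<integral>z. indicator (ball 0 R) z * (ln (norm (z - \<zeta>)))^2 \<partial>(lborel :: complex measure)) \<le> enn2real J"
    if \<zeta>: "norm \<zeta> \<le> R" for \<zeta>
  proof -
    have "(\<integral>\<^sup>+z. ennreal (indicator (ball 0 R) z * (ln (norm (z - \<zeta>)))^2) \<partial>lborel)
       \<le> (\<integral>\<^sup>+z. ennreal ((ln (norm (z - \<zeta>)))^2) * indicator (ball 0 (2 * R)) (z - \<zeta>) \<partial>lborel)"
    proof (rule nn_integral_mono)
      fix z :: complex
      have "norm (z - \<zeta>) < 2 * R" if "norm z < R" using norm_triangle_ineq4[of z \<zeta>] that \<zeta> by linarith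
      then show "ennreal (indicator (ball 0 R) z * (ln (norm (z - \<zeta>)))^2) \<le> ennreal ((ln (norm (z - \<zeta>)))^2) * indicator (ball 0 (2 * R)) (z - \<zeta>)"
        by (auto simp: indicator_def)
    qed
    also have "\<dots> = J"
    proof -
      have "J = (\<integral>\<^sup>+z. ennreal ((ln (norm z))^2) * indicator (ball 0 (2 * R)) z \<partial>distr lborel borel (\<lambda>z. - \<zeta> + z))"
        unfolding J_def by (subst lborel_distr_plus) simp
      also have "\<dots> = (\<integral>\<^sup>+z. ennreal ((ln (norm (z - \<zeta>)))^2) * indicator (ball 0 (2 * R)) (z - \<zeta>) \<partial>lborel)"
        by (subst nn_integral_distr) (simp_all add: add.commute, measurable)
      finally show ?thesis by simp
    qed
    finally have le: "(\<integral>\<^sup>+z. ennreal (indicator (ball 0 R) z * (ln (norm (z - \<zeta>)))^2) \<partial>lborel) \<le> J" .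
    have int: "integrable lborel (\<lambda>z. indicator (ball 0 R) z * (ln (norm (z - \<zeta>)))^2)"
      by (rule integrableI_nonneg) (use le J in \<open>auto intro: le_less_trans\<close>)
    then show ?thesis using le J by (auto simp: integral_eq_nn_integral enn2real_mono)
  qed
  then show ?thesis by blast
qed

lemma integrable_ln_times:
  fixes \<zeta> :: complex
  assumes G: "continuous_on UNIV G" and z: "\<And>z. R \<le> norm z \<Longrightarrow> G z = 0"
  shows "integrable lborel (\<lambda>z. ln (norm (z - \<zeta>)) * G z)"
    and "integrable lborel (\<lambda>z. \<bar>ln (norm (z - \<zeta>))\<bar> * G z)"
proof -
  define R' where "R' = max R (norm \<zeta>)"
  have Gm[measurable]: "G \<in> borel_measurable borel" using G by (rule borel_measurable_continuous_onI)
  have "compact (G ` cball 0 R)" by (intro compact_continuous_image continuous_on_subset[OF G]) auto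
  then obtain B where B: "\<And>z. z \<in> cball 0 R \<Longrightarrow> norm (G z) \<le> B"
    by (meson bounded_iff compact_imp_bounded image_eqI)
  have i: "integrable lborel (\<lambda>z. indicator (ball 0 R') z * (ln (norm (z - \<zeta>)))^2)"
    using ln_sq_local_bound[of R'] unfolding R'_def by auto
  have j: "integrable lborel (\<lambda>z. B * (indicator (ball 0 R') z + indicator (ball 0 R') z * (ln (norm (z - \<zeta>)))^2))"
    by (intro Bochner_Integration.integrable_add integrable_mult_right i)
       (use emeasure_lborel_ball_finite[of 0 R'] in \<open>simp add: integrable_indicator_iff infinity_ennreal_def\<close>)
  have le: "norm (ln (norm (z - \<zeta>)) * G z) \<le> norm (B * (indicator (ball 0 R') z + indicator (ball 0 R') z * (ln (norm (z - \<zeta>)))^2))" for z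
  proof (cases "norm z < R")
    case True
    have "\<bar>t\<bar> \<le> 1 + t^2" for t :: real
      using sum_power2_ge_zero[of 0 0] power2_ge_1_iff[of t] self_le_power[of "\<bar>t\<bar>" 2]
      by (cases "\<bar>t\<bar> \<ge> 1") (auto simp: add_increasing2)
    then have "norm (G z) * \<bar>ln (norm (z - \<zeta>))\<bar> \<le> B * (1 + (ln (norm (z - \<zeta>)))^2)"
      using B[of z] True by (intro mult_mono) (auto intro: order_trans[OF norm_ge_zero])
    also have "\<dots> \<le> \<bar>B * (1 + (ln (norm (z - \<zeta>)))^2)\<bar>" by simp
    finally show ?thesis using True by (simp add: abs_mult R'_def mult.commute)
  qed (use z in auto)
  show "integrable lborel (\<lambda>z. ln (norm (z - \<zeta>)) * G z)"
    by (rule Bochner_Integration.integrable_bound[OF j]) (measurable, rule AE_I2, rule le)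
  show "integrable lborel (\<lambda>z. \<bar>ln (norm (z - \<zeta>))\<bar> * G z)"
  proof (rule Bochner_Integration.integrable_bound[OF j])
    have "norm (\<bar>ln (norm (z - \<zeta>))\<bar> * G z) = norm (ln (norm (z - \<zeta>)) * G z)" for z by (simp add: abs_mult)
    then show "AE z in lborel. norm (\<bar>ln (norm (z - \<zeta>))\<bar> * G z)
        \<le> norm (B * (indicator (ball 0 R') z + indicator (ball 0 R') z * (ln (norm (z - \<zeta>)))^2))"
      using le by (simp only: AE_I2)
  qed measurable
qed

text \<open>The regularized logarithm increases with \<open>e\<close>, so for
  \<open>0 < e \<le> 1\<close> it lies between its values at \<open>e = 0\<close> and
  \<open>e = 1\<close>; both are integrable against \<open>G\<close>.\<close>

lemma integral_ln_regularized_tendsto: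
  fixes \<zeta> :: complex
  assumes cG: "continuous_on UNIV G" and G0: "\<And>z. R \<le> norm z \<Longrightarrow> G z = 0"
    and e: "\<And>n. e n > 0" "\<And>n. e n \<le> 1" and elim: "e \<longlonglongrightarrow> 0"
  shows "(\<lambda>n. \<integral>z. ln ((norm (z - \<zeta>))^2 + e n) / 2 * G z \<partial>lborel)
      \<longlonglongrightarrow> (LBINT z. ln (norm (z - \<zeta>)) * G z)"
proof -
  have [measurable]: "G \<in> borel_measurable borel" using cG by (rule borel_measurable_continuous_onI)
  show ?thesis
  proof (rule integral_dominated_convergence[where w = "\<lambda>z. \<bar>ln (norm (z - \<zeta>))\<bar> * \<bar>G z\<bar> + ln ((norm (z - \<zeta>))^2 + 1) / 2 * \<bar>G z\<bar>"])
    have "continuous_on UNIV (\<lambda>z. ln ((norm (z - \<zeta>))^2 + 1) / 2 * \<bar>G z\<bar>)"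
      by (intro continuous_on_mult has_laplacian_continuous[OF has_laplacian_log[of 1 \<zeta>]] continuous_on_rabs cG) simp
    then have "integrable lborel (\<lambda>z. ln ((norm (z - \<zeta>))^2 + 1) / 2 * \<bar>G z\<bar>)"
      by (rule integrable_compact_support[where R = R]) (simp add: G0)
    moreover have "integrable lborel (\<lambda>z. \<bar>ln (norm (z - \<zeta>))\<bar> * \<bar>G z\<bar>)"
      by (rule integrable_ln_times(2)[of _ R]) (use cG G0 in \<open>auto intro!: continuous_intros\<close>)
    ultimately show "integrable lborel (\<lambda>z. \<bar>ln (norm (z - \<zeta>))\<bar> * \<bar>G z\<bar> + ln ((norm (z - \<zeta>))^2 + 1) / 2 * \<bar>G z\<bar>)"
      by simp
    have AE: "AE z in lborel. z \<noteq> \<zeta>" by (rule AE_lborel_singleton)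
    show "AE z in lborel. (\<lambda>n. ln ((norm (z - \<zeta>))^2 + e n) / 2 * G z) \<longlonglongrightarrow> ln (norm (z - \<zeta>)) * G z" using AE
    proof eventually_elim
      case (elim z)
      then have "(\<lambda>n. ln ((norm (z - \<zeta>))^2 + e n) / 2 * G z) \<longlonglongrightarrow> ln ((norm (z - \<zeta>))^2 + 0) / 2 * G z"
        by (intro tendsto_intros \<open>e \<longlonglongrightarrow> 0\<close>) auto
      then show ?case using elim by (simp add: ln_realpow)
    qed
    show "AE z in lborel. norm (ln ((norm (z - \<zeta>))^2 + e n) / 2 * G z)
        \<le> \<bar>ln (norm (z - \<zeta>))\<bar> * \<bar>G z\<bar> + ln ((norm (z - \<zeta>))^2 + 1) / 2 * \<bar>G z\<bar>" for n using AE
    proof eventually_elim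
      case (elim z)
      define w where "w = (norm (z - \<zeta>))^2"
      have w: "w > 0" using elim by (simp add: w_def)
      have "ln w = 2 * ln (norm (z - \<zeta>))" using elim by (simp add: w_def ln_realpow)
      moreover have "ln w \<le> ln (w + e n)" "ln (w + e n) \<le> ln (w + 1)" "0 \<le> ln (w + 1)" using w e[of n] by auto
      ultimately have "\<bar>ln (w + e n) / 2\<bar> \<le> \<bar>ln (norm (z - \<zeta>))\<bar> + ln (w + 1) / 2" by linarith
      then have "\<bar>ln (w + e n) / 2\<bar> * \<bar>G z\<bar> \<le> (\<bar>ln (norm (z - \<zeta>))\<bar> + ln (w + 1) / 2) * \<bar>G z\<bar>"
        by (intro mult_right_mono) auto
      then show ?case unfolding w_def by (simp add: abs_mult ring_distribs)
    qed
  qed measurable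
qed

text \<open>The distributional identity that the Laplacian of \<open>ln |z - \<zeta>|\<close> is
  \<open>2 pi\<close> times the point mass at \<open>\<zeta>\<close>: Green's identity for the
  regularized logarithm, then \<open>e \<rightarrow> 0\<close> on both sides.\<close>

proposition integral_ln_laplacian:
  assumes g: "has_laplacian g G" and z: "\<And>z. R \<le> norm z \<Longrightarrow> g z = 0"
  shows "(LBINT z. ln (norm (z - \<zeta>)) * G z) = 2 * pi * g \<zeta>"
proof -
  define e where "e n = 1 / real (Suc n)" for n
  have e: "e n > 0" "e n \<le> 1" for n by (auto simp: e_def)
  have elim: "e \<longlonglongrightarrow> 0" unfolding e_def using LIMSEQ_Suc[OF lim_1_over_n] .
  have cg: "continuous_on UNIV g" and cG: "continuous_on UNIV G"
    using g by (auto intro: has_laplacian_continuous has_laplacian_continuous')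
  have [measurable]: "g \<in> borel_measurable borel" "G \<in> borel_measurable borel"
    using cg cG by (auto intro: borel_measurable_continuous_onI)
  have G0: "G z = 0" if "R \<le> norm z" for z using has_laplacian_vanishes[OF g z that] .
  have "compact (g ` cball 0 R)" by (intro compact_continuous_image continuous_on_subset[OF cg]) auto
  then obtain B where B: "\<And>z. z \<in> cball 0 R \<Longrightarrow> norm (g z) \<le> B"
    by (meson bounded_iff compact_imp_bounded image_eqI)
  have B: "\<bar>g z\<bar> \<le> max B 0" for z using B[of z] z[of z] by (cases "norm z \<le> R") auto
  have eq: "(LBINT z. ln ((norm (z - \<zeta>))^2 + e n) / 2 * G z) = (LBINT z. g z * poisson_kernel (e n) (z - \<zeta>))" for n
    using green_identity[OF has_laplacian_log[OF e(1)[of n], where c = \<zeta>] g z] by (simp add: mult.commute)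
  have 1: "(\<lambda>n. \<integral>z. g z * poisson_kernel (e n) (z - \<zeta>) \<partial>lborel) \<longlonglongrightarrow> 2 * pi * g \<zeta>"
  proof (rule poisson_kernel_approximate_identity[OF e(1) _ B])
    fix w
    have "(\<lambda>n. \<zeta> + of_real (sqrt (e n)) * w) \<longlonglongrightarrow> \<zeta> + of_real (sqrt 0) * w" by (intro tendsto_intros elim)
    then show "(\<lambda>n. g (\<zeta> + of_real (sqrt (e n)) * w)) \<longlonglongrightarrow> g \<zeta>"
      using cg by (intro isCont_tendsto_compose[of \<zeta> g]) (auto simp: continuous_on_eq_continuous_at)
  qed simp
  have "(\<lambda>n. \<integral>z. ln ((norm (z - \<zeta>))^2 + e n) / 2 * G z \<partial>lborel) \<longlonglongrightarrow> (LBINT z. ln (norm (z - \<zeta>)) * G z)"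
    using cG G0 e elim by (rule integral_ln_regularized_tendsto)
  from LIMSEQ_unique[OF this[unfolded eq] 1] show ?thesis .
qed

section \<open>Weighted means of the logarithm\<close>

text \<open>A radial probability density on the disc, \<open>pi R^2 / 3\<close> being the integral
  of the clamped square. Its multiple by \<open>2 pi\<close> is the limit, as
  \<open>e \<rightarrow> 0\<close>, of the term \<open>6 / R^2 * (cutoff R e c z)^2\<close> in
  \<open>has_laplacian_log_tail\<close>.\<close>

definition bump :: "real \<Rightarrow> complex \<Rightarrow> complex \<Rightarrow> real" where
  "bump R c z = 3 / (pi * R^2) * (max 0 (1 - (norm (z - c))\<^sup>2 / R^2))^2"

lemma bump_nonneg: "bump R c z \<ge> 0" by (simp add: bump_def)

lemma continuous_bump: "continuous_on A (bump R c)"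
  unfolding bump_def by (cases "R = 0") (auto intro!: continuous_intros)

lemma bump_eq_0: "R > 0 \<Longrightarrow> R \<le> norm (z - c) \<Longrightarrow> bump R c z = 0"
  using power_mono[of R "norm (z - c)" 2] by (simp add: bump_def max_def field_simps)

lemma bump_ge:
  assumes "R > 0" "norm (z - c) \<le> 2 / 3 * R"
  shows "3 / (pi * R^2) * (5 / 9)^2 \<le> bump R c z"
proof -
  have "(norm (z - c))^2 \<le> (2 / 3 * R)^2" using assms by (intro power_mono) auto
  then have "(norm (z - c))^2 / R^2 \<le> 4 / 9" using assms by (simp add: field_simps power2_eq_square)
  then have "5 / 9 \<le> 1 - (norm (z - c))\<^sup>2 / R^2" by simp
  then have "5 / 9 \<le> max 0 (1 - (norm (z - c))\<^sup>2 / R^2)" by (rule max.coboundedI2)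
  then have "(5 / 9)^2 \<le> (max 0 (1 - (norm (z - c))\<^sup>2 / R^2))^2" by (rule power_mono) simp
  then show ?thesis unfolding bump_def using assms by (intro mult_left_mono) auto
qed

text \<open>
  The test functions below are \<open>C\<^sup>2\<close> truncations of \<open>- ln \<bar>z - c\<bar>\<close>, regularized at \<open>c\<close>; their
  Laplacian is \<open>2\<pi>\<close> times the bump minus an approximation of \<open>2\<pi>\<delta>\<^sub>c\<close>.
\<close>

definition log_tail :: "real \<Rightarrow> real" where
  "log_tail y = - (ln (1 - y) + y + y^2 / 2 + y ^ 3 / 3) / 2"

definition log_tail' :: "real \<Rightarrow> real" where
  "log_tail' y = y ^ 3 / (2 * (1 - y))"

definition log_tail'' :: "real \<Rightarrow> real" where
  "log_tail'' y = (3 * y^2 - 2 * y ^ 3) / (2 * (1 - y)^2)"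

lemma DERIV_log_tail: "y < 1 \<Longrightarrow> (log_tail has_real_derivative log_tail' y) (at y)"
  unfolding log_tail_def[abs_def] log_tail'_def
  by (auto intro!: derivative_eq_intros simp: divide_simps) (simp add: algebra_simps power2_eq_square power3_eq_cube)

lemma DERIV_log_tail': "y < 1 \<Longrightarrow> (log_tail' has_real_derivative log_tail'' y) (at y)"
  unfolding log_tail'_def[abs_def] log_tail''_def
  by (auto intro!: derivative_eq_intros simp: divide_simps) (simp add: algebra_simps power2_eq_square power3_eq_cube)

lemma log_tail_nonneg: "0 \<le> y \<Longrightarrow> y < 1 \<Longrightarrow> 0 \<le> log_tail y"
proof -
  assume y: "0 \<le> y" "y < 1"
  have "log_tail 0 \<le> log_tail y"
  proof (rule DERIV_nonneg_imp_nondecreasing[OF y(1)])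
    fix x assume "0 \<le> x" "x \<le> y"
    then show "\<exists>d. (log_tail has_real_derivative d) (at x) \<and> 0 \<le> d"
      using y DERIV_log_tail[of x] by (intro exI[of _ "log_tail' x"]) (auto simp: log_tail'_def)
  qed
  then show ?thesis by (simp add: log_tail_def)
qed

text \<open>The argument fed to \<open>log_tail\<close>: the shift by \<open>e\<close> keeps it
  strictly below the singularity at 1, and it vanishes outside the disc.\<close>

definition cutoff :: "real \<Rightarrow> real \<Rightarrow> complex \<Rightarrow> complex \<Rightarrow> real" where
  "cutoff R e c z = max 0 (1 - ((norm (z - c))^2 + e) / R^2)"

lemma cutoff_bounds: "e > 0 \<Longrightarrow> 0 \<le> cutoff R e c z" "e > 0 \<Longrightarrow> R > 0 \<Longrightarrow> cutoff R e c z < 1"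
  by (auto simp: cutoff_def max_def add_nonneg_pos)

lemma cutoff_eq_0: "e > 0 \<Longrightarrow> R > 0 \<Longrightarrow> R \<le> norm (z - c) \<Longrightarrow> cutoff R e c z = 0"
proof -
  assume *: "e > 0" "R > 0" "R \<le> norm (z - c)"
  then have "R^2 \<le> (norm (z - c))^2" by (intro power_mono) simp_all
  with * have "R^2 \<le> (norm (z - c))^2 + e" by linarith
  with * have "1 \<le> ((norm (z - c))^2 + e) / R^2" by (intro le_divide_eq_1_pos[THEN iffD2]) simp_all
  then show ?thesis by (simp add: cutoff_def max_def)
qed

lemma continuous_cutoff: "R > 0 \<Longrightarrow> continuous_on A (cutoff R e c)"
  unfolding cutoff_def by (auto intro!: continuous_intros)

text \<open>\<open>log_tail\<close> is \<open>- ln (1 - y) / 2\<close> minus its Taylor polynomial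
  of degree 3, so it vanishes to fourth order at 0 and clamping at the rim of the disc keeps two
  continuous derivatives. With \<open>y = 1 - (w + e) / R^2\<close> the logarithm is that of
  \<open>w + e\<close> up to a constant. In the Laplacian the Poisson kernel appears with the weight
  \<open>3 y^2 - 2 y^3\<close>, which is 0 at the rim and tends to 1 at the centre as
  \<open>e \<rightarrow> 0\<close>.\<close>

lemma has_laplacian_log_tail:
  assumes R: "R > 0" and e: "e > 0"
  shows "has_laplacian (\<lambda>z. log_tail (cutoff R e c z))
    (\<lambda>z. 6 / R^2 * (cutoff R e c z)^2 - (3 * (cutoff R e c z)^2 - 2 * (cutoff R e c z) ^ 3) * poisson_kernel e (z - c))"
proof -
  define t where "t w = 1 - (w + e) / R^2" for w
  have t1: "t w < 1" if "0 \<le> w" for w using that e R by (simp add: t_def)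
  have dt: "(t has_real_derivative - 1 / R^2) (at w)" for w unfolding t_def
    by (rule DERIV_cong[OF DERIV_diff[OF DERIV_const DERIV_cdivide[OF DERIV_add[OF DERIV_ident DERIV_const]]]]) simp
  have "has_laplacian (\<lambda>z. log_tail (max 0 (t ((norm (z - c))^2))))
    (\<lambda>z. 4 * (log_tail' (max 0 (t ((norm (z - c))^2))) * (- 1 / R^2) +
       (norm (z - c))^2 * (log_tail'' (max 0 (t ((norm (z - c))^2))) * (- 1 / R^2) * (- 1 / R^2))))"
  proof (rule has_laplacian_radial[where \<phi> = "\<lambda>w. log_tail (max 0 (t w))"
      and \<phi>' = "\<lambda>w. log_tail' (max 0 (t w)) * (- 1 / R^2)"
      and \<phi>'' = "\<lambda>w. log_tail'' (max 0 (t w)) * (- 1 / R^2) * (- 1 / R^2)"])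
    fix w :: real assume w: "0 \<le> w"
    have "((\<lambda>s. log_tail (max 0 s)) has_real_derivative log_tail' (max 0 (t w))) (at (t w))"
      by (rule DERIV_comp_max_0[OF DERIV_log_tail _ _ t1[OF w]]) (simp_all add: log_tail'_def)
    then show "((\<lambda>w. log_tail (max 0 (t w))) has_real_derivative log_tail' (max 0 (t w)) * (- 1 / R^2)) (at w)"
      by (rule DERIV_chain2[OF _ dt])
    have "((\<lambda>s. log_tail' (max 0 s)) has_real_derivative log_tail'' (max 0 (t w))) (at (t w))"
      by (rule DERIV_comp_max_0[OF DERIV_log_tail' _ _ t1[OF w]]) (simp_all add: log_tail''_def)
    from DERIV_chain2[OF this dt]
    show "((\<lambda>w. log_tail' (max 0 (t w)) * (- 1 / R^2)) has_real_derivative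
        log_tail'' (max 0 (t w)) * (- 1 / R^2) * (- 1 / R^2)) (at w)" by (rule DERIV_cmult_right)
  next
    have ct: "continuous_on {0..} t" unfolding t_def using R by (intro continuous_intros) auto
    have "1 - max 0 (t w) \<noteq> 0" if "w \<in> {0..}" for w using t1[of w] that by auto
    then show "continuous_on {0..} (\<lambda>w. log_tail'' (max 0 (t w)) * (- 1 / R^2) * (- 1 / R^2))"
      unfolding log_tail''_def by (intro continuous_intros ct) (use R in auto)
  qed
  moreover have "4 * (log_tail' (max 0 (t w)) * (- 1 / R^2) + w * (log_tail'' (max 0 (t w)) * (- 1 / R^2) * (- 1 / R^2)))
     = 6 / R^2 * (max 0 (t w))^2 - (3 * (max 0 (t w))^2 - 2 * (max 0 (t w)) ^ 3) * (2 * e / (w + e)^2)"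
    if w: "0 \<le> w" for w
  proof (cases "t w > 0")
    case False
    then have "max 0 (t w) = 0" by simp
    then show ?thesis by (simp add: log_tail'_def log_tail''_def)
  next
    case True
    define s where "s = (w + e) / R^2"
    have s: "s > 0" using w e R by (simp add: s_def)
    have ws: "w = R^2 * s - e" and wes: "w + e = R^2 * s" using R by (auto simp: s_def)
    have m: "max 0 (t w) = 1 - s" using True by (simp add: t_def s_def)
    define r where "r = R^2"
    have r: "r > 0" using R by (simp add: r_def)
    have "4 * ((1 - s) ^ 3 / (2 * s) * (- 1 / r) + (r * s - e) * ((3 * (1 - s)^2 - 2 * (1 - s) ^ 3) / (2 * s^2) * (- 1 / r) * (- 1 / r)))
      = 6 / r * (1 - s)^2 - (3 * (1 - s)^2 - 2 * (1 - s) ^ 3) * (2 * e / (r * s)^2)"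
      using s r by (simp add: divide_simps) (simp add: algebra_simps power2_eq_square power3_eq_cube)
    then show ?thesis unfolding m wes r_def[symmetric] log_tail'_def log_tail''_def by (simp add: ws r_def)
  qed
  ultimately show ?thesis unfolding cutoff_def poisson_kernel_def t_def by simp
qed

lemma has_laplacian_const: "has_laplacian (\<lambda>_. k) (\<lambda>_. 0)"
  using has_laplacianI[of "\<lambda>_. k" "\<lambda>_. 0" "\<lambda>_. 0" "\<lambda>_. 0" "\<lambda>_. 0"] by (simp add: has_partials_def)

lemma continuous_bounded_ball:
  fixes u :: "complex \<Rightarrow> real"
  assumes "continuous_on UNIV u"
  obtains B where "B \<ge> 0" "\<And>z. norm (z - c) \<le> R \<Longrightarrow> \<bar>u z\<bar> \<le> B"
proof -
  have "compact (u ` cball c R)" by (intro compact_continuous_image continuous_on_subset[OF assms]) auto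
  then have "bounded (u ` cball c R)" by (rule compact_imp_bounded)
  then obtain B where "B > 0" and B: "\<forall>x\<in>u ` cball c R. norm x \<le> B" unfolding bounded_pos by (elim exE conjE)
  show ?thesis
  proof (rule that[of B])
    show "\<bar>u z\<bar> \<le> B" if "norm (z - c) \<le> R" for z using B that by (simp add: dist_norm norm_minus_commute)
  qed (use \<open>B > 0\<close> in simp)
qed

text \<open>For \<open>e \<rightarrow> 0\<close> the first term gives the mean against
  \<open>bump\<close> and the second, by the approximate identity, the value at \<open>c\<close>.
  The sign of the integral of \<open>u\<close> against these Laplacians thus decides between the
  sub-mean value inequality and equality.\<close>

lemma log_tail_laplacian_tendsto:
  fixes u :: "complex \<Rightarrow> real"
  assumes R: "R > 0" and u: "continuous_on UNIV u"
  defines "e \<equiv> \<lambda>n. 1 / real (Suc n)"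
  shows "(\<lambda>n. \<integral>z. u z * (6 / R^2 * (cutoff R (e n) c z)^2 -
      (3 * (cutoff R (e n) c z)^2 - 2 * (cutoff R (e n) c z) ^ 3) * poisson_kernel (e n) (z - c)) \<partial>lborel)
    \<longlonglongrightarrow> 2 * pi * ((LBINT z. bump R c z * u z) - u c)"
proof -
  have e: "e n > 0" for n by (simp add: e_def)
  have elim: "e \<longlonglongrightarrow> 0" unfolding e_def using LIMSEQ_Suc[OF lim_1_over_n] .
  have [measurable]: "u \<in> borel_measurable borel" using u by (rule borel_measurable_continuous_onI)
  have [measurable]: "cutoff R a c \<in> borel_measurable borel" for a
    using continuous_cutoff[OF R] by (rule borel_measurable_continuous_onI)
  obtain B where B: "B \<ge> 0" "\<And>z. norm (z - c) \<le> R \<Longrightarrow> \<bar>u z\<bar> \<le> B" using continuous_bounded_ball[OF u] by blast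
  have cb: "0 \<le> cutoff R (e n) c z" "cutoff R (e n) c z < 1" for n z
    using cutoff_bounds[OF e[of n], of R c z] R by simp_all
  have cl: "(\<lambda>n. cutoff R (e n) c z) \<longlonglongrightarrow> max 0 (1 - ((norm (z - c))^2 + 0) / R^2)" for z
    unfolding cutoff_def using R by (intro tendsto_intros elim) auto
  have 1: "(\<lambda>n. \<integral>z. u z * (6 / R^2 * (cutoff R (e n) c z)^2) \<partial>lborel)
     \<longlonglongrightarrow> (LBINT z. u z * (6 / R^2 * (max 0 (1 - ((norm (z - c))^2 + 0) / R^2))^2))"
  proof (rule integral_dominated_convergence[where w = "\<lambda>z. 6 / R^2 * B * indicator (cball c R) z"])
    show "integrable lborel (\<lambda>z. 6 / R^2 * B * indicator (cball c R) z)"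
      using emeasure_lborel_cball_finite[of c R] by (simp add: integrable_indicator_iff infinity_ennreal_def)
    show "AE z in lborel. (\<lambda>n. u z * (6 / R^2 * (cutoff R (e n) c z)^2)) \<longlonglongrightarrow>
        u z * (6 / R^2 * (max 0 (1 - ((norm (z - c))^2 + 0) / R^2))^2)" by (intro AE_I2 tendsto_intros cl)
    show "AE z in lborel. norm (u z * (6 / R^2 * (cutoff R (e n) c z)^2)) \<le> 6 / R^2 * B * indicator (cball c R) z" for n
    proof (rule AE_I2)
      fix z
      show "norm (u z * (6 / R^2 * (cutoff R (e n) c z)^2)) \<le> 6 / R^2 * B * indicator (cball c R) z"
      proof (cases "norm (z - c) \<le> R")
        case True
        have "(cutoff R (e n) c z)^2 \<le> 1" using cb[of n z] by (intro power_le_one) auto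
        then have "\<bar>u z\<bar> * (6 / R^2 * (cutoff R (e n) c z)^2) \<le> B * (6 / R^2 * 1)"
          using B True by (intro mult_mono mult_left_mono) auto
        then show ?thesis using True by (simp add: abs_mult dist_norm norm_minus_commute mult_ac)
      next
        case False
        then show ?thesis using cutoff_eq_0[OF e[of n] R, of z c] B(1) by simp
      qed
    qed
  qed measurable
  have 2: "(\<lambda>n. \<integral>z. u z * (3 * (cutoff R (e n) c z)^2 - 2 * (cutoff R (e n) c z) ^ 3) * poisson_kernel (e n) (z - c) \<partial>lborel)
     \<longlonglongrightarrow> 2 * pi * u c"
  proof (rule poisson_kernel_approximate_identity[OF e, where M = "5 * B"])
    fix n z
    show "\<bar>u z * (3 * (cutoff R (e n) c z)^2 - 2 * (cutoff R (e n) c z) ^ 3)\<bar> \<le> 5 * B"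
    proof (cases "norm (z - c) \<le> R")
      case True
      have "(cutoff R (e n) c z)^2 \<le> 1" "(cutoff R (e n) c z) ^ 3 \<le> 1" "0 \<le> (cutoff R (e n) c z) ^ 3" "0 \<le> (cutoff R (e n) c z)^2"
        using cb[of n z] by (auto intro: power_le_one)
      then have "\<bar>3 * (cutoff R (e n) c z)^2 - 2 * (cutoff R (e n) c z) ^ 3\<bar> \<le> 5" by arith
      then have "\<bar>u z\<bar> * \<bar>3 * (cutoff R (e n) c z)^2 - 2 * (cutoff R (e n) c z) ^ 3\<bar> \<le> B * 5"
        using B True by (intro mult_mono) auto
      then show ?thesis by (simp add: abs_mult)
    next
      case False
      then show ?thesis using cutoff_eq_0[OF e[of n] R, of z c] B by simp
    qed
  next
    fix w :: complex
    have l: "(\<lambda>n. c + of_real (sqrt (e n)) * w) \<longlonglongrightarrow> c + of_real (sqrt 0) * w" by (intro tendsto_intros elim)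
    then have ul: "(\<lambda>n. u (c + of_real (sqrt (e n)) * w)) \<longlonglongrightarrow> u c"
      using u by (intro isCont_tendsto_compose[of c u]) (simp_all add: continuous_on_eq_continuous_at)
    have "(\<lambda>n. cutoff R (e n) c (c + of_real (sqrt (e n)) * w)) \<longlonglongrightarrow> max 0 (1 - ((norm (c + of_real (sqrt 0) * w - c))^2 + 0) / R^2)"
      unfolding cutoff_def using R by (intro tendsto_intros l elim) auto
    then have "(\<lambda>n. cutoff R (e n) c (c + of_real (sqrt (e n)) * w)) \<longlonglongrightarrow> 1" by simp
    then have "(\<lambda>n. u (c + of_real (sqrt (e n)) * w) * (3 * (cutoff R (e n) c (c + of_real (sqrt (e n)) * w))^2
        - 2 * (cutoff R (e n) c (c + of_real (sqrt (e n)) * w)) ^ 3)) \<longlonglongrightarrow> u c * (3 * 1^2 - 2 * 1 ^ 3)"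
      by (intro tendsto_intros ul)
    then show "(\<lambda>n. u (c + of_real (sqrt (e n)) * w) * (3 * (cutoff R (e n) c (c + of_real (sqrt (e n)) * w))^2
        - 2 * (cutoff R (e n) c (c + of_real (sqrt (e n)) * w)) ^ 3)) \<longlonglongrightarrow> u c" by simp
  qed measurable
  have split: "(\<integral>z. u z * (6 / R^2 * (cutoff R (e n) c z)^2 -
      (3 * (cutoff R (e n) c z)^2 - 2 * (cutoff R (e n) c z) ^ 3) * poisson_kernel (e n) (z - c)) \<partial>lborel)
    = (LBINT z. u z * (6 / R^2 * (cutoff R (e n) c z)^2))
     - (LBINT z. u z * (3 * (cutoff R (e n) c z)^2 - 2 * (cutoff R (e n) c z) ^ 3) * poisson_kernel (e n) (z - c))" for n
  proof (subst Bochner_Integration.integral_diff[symmetric])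
    have z: "R + norm c \<le> norm z \<Longrightarrow> cutoff R (e n) c z = 0" for z
      using cutoff_eq_0[OF e[of n] R, of z c] norm_triangle_ineq2[of z c] by linarith
    show "integrable lborel (\<lambda>z. u z * (6 / R^2 * (cutoff R (e n) c z)^2))"
      by (rule integrable_compact_support[where R = "R + norm c"])
        (intro continuous_on_mult continuous_on_power continuous_intros u continuous_cutoff R, simp add: z)
    show "integrable lborel (\<lambda>z. u z * (3 * (cutoff R (e n) c z)^2 - 2 * (cutoff R (e n) c z) ^ 3) * poisson_kernel (e n) (z - c))"
      by (rule integrable_compact_support[where R = "R + norm c"])
        (intro continuous_on_mult continuous_on_diff continuous_on_power continuous_on_const u continuous_cutoff R
            continuous_poisson_kernel e, simp add: z)
  qed (simp add: algebra_simps)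
  have "(LBINT z. u z * (6 / R^2 * (max 0 (1 - ((norm (z - c))^2 + 0) / R^2))^2))
     = (LBINT z. 2 * pi * (bump R c z * u z))"
    using R by (intro Bochner_Integration.integral_cong) (auto simp: bump_def field_simps)
  then have "(LBINT z. u z * (6 / R^2 * (max 0 (1 - ((norm (z - c))^2 + 0) / R^2))^2))
     = 2 * pi * (LBINT z. bump R c z * u z)" by simp
  with tendsto_diff[OF 1 2] show ?thesis unfolding split by (simp add: right_diff_distrib)
qed

lemma log_tail_vanishes:
  assumes "R > 0" "e > 0" "R + norm c \<le> norm z"
  shows "log_tail (cutoff R e c z) = 0"
proof -
  have "cutoff R e c z = 0"
    using cutoff_eq_0[OF assms(2,1), of z c] norm_triangle_ineq2[of z c] assms by linarith
  then show ?thesis by (simp add: log_tail_def)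
qed

text \<open>The case \<open>u = 1\<close> of the preceding limit: by Green's identity with a
  constant every approximating integral is 0, so the mean of 1 equals 1.\<close>

lemma integral_bump: "R > 0 \<Longrightarrow> (LBINT z. bump R c z) = 1"
proof -
  assume R: "R > 0"
  have pos: "0 < 1 / real (Suc n)" for n by simp
  have zero: "(LBINT z. 1 * (6 / R^2 * (cutoff R e c z)^2 - (3 * (cutoff R e c z)^2 - 2 * (cutoff R e c z) ^ 3) * poisson_kernel e (z - c))) = 0"
    if "e > 0" for e
    using green_identity[OF has_laplacian_const[of 1] has_laplacian_log_tail[OF R that, of c], of "R + norm c"]
      log_tail_vanishes[OF R that] by simp
  then have "(\<lambda>n. 0 :: real) \<longlonglongrightarrow> 2 * pi * ((LBINT z. bump R c z * 1) - 1)"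
    using log_tail_laplacian_tendsto[OF R continuous_on_const[of UNIV 1], of c] by (simp only: zero[OF pos])
  then show ?thesis using LIMSEQ_unique[OF tendsto_const] by fastforce
qed

lemma integrable_bump: "R > 0 \<Longrightarrow> integrable lborel (bump R c)"
proof (rule integrable_compact_support[where R = "R + norm c"])
  show "bump R c z = 0" if "R > 0" "R + norm c \<le> norm z" for z
    using bump_eq_0[of R z c] norm_triangle_ineq2[of z c] that by linarith
qed (rule continuous_bump)

lemma integrable_bump_ln:
  assumes R: "R > 0" shows "integrable lborel (\<lambda>z. bump R c z * ln (norm (z - \<zeta>)))"
proof -
  have "bump R c z = 0" if "R + norm c \<le> norm z" for z
    using bump_eq_0[of R z c] norm_triangle_ineq2[of z c] that R by linarith
  then show ?thesis
    using integrable_ln_times(1)[OF continuous_bump, of "R + norm c" R c \<zeta>] by (simp add: mult.commute)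
qed

text \<open>The sub-mean value inequality. For the regularized logarithm it holds since its
  Laplacian and the test functions are both nonnegative; the regularization \<open>a\<close> is
  removed afterwards, the value at \<open>c\<close> staying finite because
  \<open>c \<noteq> \<zeta>\<close>.\<close>

proposition ln_le_integral_bump:
  assumes R: "R > 0" and ne: "c \<noteq> \<zeta>"
  shows "ln (norm (c - \<zeta>)) \<le> (LBINT z. bump R c z * ln (norm (z - \<zeta>)))"
proof -
  have le: "ln ((norm (c - \<zeta>))^2 + a) / 2 \<le> (LBINT z. ln ((norm (z - \<zeta>))^2 + a) / 2 * bump R c z)"
    if a: "a > 0" for a
  proof -
    have "(\<integral>z. ln ((norm (z - \<zeta>))^2 + a) / 2 * (6 / R^2 * (cutoff R e c z)^2 -
        (3 * (cutoff R e c z)^2 - 2 * (cutoff R e c z) ^ 3) * poisson_kernel e (z - c)) \<partial>lborel) \<ge> 0" if e: "e > 0" for e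
    proof -
      have "(\<integral>z. ln ((norm (z - \<zeta>))^2 + a) / 2 * (6 / R^2 * (cutoff R e c z)^2 -
        (3 * (cutoff R e c z)^2 - 2 * (cutoff R e c z) ^ 3) * poisson_kernel e (z - c)) \<partial>lborel)
        = (LBINT z. poisson_kernel a (z - \<zeta>) * log_tail (cutoff R e c z))"
        by (rule green_identity[OF has_laplacian_log[OF a] has_laplacian_log_tail[OF R e], of "R + norm c"])
          (rule log_tail_vanishes[OF R e])
      also have "\<dots> \<ge> 0"
        by (intro Bochner_Integration.integral_nonneg mult_nonneg_nonneg poisson_kernel_nonneg log_tail_nonneg
            cutoff_bounds[OF e] R less_imp_le[OF a])
      finally show ?thesis .
    qed
    then have "0 \<le> 2 * pi * ((LBINT z. bump R c z * (ln ((norm (z - \<zeta>))^2 + a) / 2)) - ln ((norm (c - \<zeta>))^2 + a) / 2)"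
      by (intro LIMSEQ_le_const[OF log_tail_laplacian_tendsto[OF R has_laplacian_continuous[OF has_laplacian_log[OF a]]]]) auto
    then show ?thesis using pi_gt_zero[THEN not_le[THEN iffD2]] by (simp add: zero_le_mult_iff mult.commute)
  qed
  define e where "e n = 1 / real (Suc n)" for n
  have e: "e n > 0" "e n \<le> 1" for n by (auto simp: e_def)
  have elim: "e \<longlonglongrightarrow> 0" unfolding e_def using LIMSEQ_Suc[OF lim_1_over_n] .
  have b0: "bump R c z = 0" if "R + norm c \<le> norm z" for z
    using bump_eq_0[of R z c] norm_triangle_ineq2[of z c] that R by linarith
  have l1: "(\<lambda>n. \<integral>z. ln ((norm (z - \<zeta>))^2 + e n) / 2 * bump R c z \<partial>lborel) \<longlonglongrightarrow> (LBINT z. ln (norm (z - \<zeta>)) * bump R c z)"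
    by (rule integral_ln_regularized_tendsto[OF continuous_bump b0 e elim])
  have l2: "(\<lambda>n. ln ((norm (c - \<zeta>))^2 + e n) / 2) \<longlonglongrightarrow> ln ((norm (c - \<zeta>))^2 + 0) / 2"
    using ne by (intro tendsto_intros elim) auto
  have "ln ((norm (c - \<zeta>))^2 + 0) / 2 \<le> (LBINT z. ln (norm (z - \<zeta>)) * bump R c z)"
    by (rule LIMSEQ_le[OF l2 l1]) (intro exI[of _ 0] allI impI le e)
  then show ?thesis using ne by (simp add: ln_realpow mult.commute)
qed

text \<open>The mean value property for a logarithm with its pole outside the closed disc: the test
  functions are supported in the disc, so \<open>integral_ln_laplacian\<close> evaluates them at
  \<open>\<zeta>\<close> to 0.\<close>

proposition ln_eq_integral_bump:
  assumes R: "R > 0" and far: "R < norm (\<zeta> - c)"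
  shows "(LBINT z. bump R c z * ln (norm (z - \<zeta>))) = ln (norm (c - \<zeta>))"
proof -
  define d where "d = norm (\<zeta> - c) - R"
  have d: "d > 0" using far by (simp add: d_def)
  \<comment> \<open>The limit lemma asks for a function continuous on the whole plane; truncation at
    the distance \<open>d\<close> from \<open>\<zeta>\<close> to the disc changes nothing on the
    disc.\<close>
  define u where "u z = ln (max d (norm (z - \<zeta>)))" for z
  have cu: "continuous_on UNIV u" unfolding u_def using d by (intro continuous_intros) auto
  have ueq: "u z = ln (norm (z - \<zeta>))" if "norm (z - c) \<le> R" for z
    using that norm_triangle_ineq[of "\<zeta> - z" "z - c"] by (simp add: u_def d_def max_def norm_minus_commute)
  have pos: "0 < 1 / real (Suc n)" for n by simp
  have zero: "(\<integral>z. u z * (6 / R^2 * (cutoff R e c z)^2 -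
        (3 * (cutoff R e c z)^2 - 2 * (cutoff R e c z) ^ 3) * poisson_kernel e (z - c)) \<partial>lborel) = 0" if e: "e > 0" for e
  proof -
    have "(\<integral>z. u z * (6 / R^2 * (cutoff R e c z)^2 -
        (3 * (cutoff R e c z)^2 - 2 * (cutoff R e c z) ^ 3) * poisson_kernel e (z - c)) \<partial>lborel)
      = (\<integral>z. ln (norm (z - \<zeta>)) * (6 / R^2 * (cutoff R e c z)^2 -
        (3 * (cutoff R e c z)^2 - 2 * (cutoff R e c z) ^ 3) * poisson_kernel e (z - c)) \<partial>lborel)"
    proof (rule Bochner_Integration.integral_cong[OF refl])
      fix z
      show "u z * (6 / R^2 * (cutoff R e c z)^2 -
        (3 * (cutoff R e c z)^2 - 2 * (cutoff R e c z) ^ 3) * poisson_kernel e (z - c)) =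
        ln (norm (z - \<zeta>)) * (6 / R^2 * (cutoff R e c z)^2 -
        (3 * (cutoff R e c z)^2 - 2 * (cutoff R e c z) ^ 3) * poisson_kernel e (z - c))"
        using ueq[of z] cutoff_eq_0[OF e R, of z c] by (cases "norm (z - c) \<le> R") simp_all
    qed
    also have "\<dots> = 2 * pi * log_tail (cutoff R e c \<zeta>)"
      by (rule integral_ln_laplacian[OF has_laplacian_log_tail[OF R e], of "R + norm c"])
        (rule log_tail_vanishes[OF R e])
    also have "\<dots> = 0" using cutoff_eq_0[OF e R, of \<zeta> c] far by (simp add: log_tail_def)
    finally show ?thesis .
  qed
  have "(\<lambda>n. 0 :: real) \<longlonglongrightarrow> 2 * pi * ((LBINT z. bump R c z * u z) - u c)"
    using log_tail_laplacian_tendsto[OF R cu, of c] by (simp only: zero[OF pos])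
  then have "(LBINT z. bump R c z * u z) = u c" using LIMSEQ_unique[OF tendsto_const] by fastforce
  moreover have "(LBINT z. bump R c z * u z) = (LBINT z. bump R c z * ln (norm (z - \<zeta>)))"
  proof (rule Bochner_Integration.integral_cong[OF refl])
    fix z show "bump R c z * u z = bump R c z * ln (norm (z - \<zeta>))"
      using ueq[of z] bump_eq_0[OF R, of z c] by (cases "norm (z - c) \<le> R") simp_all
  qed
  ultimately show ?thesis using ueq[of c] R by simp
qed

section \<open>Convergence in mean of logarithms of polynomials\<close>

lemma degree_eq_sum_order:
  fixes p :: "complex poly"
  assumes "p \<noteq> 0"
  shows "(\<Sum>\<zeta>\<in>zeros p. order \<zeta> p) = degree p"
proof -
  have fin: "finite (zeros p)" using assms by (rule finite_zeros)
  have "degree p = degree (smult (lead_coeff p) (\<Prod>z\<in>zeros p. [:- z, 1:] ^ order z p))"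
    using complex_poly_decompose[of p] by (simp add: zeros_def)
  also have "\<dots> = degree (\<Prod>z\<in>zeros p. [:- z, 1:] ^ order z p)" using assms by simp
  also have "\<dots> = (\<Sum>z\<in>zeros p. degree ([:- z, 1:] ^ order z p))" by (rule degree_prod_eq_sum_degree) auto
  also have "\<dots> = (\<Sum>\<zeta>\<in>zeros p. order \<zeta> p)" by (simp add: degree_linear_power)
  finally show ?thesis ..
qed

lemma ln_norm_poly:
  fixes p :: "complex poly"
  assumes "poly p z \<noteq> 0"
  shows "ln (norm (poly p z)) = ln (norm (lead_coeff p)) + (\<Sum>\<zeta>\<in>zeros p. real (order \<zeta> p) * ln (norm (z - \<zeta>)))"
proof -
  have p: "p \<noteq> 0" using assms by auto
  then have fin: "finite (zeros p)" by (rule finite_zeros)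
  have "poly p z = poly (smult (lead_coeff p) (\<Prod>z\<in>zeros p. [:- z, 1:] ^ order z p)) z"
    using complex_poly_decompose[of p] by (simp add: zeros_def)
  also have "\<dots> = lead_coeff p * (\<Prod>\<zeta>\<in>zeros p. (z - \<zeta>) ^ order \<zeta> p)" by (simp add: poly_prod)
  finally have "norm (poly p z) = norm (lead_coeff p) * (\<Prod>\<zeta>\<in>zeros p. norm (z - \<zeta>) ^ order \<zeta> p)"
    by (simp add: norm_mult prod_norm[symmetric] norm_power)
  moreover have nz: "z - \<zeta> \<noteq> 0" if "\<zeta> \<in> zeros p" for \<zeta> using that assms by (auto simp: zeros_def)
  then have "(\<Prod>\<zeta>\<in>zeros p. norm (z - \<zeta>) ^ order \<zeta> p) > 0" by (intro prod_pos) auto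
  moreover have "ln (\<Prod>\<zeta>\<in>zeros p. norm (z - \<zeta>) ^ order \<zeta> p) = (\<Sum>\<zeta>\<in>zeros p. real (order \<zeta> p) * ln (norm (z - \<zeta>)))"
    using nz by (subst ln_prod[OF fin]) (auto simp: ln_realpow intro!: sum.cong)
  ultimately show ?thesis using p by (simp add: ln_mult_pos)
qed

lemma ball_borel [measurable]: "ball (c :: complex) r \<in> sets borel" by simp

lemma AE_not_finite: "finite S \<Longrightarrow> AE z :: complex in lborel. z \<notin> S"
  by (rule AE_not_in) (simp add: finite_imp_null_set_lborel)

lemma borel_measurable_ln_norm_poly [measurable]:
  "(\<lambda>z. ln (norm (poly (p :: complex poly) z))) \<in> borel_measurable borel"
proof -
  have [measurable]: "poly p \<in> borel_measurable borel"
    by (intro borel_measurable_continuous_onI continuous_on_poly continuous_on_id)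
  show ?thesis by measurable
qed

lemma ln_norm_poly_le_integral_bump:
  fixes p :: "complex poly"
  assumes R: "R > 0" and p: "poly p c \<noteq> 0"
  shows "integrable lborel (\<lambda>z. bump R c z * ln (norm (poly p z)))"
    and "ln (norm (poly p c)) \<le> (LBINT z. bump R c z * ln (norm (poly p z)))"
proof -
  have p0: "p \<noteq> 0" using p by auto
  then have fin: "finite (zeros p)" by (rule finite_zeros)
  have [measurable]: "bump R c \<in> borel_measurable borel"
    by (intro borel_measurable_continuous_onI continuous_bump)
  define f where "f z = bump R c z * ln (norm (lead_coeff p))
      + (\<Sum>\<zeta>\<in>zeros p. real (order \<zeta> p) * (bump R c z * ln (norm (z - \<zeta>))))" for z
  have AE: "AE z in lborel. bump R c z * ln (norm (poly p z)) = f z" using AE_not_finite[OF fin]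
  proof eventually_elim
    case (elim z)
    then have "poly p z \<noteq> 0" by (simp add: zeros_def)
    then show ?case unfolding f_def ln_norm_poly[OF \<open>poly p z \<noteq> 0\<close>]
      by (simp add: distrib_left sum_distrib_left mult_ac)
  qed
  have intf: "integrable lborel f"
    unfolding f_def using integrable_bump[OF R] integrable_bump_ln[OF R] by auto
  have [measurable]: "f \<in> borel_measurable borel" using intf by auto
  show "integrable lborel (\<lambda>z. bump R c z * ln (norm (poly p z)))"
    using integrable_cong_AE[THEN iffD2, OF _ _ AE intf] by simp
  have "ln (norm (poly p c)) = ln (norm (lead_coeff p)) + (\<Sum>\<zeta>\<in>zeros p. real (order \<zeta> p) * ln (norm (c - \<zeta>)))"
    by (rule ln_norm_poly[OF p])
  also have "\<dots> \<le> ln (norm (lead_coeff p)) + (\<Sum>\<zeta>\<in>zeros p. real (order \<zeta> p) * (LBINT z. bump R c z * ln (norm (z - \<zeta>))))"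
    using p by (intro add_left_mono sum_mono mult_left_mono ln_le_integral_bump R) (auto simp: zeros_def)
  also have "\<dots> = (LBINT z. f z)" unfolding f_def using integrable_bump[OF R] integrable_bump_ln[OF R]
    by (simp add: Bochner_Integration.integral_add Bochner_Integration.integral_sum integral_bump[OF R])
  also have "\<dots> = (LBINT z. bump R c z * ln (norm (poly p z)))"
    by (rule integral_cong_AE[symmetric]) (use AE in simp_all)
  finally show "ln (norm (poly p c)) \<le> (LBINT z. bump R c z * ln (norm (poly p z)))" .
qed

section \<open>From one good point to L1 convergence on connected sets\<close>

definition l1_on :: "complex set \<Rightarrow> (complex \<Rightarrow> real) \<Rightarrow> (complex \<Rightarrow> real) \<Rightarrow> ennreal" where
  "l1_on B f g = (\<integral>\<^sup>+z. ennreal \<bar>f z - g z\<bar> * indicator B z \<partial>lborel)"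

lemma l1_on_mono: "A \<subseteq> B \<Longrightarrow> l1_on A f g \<le> l1_on B f g"
  unfolding l1_on_def by (intro nn_integral_mono mult_left_mono) (auto simp: indicator_def)

lemma tendsto_0_ennrealI:
  fixes X :: "nat \<Rightarrow> ennreal"
  assumes "\<And>e :: real. e > 0 \<Longrightarrow> \<forall>\<^sub>F n in F. X n \<le> ennreal e"
  shows "(X \<longlongrightarrow> 0) F"
proof (rule order_tendstoI)
  fix a :: ennreal assume "0 < a"
  then obtain b where b: "0 < b" "b < a" using dense by blast
  then have "b < \<infinity>" using order.strict_trans2[of b a top] by (simp add: infinity_ennreal_def)
  then obtain e where e: "b = ennreal e" "0 \<le> e" by (cases b) (auto simp: infinity_ennreal_def)
  with b have "e > 0" by simp
  from assms[OF this] show "\<forall>\<^sub>F n in F. X n < a" by eventually_elim (use b e in auto)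
qed auto

lemma tendsto_0_ennrealD:
  fixes X :: "nat \<Rightarrow> ennreal"
  assumes "(X \<longlongrightarrow> 0) F" "e > (0 :: real)"
  shows "\<forall>\<^sub>F n in F. X n \<le> ennreal e"
  using order_tendstoD(2)[OF assms(1), of "ennreal e"] assms(2) by (auto elim!: eventually_mono)

lemma tendsto_0_ennreal_mono:
  fixes X Y :: "nat \<Rightarrow> ennreal"
  assumes "(Y \<longlongrightarrow> 0) F" "\<And>n. X n \<le> Y n"
  shows "(X \<longlongrightarrow> 0) F"
proof (rule tendsto_0_ennrealI)
  fix e :: real assume "e > 0"
  from tendsto_0_ennrealD[OF assms(1) this] show "\<forall>\<^sub>F n in F. X n \<le> ennreal e"
    by eventually_elim (rule order_trans[OF assms(2)])
qed

text \<open>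
  Harnack-type step: \<open>v + \<epsilon> - u n\<close> is nonnegative and superharmonic, so smallness at one point
  near \<open>z0\<close> gives smallness in mean.
\<close>

lemma l1_step:
  fixes p :: "nat \<Rightarrow> complex poly" and s k :: "nat \<Rightarrow> real" and m :: "complex \<Rightarrow> real"
  defines "u \<equiv> \<lambda>n z. s n * ln (norm (poly (p n) z)) + k n"
  assumes s: "\<And>n. s n \<ge> 0" and [measurable]: "v \<in> borel_measurable borel"
    and A: "finite A" "A \<inter> cball z0 R = {}" and R: "R > 0"
    and v: "\<And>z. z \<in> cball z0 R \<Longrightarrow> v z = (\<Sum>a\<in>A. m a * ln (norm (z - a)))"
    and upper: "\<And>\<epsilon>. \<epsilon> > 0 \<Longrightarrow> \<forall>\<^sub>F n in sequentially. \<forall>z\<in>cball z0 R. poly (p n) z \<noteq> 0 \<longrightarrow> u n z \<le> v z + \<epsilon>"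
    and lower: "\<And>\<epsilon>. \<epsilon> > 0 \<Longrightarrow> \<forall>\<^sub>F n in sequentially. \<exists>w\<in>ball z0 (R / 4). poly (p n) w \<noteq> 0 \<and> v w - \<epsilon> \<le> u n w"
  shows "(\<lambda>n. l1_on (ball z0 (R / 4)) (u n) v) \<longlonglongrightarrow> 0"
proof (rule tendsto_0_ennrealI)
  fix e :: real assume e: "e > 0"
  \<comment> \<open>For \<open>w\<close> within \<open>R / 4\<close> of \<open>z0\<close>, the disc
    of radius \<open>3 / 4 * R\<close> about \<open>w\<close> stays in \<open>cball z0 R\<close>,
    and \<open>ball z0 (R / 4)\<close> lies within \<open>R / 2 = 2 / 3 * \<rho>\<close> of
    \<open>w\<close>, where \<open>bump_ge\<close> bounds the weight below by
    \<open>c\<close>.\<close>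
  define \<rho> where "\<rho> = 3 / 4 * R"
  have \<rho>: "\<rho> > 0" using R by (simp add: \<rho>_def)
  define c where "c = 3 / (pi * \<rho>^2) * (5 / 9)^2"
  have c: "c > 0" using \<rho> by (simp add: c_def)
  define V where "V = measure lborel (ball z0 (R / 4))"
  have V: "V \<ge> 0" "emeasure lborel (ball z0 (R / 4)) = ennreal V"
    using emeasure_lborel_ball_finite[of z0 "R / 4"]
    by (auto simp: V_def infinity_ennreal_def intro!: emeasure_eq_ennreal_measure)
  define \<epsilon> where "\<epsilon> = e / (2 / c + V + 1)"
  have \<epsilon>: "\<epsilon> > 0" using e c V by (auto simp: \<epsilon>_def intro!: divide_pos_pos add_nonneg_pos)
  have \<epsilon>e: "2 * \<epsilon> / c + \<epsilon> * V \<le> e"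
  proof -
    have pos: "2 / c + V + 1 > 0" using c V by (auto intro!: add_nonneg_pos)
    have "2 * \<epsilon> / c + \<epsilon> * V = \<epsilon> * (2 / c + V)" by (simp add: algebra_simps)
    also have "\<dots> \<le> \<epsilon> * (2 / c + V + 1)" using \<epsilon> by (intro mult_left_mono) auto
    also have "\<dots> = e" using pos by (simp add: \<epsilon>_def)
    finally show ?thesis .
  qed
  show "\<forall>\<^sub>F n in sequentially. l1_on (ball z0 (R / 4)) (u n) v \<le> ennreal e" using upper[OF \<epsilon>] lower[OF \<epsilon>]
  proof eventually_elim
    case (elim n)
    then obtain w where w: "w \<in> ball z0 (R / 4)" "poly (p n) w \<noteq> 0" "v w - \<epsilon> \<le> u n w" by blast
    have pn: "p n \<noteq> 0" using w by auto
    have wR: "cball w \<rho> \<subseteq> cball z0 R"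
      using w(1) by (intro cball_subset_cball_iff[THEN iffD2]) (simp add: \<rho>_def dist_commute)
    have far: "\<rho> < norm (a - w)" if "a \<in> A" for a
    proof -
      have "a \<notin> cball w \<rho>" using that A wR by blast
      then show ?thesis by (simp add: dist_norm norm_minus_commute)
    qed
    have wz: "w \<in> cball z0 R" using wR \<rho> by (meson centre_in_cball less_imp_le subsetD)
    define g where "g z = bump \<rho> w z * (v z + \<epsilon> - u n z)" for z
    define g' where "g' z = (\<Sum>a\<in>A. m a * (bump \<rho> w z * ln (norm (z - a)))) + (\<epsilon> - k n) * bump \<rho> w z
        - s n * (bump \<rho> w z * ln (norm (poly (p n) z)))" for z
    have gg: "g z = g' z" for z
    proof (cases "z \<in> cball w \<rho>")
      case True
      then have "v z = (\<Sum>a\<in>A. m a * ln (norm (z - a)))" using wR v by blast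
      then show ?thesis by (simp add: g_def g'_def u_def sum_distrib_left algebra_simps)
    next
      case False
      then have "bump \<rho> w z = 0" using bump_eq_0[OF \<rho>, of z w] by (simp add: dist_norm norm_minus_commute)
      then show ?thesis by (simp add: g_def g'_def)
    qed
    note ints = integrable_bump[OF \<rho>, of w] integrable_bump_ln[OF \<rho>, of w] ln_norm_poly_le_integral_bump(1)[OF \<rho> w(2)]
    have ig: "integrable lborel g" unfolding gg[abs_def] g'_def using ints by auto
    \<comment> \<open>Since \<open>A\<close> lies outside the disc, the mean of \<open>v\<close> is
      exactly \<open>v w\<close>; the mean of \<open>u n\<close> is at least \<open>u n w\<close>.
      The choice of \<open>w\<close> then leaves at most \<open>2 \<epsilon>\<close>.\<close>
    have "(LBINT z. g z) = (\<Sum>a\<in>A. m a * (LBINT z. bump \<rho> w z * ln (norm (z - a)))) + (\<epsilon> - k n)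
        - s n * (LBINT z. bump \<rho> w z * ln (norm (poly (p n) z)))"
      unfolding gg g'_def using ints by (simp add: integral_bump[OF \<rho>])
    also have "(\<Sum>a\<in>A. m a * (LBINT z. bump \<rho> w z * ln (norm (z - a)))) = (\<Sum>a\<in>A. m a * ln (norm (w - a)))"
      by (intro sum.cong refl) (simp add: ln_eq_integral_bump[OF \<rho> far])
    also have "\<dots> = v w" using v[OF wz] by simp
    also have "v w + (\<epsilon> - k n) - s n * (LBINT z. bump \<rho> w z * ln (norm (poly (p n) z)))
       \<le> v w + (\<epsilon> - k n) - s n * ln (norm (poly (p n) w))"
      using s[of n] by (intro diff_left_mono mult_left_mono ln_norm_poly_le_integral_bump(2)[OF \<rho> w(2)]) auto
    also have "\<dots> = v w + \<epsilon> - u n w" by (simp add: u_def)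
    also have "\<dots> \<le> 2 * \<epsilon>" using w(3) by simp
    finally have intg: "(LBINT z. g z) \<le> 2 * \<epsilon>" .
    have AE: "AE z in lborel. z \<notin> zeros (p n)" by (rule AE_not_finite[OF finite_zeros[OF pn]])
    have ge0: "v z + \<epsilon> - u n z \<ge> 0" if "z \<notin> zeros (p n)" "z \<in> cball z0 R" for z
      using elim(1) that by (auto simp: zeros_def)
    have g0: "AE z in lborel. 0 \<le> g z" using AE
    proof eventually_elim
      case (elim z)
      show ?case
      proof (cases "z \<in> cball w \<rho>")
        case True
        then show ?thesis unfolding g_def using ge0[OF elim] wR bump_nonneg by (intro mult_nonneg_nonneg) auto
      next
        case False
        then have "bump \<rho> w z = 0" using bump_eq_0[OF \<rho>, of z w] by (simp add: dist_norm norm_minus_commute)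
        then show ?thesis by (simp add: g_def)
      qed
    qed
    have [measurable]: "u n \<in> borel_measurable borel" unfolding u_def by measurable
    have [measurable]: "g \<in> borel_measurable borel" using ig by auto
    have "l1_on (ball z0 (R / 4)) (u n) v \<le> (\<integral>\<^sup>+z. ennreal (1 / c) * ennreal (g z) + ennreal \<epsilon> * indicator (ball z0 (R / 4)) z \<partial>lborel)"
      unfolding l1_on_def
    proof (rule nn_integral_mono_AE)
      show "AE z in lborel. ennreal \<bar>u n z - v z\<bar> * indicator (ball z0 (R / 4)) z
          \<le> ennreal (1 / c) * ennreal (g z) + ennreal \<epsilon> * indicator (ball z0 (R / 4)) z" using AE g0
      proof eventually_elim
        case (elim z)
        show ?case
        proof (cases "z \<in> ball z0 (R / 4)")
          case True
          then have zR: "z \<in> cball z0 R" using R by simp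
          have "dist z w \<le> dist z z0 + dist z0 w" by (rule dist_triangle)
          then have "norm (z - w) \<le> 2 / 3 * \<rho>"
            using True w(1) by (simp add: \<rho>_def dist_norm norm_minus_commute)
          then have "c \<le> bump \<rho> w z" unfolding c_def by (rule bump_ge[OF \<rho>])
          then have "c * (v z + \<epsilon> - u n z) \<le> g z"
            unfolding g_def using ge0[OF elim(1) zR] by (rule mult_right_mono)
          then have "v z + \<epsilon> - u n z \<le> 1 / c * g z" using c by (simp add: field_simps)
          then have "\<bar>u n z - v z\<bar> \<le> 1 / c * g z + \<epsilon>" using ge0[OF elim(1) zR] \<epsilon> by linarith
          then have "ennreal \<bar>u n z - v z\<bar> \<le> ennreal (1 / c * g z + \<epsilon>)" by (rule ennreal_leI)
          also have "\<dots> = ennreal (1 / c) * ennreal (g z) + ennreal \<epsilon>"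
          proof -
            have "0 \<le> 1 / c * g z" using c elim(2) by simp
            then have "ennreal (1 / c * g z + \<epsilon>) = ennreal (1 / c * g z) + ennreal \<epsilon>"
              using \<epsilon> by (intro ennreal_plus) simp_all
            also have "ennreal (1 / c * g z) = ennreal (1 / c) * ennreal (g z)"
              using c elim(2) by (intro ennreal_mult) simp_all
            finally show ?thesis .
          qed
          finally show ?thesis using True by simp
        qed simp
      qed
    qed
    also have "\<dots> = ennreal (1 / c) * (\<integral>\<^sup>+z. ennreal (g z) \<partial>lborel) + ennreal \<epsilon> * ennreal V"
      by (subst nn_integral_add, measurable, subst nn_integral_cmult, measurable)
        (simp add: nn_integral_cmult_indicator V)
    also have "(\<integral>\<^sup>+z. ennreal (g z) \<partial>lborel) = ennreal (LBINT z. g z)"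
      by (rule nn_integral_eq_integral[OF ig g0])
    also have "ennreal (1 / c) * ennreal (LBINT z. g z) + ennreal \<epsilon> * ennreal V \<le>
       ennreal (1 / c) * ennreal (2 * \<epsilon>) + ennreal \<epsilon> * ennreal V"
      by (intro add_right_mono mult_left_mono ennreal_leI intg) simp
    also have "\<dots> = ennreal (2 * \<epsilon> / c + \<epsilon> * V)"
    proof -
      have "ennreal (1 / c) * ennreal (2 * \<epsilon>) = ennreal (2 * \<epsilon> / c)"
        using c \<epsilon> by (subst ennreal_mult[symmetric]) simp_all
      moreover have "ennreal \<epsilon> * ennreal V = ennreal (\<epsilon> * V)"
        using V \<epsilon> by (subst ennreal_mult[symmetric]) simp_all
      moreover have "0 \<le> 2 * \<epsilon> / c" "0 \<le> \<epsilon> * V" using c \<epsilon> V by simp_all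
      ultimately show ?thesis by (simp only: ennreal_plus)
    qed
    also have "\<dots> \<le> ennreal e" using \<epsilon>e by (rule ennreal_leI)
    finally show ?case .
  qed
qed

text \<open>The good points \<open>y n\<close> wander in \<open>K0\<close>, so no fixed small disc
  need contain them. If convergence fails for infinitely many \<open>n\<close>, compactness gives a
  subsequence of those indices along which \<open>y\<close> converges to some \<open>y0\<close>;
  along it the set \<open>G\<close> of points with local L1 convergence is open, relatively closed
  and contains \<open>y0\<close>, hence is all of \<open>D\<close>, contradicting the choice of the
  indices.\<close>

proposition l1_on_connected:
  fixes p :: "nat \<Rightarrow> complex poly" and s k :: "nat \<Rightarrow> real" and m :: "complex \<Rightarrow> real"
  defines "u \<equiv> \<lambda>n z. s n * ln (norm (poly (p n) z)) + k n"
  assumes s: "\<And>n. s n \<ge> 0" and p0: "\<And>n. p n \<noteq> 0" and vm[measurable]: "v \<in> borel_measurable borel"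
    and D: "open D" "connected D" and A: "finite A" "A \<inter> D = {}"
    and v: "\<And>z. z \<in> D \<Longrightarrow> v z = (\<Sum>a\<in>A. m a * ln (norm (z - a)))"
    and upper: "\<And>K \<epsilon>. compact K \<Longrightarrow> K \<subseteq> D \<Longrightarrow> \<epsilon> > 0 \<Longrightarrow>
       \<forall>\<^sub>F n in sequentially. \<forall>z\<in>K. poly (p n) z \<noteq> 0 \<longrightarrow> u n z \<le> v z + \<epsilon>"
    and K0: "compact K0" "K0 \<subseteq> D" "\<And>n. y n \<in> K0"
    and lower: "\<And>\<epsilon>. \<epsilon> > 0 \<Longrightarrow> \<forall>\<^sub>F n in sequentially. poly (p n) (y n) \<noteq> 0 \<and> v (y n) - \<epsilon> \<le> u n (y n)"
    and R: "cball z R \<subseteq> D" "R > 0"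
  shows "(\<lambda>n. l1_on (ball z (R / 4)) (u n) v) \<longlonglongrightarrow> 0"
proof (rule ccontr)
  assume contra: "\<not> ?thesis"
  have "\<exists>e>0 :: real. \<not> (\<forall>\<^sub>F n in sequentially. l1_on (ball z (R / 4)) (u n) v \<le> ennreal e)"
  proof (rule ccontr)
    assume "\<not> ?thesis"
    then have "\<forall>\<^sub>F n in sequentially. l1_on (ball z (R / 4)) (u n) v \<le> ennreal e" if "e > 0" for e :: real
      using that by blast
    then have "(\<lambda>n. l1_on (ball z (R / 4)) (u n) v) \<longlonglongrightarrow> 0" by (rule tendsto_0_ennrealI)
    with contra show False by contradiction
  qed
  then obtain e :: real where e: "e > 0" "\<not> (\<forall>\<^sub>F n in sequentially. l1_on (ball z (R / 4)) (u n) v \<le> ennreal e)"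
    by blast
  define I where "I = {n. \<not> l1_on (ball z (R / 4)) (u n) v \<le> ennreal e}"
  have "infinite I" using e(2) unfolding I_def cofinite_eq_sequentially[symmetric] eventually_cofinite by simp
  then obtain \<sigma> :: "nat \<Rightarrow> nat" where \<sigma>: "strict_mono \<sigma>" "\<And>n. \<sigma> n \<in> I" using infinite_enumerate by blast
  obtain y0 \<tau> where y0: "y0 \<in> K0" "strict_mono \<tau>" "((y \<circ> \<sigma>) \<circ> \<tau>) \<longlonglongrightarrow> y0"
    using K0(1,3) compact_imp_seq_compact[OF K0(1)] unfolding seq_compact_def by (metis comp_apply)
  define \<rho> where "\<rho> = \<sigma> \<circ> \<tau>"
  have \<rho>: "strict_mono \<rho>" unfolding \<rho>_def using \<sigma>(1) y0(2) by (rule strict_mono_o)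
  have ev: "\<forall>\<^sub>F n in sequentially. Q (\<rho> n)" if "\<forall>\<^sub>F n in sequentially. Q n" for Q
    using that \<rho> by (rule eventually_subseq[rotated])
  have step: "(\<lambda>n. l1_on (ball z0 (r / 4)) (u (\<rho> n)) v) \<longlonglongrightarrow> 0"
    if r: "cball z0 r \<subseteq> D" "r > 0"
      and low: "\<And>\<epsilon>. \<epsilon> > 0 \<Longrightarrow> \<forall>\<^sub>F n in sequentially. \<exists>w\<in>ball z0 (r / 4). poly (p (\<rho> n)) w \<noteq> 0 \<and> v w - \<epsilon> \<le> u (\<rho> n) w"
    for z0 r unfolding u_def
  proof (rule l1_step[of "\<lambda>n. s (\<rho> n)" v A z0 r m "\<lambda>n. p (\<rho> n)" "\<lambda>n. k (\<rho> n)"])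
    show "A \<inter> cball z0 r = {}" using A r by blast
    show "\<And>z. z \<in> cball z0 r \<Longrightarrow> v z = (\<Sum>a\<in>A. m a * ln (norm (z - a)))" using r v by blast
    show "\<forall>\<^sub>F n in sequentially. \<forall>z\<in>cball z0 r. poly (p (\<rho> n)) z \<noteq> 0 \<longrightarrow>
        s (\<rho> n) * ln (norm (poly (p (\<rho> n)) z)) + k (\<rho> n) \<le> v z + \<epsilon>" if "\<epsilon> > 0" for \<epsilon>
      using ev[OF upper[OF compact_cball r(1) that]] by (simp add: u_def)
    show "\<forall>\<^sub>F n in sequentially. \<exists>w\<in>ball z0 (r / 4). poly (p (\<rho> n)) w \<noteq> 0 \<and>
        v w - \<epsilon> \<le> s (\<rho> n) * ln (norm (poly (p (\<rho> n)) w)) + k (\<rho> n)" if "\<epsilon> > 0" for \<epsilon>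
      using low[OF that] by (simp add: u_def)
  qed (use s A r in auto)
  define G where "G = {z \<in> D. \<exists>r>0. (\<lambda>n. l1_on (ball z r) (u (\<rho> n)) v) \<longlonglongrightarrow> 0}"
  \<comment> \<open>Local convergence near \<open>x\<close> spreads to any disc whose quarter
    contains \<open>x\<close>: were \<open>u\<close> below \<open>v - \<epsilon>\<close> throughout
    the small ball \<open>B\<close>, its L1 distance from \<open>v\<close> there would be at least
    \<open>\<epsilon> V\<close>. So some point of \<open>B\<close> is good, and \<open>step\<close>
    applies.\<close>
  have near: "(\<lambda>n. l1_on (ball z0 (r / 4)) (u (\<rho> n)) v) \<longlonglongrightarrow> 0"
    if r: "cball z0 r \<subseteq> D" "r > 0" and x: "x \<in> G" "x \<in> ball z0 (r / 4)" for z0 r x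
  proof (rule step[OF r])
    fix \<epsilon> :: real assume \<epsilon>: "\<epsilon> > 0"
    from x obtain q where q: "q > 0" "(\<lambda>n. l1_on (ball x q) (u (\<rho> n)) v) \<longlonglongrightarrow> 0" by (auto simp: G_def)
    define B where "B = ball x (min q (r / 4 - dist z0 x))"
    have Bsub: "B \<subseteq> ball x q" by (auto simp: B_def)
    have "a \<in> ball z0 (r / 4)" if "a \<in> B" for a using that dist_triangle[of z0 a x] by (auto simp: B_def)
    then have Bsub2: "B \<subseteq> ball z0 (r / 4)" by blast
    have "min q (r / 4 - dist z0 x) > 0" using q x by simp
    then have posB: "emeasure lborel B > 0"
      using emeasure_lborel_ball_finite[of x "min q (r / 4 - dist z0 x)"] content_ball_pos[of "min q (r / 4 - dist z0 x)" x]
      unfolding B_def by (simp add: measure_def enn2real_positive_iff)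
    have finB: "emeasure lborel B < \<infinity>" unfolding B_def by (rule emeasure_lborel_ball_finite)
    define V where "V = measure lborel B"
    have V: "emeasure lborel B = ennreal V" "V > 0"
      using posB finB by (auto simp: V_def infinity_ennreal_def measure_def enn2real_positive_iff
          intro!: emeasure_eq_ennreal_measure)
    have "\<forall>\<^sub>F n in sequentially. l1_on (ball x q) (u (\<rho> n)) v \<le> ennreal (\<epsilon> * V / 2)"
      using \<epsilon> V by (intro tendsto_0_ennrealD[OF q(2)]) simp
    then show "\<forall>\<^sub>F n in sequentially. \<exists>w\<in>ball z0 (r / 4). poly (p (\<rho> n)) w \<noteq> 0 \<and> v w - \<epsilon> \<le> u (\<rho> n) w"
    proof eventually_elim
      case (elim n)
      show ?case
      proof (rule ccontr)
        assume no: "\<not> ?thesis"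
        have "ennreal \<epsilon> * ennreal V = (\<integral>\<^sup>+z\<in>B. ennreal \<epsilon> \<partial>lborel)"
          using nn_integral_cmult_indicator[of B lborel "ennreal \<epsilon>"] V(1) by (simp add: B_def)
        also have "\<dots> \<le> l1_on (ball x q) (u (\<rho> n)) v" unfolding l1_on_def
        proof (rule nn_integral_mono_AE)
          show "AE z in lborel. ennreal \<epsilon> * indicator B z \<le> ennreal \<bar>u (\<rho> n) z - v z\<bar> * indicator (ball x q) z"
            using AE_not_finite[OF finite_zeros[OF p0[of "\<rho> n"]]]
          proof eventually_elim
            case (elim z)
            show ?case
            proof (cases "z \<in> B")
              case True
              then have "\<epsilon> \<le> \<bar>u (\<rho> n) z - v z\<bar>" using no elim Bsub2 by (force simp: zeros_def)
              then show ?thesis using True Bsub by (auto intro: ennreal_leI)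
            qed simp
          qed
        qed
        also have "\<dots> \<le> ennreal (\<epsilon> * V / 2)" by (rule elim)
        also have "ennreal \<epsilon> * ennreal V = ennreal (\<epsilon> * V)" using \<epsilon> V by (simp add: ennreal_mult)
        finally have "\<epsilon> * V \<le> \<epsilon> * V / 2" using \<epsilon> V by (subst (asm) ennreal_le_iff) auto
        moreover have "\<epsilon> * V > 0" using \<epsilon> V by simp
        ultimately show False by linarith
      qed
    qed
  qed
  have "open G"
  proof (rule openI)
    fix x assume x: "x \<in> G"
    then obtain q where q: "q > 0" "(\<lambda>n. l1_on (ball x q) (u (\<rho> n)) v) \<longlonglongrightarrow> 0" and xD: "x \<in> D"
      by (auto simp: G_def)
    obtain q' where q': "q' > 0" "ball x q' \<subseteq> D" using D(1) xD open_contains_ball by blast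
    have "ball x (min q q') \<subseteq> G"
    proof
      fix x' assume x': "x' \<in> ball x (min q q')"
      have "ball x' (q - dist x x') \<subseteq> ball x q"
        by (intro ball_subset_ball_iff[THEN iffD2]) (simp add: dist_commute)
      then have "(\<lambda>n. l1_on (ball x' (q - dist x x')) (u (\<rho> n)) v) \<longlonglongrightarrow> 0"
        by (intro tendsto_0_ennreal_mono[OF q(2)] l1_on_mono)
      moreover have "q - dist x x' > 0" "x' \<in> D" using x' q' by auto
      ultimately show "x' \<in> G" unfolding G_def by blast
    qed
    then show "\<exists>r>0. ball x r \<subseteq> G" using q(1) q'(1) by (intro exI[of _ "min q q'"]) simp
  qed
  moreover have "open (D - G)"
  proof (rule openI)
    fix x assume x: "x \<in> D - G"
    then obtain q where q: "q > 0" "cball x q \<subseteq> D" using D(1) open_contains_cball by blast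
    \<comment> \<open>A point of \<open>G\<close> in this ball would, by \<open>near\<close>, put
      the centre \<open>x\<close> into \<open>G\<close>.\<close>
    have "ball x (q / 4) \<subseteq> D - G"
    proof
      fix x' assume x': "x' \<in> ball x (q / 4)"
      then have "x' \<in> D" using q by (auto simp: subset_iff)
      moreover have "x' \<notin> G"
      proof
        assume "x' \<in> G"
        from near[OF q(2,1) this x'] have "x \<in> G" using x q(1) unfolding G_def
          by (auto intro!: exI[of _ "q / 4"])
        with x show False by simp
      qed
      ultimately show "x' \<in> D - G" by simp
    qed
    then show "\<exists>r>0. ball x r \<subseteq> D - G" using q(1) by (intro exI[of _ "q / 4"]) simp
  qed
  moreover have "y0 \<in> G"
  proof -
    have y0D: "y0 \<in> D" using y0 K0 by blast
    then obtain q where q: "q > 0" "cball y0 q \<subseteq> D" using D(1) open_contains_cball by blast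
    have "(\<lambda>n. l1_on (ball y0 (q / 4)) (u (\<rho> n)) v) \<longlonglongrightarrow> 0"
    proof (rule step[OF q(2,1)])
      fix \<epsilon> :: real assume \<epsilon>: "\<epsilon> > 0"
      have "(\<lambda>n. y (\<rho> n)) \<longlonglongrightarrow> y0" using y0(3) by (simp add: \<rho>_def o_def)
      then have "\<forall>\<^sub>F n in sequentially. y (\<rho> n) \<in> ball y0 (q / 4)"
        using q(1) by (intro topological_tendstoD) auto
      then show "\<forall>\<^sub>F n in sequentially. \<exists>w\<in>ball y0 (q / 4). poly (p (\<rho> n)) w \<noteq> 0 \<and> v w - \<epsilon> \<le> u (\<rho> n) w"
        using ev[OF lower[OF \<epsilon>]] by eventually_elim blast
    qed
    then show ?thesis using y0D q(1) unfolding G_def by (auto intro!: exI[of _ "q / 4"])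
  qed
  ultimately have "D \<subseteq> G" using connectedD[OF D(2), of G "D - G"] y0 K0 by (auto simp: G_def)
  moreover have "z \<in> D" using R by auto
  ultimately have "z \<in> G" by blast
  from near[OF R this] have lim: "(\<lambda>n. l1_on (ball z (R / 4)) (u (\<rho> n)) v) \<longlonglongrightarrow> 0" using R(2) by simp
  have "\<forall>\<^sub>F n in sequentially. l1_on (ball z (R / 4)) (u (\<rho> n)) v \<le> ennreal e"
    by (rule tendsto_0_ennrealD[OF lim e(1)])
  then obtain n where "l1_on (ball z (R / 4)) (u (\<rho> n)) v \<le> ennreal e"
    using eventually_happens'[OF sequentially_bot] by blast
  then show False using \<sigma>(2)[of "\<tau> n"] by (simp add: I_def \<rho>_def)
qed

section \<open>Uniform L2 bounds and convergence across null sets\<close>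

lemma nn_integral_abs_le_sq:
  fixes f :: "complex \<Rightarrow> real"
  assumes [measurable]: "f \<in> borel_measurable borel" "A \<in> sets borel" and T: "T > 0"
  shows "(\<integral>\<^sup>+z\<in>A. ennreal \<bar>f z\<bar> \<partial>lborel)
     \<le> ennreal T * emeasure lborel A + ennreal (1 / T) * (\<integral>\<^sup>+z\<in>A. ennreal ((f z)^2) \<partial>lborel)"
proof -
  \<comment> \<open>This is how an L2 bound yields uniform integrability: a large \<open>T\<close>
    makes the second term small, then a small measure of \<open>A\<close> the first.\<close>
  have *: "\<bar>x\<bar> \<le> T + 1 / T * x^2" for x :: real
  proof (cases "\<bar>x\<bar> \<le> T")
    case True then show ?thesis using T by (simp add: add_increasing2)
  next
    case False
    then have "T * \<bar>x\<bar> \<le> \<bar>x\<bar> * \<bar>x\<bar>" by (intro mult_right_mono) auto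
    then have "\<bar>x\<bar> \<le> 1 / T * x^2" using T by (simp add: field_simps power2_eq_square)
    then show ?thesis using T by simp
  qed
  have "(\<integral>\<^sup>+z\<in>A. ennreal \<bar>f z\<bar> \<partial>lborel)
     \<le> (\<integral>\<^sup>+z. ennreal T * indicator A z + ennreal (1 / T) * (ennreal ((f z)^2) * indicator A z) \<partial>lborel)"
  proof (rule nn_integral_mono)
    fix z
    have "ennreal \<bar>f z\<bar> \<le> ennreal (T + 1 / T * (f z)^2)" by (rule ennreal_leI[OF *])
    also have "\<dots> = ennreal T + ennreal (1 / T * (f z)^2)" using T by (intro ennreal_plus) simp_all
    also have "ennreal (1 / T * (f z)^2) = ennreal (1 / T) * ennreal ((f z)^2)"
      using T by (intro ennreal_mult) simp_all
    finally show "ennreal \<bar>f z\<bar> * indicator A z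
        \<le> ennreal T * indicator A z + ennreal (1 / T) * (ennreal ((f z)^2) * indicator A z)"
      by (cases "z \<in> A") simp_all
  qed
  also have "\<dots> = ennreal T * emeasure lborel A + ennreal (1 / T) * (\<integral>\<^sup>+z\<in>A. ennreal ((f z)^2) \<partial>lborel)"
    by (subst nn_integral_add, measurable, subst nn_integral_cmult, measurable)
      (simp add: nn_integral_cmult_indicator)
  finally show ?thesis .
qed

text \<open>The far zeros only contribute a bounded error after subtracting \<open>ln \<bar>\<zeta>\<bar>\<close>.\<close>

definition tame_log :: "real \<Rightarrow> complex \<Rightarrow> complex \<Rightarrow> real" where
  "tame_log R \<zeta> z = (if norm \<zeta> < 2 * R then ln (norm (z - \<zeta>)) else ln (norm (z - \<zeta>)) - ln (norm \<zeta>))"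

lemma borel_measurable_tame_log [measurable]: "tame_log R \<zeta> \<in> borel_measurable borel"
  unfolding tame_log_def by measurable

text \<open>For \<open>|\<zeta>| \<ge> 2 R\<close> and \<open>|z| < R\<close> the quotient
  \<open>|z - \<zeta>| / |\<zeta>|\<close> lies between 1/2 and 2, so the square is at most
  \<open>(ln 2)^2\<close>; the remaining \<open>\<zeta>\<close> fall under the local bound for
  radius \<open>2 R\<close>.\<close>

lemma tame_log_sq_bound:
  assumes R: "R > 0"
  shows "\<exists>M\<ge>0. \<forall>\<zeta>. (\<integral>\<^sup>+z\<in>ball 0 R. ennreal ((tame_log R \<zeta> z)^2) \<partial>lborel) \<le> ennreal M"
proof -
  obtain M where M: "\<And>\<zeta> :: complex. norm \<zeta> \<le> 2 * R \<Longrightarrow>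
     integrable lborel (\<lambda>z. indicator (ball 0 (2 * R)) z * (ln (norm (z - \<zeta>)))^2) \<and>
     (\<integral>z. indicator (ball 0 (2 * R)) z * (ln (norm (z - \<zeta>)))^2 \<partial>(lborel :: complex measure)) \<le> M"
    using ln_sq_local_bound[of "2 * R"] by blast
  have M0: "M \<ge> 0"
  proof -
    have "0 \<le> (\<integral>z. indicator (ball 0 (2 * R)) z * (ln (norm (z - 0)))^2 \<partial>(lborel :: complex measure))"
      by (intro Bochner_Integration.integral_nonneg) simp
    also have "\<dots> \<le> M" using M[of 0] R by simp
    finally show ?thesis .
  qed
  define V where "V = measure lborel (ball (0 :: complex) R)"
  have V: "emeasure lborel (ball (0 :: complex) R) = ennreal V" "V \<ge> 0"
    using emeasure_lborel_ball_finite[of "0 :: complex" R]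
    by (auto simp: V_def infinity_ennreal_def intro!: emeasure_eq_ennreal_measure)
  have "(\<integral>\<^sup>+z\<in>ball 0 R. ennreal ((tame_log R \<zeta> z)^2) \<partial>lborel) \<le> ennreal (max M ((ln 2)^2 * V))" for \<zeta>
  proof (cases "norm \<zeta> < 2 * R")
    case True
    have "(\<integral>\<^sup>+z\<in>ball 0 R. ennreal ((tame_log R \<zeta> z)^2) \<partial>lborel)
       \<le> (\<integral>\<^sup>+z. ennreal (indicator (ball 0 (2 * R)) z * (ln (norm (z - \<zeta>)))^2) \<partial>lborel)"
      using True R by (intro nn_integral_mono) (auto simp: tame_log_def indicator_def)
    also have "\<dots> = ennreal (LBINT z. indicator (ball 0 (2 * R)) z * (ln (norm (z - \<zeta>)))^2)"
      using M[of \<zeta>] True by (intro nn_integral_eq_integral) auto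
    also have "\<dots> \<le> ennreal M" using M[of \<zeta>] True by (intro ennreal_leI) auto
    also have "\<dots> \<le> ennreal (max M ((ln 2)^2 * V))" by (intro ennreal_leI) simp
    finally show ?thesis .
  next
    case False
    have "(\<integral>\<^sup>+z\<in>ball 0 R. ennreal ((tame_log R \<zeta> z)^2) \<partial>lborel)
       \<le> (\<integral>\<^sup>+z. ennreal ((ln 2)^2) * indicator (ball 0 R) z \<partial>(lborel :: complex measure))"
    proof (rule nn_integral_mono)
      fix z :: complex
      show "ennreal ((tame_log R \<zeta> z)^2) * indicator (ball 0 R) z \<le> ennreal ((ln 2)^2) * indicator (ball 0 R) z"
      proof (cases "norm z < R")
        case True
        have z: "norm \<zeta> > 0" using False R by linarith
        have a: "norm \<zeta> / 2 \<le> norm (z - \<zeta>)" "norm (z - \<zeta>) \<le> norm \<zeta> * 2"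
          using True False norm_triangle_ineq2[of \<zeta> z] norm_triangle_ineq4[of z \<zeta>]
          by (auto simp: norm_minus_commute)
        have zz: "norm (z - \<zeta>) > 0" using a(1) z by linarith
        have "ln (norm \<zeta> / 2) \<le> ln (norm (z - \<zeta>))" "ln (norm (z - \<zeta>)) \<le> ln (norm \<zeta> * 2)"
          using a z zz by (simp_all del: ln_mult ln_divide_pos)
        moreover have "ln (norm \<zeta> / 2) = ln (norm \<zeta>) - ln 2" using z by (simp add: ln_div)
        moreover have "ln (norm \<zeta> * 2) = ln (norm \<zeta>) + ln 2" using z by (simp add: ln_mult_pos)
        ultimately have "\<bar>tame_log R \<zeta> z\<bar> \<le> ln 2" using False by (simp add: tame_log_def)
        then have "(tame_log R \<zeta> z)^2 \<le> (ln 2)^2" by (rule abs_le_square_iff[THEN iffD1, OF order_trans]) simp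
        then show ?thesis using True by (simp add: ennreal_leI)
      qed simp
    qed
    also have "\<dots> = ennreal ((ln 2)^2 * V)" using V by (simp add: nn_integral_cmult_indicator ennreal_mult)
    also have "\<dots> \<le> ennreal (max M ((ln 2)^2 * V))" by (intro ennreal_leI) simp
    finally show ?thesis .
  qed
  then show ?thesis using M0 by (intro exI[of _ "max M ((ln 2)^2 * V)"]) auto
qed

lemma sum_weighted_sq_le:
  fixes w f :: "'a \<Rightarrow> real"
  assumes "\<And>i. i \<in> I \<Longrightarrow> w i \<ge> 0"
  shows "(\<Sum>i\<in>I. w i * f i)^2 \<le> (\<Sum>i\<in>I. w i) * (\<Sum>i\<in>I. w i * (f i)^2)"
proof -
  have "(\<Sum>i\<in>I. w i * f i) = (\<Sum>i\<in>I. sqrt (w i) * (sqrt (w i) * f i))"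
    using assms by (intro sum.cong) (auto simp: mult.assoc[symmetric])
  also have "\<dots>^2 \<le> (\<Sum>i\<in>I. (sqrt (w i))^2) * (\<Sum>i\<in>I. (sqrt (w i) * f i)^2)" by (rule Cauchy_Schwarz_ineq_sum)
  also have "\<dots> = (\<Sum>i\<in>I. w i) * (\<Sum>i\<in>I. w i * (f i)^2)"
    using assms by (simp add: power_mult_distrib cong: sum.cong)
  finally show ?thesis .
qed

text \<open>A Vitali argument: \<open>u n - v\<close> is bounded in L2 on a large ball and converges
  in L1 near almost every point. For the L2 bound, \<open>u n\<close> is split into a sum
  \<open>s n\<close> of tame logarithms, controlled because the degree is at most
  \<open>C n\<close>, and a constant \<open>K n\<close>. The degrees say nothing about
  \<open>K n\<close>; it is bounded because \<open>u n\<close> converges in mean on one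
  ball.\<close>

proposition l1_on_ball_tendsto_0:
  fixes p :: "nat \<Rightarrow> complex poly" and k :: "nat \<Rightarrow> real"
  defines "u \<equiv> \<lambda>n z. 1 / real n * ln (norm (poly (p n) z)) + k n"
  assumes p0: "\<And>n. p n \<noteq> 0" and deg: "\<And>n. real (degree (p n)) \<le> C * real n" and C: "C \<ge> 0"
    and vm[measurable]: "v \<in> borel_measurable borel"
    and v2: "\<And>R. (\<integral>\<^sup>+z\<in>ball 0 R. ennreal ((v z)^2) \<partial>lborel) < \<infinity>"
    and D: "open D" "D \<noteq> {}" "emeasure lborel (- D) = 0"
    and loc: "\<And>z. z \<in> D \<Longrightarrow> \<exists>r>0. (\<lambda>n. l1_on (ball z r) (u n) v) \<longlonglongrightarrow> 0"
  shows "(\<lambda>n. l1_on (ball 0 R) (u n) v) \<longlonglongrightarrow> 0"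
proof -
  obtain z0 where z0: "z0 \<in> D" using D by blast
  obtain r0 where r0: "r0 > 0" "(\<lambda>n. l1_on (ball z0 r0) (u n) v) \<longlonglongrightarrow> 0" using loc[OF z0] by blast
  \<comment> \<open>One ball containing both the target and the disc that controls
    \<open>K n\<close>.\<close>
  define R' where "R' = max R (norm z0 + r0)"
  have R': "R' > 0" using r0 by (auto simp: R'_def less_max_iff_disj intro!: add_nonneg_pos)
  define B where "B = ball (0 :: complex) R'"
  have B_sets[measurable]: "B \<in> sets borel" by (simp add: B_def)
  have subB: "ball z0 r0 \<subseteq> B" "ball 0 R \<subseteq> B"
    unfolding B_def R'_def by (auto intro!: ball_subset_ball_iff[THEN iffD2] simp: dist_norm)
  have um[measurable]: "u n \<in> borel_measurable borel" for n unfolding u_def by measurable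
  obtain M where M: "M \<ge> 0" "\<And>\<zeta>. (\<integral>\<^sup>+z\<in>B. ennreal ((tame_log R' \<zeta> z)^2) \<partial>lborel) \<le> ennreal M"
    using tame_log_sq_bound[OF R'] unfolding B_def by blast
  define s where "s n z = 1 / real n * (\<Sum>\<zeta>\<in>zeros (p n). real (order \<zeta> (p n)) * tame_log R' \<zeta> z)" for n z
  \<comment> \<open>All that is constant in \<open>z\<close>: the leading coefficient, the
    logarithms subtracted for the far zeros, and \<open>k n\<close>.\<close>
  define K where "K n = 1 / real n * (ln (norm (lead_coeff (p n))) +
      (\<Sum>\<zeta>\<in>zeros (p n). real (order \<zeta> (p n)) * (if norm \<zeta> < 2 * R' then 0 else ln (norm \<zeta>)))) + k n" for n
  have sm[measurable]: "s n \<in> borel_measurable borel" for n unfolding s_def by measurable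
  have us: "u n z = K n + s n z" if "z \<notin> zeros (p n)" for n z
  proof -
    have nz: "poly (p n) z \<noteq> 0" using that by (simp add: zeros_def)
    have "(\<Sum>\<zeta>\<in>zeros (p n). real (order \<zeta> (p n)) * ln (norm (z - \<zeta>)))
       = (\<Sum>\<zeta>\<in>zeros (p n). real (order \<zeta> (p n)) * (if norm \<zeta> < 2 * R' then 0 else ln (norm \<zeta>)))
       + (\<Sum>\<zeta>\<in>zeros (p n). real (order \<zeta> (p n)) * tame_log R' \<zeta> z)"
      unfolding sum.distrib[symmetric] by (intro sum.cong refl) (simp add: tame_log_def algebra_simps)
    then show ?thesis unfolding u_def K_def s_def ln_norm_poly[OF nz] by (simp add: algebra_simps)
  qed
  \<comment> \<open>Cauchy-Schwarz with the multiplicities as weights: their sum is the degree, at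
    most \<open>C n\<close>, and it enters twice, which the factor \<open>1 / n^2\<close>
    absorbs.\<close>
  have s2: "(\<integral>\<^sup>+z\<in>B. ennreal ((s n z)^2) \<partial>lborel) \<le> ennreal (C^2 * M)" for n
  proof (cases "n = 0")
    case True
    then show ?thesis by (simp add: s_def)
  next
    case False
    define d where "d = real (degree (p n))"
    have dsum: "(\<Sum>\<zeta>\<in>zeros (p n). real (order \<zeta> (p n))) = d"
      unfolding d_def degree_eq_sum_order[OF p0, symmetric] by simp
    have d0: "d \<ge> 0" by (simp add: d_def)
    have "(s n z)^2 \<le> d / (real n)^2 * (\<Sum>\<zeta>\<in>zeros (p n). real (order \<zeta> (p n)) * (tame_log R' \<zeta> z)^2)" for z
    proof -
      have "(s n z)^2 = 1 / (real n)^2 * (\<Sum>\<zeta>\<in>zeros (p n). real (order \<zeta> (p n)) * tame_log R' \<zeta> z)^2"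
        by (simp add: s_def power_mult_distrib power_divide)
      also have "\<dots> \<le> 1 / (real n)^2 * (d * (\<Sum>\<zeta>\<in>zeros (p n). real (order \<zeta> (p n)) * (tame_log R' \<zeta> z)^2))"
        unfolding dsum[symmetric] by (intro mult_left_mono sum_weighted_sq_le) simp_all
      finally show ?thesis by simp
    qed
    then have "(\<integral>\<^sup>+z\<in>B. ennreal ((s n z)^2) \<partial>lborel) \<le>
      (\<integral>\<^sup>+z. ennreal (d / (real n)^2) * (\<Sum>\<zeta>\<in>zeros (p n). ennreal (real (order \<zeta> (p n))) * (ennreal ((tame_log R' \<zeta> z)^2) * indicator B z)) \<partial>lborel)"
    proof (intro nn_integral_mono)
      fix z
      have "ennreal ((s n z)^2) \<le> ennreal (d / (real n)^2 * (\<Sum>\<zeta>\<in>zeros (p n). real (order \<zeta> (p n)) * (tame_log R' \<zeta> z)^2))"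
        by (rule ennreal_leI) fact
      also have "\<dots> = ennreal (d / (real n)^2) * ennreal (\<Sum>\<zeta>\<in>zeros (p n). real (order \<zeta> (p n)) * (tame_log R' \<zeta> z)^2)"
        using d0 by (intro ennreal_mult) (auto intro!: sum_nonneg)
      also have "ennreal (\<Sum>\<zeta>\<in>zeros (p n). real (order \<zeta> (p n)) * (tame_log R' \<zeta> z)^2)
        = (\<Sum>\<zeta>\<in>zeros (p n). ennreal (real (order \<zeta> (p n))) * ennreal ((tame_log R' \<zeta> z)^2))"
      proof -
        have "ennreal (\<Sum>\<zeta>\<in>zeros (p n). real (order \<zeta> (p n)) * (tame_log R' \<zeta> z)^2)
          = (\<Sum>\<zeta>\<in>zeros (p n). ennreal (real (order \<zeta> (p n)) * (tame_log R' \<zeta> z)^2))"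
          by (rule sum_ennreal[symmetric]) simp
        also have "\<dots> = (\<Sum>\<zeta>\<in>zeros (p n). ennreal (real (order \<zeta> (p n))) * ennreal ((tame_log R' \<zeta> z)^2))"
          by (intro sum.cong refl ennreal_mult) simp_all
        finally show ?thesis .
      qed
      finally show "ennreal ((s n z)^2) * indicator B z \<le> ennreal (d / (real n)^2) *
          (\<Sum>\<zeta>\<in>zeros (p n). ennreal (real (order \<zeta> (p n))) * (ennreal ((tame_log R' \<zeta> z)^2) * indicator B z))"
        by (cases "z \<in> B") simp_all
    qed
    also have "\<dots> = ennreal (d / (real n)^2) * (\<Sum>\<zeta>\<in>zeros (p n). ennreal (real (order \<zeta> (p n))) * (\<integral>\<^sup>+z\<in>B. ennreal ((tame_log R' \<zeta> z)^2) \<partial>lborel))"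
      by (subst nn_integral_cmult, measurable, subst nn_integral_sum, measurable) (simp add: nn_integral_cmult)
    also have "\<dots> \<le> ennreal (d / (real n)^2) * (\<Sum>\<zeta>\<in>zeros (p n). ennreal (real (order \<zeta> (p n))) * ennreal M)"
      by (intro mult_left_mono sum_mono M(2)) simp_all
    also have "\<dots> = ennreal (d / (real n)^2) * ennreal (d * M)"
    proof -
      have "(\<Sum>\<zeta>\<in>zeros (p n). ennreal (real (order \<zeta> (p n))) * ennreal M) = ennreal (d * M)"
        unfolding sum_distrib_right[symmetric] using M d0
        by (subst sum_ennreal) (simp_all add: dsum ennreal_mult)
      then show ?thesis by simp
    qed
    also have "\<dots> = ennreal ((d / real n)^2 * M)"
      using d0 M by (subst ennreal_mult[symmetric]) (simp_all add: power2_eq_square field_simps)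
    also have "\<dots> \<le> ennreal (C^2 * M)"
    proof (intro ennreal_leI mult_right_mono power_mono M)
      show "d / real n \<le> C" using deg[of n] False by (simp add: d_def field_simps)
    qed (use d0 in simp)
    finally show ?thesis .
  qed
  define VB where "VB = measure lborel B"
  have VB: "emeasure lborel B = ennreal VB" "VB \<ge> 0" using emeasure_lborel_ball_finite[of "0 :: complex" R']
    by (auto simp: VB_def B_def infinity_ennreal_def intro!: emeasure_eq_ennreal_measure)
  define v2B where "v2B = enn2real (\<integral>\<^sup>+z\<in>B. ennreal ((v z)^2) \<partial>lborel)"
  have v2B: "(\<integral>\<^sup>+z\<in>B. ennreal ((v z)^2) \<partial>lborel) = ennreal v2B" "v2B \<ge> 0"
    using v2[of R'] unfolding v2B_def B_def by (simp_all add: infinity_ennreal_def less_top)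
  define V0 where "V0 = measure lborel (ball z0 r0)"
  have V0: "emeasure lborel (ball z0 r0) = ennreal V0" "V0 > 0"
    using emeasure_lborel_ball_finite[of z0 r0] content_ball_pos[OF r0(1), of z0]
    by (auto simp: V0_def infinity_ennreal_def intro!: emeasure_eq_ennreal_measure)
  define Kb where "Kb = (1 + (VB + v2B) + (VB + C^2 * M)) / V0"
  have AEz: "AE z in lborel. z \<notin> zeros (p n)" for n by (rule AE_not_finite[OF finite_zeros[OF p0]])
  \<comment> \<open>On \<open>ball z0 r0\<close> the constant is almost everywhere
    \<open>u n - s n\<close>, and \<open>u n - v\<close>, \<open>v\<close> and \<open>s n\<close>
    are all bounded in L1 there.\<close>
  have Kev: "\<forall>\<^sub>F n in sequentially. \<bar>K n\<bar> \<le> Kb" using tendsto_0_ennrealD[OF r0(2), of 1, simplified]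
  proof eventually_elim
    case (elim n)
    have sq1: "(\<integral>\<^sup>+z\<in>ball z0 r0. ennreal \<bar>f z\<bar> \<partial>lborel) \<le> ennreal (VB + x)"
      if [measurable]: "f \<in> borel_measurable borel" and x: "x \<ge> 0"
        "(\<integral>\<^sup>+z\<in>B. ennreal ((f z)^2) \<partial>lborel) \<le> ennreal x" for f x
    proof -
      have "(\<integral>\<^sup>+z\<in>ball z0 r0. ennreal \<bar>f z\<bar> \<partial>lborel) \<le> (\<integral>\<^sup>+z\<in>B. ennreal \<bar>f z\<bar> \<partial>lborel)"
        using subB by (intro nn_integral_mono mult_left_mono) (auto simp: indicator_def)
      also have "\<dots> \<le> ennreal 1 * emeasure lborel B + ennreal (1 / 1) * (\<integral>\<^sup>+z\<in>B. ennreal ((f z)^2) \<partial>lborel)"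
        by (rule nn_integral_abs_le_sq) auto
      also have "\<dots> \<le> ennreal VB + ennreal x" using x VB by (simp add: add_left_mono)
      also have "\<dots> = ennreal (VB + x)" using x VB by (simp add: ennreal_plus)
      finally show ?thesis .
    qed
    have "ennreal \<bar>K n\<bar> * ennreal V0 = (\<integral>\<^sup>+z\<in>ball z0 r0. ennreal \<bar>K n\<bar> \<partial>lborel)"
      by (simp add: nn_integral_cmult_indicator V0)
    also have "\<dots> \<le> (\<integral>\<^sup>+z. (ennreal \<bar>u n z - v z\<bar> * indicator (ball z0 r0) z + ennreal \<bar>v z\<bar> * indicator (ball z0 r0) z)
        + ennreal \<bar>s n z\<bar> * indicator (ball z0 r0) z \<partial>lborel)"
    proof (rule nn_integral_mono_AE)
      show "AE z in lborel. ennreal \<bar>K n\<bar> * indicator (ball z0 r0) z \<le>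
        (ennreal \<bar>u n z - v z\<bar> * indicator (ball z0 r0) z + ennreal \<bar>v z\<bar> * indicator (ball z0 r0) z)
        + ennreal \<bar>s n z\<bar> * indicator (ball z0 r0) z" using AEz[of n]
      proof eventually_elim
        case (elim z)
        have "\<bar>K n\<bar> \<le> (\<bar>u n z - v z\<bar> + \<bar>v z\<bar>) + \<bar>s n z\<bar>" using us[OF elim] by linarith
        then have "ennreal \<bar>K n\<bar> \<le> ennreal ((\<bar>u n z - v z\<bar> + \<bar>v z\<bar>) + \<bar>s n z\<bar>)" by (rule ennreal_leI)
        also have "\<dots> = (ennreal \<bar>u n z - v z\<bar> + ennreal \<bar>v z\<bar>) + ennreal \<bar>s n z\<bar>" by (simp add: ennreal_plus)
        finally show ?case by (cases "z \<in> ball z0 r0") simp_all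
      qed
    qed
    also have "\<dots> = (l1_on (ball z0 r0) (u n) v + (\<integral>\<^sup>+z\<in>ball z0 r0. ennreal \<bar>v z\<bar> \<partial>lborel))
        + (\<integral>\<^sup>+z\<in>ball z0 r0. ennreal \<bar>s n z\<bar> \<partial>lborel)"
      unfolding l1_on_def by (subst nn_integral_add, measurable, subst nn_integral_add, measurable)
    also have "\<dots> \<le> (1 + ennreal (VB + v2B)) + ennreal (VB + C^2 * M)"
      using elim v2B M s2[of n] by (intro add_mono sq1) simp_all
    also have "\<dots> = ennreal (1 + (VB + v2B) + (VB + C^2 * M))"
    proof -
      have add: "(1 + ennreal x) + ennreal y = ennreal (1 + x + y)" if "x \<ge> 0" "y \<ge> 0" for x y
        using that by (simp add: ennreal_plus)
      show ?thesis by (rule add) (use VB v2B M in simp_all)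
    qed
    also have "ennreal \<bar>K n\<bar> * ennreal V0 = ennreal (\<bar>K n\<bar> * V0)" using V0 by (simp add: ennreal_mult)
    finally have "\<bar>K n\<bar> * V0 \<le> 1 + (VB + v2B) + (VB + C^2 * M)"
      using VB v2B M by (subst (asm) ennreal_le_iff) simp_all
    then show ?case unfolding Kb_def using V0 by (simp add: pos_le_divide_eq)
  qed
  define Q where "Q = 3 * (Kb^2 * VB + C^2 * M + v2B)"
  have Q0: "Q \<ge> 0" using VB M v2B by (simp add: Q_def)
  have uv2: "(\<integral>\<^sup>+z\<in>B. ennreal ((u n z - v z)^2) \<partial>lborel) \<le> ennreal Q" if Kn: "\<bar>K n\<bar> \<le> Kb" for n
  proof -
    have "(\<integral>\<^sup>+z\<in>B. ennreal ((u n z - v z)^2) \<partial>lborel)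
      \<le> (\<integral>\<^sup>+z. 3 * ((ennreal (Kb^2) * indicator B z + ennreal ((s n z)^2) * indicator B z) + ennreal ((v z)^2) * indicator B z) \<partial>lborel)"
    proof (rule nn_integral_mono_AE)
      show "AE z in lborel. ennreal ((u n z - v z)^2) * indicator B z \<le>
        3 * ((ennreal (Kb^2) * indicator B z + ennreal ((s n z)^2) * indicator B z) + ennreal ((v z)^2) * indicator B z)"
        using AEz[of n]
      proof eventually_elim
        case (elim z)
        have sq: "(a + b - c)^2 \<le> 3 * ((a^2 + b^2) + c^2)" for a b c :: real
        proof -
          have "0 \<le> (a - b)^2 + (a + c)^2 + (b + c)^2" by simp
          then show ?thesis by (simp add: power2_eq_square algebra_simps)
        qed
        have "(K n)^2 \<le> Kb^2" using Kn by (simp add: power2_le_iff_abs_le)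
        then have "(u n z - v z)^2 \<le> 3 * ((Kb^2 + (s n z)^2) + (v z)^2)"
          unfolding us[OF elim] by (intro order_trans[OF sq] mult_left_mono add_right_mono) simp_all
        then have "ennreal ((u n z - v z)^2) \<le> ennreal (3 * ((Kb^2 + (s n z)^2) + (v z)^2))" by (rule ennreal_leI)
        also have "\<dots> = 3 * ((ennreal (Kb^2) + ennreal ((s n z)^2)) + ennreal ((v z)^2))"
          by (simp add: ennreal_plus ennreal_mult')
        finally show ?case by (cases "z \<in> B") simp_all
      qed
    qed
    also have "\<dots> = 3 * ((ennreal (Kb^2) * ennreal VB + (\<integral>\<^sup>+z\<in>B. ennreal ((s n z)^2) \<partial>lborel))
        + (\<integral>\<^sup>+z\<in>B. ennreal ((v z)^2) \<partial>lborel))"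
      by (simp add: nn_integral_cmult nn_integral_add nn_integral_cmult_indicator VB)
    also have "\<dots> \<le> 3 * ((ennreal (Kb^2) * ennreal VB + ennreal (C^2 * M)) + ennreal v2B)"
      using s2[of n] v2B by (intro mult_left_mono add_mono) simp_all
    also have "\<dots> = ennreal Q" using VB M v2B by (simp add: Q_def ennreal_plus ennreal_mult')
    finally show ?thesis .
  qed
  have main: "(\<lambda>n. l1_on B (u n) v) \<longlonglongrightarrow> 0"
  proof (rule tendsto_0_ennrealI)
    fix e :: real assume e: "e > 0"
    \<comment> \<open>On the small exceptional set the L1 norm is at most
      \<open>T * \<delta> + Q / T\<close>, and both parts come out at most \<open>e / 4\<close>;
      \<open>Q + 1\<close> keeps \<open>T\<close> positive when \<open>Q = 0\<close>.\<close>
    define T where "T = 4 * (Q + 1) / e"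
    have T: "T > 0" using e Q0 by (simp add: T_def)
    have TQ: "1 / T * Q \<le> e / 4"
    proof -
      have "1 / T * Q = e / 4 * (Q / (Q + 1))" by (simp add: T_def)
      also have "\<dots> \<le> e / 4 * 1" using e Q0 by (intro mult_left_mono) auto
      finally show ?thesis by simp
    qed
    define \<delta> where "\<delta> = e / (4 * T)"
    have \<delta>: "\<delta> > 0" "T * \<delta> = e / 4" using e T by (simp_all add: \<delta>_def)
    have "\<forall>z\<in>D. \<exists>r>0. (\<lambda>n. l1_on (ball z r) (u n) v) \<longlonglongrightarrow> 0" using loc by blast
    from bchoice[OF this] obtain r
      where r': "\<forall>z\<in>D. r z > 0 \<and> (\<lambda>n. l1_on (ball z (r z)) (u n) v) \<longlonglongrightarrow> 0" ..
    then have r: "z \<in> D \<Longrightarrow> r z > 0" "z \<in> D \<Longrightarrow> (\<lambda>n. l1_on (ball z (r z)) (u n) v) \<longlonglongrightarrow> 0" for z by blast+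
    \<comment> \<open>Countably many of the balls already cover \<open>D\<close>, so the parts
      \<open>N j\<close> of \<open>B\<close> missed by the first of them decrease to a null set, and
      finitely many balls cover \<open>B\<close> up to measure \<open>\<delta>\<close>.\<close>
    obtain F' where F': "F' \<subseteq> (\<lambda>z. ball z (r z)) ` D" "countable F'" "\<Union> F' = \<Union> ((\<lambda>z. ball z (r z)) ` D)"
      by (rule Lindelof[of "(\<lambda>z. ball z (r z)) ` D"]) auto
    have cover: "D \<subseteq> \<Union> F'" unfolding F'(3) using r(1) by auto
    then have F'ne: "F' \<noteq> {}" using D(2) by auto
    define E where "E = from_nat_into F'"
    have E: "E i \<in> F'" for i unfolding E_def using F'ne by (rule from_nat_into)
    have EU: "(\<Union>i. E i) = \<Union> F'" unfolding E_def using F'(2) F'ne by (simp add: range_from_nat_into)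
    have Elim: "(\<lambda>n. l1_on (E i) (u n) v) \<longlonglongrightarrow> 0" for i
    proof -
      obtain z where "z \<in> D" "E i = ball z (r z)" using E[of i] F'(1) by blast
      then show ?thesis using r(2)[of z] by simp
    qed
    have Eop: "open (E i)" for i using E[of i] F'(1) by auto
    have Es[measurable]: "E i \<in> sets borel" for i using Eop by simp
    define N where "N j = B - (\<Union>i\<le>j. E i)" for j
    have Ns[measurable]: "N j \<in> sets borel" for j unfolding N_def by measurable
    have "(\<lambda>j. emeasure lborel (N j)) \<longlonglongrightarrow> emeasure lborel (\<Inter>j. N j)"
    proof (rule Lim_emeasure_decseq)
      show "range N \<subseteq> sets lborel" by auto
      show "decseq N" unfolding N_def by (intro decseq_SucI) auto
      show "emeasure lborel (N i) \<noteq> \<infinity>" for i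
      proof -
        have "emeasure lborel (N i) \<le> emeasure lborel B" by (intro emeasure_mono) (auto simp: N_def)
        then show ?thesis using VB by (auto simp: infinity_ennreal_def top_unique)
      qed
    qed
    moreover have "emeasure lborel (\<Inter>j. N j) = 0"
    proof -
      have "(\<Inter>j. N j) \<subseteq> - D" using cover EU by (auto simp: N_def)
      then have "emeasure lborel (\<Inter>j. N j) \<le> emeasure lborel (- D)" using D(1) by (intro emeasure_mono) auto
      then show ?thesis using D(3) by simp
    qed
    ultimately have Nlim: "(\<lambda>j. emeasure lborel (N j)) \<longlonglongrightarrow> 0" by simp
    obtain j where j: "emeasure lborel (N j) \<le> ennreal \<delta>"
      using eventually_happens'[OF sequentially_bot tendsto_0_ennrealD[OF Nlim \<delta>(1)]] by blast
    have "(\<lambda>n. \<Sum>i\<le>j. l1_on (E i) (u n) v) \<longlonglongrightarrow> (\<Sum>i\<le>j. 0)" by (intro tendsto_sum Elim)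
    then have "(\<lambda>n. \<Sum>i\<le>j. l1_on (E i) (u n) v) \<longlonglongrightarrow> 0" by simp
    from tendsto_0_ennrealD[OF this, of "e / 4"]
    have "\<forall>\<^sub>F n in sequentially. (\<Sum>i\<le>j. l1_on (E i) (u n) v) \<le> ennreal (e / 4)" using e by simp
    then show "\<forall>\<^sub>F n in sequentially. l1_on B (u n) v \<le> ennreal e" using Kev
    proof eventually_elim
      case (elim n)
      have "l1_on B (u n) v \<le> (\<integral>\<^sup>+z. (\<Sum>i\<le>j. ennreal \<bar>u n z - v z\<bar> * indicator (E i) z) + ennreal \<bar>u n z - v z\<bar> * indicator (N j) z \<partial>lborel)"
        unfolding l1_on_def
      proof (rule nn_integral_mono)
        fix z
        show "ennreal \<bar>u n z - v z\<bar> * indicator B z \<le>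
          (\<Sum>i\<le>j. ennreal \<bar>u n z - v z\<bar> * indicator (E i) z) + ennreal \<bar>u n z - v z\<bar> * indicator (N j) z"
        proof (cases "\<exists>i\<le>j. z \<in> E i")
          case True
          then obtain i where i: "i \<le> j" "z \<in> E i" by blast
          have "ennreal \<bar>u n z - v z\<bar> * indicator B z \<le> ennreal \<bar>u n z - v z\<bar> * indicator (E i) z"
            using i by (intro mult_left_mono) (simp_all add: indicator_def)
          also have "\<dots> \<le> (\<Sum>i\<le>j. ennreal \<bar>u n z - v z\<bar> * indicator (E i) z)"
            using i by (intro member_le_sum) simp_all
          finally show ?thesis by (rule order_trans) simp
        next
          case False
          then have "(indicator B z :: ennreal) \<le> indicator (N j) z" by (auto simp: N_def indicator_def)
          then have "ennreal \<bar>u n z - v z\<bar> * indicator B z \<le> ennreal \<bar>u n z - v z\<bar> * indicator (N j) z"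
            by (intro mult_left_mono) simp_all
          then show ?thesis by (rule order_trans) simp
        qed
      qed
      also have "\<dots> = (\<Sum>i\<le>j. l1_on (E i) (u n) v) + (\<integral>\<^sup>+z. ennreal \<bar>u n z - v z\<bar> * indicator (N j) z \<partial>lborel)"
        unfolding l1_on_def by (subst nn_integral_add, measurable, subst nn_integral_sum, measurable)
      also have "\<dots> \<le> ennreal (e / 4) + (ennreal T * ennreal \<delta> + ennreal (1 / T) * ennreal Q)"
      proof (intro add_mono elim(1))
        have i2: "(\<integral>\<^sup>+z\<in>N j. ennreal ((u n z - v z)^2) \<partial>lborel) \<le> ennreal Q"
        proof (rule order_trans[OF _ uv2[OF elim(2)]])
          show "(\<integral>\<^sup>+z\<in>N j. ennreal ((u n z - v z)^2) \<partial>lborel)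
            \<le> (\<integral>\<^sup>+z\<in>B. ennreal ((u n z - v z)^2) \<partial>lborel)"
            by (intro nn_integral_mono mult_left_mono) (auto simp: N_def indicator_def)
        qed
        have "(\<integral>\<^sup>+z. ennreal \<bar>u n z - v z\<bar> * indicator (N j) z \<partial>lborel)
          \<le> ennreal T * emeasure lborel (N j) + ennreal (1 / T) * (\<integral>\<^sup>+z\<in>N j. ennreal ((u n z - v z)^2) \<partial>lborel)"
          by (rule nn_integral_abs_le_sq[OF _ _ T]) measurable
        then show "(\<integral>\<^sup>+z. ennreal \<bar>u n z - v z\<bar> * indicator (N j) z \<partial>lborel)
            \<le> ennreal T * ennreal \<delta> + ennreal (1 / T) * ennreal Q"
          by (rule order_trans) (intro add_mono mult_left_mono j i2, simp_all)
      qed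
      also have "ennreal T * ennreal \<delta> = ennreal (T * \<delta>)"
        using T \<delta>(1) by (intro ennreal_mult[symmetric]) simp_all
      also have "ennreal (1 / T) * ennreal Q = ennreal (1 / T * Q)"
        using T Q0 by (intro ennreal_mult[symmetric]) simp_all
      also have "ennreal (e / 4) + (ennreal (T * \<delta>) + ennreal (1 / T * Q)) = ennreal (e / 4 + (T * \<delta> + 1 / T * Q))"
      proof -
        have add: "ennreal x + (ennreal y + ennreal z) = ennreal (x + (y + z))" if "x \<ge> 0" "y \<ge> 0" "z \<ge> 0" for x y z
          using that by (simp add: ennreal_plus)
        show ?thesis by (rule add) (use e T \<delta>(1) Q0 in simp_all)
      qed
      also have "\<dots> \<le> ennreal e" using TQ \<delta>(2) e by (intro ennreal_leI) linarith
      finally show ?case .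
    qed
  qed
  show ?thesis by (rule tendsto_0_ennreal_mono[OF main l1_on_mono[OF subB(2)]])
qed

lemma integral_tendsto_of_l1_on:
  fixes u :: "nat \<Rightarrow> complex \<Rightarrow> real"
  assumes l1: "(\<lambda>n. l1_on (ball 0 R) (u n) v) \<longlonglongrightarrow> 0"
    and G: "continuous_on UNIV G" "\<And>z. R \<le> norm z \<Longrightarrow> G z = 0"
    and int: "\<And>n. integrable lborel (\<lambda>z. u n z * G z)" "integrable lborel (\<lambda>z. v z * G z)"
    and [measurable]: "\<And>n. u n \<in> borel_measurable borel" "v \<in> borel_measurable borel"
  shows "(\<lambda>n. \<integral>z. u n z * G z \<partial>lborel) \<longlonglongrightarrow> (LBINT z. v z * G z)"
proof -
  have [measurable]: "G \<in> borel_measurable borel" using G(1) by (rule borel_measurable_continuous_onI)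
  obtain M where M: "M \<ge> 0" "\<And>z. norm (z - 0) \<le> R \<Longrightarrow> \<bar>G z\<bar> \<le> M" using continuous_bounded_ball[OF G(1)] by blast
  have le: "ennreal \<bar>(LBINT z. u n z * G z) - (LBINT z. v z * G z)\<bar> \<le> ennreal M * l1_on (ball 0 R) (u n) v" for n
  proof -
    have i: "integrable lborel (\<lambda>z. u n z * G z - v z * G z)" using int by auto
    have "\<bar>(LBINT z. u n z * G z) - (LBINT z. v z * G z)\<bar> = \<bar>\<integral>z. u n z * G z - v z * G z \<partial>lborel\<bar>"
      using int by simp
    also have "\<dots> \<le> (LBINT z. \<bar>u n z * G z - v z * G z\<bar>)" by (rule integral_abs_bound)
    finally have "ennreal \<bar>(LBINT z. u n z * G z) - (LBINT z. v z * G z)\<bar>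
        \<le> ennreal (LBINT z. \<bar>u n z * G z - v z * G z\<bar>)" by (rule ennreal_leI)
    also have "\<dots> = (\<integral>\<^sup>+z. ennreal \<bar>u n z * G z - v z * G z\<bar> \<partial>lborel)"
      by (rule nn_integral_eq_integral[symmetric]) (use i in auto)
    also have "\<dots> \<le> (\<integral>\<^sup>+z. ennreal M * (ennreal \<bar>u n z - v z\<bar> * indicator (ball 0 R) z) \<partial>lborel)"
    proof (rule nn_integral_mono)
      fix z
      show "ennreal \<bar>u n z * G z - v z * G z\<bar> \<le> ennreal M * (ennreal \<bar>u n z - v z\<bar> * indicator (ball 0 R) z)"
      proof (cases "norm z < R")
        case True
        have "\<bar>u n z * G z - v z * G z\<bar> = \<bar>G z\<bar> * \<bar>u n z - v z\<bar>"
          by (simp add: abs_mult[symmetric] algebra_simps)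
        also have "\<dots> \<le> M * \<bar>u n z - v z\<bar>" using M(2)[of z] True by (intro mult_right_mono) auto
        finally have "ennreal \<bar>u n z * G z - v z * G z\<bar> \<le> ennreal (M * \<bar>u n z - v z\<bar>)" by (rule ennreal_leI)
        then show ?thesis using True M(1) by (simp add: ennreal_mult)
      next
        case False
        then show ?thesis using G(2)[of z] by simp
      qed
    qed
    also have "\<dots> = ennreal M * l1_on (ball 0 R) (u n) v"
      unfolding l1_on_def by (rule nn_integral_cmult) measurable
    finally show ?thesis .
  qed
  show ?thesis
  proof (rule LIMSEQ_I)
    fix r :: real assume r: "r > 0"
    define q where "q = r / (2 * (M + 1))"
    have q: "q > 0" "M * q < r"
    proof -
      show "q > 0" using r M(1) by (simp add: q_def)
      then have "M * q \<le> (M + 1) * q" by simp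
      also have "(M + 1) * q = r / 2" using M(1) by (simp add: q_def field_simps)
      finally show "M * q < r" using r by simp
    qed
    obtain n0 where n0: "\<And>n. n \<ge> n0 \<Longrightarrow> l1_on (ball 0 R) (u n) v \<le> ennreal q"
      using tendsto_0_ennrealD[OF l1 q(1)] by (auto simp: eventually_sequentially)
    have "norm ((LBINT z. u n z * G z) - (LBINT z. v z * G z)) < r" if "n \<ge> n0" for n
    proof -
      have "ennreal \<bar>(LBINT z. u n z * G z) - (LBINT z. v z * G z)\<bar> \<le> ennreal M * ennreal q"
        using le[of n] mult_left_mono[OF n0[OF that], of "ennreal M"] by (meson order_trans zero_le)
      also have "\<dots> = ennreal (M * q)" using M q by (simp add: ennreal_mult)
      finally have "\<bar>(LBINT z. u n z * G z) - (LBINT z. v z * G z)\<bar> \<le> M * q"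
        using M q by (subst (asm) ennreal_le_iff) auto
      then show ?thesis using q by simp
    qed
    then show "\<exists>no. \<forall>n\<ge>no. norm ((LBINT z. u n z * G z) - (LBINT z. v z * G z)) < r" by blast
  qed
qed

section \<open>Growth of higher derivatives\<close>

text \<open>Cauchy's inequality on circles of radius \<open>exp (- \<epsilon>)\<close> times the
  distance to \<open>S\<close>. The factor below 1 keeps all these circles, for all centres in
  \<open>K\<close>, in a single compact set \<open>L\<close> off \<open>S\<close>, so that one
  \<open>M\<close> serves every \<open>z\<close> and \<open>n\<close>.\<close>

lemma higher_deriv_bound_compact:
  fixes f :: "complex \<Rightarrow> complex"
  assumes hol: "f holomorphic_on - S" and S: "finite S" "S \<noteq> {}"
    and K: "compact K" "K \<inter> S = {}" and e: "\<epsilon> > 0"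
  shows "\<exists>M>0. \<forall>n. \<forall>z\<in>K. norm ((deriv ^^ n) f z) / fact n \<le> M * (exp \<epsilon> / infdist z S) ^ n"
proof (cases "K = {}")
  case False
  have cl: "closed S" using S by (simp add: finite_imp_closed)
  have pos: "infdist z S > 0" if "z \<in> K" for z
    using that K cl S in_closed_iff_infdist_zero[of S z] infdist_nonneg[of z S]
    by (metis disjoint_iff less_eq_real_def)
  obtain z0 where z0: "z0 \<in> K" "\<And>z. z \<in> K \<Longrightarrow> infdist z0 S \<le> infdist z S"
    using continuous_attains_inf[OF K(1) False continuous_on_infdist[OF continuous_on_id, where A = S]] by auto
  obtain R where R: "\<And>z. z \<in> K \<Longrightarrow> norm z + infdist z S \<le> R"
  proof -
    have "compact ((\<lambda>z. norm z + infdist z S) ` K)" by (intro compact_continuous_image K continuous_intros)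
    then have "bdd_above ((\<lambda>z. norm z + infdist z S) ` K)"
      by (simp add: bounded_imp_bdd_above compact_imp_bounded)
    then show ?thesis using that by (auto simp: bdd_above_def)
  qed
  define q where "q = exp (- \<epsilon>)"
  have q: "0 < q" "q < 1" using e by (auto simp: q_def)
  define L where "L = {w. (1 - q) * infdist z0 S \<le> infdist w S} \<inter> cball 0 R"
  have "compact L" unfolding L_def by (intro closed_Int_compact closed_Collect_le continuous_intros) auto
  moreover have LS: "L \<subseteq> - S" using pos[OF z0(1)] q by (auto simp: L_def mult_le_0_iff)
  ultimately have "bounded (f ` L)"
    by (intro compact_imp_bounded compact_continuous_image holomorphic_on_imp_continuous_on
        holomorphic_on_subset[OF hol])
  then obtain M where M: "M > 0" "\<And>w. w \<in> L \<Longrightarrow> norm (f w) \<le> M" by (auto simp: bounded_pos)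
  have "norm ((deriv ^^ n) f z) / fact n \<le> M * (exp \<epsilon> / infdist z S) ^ n" if z: "z \<in> K" for n z
  proof -
    define r where "r = q * infdist z S"
    have r: "r > 0" using q pos[OF z] by (simp add: r_def)
    have sub: "cball z r \<subseteq> L"
    proof
      fix w assume w: "w \<in> cball z r"
      have "infdist z S \<le> infdist w S + dist z w" by (rule infdist_triangle)
      then have "(1 - q) * infdist z S \<le> infdist w S" using w by (simp add: r_def algebra_simps)
      moreover have "(1 - q) * infdist z0 S \<le> (1 - q) * infdist z S"
        using z0(2)[OF z] q by (intro mult_left_mono) auto
      moreover have "norm w \<le> norm z + dist z w" by (metis dist_norm norm_triangle_sub norm_minus_commute)
      moreover have "r \<le> infdist z S" using q pos[OF z] by (simp add: r_def mult_le_cancel_right1)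
      ultimately show "w \<in> L" using w R[OF z] by (auto simp: L_def)
    qed
    have h: "f holomorphic_on cball z r" using holomorphic_on_subset[OF hol] sub LS by blast
    have "norm ((deriv ^^ n) f z) \<le> fact n * M / r ^ n"
    proof (rule Cauchy_inequality)
      show "f holomorphic_on ball z r" using h ball_subset_cball holomorphic_on_subset by blast
      show "continuous_on (cball z r) f" using h holomorphic_on_imp_continuous_on by blast
      show "norm (f x) \<le> M" if "norm (z - x) = r" for x
        using that sub M(2)[of x] by (auto simp: dist_norm subset_iff)
    qed (rule r)
    then have "norm ((deriv ^^ n) f z) / fact n \<le> M / r ^ n" by (simp add: field_simps)
    also have "M / r ^ n = M * (exp \<epsilon> / infdist z S) ^ n"
    proof -
      have "exp \<epsilon> / infdist z S = 1 / r" by (simp add: r_def q_def exp_minus divide_inverse)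
      then show ?thesis by (simp add: power_divide)
    qed
    finally show ?thesis .
  qed
  with M show ?thesis by blast
qed (auto intro: exI[of _ 1])

text \<open>Integration by parts on a closed circle. The power of \<open>w - a\<close> is raised
  together with the order of the derivative, so that each step returns to the same moment of
  \<open>f\<close> and contributes the factor \<open>- (k + n + 1)\<close>.\<close>

lemma contour_integral_higher_deriv_moment:
  fixes f :: "complex \<Rightarrow> complex"
  assumes hol: "f holomorphic_on ball a R - {a}" and s: "0 < s" "s < R"
  shows "contour_integral (circlepath a s) (\<lambda>w. (deriv ^^ n) f w * (w - a) ^ (k + n))
     = (- 1) ^ n * (fact (k + n) / fact k) * contour_integral (circlepath a s) (\<lambda>w. f w * (w - a) ^ k)"
proof (induction n)
  case (Suc n)
  define D where "D = ball a R - {a}"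
  have D: "open D" by (auto simp: D_def)
  have holn: "(deriv ^^ m) f holomorphic_on D" for m
    using holomorphic_higher_deriv[OF hol] D unfolding D_def by blast
  have sub: "sphere a s \<subseteq> D" using s by (auto simp: D_def)
  define g where "g w = (deriv ^^ Suc n) f w * (w - a) ^ (k + Suc n)" for w
  define h where "h w = (deriv ^^ n) f w * (w - a) ^ (k + n)" for w
  have cont: "continuous_on (sphere a s) g" "continuous_on (sphere a s) h" unfolding g_def h_def
    by (intro continuous_on_mult continuous_on_subset[OF holomorphic_on_imp_continuous_on[OF holn] sub]
        continuous_intros)+
  have ci: "g contour_integrable_on (circlepath a s)" "h contour_integrable_on (circlepath a s)"
    using cont s by (auto intro!: contour_integrable_continuous_circlepath)
  have "((\<lambda>w. g w + of_nat (k + Suc n) * h w) has_contour_integral 0) (circlepath a s)"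
  proof (rule Cauchy_theorem_primitive[of D "\<lambda>w. (deriv ^^ n) f w * (w - a) ^ (k + Suc n)"])
    fix w assume w: "w \<in> D"
    have "((deriv ^^ n) f has_field_derivative (deriv ^^ Suc n) f w) (at w)"
      using holomorphic_derivI[OF holn D w] by simp
    moreover have lin: "((\<lambda>w. w - a) has_field_derivative 1) (at w)" by (auto intro!: derivative_eq_intros)
    have "((\<lambda>w. (w - a) ^ (k + Suc n)) has_field_derivative of_nat (k + Suc n) * (w - a) ^ (k + n)) (at w)"
      using DERIV_power[OF lin, of "Suc (k + n)"] by (simp add: add.assoc)
    ultimately have "((\<lambda>w. (deriv ^^ n) f w * (w - a) ^ (k + Suc n)) has_field_derivative g w + of_nat (k + Suc n) * h w) (at w)"
      by (rule DERIV_cong[OF DERIV_mult]) (simp add: g_def h_def mult_ac)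
    then show "((\<lambda>w. (deriv ^^ n) f w * (w - a) ^ (k + Suc n)) has_field_derivative g w + of_nat (k + Suc n) * h w) (at w within D)"
      by (rule has_field_derivative_at_within)
  qed (use s sub in auto)
  from contour_integral_unique[OF this]
  have "contour_integral (circlepath a s) g + of_nat (k + Suc n) * contour_integral (circlepath a s) h = 0"
    by (simp only: contour_integral_add[OF ci(1) contour_integrable_lmul[OF ci(2)]] contour_integral_lmul[OF ci(2)])
  then have "contour_integral (circlepath a s) g = - of_nat (k + Suc n) * contour_integral (circlepath a s) h"
    by (simp only: eq_neg_iff_add_eq_0 mult_minus_left)
  also have "contour_integral (circlepath a s) h
      = (- 1) ^ n * (fact (k + n) / fact k) * contour_integral (circlepath a s) (\<lambda>w. f w * (w - a) ^ k)"
    unfolding h_def by (rule Suc.IH)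
  finally have *: "contour_integral (circlepath a s) g = - of_nat (k + Suc n) *
      ((- 1) ^ n * (fact (k + n) / fact k) * contour_integral (circlepath a s) (\<lambda>w. f w * (w - a) ^ k))" .
  define K where "K = (of_nat (k + Suc n) :: complex)"
  have fct: "fact (k + Suc n) = K * fact (k + n)" by (simp add: K_def)
  show ?case using * unfolding g_def K_def[symmetric] fct by (simp add: mult_ac del: funpow.simps)
qed simp

text \<open>The moment of the \<open>n\<close>-th derivative is a fixed nonzero number times
  \<open>fact (k + n) / fact k\<close>, which is at least \<open>fact n\<close>; this is impossible
  if the derivative is too small on the whole circle.\<close>

lemma higher_deriv_lower_bound_circle:
  fixes f :: "complex \<Rightarrow> complex"
  assumes hol: "f holomorphic_on ball a R - {a}" and s: "0 < s" "s < R"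
    and A: "contour_integral (circlepath a s) (\<lambda>w. f w * (w - a) ^ k) \<noteq> 0"
  shows "\<exists>c>0. \<forall>n. \<exists>w\<in>sphere a s. c / s ^ n \<le> norm ((deriv ^^ n) f w) / fact n"
proof -
  define I where "I = contour_integral (circlepath a s) (\<lambda>w. f w * (w - a) ^ k)"
  \<comment> \<open>Half the constant that the length \<open>2 pi s\<close> and the weight
    \<open>s ^ (k + n)\<close> would allow, so that the final comparison is strict.\<close>
  define c where "c = norm I / (4 * pi * s ^ Suc k)"
  have c: "c > 0" using A s by (simp add: c_def I_def)
  have "\<exists>w\<in>sphere a s. c / s ^ n \<le> norm ((deriv ^^ n) f w) / fact n" for n
  proof (rule ccontr)
    assume "\<not> ?thesis"
    then have lt: "norm ((deriv ^^ n) f w) \<le> fact n * c / s ^ n" if "w \<in> sphere a s" for w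
      using that by (force simp: field_simps not_le)
    define h where "h w = (deriv ^^ n) f w * (w - a) ^ (k + n)" for w
    have "(deriv ^^ n) f holomorphic_on ball a R - {a}" using holomorphic_higher_deriv[OF hol] by blast
    then have "continuous_on (sphere a s) h" unfolding h_def using s
      by (intro continuous_intros holomorphic_on_imp_continuous_on[THEN continuous_on_subset]) auto
    then have "h contour_integrable_on (circlepath a s)"
      using s by (auto intro!: contour_integrable_continuous_circlepath)
    then have "(h has_contour_integral contour_integral (circlepath a s) h) (circlepath a s)"
      by (rule has_contour_integral_integral)
    then have "norm (contour_integral (circlepath a s) h) \<le> (fact n * c / s ^ n * s ^ (k + n)) * (2 * pi * s)"
    proof (rule has_contour_integral_bound_circlepath)
      fix w assume w: "norm (w - a) = s"
      then have "w \<in> sphere a s" by (simp add: dist_norm norm_minus_commute)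
      then have "norm ((deriv ^^ n) f w) * s ^ (k + n) \<le> fact n * c / s ^ n * s ^ (k + n)"
        using s by (intro mult_right_mono lt) auto
      then show "norm (h w) \<le> fact n * c / s ^ n * s ^ (k + n)" by (simp add: h_def norm_mult norm_power w)
    qed (use c s in auto)
    also have "\<dots> = fact n * norm I / 2" using s by (simp add: c_def power_add field_simps)
    finally have "norm (contour_integral (circlepath a s) h) \<le> fact n * norm I / 2" .
    moreover have "contour_integral (circlepath a s) h = (- 1) ^ n * (fact (k + n) / fact k) * I"
      unfolding h_def I_def by (rule contour_integral_higher_deriv_moment[OF hol s])
    then have "norm (contour_integral (circlepath a s) h) = fact (k + n) / fact k * norm I"
      by (simp add: norm_mult norm_divide norm_power)
    moreover have "fact n \<le> (fact (k + n) / fact k :: real)"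
    proof -
      have "fact k * fact n \<le> (fact (k + n) :: nat)" by (rule dvd_imp_le[OF fact_fact_dvd_fact]) simp
      then have "real (fact k * fact n) \<le> real (fact (k + n))" by (rule of_nat_mono)
      then show ?thesis by (simp add: field_simps)
    qed
    then have "fact n * norm I \<le> fact (k + n) / fact k * norm I" by (intro mult_right_mono) auto
    ultimately have "fact n * norm I \<le> fact n * norm I / 2" by linarith
    moreover have "fact n * norm I > 0" using A by (simp add: I_def)
    ultimately show False by simp
  qed
  with c show ?thesis by blast
qed

lemma contour_integral_circlepath_indep:
  assumes "h holomorphic_on ball a R - {a}" "0 < r" "r < R" "0 < s" "s < R"
  shows "contour_integral (circlepath a r) h = contour_integral (circlepath a s) h"
proof -
  have "(h has_contour_integral 2 * pi * \<i> * residue h a) (circlepath a t)" if "0 < t" "t < R" for t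
    using that assms by (intro base_residue[of "ball a R"]) auto
  then show ?thesis using assms contour_integral_unique by metis
qed

text \<open>The moments are, up to \<open>2 pi \<i>\<close>, the Laurent coefficients of negative
  index, so the Cauchy integral over the circle should be the extension. Comparing this circle with
  one of radius \<open>r < |z - a|\<close>, what has to be shown is that the Cauchy integral over
  the inner circle vanishes.\<close>

lemma extends_if_moments_vanish:
  fixes f :: "complex \<Rightarrow> complex"
  assumes hol: "f holomorphic_on ball a R - {a}" and s: "0 < s" "s < R"
    and mom: "\<And>k. contour_integral (circlepath a s) (\<lambda>w. f w * (w - a) ^ k) = 0"
  shows "\<exists>F. F holomorphic_on ball a s \<and> (\<forall>z\<in>ball a s - {a}. F z = f z)"
proof -
  define F where "F z = contour_integral (circlepath a s) (\<lambda>w. f w / (w - z)) / (2 * pi * \<i>)" for z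
  have cf: "continuous_on (sphere a r) f" if "0 < r" "r < R" for r
    using that by (intro continuous_on_subset[OF holomorphic_on_imp_continuous_on[OF hol]]) auto
  have ci: "(\<lambda>w. f w / (w - z)) contour_integrable_on circlepath a r"
    if "0 < r" "r < R" "norm (z - a) \<noteq> r" for r z
  proof (rule contour_integrable_continuous_circlepath)
    have "continuous_on (sphere a r) (\<lambda>w. f w / (w - z))"
      by (intro continuous_on_divide cf that continuous_intros)
        (use that in \<open>auto simp: dist_norm norm_minus_commute\<close>)
    then show "continuous_on (path_image (circlepath a r)) (\<lambda>w. f w / (w - z))" using that by simp
  qed
  have "F holomorphic_on ball a s"
  proof (rule holomorphic_onI)
    fix z assume z: "z \<in> ball a s"
    have "((\<lambda>z. contour_integral (circlepath a s) (\<lambda>w. f w / (w - z))) has_field_derivative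
        (of_nat 1 * contour_integral (circlepath a s) (\<lambda>u. f u / (u - z) ^ Suc 1))) (at z)"
    proof (rule Cauchy_next_derivative_circlepath(2)[OF _ _ _ z])
      show "continuous_on (path_image (circlepath a s)) f" using cf[OF s] s by simp
      show "((\<lambda>u. f u / (u - w) ^ 1) has_contour_integral contour_integral (circlepath a s) (\<lambda>w'. f w' / (w' - w))) (circlepath a s)"
        if "w \<in> ball a s" for w
        using has_contour_integral_integral[OF ci[OF s, of w]] that by (simp add: dist_norm norm_minus_commute)
    qed auto
    then have "(F has_field_derivative
        (of_nat 1 * contour_integral (circlepath a s) (\<lambda>u. f u / (u - z) ^ Suc 1)) / (2 * pi * \<i>)) (at z)"
      unfolding F_def by (rule DERIV_cdivide)
    then show "F field_differentiable at z within ball a s"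
      unfolding field_differentiable_def using has_field_derivative_at_within by blast
  qed
  moreover have "F z = f z" if z: "z \<in> ball a s - {a}" for z
  proof -
    have zR: "z \<in> ball a R - {a}" using z s by auto
    \<comment> \<open>The difference quotient is holomorphic also at \<open>z\<close>, so its
      integrals over both circles agree.\<close>
    define q where "q w = (if w = z then deriv f z else (f w - f z) / (w - z))" for w
    have q: "q holomorphic_on ball a R - {a}" unfolding q_def using pole_lemma_open[OF hol, of z] by auto
    define r where "r = norm (z - a) / 2"
    have r: "0 < r" "r < norm (z - a)" "r < R" using z s by (auto simp: r_def dist_norm norm_minus_commute)
    have split: "contour_integral (circlepath a t) q
       = contour_integral (circlepath a t) (\<lambda>w. f w / (w - z)) - f z * contour_integral (circlepath a t) (\<lambda>w. 1 / (w - z))"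
      if t: "0 < t" "t < R" "norm (z - a) \<noteq> t" for t
    proof -
      have "contour_integral (circlepath a t) q = contour_integral (circlepath a t) (\<lambda>w. f w / (w - z) - f z * (1 / (w - z)))"
      proof (rule contour_integral_eq)
        fix w assume "w \<in> path_image (circlepath a t)"
        then have "w \<noteq> z" using t by (auto simp: dist_norm norm_minus_commute)
        then show "q w = f w / (w - z) - f z * (1 / (w - z))" by (simp add: q_def diff_divide_distrib)
      qed
      moreover have "(\<lambda>w. 1 / (w - z)) contour_integrable_on circlepath a t"
        using t by (intro contour_integrable_continuous_circlepath continuous_on_divide continuous_intros)
          (auto simp: dist_norm norm_minus_commute)
      ultimately show ?thesis
        by (simp only: contour_integral_diff[OF ci[OF t] contour_integrable_lmul] contour_integral_lmul)
    qed
    have nz: "norm (z - a) \<noteq> s" "norm (z - a) \<noteq> r" using z r by (auto simp: dist_norm norm_minus_commute)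
    have "((\<lambda>w. 1 / (w - z)) has_contour_integral 2 * pi * \<i> * 1) (circlepath a s)"
      using Cauchy_integral_circlepath_simple[of "\<lambda>_. 1" a s z] z by (simp add: dist_norm norm_minus_commute)
    then have big: "contour_integral (circlepath a s) (\<lambda>w. 1 / (w - z)) = 2 * pi * \<i>"
      by (simp add: contour_integral_unique)
    have "((\<lambda>w. 1 / (w - z)) has_contour_integral 0) (circlepath a r)"
      by (rule Cauchy_theorem_convex_simple[of _ "cball a r"])
         (use r in \<open>auto intro!: holomorphic_on_divide holomorphic_on_diff simp: dist_norm norm_minus_commute\<close>)
    then have small: "contour_integral (circlepath a r) (\<lambda>w. 1 / (w - z)) = 0"
      by (rule contour_integral_unique)
    \<comment> \<open>Vanishing moments give \<open>I (k + 1) = (z - a) I k\<close>, so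
      \<open>I k\<close> has size \<open>|z - a| ^ k |I 0|\<close>, while directly it is
      \<open>O(r ^ k)\<close> with \<open>r = |z - a| / 2\<close>. Hence
      \<open>I 0 = 0\<close>.\<close>
    have small_f: "contour_integral (circlepath a r) (\<lambda>w. f w / (w - z)) = 0"
    proof -
      define I where "I k = contour_integral (circlepath a r) (\<lambda>w. f w * (w - a) ^ k / (w - z))" for k
      have ne: "w \<noteq> z" if "w \<in> sphere a r" for w using that r(2) by (auto simp: dist_norm norm_minus_commute)
      have cz: "continuous_on (sphere a r) (\<lambda>w. f w * (w - a) ^ k / (w - z))" for k
        by (intro continuous_on_divide continuous_on_mult cf r continuous_intros) (use ne in auto)
      have I: "((\<lambda>w. f w * (w - a) ^ k / (w - z)) has_contour_integral I k) (circlepath a r)" for k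
        unfolding I_def using cz[of k] r(1) by (intro has_contour_integral_integral contour_integrable_continuous_circlepath) simp
      have mom0: "((\<lambda>w. f w * (w - a) ^ k) has_contour_integral 0) (circlepath a r)" for k
      proof -
        have h: "(\<lambda>w. f w * (w - a) ^ k) holomorphic_on ball a R - {a}"
          by (intro holomorphic_on_mult hol holomorphic_intros)
        have "continuous_on (sphere a r) (\<lambda>w. f w * (w - a) ^ k)" by (intro continuous_on_mult cf r continuous_intros)
        then have "(\<lambda>w. f w * (w - a) ^ k) contour_integrable_on circlepath a r"
          using r(1) by (intro contour_integrable_continuous_circlepath) simp
        from has_contour_integral_integral[OF this] show ?thesis
          using contour_integral_circlepath_indep[OF h, of r s] mom[of k] r s by simp
      qed
      have step: "I (Suc k) = (z - a) * I k" for k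
      proof -
        have "((\<lambda>w. f w * (w - a) ^ Suc k / (w - z) - f w * (w - a) ^ k) has_contour_integral I (Suc k) - 0) (circlepath a r)"
          by (rule has_contour_integral_diff[OF I mom0])
        then have "((\<lambda>w. (z - a) * (f w * (w - a) ^ k / (w - z))) has_contour_integral I (Suc k) - 0) (circlepath a r)"
        proof (rule has_contour_integral_eq)
          fix w assume "w \<in> path_image (circlepath a r)"
          then have "w \<noteq> z" using ne r(1) by simp
          then have "x * (w - a) / (w - z) - x = (z - a) * (x / (w - z))" for x by (simp add: field_simps)
          from this[of "f w * (w - a) ^ k"]
          show "f w * (w - a) ^ Suc k / (w - z) - f w * (w - a) ^ k = (z - a) * (f w * (w - a) ^ k / (w - z))"
            by (simp only: power_Suc mult_ac)
        qed
        from contour_integral_unique[OF this] contour_integral_unique[OF has_contour_integral_lmul[OF I[of k], of "z - a"]]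
        show ?thesis by simp
      qed
      have Ik: "I k = (z - a) ^ k * I 0" for k by (induction k) (simp_all add: step)
      have "bounded ((\<lambda>w. f w * (w - a) ^ 0 / (w - z)) ` sphere a r)"
        by (intro compact_imp_bounded compact_continuous_image cz compact_sphere)
      then obtain b where b: "\<forall>x\<in>(\<lambda>w. f w * (w - a) ^ 0 / (w - z)) ` sphere a r. norm x \<le> b"
        unfolding bounded_iff ..
      have le: "norm (I 0) \<le> \<bar>b\<bar> * (1 / 2) ^ k * (2 * pi * r)" for k
      proof -
        have "norm (I k) \<le> \<bar>b\<bar> * r ^ k * (2 * pi * r)"
        proof (rule has_contour_integral_bound_circlepath[OF I])
          fix w assume w: "norm (w - a) = r"
          then have "w \<in> sphere a r" by (simp add: dist_norm norm_minus_commute)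
          from b[rule_format, OF imageI[OF this]] have "norm (f w / (w - z)) \<le> \<bar>b\<bar>" by simp
          then have "norm (f w / (w - z)) * r ^ k \<le> \<bar>b\<bar> * r ^ k" using r(1) by (intro mult_right_mono) simp_all
          then show "norm (f w * (w - a) ^ k / (w - z)) \<le> \<bar>b\<bar> * r ^ k"
            by (simp add: norm_mult norm_divide norm_power w)
        qed (use r(1) in simp_all)
        moreover have "norm (I k) = 2 ^ k * r ^ k * norm (I 0)"
          unfolding Ik[of k] by (simp add: norm_mult norm_power r_def power_mult_distrib[symmetric])
        ultimately show ?thesis using r(1) by (simp add: field_simps power_divide)
      qed
      have "(\<lambda>k. \<bar>b\<bar> * (1 / 2) ^ k * (2 * pi * r)) \<longlonglongrightarrow> \<bar>b\<bar> * 0 * (2 * pi * r)"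
        by (intro tendsto_intros LIMSEQ_realpow_zero) auto
      then have "(\<lambda>k. \<bar>b\<bar> * (1 / 2) ^ k * (2 * pi * r)) \<longlonglongrightarrow> 0" by simp
      then have "norm (I 0) \<le> 0" by (rule LIMSEQ_le_const) (intro exI[of _ 0] allI impI le)
      then show ?thesis by (simp add: I_def)
    qed
    have "contour_integral (circlepath a s) q = contour_integral (circlepath a r) q"
      using contour_integral_circlepath_indep[OF q] r s by blast
    then show ?thesis using split[OF s nz(1)] split[of r] r nz small_f small big by (simp add: F_def)
  qed
  ultimately show ?thesis by blast
qed

section \<open>The polynomials of a hyperexponential function\<close>

lemma poly_eq_off_finite:
  fixes p q :: "complex poly"
  assumes "finite S" "\<And>z. z \<notin> S \<Longrightarrow> poly p z = poly q z"
  shows "p = q"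
proof (rule ccontr)
  assume "p \<noteq> q"
  then have "finite {z. poly (p - q) z = 0}" by (intro poly_roots_finite) simp
  moreover have "- S \<subseteq> {z. poly (p - q) z = 0}" using assms(2) by auto
  ultimately have "finite (- S)" by (rule rev_finite_subset)
  then have "finite (UNIV :: complex set)" using assms(1) by (metis Compl_partition finite_UnI)
  then show False using infinite_UNIV_char_0 by blast
qed

lemma linear_mult_pderiv_power_mult:
  fixes q :: "complex poly"
  shows "[:-c, 1:] * pderiv ([:-c, 1:] ^ m * q) = [:-c, 1:] ^ m * (smult (of_nat m) q + [:-c, 1:] * pderiv q)"
proof (induction m)
  case (Suc m)
  have "pderiv ([:-c, 1:] ^ Suc m * q) = [:-c, 1:] * pderiv ([:-c, 1:] ^ m * q) + [:-c, 1:] ^ m * q"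
    by (simp only: power_Suc mult.assoc pderiv_mult) (simp add: pderiv_pCons)
  then have "[:-c, 1:] * pderiv ([:-c, 1:] ^ Suc m * q)
      = [:-c, 1:] * ([:-c, 1:] ^ m * (smult (of_nat m) q + [:-c, 1:] * pderiv q) + [:-c, 1:] ^ m * q)"
    by (simp only: Suc.IH)
  also have "\<dots> = [:-c, 1:] ^ Suc m * (smult (of_nat m) q + q + [:-c, 1:] * pderiv q)"
    by (simp only: power_Suc ring_distribs mult_ac add_ac)
  also have "smult (of_nat m) q + q = smult (of_nat (Suc m)) q" by (simp add: smult_add_left)
  finally show ?case .
qed simp

text \<open>The identity for \<open>U\<close> has all denominators cleared, so at a singular point
  both sides vanish and say nothing about the value of \<open>U\<close>. Here \<open>x\<close>
  stands for the linear factor at that point and \<open>X\<close>, \<open>Y\<close>,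
  \<open>Z\<close> for its powers in \<open>T\<close>, \<open>R\<close> and \<open>Q\<close>; one
  extra multiplication by \<open>x\<close> makes each derivative divisible by the same power as the
  function, and the powers cancel.\<close>

lemma log_derivative_cancel:
  fixes x X Y Z T U :: "'a :: idom"
  assumes key: "T * T * R * Q * U = W * ((S' * T - S * T') * R * Q + T * T * (R' * Q - R * Q'))"
    and T: "T = X * T1" "x * T' = X * \<tau>" and R: "R = Y * R1" "x * R' = Y * \<rho>"
    and Q: "Q = Z * Q1" "x * Q' = Z * \<omega>" and W: "W = x * X * W1" and nz: "x * X * X * Y * Z \<noteq> 0"
  shows "T1 * T1 * R1 * Q1 * U = W1 * ((x * S' * T1 - S * \<tau>) * R1 * Q1 + X * T1 * T1 * (\<rho> * Q1 - R1 * \<omega>))"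
proof -
  have "x * (T * T * R * Q * U) = W * ((x * S' * T - S * (x * T')) * R * Q + T * T * ((x * R') * Q - R * (x * Q')))"
    unfolding key by (simp add: algebra_simps)
  then have "(x * X * X * Y * Z) * (T1 * T1 * R1 * Q1 * U)
      = (x * X * X * Y * Z) * (W1 * ((x * S' * T1 - S * \<tau>) * R1 * Q1 + X * T1 * T1 * (\<rho> * Q1 - R1 * \<omega>)))"
    unfolding T(2) R(2) Q(2) unfolding T(1) R(1) Q(1) W by (simp add: algebra_simps)
  then show ?thesis by (rule mult_left_cancel[OF nz, THEN iffD1])
qed

lemma coeff_pderiv_mult_eq_0:
  fixes p q :: "complex poly"
  assumes "degree p + degree q \<le> i"
  shows "coeff (pderiv p * q) i = 0"
proof (cases "pderiv p = 0")
  case False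
  then have "degree p > 0" by (simp add: pderiv_eq_0_iff)
  then have "degree (pderiv p * q) < i"
    using degree_mult_le[of "pderiv p" q] assms by (simp add: degree_pderiv)
  then show ?thesis by (rule coeff_eq_0)
qed simp

lemma coeff_mult_bounds:
  fixes p q :: "complex poly"
  assumes "degree p \<le> i" "degree q \<le> j"
  shows "coeff (p * q) (i + j) = coeff p i * coeff q j"
proof -
  have "coeff (p * q) (i + j) = (\<Sum>k\<le>i + j. coeff p k * coeff q (i + j - k))" by (rule coeff_mult)
  also have "\<dots> = (\<Sum>k\<in>{i}. coeff p k * coeff q (i + j - k))"
  proof (rule sum.mono_neutral_right)
    show "\<forall>k\<in>{..i + j} - {i}. coeff p k * coeff q (i + j - k) = 0"
    proof
      fix k assume k: "k \<in> {..i + j} - {i}"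
      show "coeff p k * coeff q (i + j - k) = 0"
      proof (cases "k > i")
        case True
        then have "coeff p k = 0" using assms by (intro coeff_eq_0) simp
        then show ?thesis by simp
      next
        case False
        then have "j < i + j - k" using k by auto
        then have "coeff q (i + j - k) = 0" using assms by (intro coeff_eq_0) simp
        then show ?thesis by simp
      qed
    qed
  qed auto
  finally show ?thesis by simp
qed

section \<open>Values of the recursion at the singularities and the higher derivatives\<close>

context hyperexponential
begin

abbreviation "W \<equiv> W_poly Q T"
abbreviation "U \<equiv> U_poly P Q S T"
abbreviation "B \<equiv> B_poly P Q S T"
abbreviation "PT \<equiv> P_T P T"
abbreviation "Psh \<equiv> P_sharp P T"

lemma T_nz: "T \<noteq> 0" using T_nonconst by auto

lemma finite_sing: "finite (sing Q T)"
  using finite_zeros[OF T_nz] finite_zeros[OF Q_nz] by (simp add: sing_def)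

lemma zeros_T_nonempty: "zeros T \<noteq> {}"
  using fundamental_theorem_of_algebra[of T] T_nonconst by (auto simp: zeros_def constant_degree)

lemma W_nz: "W \<noteq> 0"
  unfolding W_poly_def using finite_zeros[OF T_nz] finite_zeros[OF Q_nz] by (simp del: power_Suc)

lemma poly_W_eq_0_iff: "poly W z = 0 \<longleftrightarrow> z \<in> sing Q T"
  unfolding W_poly_def sing_def using finite_zeros[OF T_nz] finite_zeros[OF Q_nz] by (auto simp: poly_prod)

lemma lead_coeff_W: "lead_coeff W = 1"
  unfolding W_poly_def by (simp add: lead_coeff_mult lead_coeff_prod lead_coeff_power del: power_Suc)

lemma degree_W: "degree W = degree T + card (sing Q T)"
proof -
  note fin = finite_zeros[OF T_nz] finite_zeros[OF Q_nz]
  have "(\<Sum>c\<in>zeros T. order c T) = degree T"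
  proof -
    have "degree T = degree (smult (lead_coeff T) (\<Prod>c\<in>zeros T. [:-c, 1:] ^ order c T))"
      using complex_poly_decompose[of T] by (simp add: zeros_def)
    also have "\<dots> = (\<Sum>c\<in>zeros T. degree ([:-c, 1:] ^ order c T))"
      using T_nz by (simp add: degree_prod_eq_sum_degree)
    finally show ?thesis by (simp add: degree_linear_power)
  qed
  then have "degree (\<Prod>c\<in>zeros T. [:-c, 1:] ^ (order c T + 1)) = degree T + card (zeros T)"
    by (subst degree_prod_eq_sum_degree) (auto simp: degree_linear_power sum_Suc simp del: power_Suc)
  moreover have "degree (\<Prod>b\<in>zeros Q - zeros T. [:-b, 1:]) = card (zeros Q - zeros T)"
    by (subst degree_prod_eq_sum_degree) auto
  moreover have "card (sing Q T) = card (zeros T) + card (zeros Q - zeros T)"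
    unfolding sing_def using fin by (metis Un_Diff_cancel card_Un_disjoint Diff_disjoint finite_Diff)
  moreover have "degree W = degree (\<Prod>c\<in>zeros T. [:-c, 1:] ^ (order c T + 1)) + degree (\<Prod>b\<in>zeros Q - zeros T. [:-b, 1:])"
    unfolding W_poly_def using fin by (intro degree_mult_eq) (auto simp del: power_Suc)
  ultimately show ?thesis by simp
qed

lemma PT_nz: "PT \<noteq> 0" unfolding P_T_def using finite_zeros[OF T_nz] by simp

lemma poly_PT_nz: "z \<notin> zeros T \<Longrightarrow> poly PT z \<noteq> 0"
  unfolding P_T_def using finite_zeros[OF T_nz] by (auto simp: poly_prod)

lemma PT_mult_Psh: "PT * Psh = P"
proof -
  have "PT = (\<Prod>c\<in>zeros T \<inter> zeros P. [:-c, 1:] ^ order c P)" unfolding P_T_def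
  proof (rule prod.mono_neutral_right)
    show "\<forall>c\<in>zeros T - zeros T \<inter> zeros P. [:-c, 1:] ^ order c P = 1" by (auto simp: zeros_def order_0I)
  qed (use finite_zeros[OF T_nz] in auto)
  also have "\<dots> dvd (\<Prod>c\<in>zeros P. [:-c, 1:] ^ order c P)"
    by (rule prod_dvd_prod_subset) (use finite_zeros[OF P_nz] in auto)
  also have "\<dots> dvd P"
    using complex_poly_decompose[of P] P_nz by (metis dvd_refl leading_coeff_0_iff smult_dvd_iff zeros_def)
  finally show ?thesis unfolding P_sharp_def by simp
qed

lemma Psh_nz: "Psh \<noteq> 0" using PT_mult_Psh P_nz by auto

lemma poly_Psh_sing: assumes "c \<in> sing Q T" shows "poly Psh c \<noteq> 0"
proof (cases "c \<in> zeros T")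
  case True
  have "[:-c, 1:] ^ order c P dvd PT"
    unfolding P_T_def using finite_zeros[OF T_nz] True by (intro dvd_prodI) auto
  then have "order c P \<le> order c PT" using PT_nz by (simp add: order_divides)
  moreover have "order c P = order c PT + order c Psh" using PT_mult_Psh P_nz by (metis order_mult)
  ultimately have "order c Psh = 0" by simp
  then show ?thesis using Psh_nz by (simp add: order_root)
next
  case False
  then have "poly Q c = 0" using assms by (auto simp: sing_def zeros_def)
  then have "poly P c \<noteq> 0" using coprime_PQ by (metis coprime_poly_0)
  then show ?thesis using PT_mult_Psh by (metis poly_mult mult_zero_right)
qed

lemma poly_U: "z \<notin> sing Q T \<Longrightarrow> poly U z = poly W z * Lam P Q S T z"
  using theI'[OF U_poly_ex1[OF hyperexponential_axioms]] unfolding U_poly_def by blast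

lemma DERIV_E:
  assumes "z \<notin> sing Q T"
  shows "((\<lambda>w. poly S w / poly T w) has_field_derivative
     (poly (pderiv S) z * poly T z - poly S z * poly (pderiv T) z) / (poly T z * poly T z)) (at z)"
  using assms by (intro DERIV_divide poly_DERIV) (auto simp: sing_def zeros_def)

text \<open>\<open>U\<close> is described only off the singular set; this polynomial identity is the
  handle on its values at singular points and on its degree. It holds off a finite set, hence
  identically.\<close>

lemma U_key:
  "T * T * PT * Q * U = W * ((pderiv S * T - S * pderiv T) * PT * Q + T * T * (pderiv PT * Q - PT * pderiv Q))"
proof (rule poly_eq_off_finite[OF finite_sing])
  fix z assume z: "z \<notin> sing Q T"
  have nz: "poly T z \<noteq> 0" "poly Q z \<noteq> 0" "poly PT z \<noteq> 0"
    using z poly_PT_nz[of z] by (auto simp: sing_def zeros_def)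
  have gen: "t * t * r * q * (w * (A / (t * t) + r' / r - q' / q)) = w * (A * r * q + t * t * (r' * q - r * q'))"
    if "t \<noteq> 0" "q \<noteq> 0" "r \<noteq> 0" for t r q w A r' q' :: complex using that by (simp add: field_simps)
  show "poly (T * T * PT * Q * U) z = poly (W * ((pderiv S * T - S * pderiv T) * PT * Q + T * T * (pderiv PT * Q - PT * pderiv Q))) z"
    using gen[OF nz, of "poly W z"] unfolding poly_mult poly_add poly_diff poly_U[OF z] Lam_def DERIV_imp_deriv[OF DERIV_E[OF z]]
    by simp
qed

text \<open>At a zero of \<open>T\<close> of multiplicity \<open>m\<close> the derivative of
  \<open>S / T\<close> has a pole of order exactly \<open>m + 1\<close>, the order of vanishing of
  \<open>W\<close>, while the other terms of \<open>\<Lambda>\<close> have at most simple poles and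
  are killed by \<open>W\<close>. The zero of \<open>W\<close> is multiple, hence
  \<open>W' = 0\<close> there.\<close>

lemma poly_U_at_zero_T:
  assumes c: "c \<in> zeros T"
  shows "poly U c \<noteq> 0" "poly (pderiv W) c = 0"
proof -
  define x where "x = [:-c, 1:]"
  have xc: "poly x c = 0" and x0: "x \<noteq> 0" by (simp_all add: x_def)
  obtain T1 where T1: "T = x ^ order c T * T1" "\<not> x dvd T1"
    unfolding x_def using order_decomp[OF T_nz] by blast
  obtain Q1 where Q1: "Q = x ^ order c Q * Q1" "\<not> x dvd Q1"
    unfolding x_def using order_decomp[OF Q_nz] by blast
  obtain R1 where R1: "PT = x ^ order c PT * R1" "\<not> x dvd R1"
    unfolding x_def using order_decomp[OF PT_nz] by blast
  have nz: "poly T1 c \<noteq> 0" "poly Q1 c \<noteq> 0" "poly R1 c \<noteq> 0"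
    using T1(2) Q1(2) R1(2) by (auto simp: x_def poly_eq_0_iff_dvd)
  define W1 where "W1 = (\<Prod>c'\<in>zeros T - {c}. [:-c', 1:] ^ (order c' T + 1)) * (\<Prod>b\<in>zeros Q - zeros T. [:-b, 1:])"
  have W1: "W = x * x ^ order c T * W1" unfolding W_poly_def W1_def x_def using finite_zeros[OF T_nz] c
    by (subst prod.remove[of _ c]) (simp_all add: mult_ac)
  have W1c: "poly W1 c \<noteq> 0"
    unfolding W1_def using finite_zeros[OF T_nz] finite_zeros[OF Q_nz] c by (auto simp: poly_prod)
  have m: "order c T > 0" using c T_nz by (simp add: zeros_def order_root)
  have S: "poly S c \<noteq> 0" using coprime_ST c by (metis coprime_poly_0 mem_Collect_eq zeros_def)
  have d: "x * pderiv (x ^ k * q) = x ^ k * (smult (of_nat k) q + x * pderiv q)" for k q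
    unfolding x_def by (rule linear_mult_pderiv_power_mult)
  have "T1 * T1 * R1 * Q1 * U = W1 * ((x * pderiv S * T1 - S * (smult (of_nat (order c T)) T1 + x * pderiv T1)) * R1 * Q1
      + x ^ order c T * T1 * T1 * ((smult (of_nat (order c PT)) R1 + x * pderiv R1) * Q1 - R1 * (smult (of_nat (order c Q)) Q1 + x * pderiv Q1)))"
  proof (rule log_derivative_cancel[OF U_key T1(1) _ R1(1) _ Q1(1) _ W1])
    show "x * pderiv T = x ^ order c T * (smult (of_nat (order c T)) T1 + x * pderiv T1)"
      using d[of "order c T" T1] T1(1) by simp
    show "x * pderiv PT = x ^ order c PT * (smult (of_nat (order c PT)) R1 + x * pderiv R1)"
      using d[of "order c PT" R1] R1(1) by simp
    show "x * pderiv Q = x ^ order c Q * (smult (of_nat (order c Q)) Q1 + x * pderiv Q1)"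
      using d[of "order c Q" Q1] Q1(1) by simp
    show "x * x ^ order c T * x ^ order c T * x ^ order c PT * x ^ order c Q \<noteq> 0" using x0 by simp
  qed
  from arg_cong[OF this, of "\<lambda>p. poly p c"]
  have "poly T1 c * poly T1 c * poly R1 c * poly Q1 c * poly U c
     = poly W1 c * (- (poly S c * (of_nat (order c T) * poly T1 c)) * poly R1 c * poly Q1 c)"
    using m by (simp add: xc zero_power)
  moreover have "poly W1 c * (- (poly S c * (of_nat (order c T) * poly T1 c)) * poly R1 c * poly Q1 c) \<noteq> 0"
    using W1c S nz m by simp
  ultimately show "poly U c \<noteq> 0" by auto
  obtain j where "order c T = Suc j" using m by (cases "order c T") auto
  then have "W = x * (x * (x ^ j * W1))" unfolding W1 by (simp add: mult_ac)
  then show "poly (pderiv W) c = 0" by (simp add: pderiv_mult xc)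
qed

text \<open>At \<open>b\<close> the zero of \<open>W\<close> is simple and \<open>\<Lambda>\<close>
  has a simple pole whose residue is minus the order of \<open>Q\<close>, so
  \<open>W \<Lambda>\<close> takes the value residue times \<open>W' b\<close>.\<close>

lemma poly_U_at_pole:
  assumes b: "b \<in> zeros Q - zeros T"
  shows "poly U b = - of_nat (order b Q) * poly (pderiv W) b" "poly (pderiv W) b \<noteq> 0"
proof -
  define x where "x = [:-b, 1:]"
  have xb: "poly x b = 0" and x0: "x \<noteq> 0" and dx: "pderiv x = 1" by (simp_all add: x_def pderiv_pCons)
  obtain Q1 where Q1: "Q = x ^ order b Q * Q1" "\<not> x dvd Q1"
    unfolding x_def using order_decomp[OF Q_nz] by blast
  have nz: "poly Q1 b \<noteq> 0" "poly T b \<noteq> 0" "poly PT b \<noteq> 0"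
    using Q1(2) b poly_PT_nz[of b] by (auto simp: x_def poly_eq_0_iff_dvd zeros_def)
  define W1 where "W1 = (\<Prod>c'\<in>zeros T. [:-c', 1:] ^ (order c' T + 1)) * (\<Prod>b'\<in>zeros Q - zeros T - {b}. [:-b', 1:])"
  have W1: "W = x * 1 * W1"
  proof -
    have "(\<Prod>b'\<in>zeros Q - zeros T. [:-b', 1:]) = x * (\<Prod>b'\<in>zeros Q - zeros T - {b}. [:-b', 1:])"
      unfolding x_def by (rule prod.remove) (use finite_zeros[OF Q_nz] b in auto)
    then show ?thesis by (simp only: W_poly_def W1_def mult_ac mult_1_right mult_1_left)
  qed
  have W1b: "poly W1 b \<noteq> 0"
    unfolding W1_def using finite_zeros[OF T_nz] finite_zeros[OF Q_nz] b by (auto simp: poly_prod)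
  have "pderiv W = W1 + x * pderiv W1" unfolding W1 by (simp add: pderiv_mult dx)
  then have dW: "poly (pderiv W) b = poly W1 b" by (simp add: xb)
  then show "poly (pderiv W) b \<noteq> 0" using W1b by simp
  have "T * T * PT * Q1 * U = W1 * ((x * pderiv S * T - S * (x * pderiv T)) * PT * Q1
      + 1 * T * T * ((x * pderiv PT) * Q1 - PT * (smult (of_nat (order b Q)) Q1 + x * pderiv Q1)))"
  proof (rule log_derivative_cancel[OF U_key _ _ _ _ Q1(1) _ W1])
    show "x * pderiv Q = x ^ order b Q * (smult (of_nat (order b Q)) Q1 + x * pderiv Q1)"
      using linear_mult_pderiv_power_mult[of b "order b Q" Q1] Q1(1) unfolding x_def by simp
    show "x * 1 * 1 * 1 * x ^ order b Q \<noteq> 0" using x0 by simp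
  qed simp_all
  from arg_cong[OF this, of "\<lambda>p. poly p b"]
  have "poly T b * poly T b * poly PT b * poly Q1 b * poly U b
     = poly T b * poly T b * poly PT b * poly Q1 b * (- of_nat (order b Q) * poly W1 b)" by (simp add: xb)
  moreover have K: "poly T b * poly T b * poly PT b * poly Q1 b \<noteq> 0" using nz by simp
  ultimately have "poly U b = - of_nat (order b Q) * poly W1 b" using mult_left_cancel[OF K] by blast
  then show "poly U b = - of_nat (order b Q) * poly (pderiv W) b" by (simp only: dW)
qed

text \<open>As \<open>W\<close> vanishes at \<open>a\<close>, the recursion reduces there to
  multiplication by \<open>U - n W'\<close>. This factor is \<open>U a \<noteq> 0\<close> at zeros
  of \<open>T\<close> and \<open>- (order a Q + n) W' a \<noteq> 0\<close> at the other poles. Hence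
  all zeros of \<open>B n\<close> lie off the singular set, which makes the two zero measures
  equal.\<close>

lemma poly_B_sing: "a \<in> sing Q T \<Longrightarrow> poly (B n) a \<noteq> 0"
proof (induction n)
  case 0
  then show ?case by (simp add: poly_Psh_sing)
next
  case (Suc n)
  have W: "poly W a = 0" using Suc.prems by (simp add: poly_W_eq_0_iff)
  show ?case
  proof (cases "a \<in> zeros T")
    case True
    then show ?thesis using Suc poly_U_at_zero_T[OF True] W by simp
  next
    case False
    then have b: "a \<in> zeros Q - zeros T" using Suc.prems by (auto simp: sing_def)
    then have "order a Q > 0" using Q_nz by (simp add: zeros_def order_root)
    then have "of_nat (order a Q) + of_nat n \<noteq> (0 :: complex)"
      by (metis add_eq_0_iff_both_eq_0 not_gr_zero of_nat_add of_nat_eq_0_iff)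
    moreover have "poly (B (Suc n)) a = - ((of_nat (order a Q) + of_nat n) * poly (pderiv W) a * poly (B n) a)"
      using W poly_U_at_pole[OF b] by (simp add: algebra_simps)
    ultimately show ?thesis using Suc poly_U_at_pole[OF b] by simp
  qed
qed

lemma B_nz: "B n \<noteq> 0"
proof -
  obtain c where "c \<in> zeros T" using zeros_T_nonempty by blast
  then have "poly (B n) c \<noteq> 0" by (intro poly_B_sing) (simp add: sing_def)
  then show ?thesis by auto
qed

lemma higher_deriv_hyp_f:
  "z \<notin> sing Q T \<Longrightarrow> (deriv ^^ n) (hyp_f P Q S T) z
     = poly PT z * poly (B n) z / (poly Q z * poly W z ^ n) * exp (poly S z / poly T z)"
proof (induction n arbitrary: z)
  case 0
  show ?case using PT_mult_Psh by (simp add: hyp_f_def flip: poly_mult)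
next
  case (Suc n)
  note z = Suc.prems
  have op: "open (- sing Q T)" using finite_sing by (simp add: finite_imp_closed open_Compl)
  have nz: "poly T z \<noteq> 0" "poly Q z \<noteq> 0" "poly PT z \<noteq> 0" "poly W z \<noteq> 0"
    using z poly_PT_nz[of z] poly_W_eq_0_iff[of z] by (auto simp: sing_def zeros_def)
  define E' where "E' = (poly (pderiv S) z * poly T z - poly S z * poly (pderiv T) z) / (poly T z * poly T z)"
  have DE: "((\<lambda>w. poly S w / poly T w) has_field_derivative E') (at z)"
    unfolding E'_def by (rule DERIV_E[OF z])
  define e where "e = exp (poly S z / poly T z)"
  have "((\<lambda>w. exp (poly S w / poly T w)) has_field_derivative exp (poly S z / poly T z) * E') (at z)"
    by (rule DERIV_chain2[OF DERIV_exp DE])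
  then have D1: "((\<lambda>w. exp (poly S w / poly T w)) has_field_derivative e * E') (at z)" unfolding e_def .
  have D2: "((\<lambda>w. poly PT w * poly (B n) w) has_field_derivative
      poly (pderiv PT) z * poly (B n) z + poly PT z * poly (pderiv (B n)) z) (at z)"
    by (rule DERIV_cong[OF DERIV_mult[OF poly_DERIV poly_DERIV]]) (simp add: algebra_simps)
  have D3: "((\<lambda>w. poly Q w * poly W w ^ n) has_field_derivative
      poly (pderiv Q) z * poly W z ^ n + poly Q z * (of_nat n * (poly W z ^ n / poly W z) * poly (pderiv W) z)) (at z)"
  proof (rule DERIV_cong[OF DERIV_mult[OF poly_DERIV DERIV_power[OF poly_DERIV]]])
    show "poly (pderiv Q) z * poly W z ^ n + of_nat n * (poly (pderiv W) z * poly W z ^ (n - Suc 0)) * poly Q z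
      = poly (pderiv Q) z * poly W z ^ n + poly Q z * (of_nat n * (poly W z ^ n / poly W z) * poly (pderiv W) z)"
      using nz(4) by (cases n) simp_all
  qed
  define D where "D = ((poly (pderiv PT) z * poly (B n) z + poly PT z * poly (pderiv (B n)) z) * (poly Q z * poly W z ^ n)
      - (poly PT z * poly (B n) z) * (poly (pderiv Q) z * poly W z ^ n + poly Q z * (of_nat n * (poly W z ^ n / poly W z) * poly (pderiv W) z)))
      / ((poly Q z * poly W z ^ n) * (poly Q z * poly W z ^ n))"
  have "((\<lambda>w. poly PT w * poly (B n) w / (poly Q w * poly W w ^ n)) has_field_derivative D) (at z)"
    unfolding D_def by (rule DERIV_divide[OF D2 D3]) (use nz in simp)
  from DERIV_mult[OF this D1]
  have D4: "((\<lambda>w. poly PT w * poly (B n) w / (poly Q w * poly W w ^ n) * exp (poly S w / poly T w)) has_field_derivative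
      D * e + e * E' * (poly PT z * poly (B n) z / (poly Q z * poly W z ^ n))) (at z)" unfolding e_def .
  have U: "poly U z = poly W z * (E' + poly (pderiv PT) z / poly PT z - poly (pderiv Q) z / poly Q z)"
    unfolding poly_U[OF z] Lam_def DERIV_imp_deriv[OF DE] ..
  have "((deriv ^^ n) (hyp_f P Q S T) has_field_derivative
      D * e + e * E' * (poly PT z * poly (B n) z / (poly Q z * poly W z ^ n))) (at z)"
    by (rule has_field_derivative_transform_within_open[OF D4 op]) (use z Suc.IH in auto)
  then have "(deriv ^^ Suc n) (hyp_f P Q S T) z
      = D * e + e * E' * (poly PT z * poly (B n) z / (poly Q z * poly W z ^ n))"
    by (simp add: DERIV_imp_deriv)
  also have "\<dots> = poly PT z * poly (B (Suc n)) z / (poly Q z * poly W z ^ Suc n) * e"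
  proof -
    have gen: "((r' * b + r * b') * (q * v) - (r * b) * (q' * v + q * (k * (v / w) * w'))) / ((q * v) * (q * v)) * e
        + e * E' * (r * b / (q * v)) = r * (w * b' + (w * (E' + r' / r - q' / q) - k * w') * b) / (q * (w * v)) * e"
      if "q \<noteq> 0" "r \<noteq> 0" "w \<noteq> 0" "v \<noteq> 0" for r r' b b' q q' v k w w' :: complex
      using that by (simp add: divide_simps) (simp add: algebra_simps)
    show ?thesis unfolding D_def using gen[OF nz(2) nz(3) nz(4), of "poly W z ^ n"] nz(4) U by simp
  qed
  finally show ?case unfolding e_def .
qed

lemma hyp_f_holomorphic: "hyp_f P Q S T holomorphic_on - sing Q T" unfolding hyp_f_def
  by (intro holomorphic_intros) (auto simp: sing_def zeros_def)

lemma zorder_higher_deriv_hyp_f: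
  assumes z: "z \<notin> sing Q T"
  shows "zorder ((deriv ^^ n) (hyp_f P Q S T)) z = int (order z (B n))"
proof -
  obtain q where q: "B n = [:-z, 1:] ^ order z (B n) * q" "\<not> [:-z, 1:] dvd q"
    using order_decomp[OF B_nz] by blast
  have qz: "poly q z \<noteq> 0" using q(2) by (simp add: poly_eq_0_iff_dvd)
  define g where "g w = poly PT w * poly q w / (poly Q w * poly W w ^ n) * exp (poly S w / poly T w)" for w
  show ?thesis
  proof (rule zorder_eqI)
    show "open (- sing Q T)" using finite_sing by (simp add: finite_imp_closed open_Compl)
    show "z \<in> - sing Q T" using z by simp
    show "g holomorphic_on - sing Q T"
      unfolding g_def by (intro holomorphic_intros) (auto simp: poly_W_eq_0_iff, auto simp: sing_def zeros_def)
    show "g z \<noteq> 0" unfolding g_def using z qz poly_PT_nz[of z] poly_W_eq_0_iff[of z] by (auto simp: sing_def zeros_def)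
    show "(deriv ^^ n) (hyp_f P Q S T) w = g w * (w - z) powi int (order z (B n))"
      if w: "w \<in> - sing Q T" "w \<noteq> z" for w
    proof -
      have "poly (B n) w = (w - z) ^ order z (B n) * poly q w" by (subst q(1)) (simp add: poly_power)
      then show ?thesis using higher_deriv_hyp_f[of w n] w by (simp add: g_def)
    qed
  qed
qed

lemma zeros_higher_deriv: "{z. z \<notin> sing Q T \<and> (deriv ^^ n) (hyp_f P Q S T) z = 0} = zeros (B n)"
proof -
  have "(deriv ^^ n) (hyp_f P Q S T) z = 0 \<longleftrightarrow> poly (B n) z = 0" if "z \<notin> sing Q T" for z
    using higher_deriv_hyp_f[OF that, of n] that poly_PT_nz[of z] poly_W_eq_0_iff[of z]
    by (auto simp: sing_def zeros_def)
  then show ?thesis using poly_B_sing by (auto simp: zeros_def)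
qed

text \<open>Poles and essential singularities are treated alike. Off \<open>a\<close> the
  derivatives satisfy \<open>W B n f^(n+1) = B (n+1) f^(n)\<close>; for an extension this persists
  at \<open>a\<close>, where \<open>W = 0\<close> and \<open>B (n+1) \<noteq> 0\<close>, so all
  derivatives vanish at \<open>a\<close> and the extension is 0. But \<open>f\<close> has only
  finitely many zeros.\<close>

lemma hyp_f_not_extendable:
  assumes a: "a \<in> sing Q T" and r: "r > 0" "ball a r \<inter> sing Q T = {a}"
  shows "\<not> (\<exists>F. F holomorphic_on ball a r \<and> (\<forall>z\<in>ball a r - {a}. F z = hyp_f P Q S T z))"
proof
  assume "\<exists>F. F holomorphic_on ball a r \<and> (\<forall>z\<in>ball a r - {a}. F z = hyp_f P Q S T z)"
  then obtain F where F: "F holomorphic_on ball a r" "\<And>z. z \<in> ball a r - {a} \<Longrightarrow> F z = hyp_f P Q S T z" by blast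
  have ns: "z \<notin> sing Q T" if "z \<in> ball a r - {a}" for z using that r by blast
  have FD: "(deriv ^^ n) F z = (deriv ^^ n) (hyp_f P Q S T) z" if z: "z \<in> ball a r - {a}" for n z
  proof (rule higher_deriv_transform_within_open[OF _ _ _ z])
    show "F holomorphic_on ball a r - {a}" using F(1) by (rule holomorphic_on_subset) auto
    show "hyp_f P Q S T holomorphic_on ball a r - {a}"
      by (rule holomorphic_on_subset[OF hyp_f_holomorphic]) (use ns in auto)
  qed (use F in auto)
  have "(deriv ^^ n) F a = 0" for n
  proof -
    define G where "G z = poly W z * poly (B n) z * (deriv ^^ Suc n) F z - poly (B (Suc n)) z * (deriv ^^ n) F z" for z
    have "(deriv ^^ m) F holomorphic_on ball a r" for m by (rule holomorphic_higher_deriv[OF F(1) open_ball])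
    then have "G holomorphic_on ball a r" unfolding G_def by (intro holomorphic_intros F(1) open_ball)
    then have "isCont G a"
      using r(1) holomorphic_on_imp_continuous_on continuous_on_eq_continuous_at[OF open_ball]
      by (metis centre_in_ball)
    then have lim: "(G \<longlongrightarrow> G a) (at a)" by (simp add: isCont_def)
    have G0: "G z = 0" if z: "z \<in> ball a r - {a}" for z
    proof -
      note nz = ns[OF z]
      have "poly W z \<noteq> 0" using nz by (simp add: poly_W_eq_0_iff)
      moreover have gen: "w * b * (p * b' / (q * (w * v)) * e) - b' * (p * b / (q * v) * e) = 0" if "w \<noteq> 0" for w b p b' q v e :: complex
        using that by (simp add: divide_simps)
      ultimately show ?thesis unfolding G_def FD[OF z] higher_deriv_hyp_f[OF nz] power_Suc by (intro gen)
    qed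
    have "\<forall>\<^sub>F z in at a. G z = 0"
      unfolding eventually_at using r(1) G0 by (intro exI[of _ r]) (auto simp: dist_commute)
    then have "(G \<longlongrightarrow> 0) (at a)" by (rule tendsto_eventually)
    then have "G a = 0" using lim by (intro tendsto_unique[OF at_neq_bot])
    moreover have "poly W a = 0" using a by (simp add: poly_W_eq_0_iff)
    ultimately show ?thesis unfolding G_def using poly_B_sing[OF a, of "Suc n"] by (simp del: B_poly.simps funpow.simps)
  qed
  then have F0: "F z = 0" if "z \<in> ball a r" for z using holomorphic_fun_eq_0_on_ball[OF F(1) that] by blast
  have "ball a r - {a} \<subseteq> zeros P"
  proof
    fix z assume z: "z \<in> ball a r - {a}"
    then have "hyp_f P Q S T z = 0" using F(2)[OF z] F0[of z] by simp
    then show "z \<in> zeros P" using ns[OF z] by (auto simp: hyp_f_def zeros_def sing_def)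
  qed
  then have "finite (ball a r - {a})" using finite_zeros[OF P_nz] by (rule finite_subset)
  then have "finite (ball a r)" by simp
  then show False using uncountable_ball[OF r(1), of a] countable_finite by blast
qed

section \<open>Degrees of the polynomials \<open>B n\<close>\<close>

abbreviation "\<kappa> \<equiv> kappa Q S T"
abbreviation "h \<equiv> h_deg S T"

lemma card_sing_pos: "card (sing Q T) > 0"
  using zeros_T_nonempty finite_sing by (auto simp: card_gt_0_iff sing_def)

lemma kappa_eq: "\<kappa> + 1 = degree W + h" using degree_W card_sing_pos unfolding kappa_def by simp

lemma kappa_pos: "\<kappa> > 0" using kappa_eq degree_W card_sing_pos T_nonconst by simp

text \<open>Near infinity \<open>\<Lambda>\<close> is \<open>H'\<close> plus terms of order
  \<open>1 / z\<close>, where \<open>H = S div T\<close>. So \<open>W \<Lambda>\<close> has degree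
  \<open>degree W + h - 1\<close> for \<open>h > 0\<close> and at most \<open>degree W - 1\<close>
  otherwise; both numbers are \<open>\<kappa>\<close>.\<close>

lemma degree_U:
  shows "degree U \<le> \<kappa>" and "h > 0 \<Longrightarrow> degree U = \<kappa>"
proof -
  define H M where "H = S div T" and "M = S mod T"
  have S: "S = H * T + M" by (simp add: H_def M_def)
  have dM: "degree M < degree T" unfolding M_def using T_nonconst T_nz degree_mod_less by (metis degree_0)
  have hH: "h = degree H" by (simp add: h_deg_def H_def)
  \<comment> \<open>The degree of the cleared denominator \<open>T T PT Q\<close>. Each term of
    \<open>V\<close> contains a derivative, and \<open>degree M < degree T\<close>, so all of them
    stay below \<open>N\<close>.\<close>
  define N where "N = 2 * degree T + degree PT + degree Q"
  define V where "V = (pderiv M * T - M * pderiv T) * PT * Q + T * T * (pderiv PT * Q - PT * pderiv Q)"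
  have inner: "(pderiv S * T - S * pderiv T) * PT * Q + T * T * (pderiv PT * Q - PT * pderiv Q)
      = pderiv H * T * T * PT * Q + V" unfolding V_def S pderiv_add pderiv_mult by (simp add: algebra_simps)
  have V0: "coeff V i = 0" if i: "N \<le> i" for i
  proof -
    have 1: "coeff (pderiv M * (T * PT * Q)) i = 0" "coeff (pderiv T * (M * PT * Q)) i = 0"
      "coeff (pderiv PT * (T * T * Q)) i = 0" "coeff (pderiv Q * (T * T * PT)) i = 0"
    proof -
      have deg: "degree (x * y * z) \<le> degree x + degree y + degree z" for x y z :: "complex poly"
        using degree_mult_le[of "x * y" z] degree_mult_le[of x y] by simp
      show "coeff (pderiv M * (T * PT * Q)) i = 0" "coeff (pderiv T * (M * PT * Q)) i = 0"
        "coeff (pderiv PT * (T * T * Q)) i = 0" "coeff (pderiv Q * (T * T * PT)) i = 0"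
        using i dM deg[of T PT Q] deg[of M PT Q] deg[of T T Q] deg[of T T PT]
        by (intro coeff_pderiv_mult_eq_0; simp add: N_def)+
    qed
    have "V = pderiv M * (T * PT * Q) - pderiv T * (M * PT * Q) + pderiv PT * (T * T * Q) - pderiv Q * (T * T * PT)"
      unfolding V_def by (simp add: algebra_simps)
    then show ?thesis using 1 by simp
  qed
  have dL: "degree (T * T * PT * Q * U) = N + degree U" if "U \<noteq> 0"
    using that T_nz PT_nz Q_nz by (simp add: degree_mult_eq N_def)
  have dd: "degree W \<ge> 1" using degree_W T_nonconst by simp
  have pos: "degree U = \<kappa>" if h: "h > 0"
  proof -
    have H': "pderiv H \<noteq> 0" "degree (pderiv H) = h - 1"
      using h hH by (auto simp: pderiv_eq_0_iff degree_pderiv)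
    have d1: "degree (pderiv H * T * T * PT * Q) = h - 1 + N"
      using H' T_nz PT_nz Q_nz by (simp add: degree_mult_eq N_def)
    have "degree (pderiv H * T * T * PT * Q + V) = h - 1 + N" "pderiv H * T * T * PT * Q + V \<noteq> 0"
    proof -
      have c: "coeff (pderiv H * T * T * PT * Q + V) (h - 1 + N) \<noteq> 0"
      proof -
        have "coeff V (h - 1 + N) = 0" by (rule V0) simp
        moreover have "coeff (pderiv H * T * T * PT * Q) (h - 1 + N) = lead_coeff (pderiv H * T * T * PT * Q)"
          by (simp add: d1)
        moreover have "pderiv H * T * T * PT * Q \<noteq> 0" using H' T_nz PT_nz Q_nz by simp
        ultimately show ?thesis by (metis add.right_neutral coeff_add leading_coeff_0_iff)
      qed
      then show "pderiv H * T * T * PT * Q + V \<noteq> 0" by (metis coeff_0)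
      show "degree (pderiv H * T * T * PT * Q + V) = h - 1 + N"
      proof (rule antisym)
        show "degree (pderiv H * T * T * PT * Q + V) \<le> h - 1 + N"
        proof (rule degree_le, intro allI impI)
          fix i assume i: "h - 1 + N < i"
          then have "coeff (pderiv H * T * T * PT * Q) i = 0" using d1 by (intro coeff_eq_0) simp
          then show "coeff (pderiv H * T * T * PT * Q + V) i = 0" using V0[of i] i by simp
        qed
        show "h - 1 + N \<le> degree (pderiv H * T * T * PT * Q + V)" using c by (rule le_degree)
      qed
    qed
    then have r: "degree (W * (pderiv H * T * T * PT * Q + V)) = degree W + (h - 1 + N)" "W * (pderiv H * T * T * PT * Q + V) \<noteq> 0"
      using W_nz by (auto simp: degree_mult_eq)
    then have "U \<noteq> 0" using U_key[unfolded inner] by auto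
    then have "N + degree U = degree W + (h - 1 + N)" using dL r U_key[unfolded inner] by simp
    then show ?thesis using kappa_eq h by simp
  qed
  then show "h > 0 \<Longrightarrow> degree U = \<kappa>" .
  show "degree U \<le> \<kappa>"
  proof (cases "h > 0 \<or> U = 0")
    case True
    then show ?thesis using pos by auto
  next
    case False
    then have "pderiv H = 0" using hH by (simp add: pderiv_eq_0_iff)
    then have k: "T * T * PT * Q * U = W * V" using U_key[unfolded inner] by simp
    have "V \<noteq> 0" using k False T_nz PT_nz Q_nz by auto
    then have "degree V < N" using V0[of "degree V"] by (metis leading_coeff_0_iff not_le)
    moreover have "N + degree U = degree W + degree V"
      using dL False k W_nz \<open>V \<noteq> 0\<close> by (simp add: degree_mult_eq)
    ultimately show ?thesis using kappa_eq by linarith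
  qed
qed

lemma degree_WB': "pderiv (B n) \<noteq> 0 \<Longrightarrow> degree (W * pderiv (B n)) + 1 = degree W + degree (B n)"
  using W_nz by (auto simp: degree_mult_eq degree_pderiv pderiv_eq_0_iff)

lemma degree_W_le_kappa: "degree W \<le> \<kappa> + 1" using kappa_eq by simp

lemma degree_factor_le: "degree (U - of_nat n * pderiv W) \<le> \<kappa>"
proof (rule degree_diff_le[OF degree_U(1)])
  have "degree (of_nat n * pderiv W) \<le> degree (pderiv W)"
    using degree_mult_le[of "of_nat n" "pderiv W"] by simp
  then show "degree (of_nat n * pderiv W) \<le> \<kappa>" using degree_W_le_kappa by (simp add: degree_pderiv)
qed

lemma degree_B_Suc_le: "degree (B (Suc n)) \<le> \<kappa> + degree (B n)"
proof -
  have "degree (W * pderiv (B n)) \<le> \<kappa> + degree (B n)"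
    using degree_WB'[of n] degree_W_le_kappa by (cases "pderiv (B n) = 0") auto
  moreover have "degree ((U - of_nat n * pderiv W) * B n) \<le> \<kappa> + degree (B n)"
    using degree_mult_le[of "U - of_nat n * pderiv W" "B n"] degree_factor_le[of n] by linarith
  ultimately show ?thesis by (simp add: degree_add_le)
qed

lemma degree_B_le: "degree (B n) \<le> \<kappa> * n + degree Psh"
proof (induction n)
  case (Suc n)
  then show ?case using degree_B_Suc_le[of n] by (simp del: B_poly.simps(2))
qed simp

text \<open>For \<open>h > 0\<close> the term \<open>U B n\<close> alone has the top degree. For
  \<open>h = 0\<close> all three terms may reach it, and the top coefficient is
  \<open>lead_coeff (B n)\<close> times \<open>D + c - n degree W\<close> with
  \<open>D = degree (B n)\<close>. Since \<open>D \<le> \<kappa> n + degree Psh\<close> and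
  \<open>degree W = \<kappa> + 1\<close>, this factor has negative real part once \<open>n\<close>
  exceeds \<open>degree Psh + |c|\<close>.\<close>

lemma degree_B_Suc_eventually: "\<forall>\<^sub>F n in sequentially. degree (B (Suc n)) = \<kappa> + degree (B n)"
proof (cases "h > 0")
  case True
  have "degree (B (Suc n)) = \<kappa> + degree (B n)" for n
  proof -
    have kd: "degree W \<le> \<kappa>" using kappa_eq True by simp
    have "degree (of_nat n * pderiv W) < \<kappa>"
      using degree_mult_le[of "of_nat n" "pderiv W"] kd kappa_pos degree_W T_nonconst
      by (simp add: degree_pderiv)
    then have "degree (U - of_nat n * pderiv W) = \<kappa>"
      using degree_U(2)[OF True] degree_add_eq_left[of "- (of_nat n * pderiv W)" U] by simp
    moreover from this have "U - of_nat n * pderiv W \<noteq> 0" using kappa_pos by auto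
    ultimately have d: "degree ((U - of_nat n * pderiv W) * B n) = \<kappa> + degree (B n)"
      using B_nz[of n] by (simp add: degree_mult_eq)
    have "degree (W * pderiv (B n)) < \<kappa> + degree (B n)"
      using degree_WB'[of n] kd kappa_pos by (cases "pderiv (B n) = 0") auto
    then show ?thesis using degree_add_eq_right[of "W * pderiv (B n)" "(U - of_nat n * pderiv W) * B n"] d by simp
  qed
  then show ?thesis by simp
next
  case False
  then have kd: "\<kappa> + 1 = degree W" using kappa_eq by simp
  define c where "c = coeff U \<kappa>"
  have "degree (B (Suc n)) = \<kappa> + degree (B n)" if n: "real n > real (degree Psh) + norm c" for n
  proof -
    define D where "D = degree (B n)"
    have c1: "coeff (W * pderiv (B n)) (\<kappa> + D) = of_nat D * lead_coeff (B n)"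
    proof (cases "D = 0")
      case True
      then have "pderiv (B n) = 0" by (simp add: D_def pderiv_eq_0_iff)
      then show ?thesis using True by simp
    next
      case D: False
      have "\<kappa> + D = degree W + (D - 1)" using kd D by simp
      then have "coeff (W * pderiv (B n)) (\<kappa> + D) = coeff W (degree W) * coeff (pderiv (B n)) (D - 1)"
        using coeff_mult_bounds[of W "degree W" "pderiv (B n)" "D - 1"] by (simp add: degree_pderiv D_def)
      then show ?thesis using D lead_coeff_W by (simp add: coeff_pderiv D_def)
    qed
    have "coeff (pderiv W) \<kappa> = of_nat (degree W)" using lead_coeff_W kd by (simp add: coeff_pderiv)
    moreover have "coeff (of_nat n * pderiv W) \<kappa> = of_nat n * coeff (pderiv W) \<kappa>"
      by (metis of_nat_poly coeff_smult mult_pCons_left mult_zero_left pCons_0_0 add.right_neutral)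
    ultimately have "coeff (U - of_nat n * pderiv W) \<kappa> = c - of_nat n * of_nat (degree W)"
      by (simp add: c_def)
    then have c2: "coeff ((U - of_nat n * pderiv W) * B n) (\<kappa> + D) = (c - of_nat n * of_nat (degree W)) * lead_coeff (B n)"
      using coeff_mult_bounds[of "U - of_nat n * pderiv W" \<kappa> "B n" D] degree_factor_le[of n] by (simp add: D_def)
    have "coeff (B (Suc n)) (\<kappa> + D) = (of_nat D + c - of_nat n * of_nat (degree W)) * lead_coeff (B n)"
      using c1 c2 by (simp add: algebra_simps)
    moreover have "of_nat D + c - of_nat n * of_nat (degree W) \<noteq> 0"
    proof
      assume "of_nat D + c - of_nat n * of_nat (degree W) = 0"
      then have "c = of_nat n * of_nat (degree W) - of_nat D" by (simp add: algebra_simps)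
      then have "Re c = real n * real (degree W) - real D" by simp
      moreover have "real D \<le> real \<kappa> * real n + real (degree Psh)"
        using degree_B_le[of n] unfolding D_def by (metis of_nat_add of_nat_mono of_nat_mult)
      moreover have "real n * real (degree W) = real \<kappa> * real n + real n"
        unfolding kd[symmetric] by (simp add: algebra_simps)
      ultimately show False using n complex_Re_le_cmod[of c] by linarith
    qed
    ultimately have "coeff (B (Suc n)) (\<kappa> + D) \<noteq> 0" using B_nz[of n] by simp
    then have "\<kappa> + D \<le> degree (B (Suc n))" by (rule le_degree)
    then show ?thesis using degree_B_Suc_le[of n] unfolding D_def by simp
  qed
  moreover have "\<forall>\<^sub>F n in sequentially. real n > real (degree Psh) + norm c"
    by (rule eventually_compose_filterlim[OF eventually_gt_at_top filterlim_real_sequentially])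
  ultimately show ?thesis by (auto elim: eventually_mono)
qed

lemma degree_B_tendsto: "(\<lambda>n. real (degree (B n)) / real n) \<longlonglongrightarrow> real \<kappa>"
proof -
  obtain n0 where n0: "\<And>n. n \<ge> n0 \<Longrightarrow> degree (B (Suc n)) = \<kappa> + degree (B n)"
    using degree_B_Suc_eventually unfolding eventually_sequentially by blast
  have d: "degree (B (n0 + m)) = \<kappa> * m + degree (B n0)" for m
    by (induction m) (simp_all add: n0 del: B_poly.simps)
  define e where "e = real (degree (B n0)) - real \<kappa> * real n0"
  have "real (degree (B n)) = real \<kappa> * real n + e" if "n \<ge> n0" for n
  proof -
    obtain m where "n = n0 + m" using \<open>n \<ge> n0\<close> le_Suc_ex by blast
    then show ?thesis using d[of m] by (simp add: e_def algebra_simps)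
  qed
  then have ev: "\<forall>\<^sub>F n in sequentially. real \<kappa> + e * (1 / real n) = real (degree (B n)) / real n"
    unfolding eventually_sequentially by (intro exI[of _ "max n0 1"]) (auto simp: add_divide_distrib)
  have "(\<lambda>n. real \<kappa> + e * (1 / real n)) \<longlonglongrightarrow> real \<kappa> + e * 0" by (intro tendsto_intros lim_1_over_n)
  then show ?thesis using tendsto_cong[OF ev] by simp
qed

lemma degree_B_pos: "\<forall>\<^sub>F n in sequentially. degree (B n) > 0"
proof -
  have "\<forall>\<^sub>F n in sequentially. real (degree (B n)) / real n > 0"
    using order_tendstoD(1)[OF degree_B_tendsto, of 0] kappa_pos by simp
  then show ?thesis by eventually_elim (auto intro: Nat.gr0I)
qed

end

section \<open>The maximum potential of finitely many sites\<close>

text \<open>By the Cauchy-Riemann equations the terms with second derivatives of \<open>F i\<close>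
  cancel between \<open>A11\<close> and \<open>A22\<close>, and the first partials of the sum are
  the real part and minus the imaginary part of
  \<open>2 (\<Sum>i. cnj (F i) (F i)')\<close>.\<close>

lemma has_laplacian_ln_sum_sq:
  fixes F :: "'i \<Rightarrow> complex poly"
  assumes pos: "\<And>z. (\<Sum>i\<in>I. (norm (poly (F i) z))^2) > 0"
  shows "has_laplacian (\<lambda>z. ln (\<Sum>i\<in>I. (norm (poly (F i) z))^2))
    (\<lambda>z. 4 * ((\<Sum>i\<in>I. (norm (poly (pderiv (F i)) z))^2) * (\<Sum>i\<in>I. (norm (poly (F i) z))^2)
        - (norm (\<Sum>i\<in>I. cnj (poly (F i) z) * poly (pderiv (F i)) z))\<^sup>2) / (\<Sum>i\<in>I. (norm (poly (F i) z))^2)^2)"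
proof -
  define r s where "r q z = Re (poly q z)" and "s q z = Im (poly q z)" for q :: "complex poly" and z
  have cr: "continuous_on UNIV (r q)" "continuous_on UNIV (s q)" for q
    unfolding r_def s_def by (intro continuous_intros)+
  have dx: "((\<lambda>t. poly q (Complex t y)) has_vector_derivative poly (pderiv q) (Complex x y)) (at x)" for q x y
  proof -
    have "((\<lambda>w. poly q (w + \<i> * of_real y)) has_field_derivative poly (pderiv q) (of_real x + \<i> * of_real y) * 1) (at (of_real x))"
      by (rule DERIV_chain2[OF poly_DERIV]) (auto intro!: derivative_eq_intros)
    from has_vector_derivative_real_field[OF this] show ?thesis by (simp add: Complex_eq)
  qed
  have dy: "((\<lambda>t. poly q (Complex x t)) has_vector_derivative \<i> * poly (pderiv q) (Complex x y)) (at y)" for q x y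
  proof -
    have "((\<lambda>w. poly q (of_real x + \<i> * w)) has_field_derivative poly (pderiv q) (of_real x + \<i> * of_real y) * \<i>) (at (of_real y))"
      by (rule DERIV_chain2[OF poly_DERIV]) (auto intro!: derivative_eq_intros)
    from has_vector_derivative_real_field[OF this] show ?thesis by (simp add: Complex_eq mult.commute)
  qed
  have D: "((\<lambda>t. r q (Complex t y)) has_real_derivative r (pderiv q) (Complex x y)) (at x)"
    "((\<lambda>t. s q (Complex t y)) has_real_derivative s (pderiv q) (Complex x y)) (at x)"
    "((\<lambda>t. r q (Complex x t)) has_real_derivative - s (pderiv q) (Complex x y)) (at y)"
    "((\<lambda>t. s q (Complex x t)) has_real_derivative r (pderiv q) (Complex x y)) (at y)" for q x y
    unfolding r_def s_def
    using has_field_derivative_Re[OF dx[of q y x]] has_field_derivative_Im[OF dx[of q y x]]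
      has_field_derivative_Re[OF dy[of q x y]] has_field_derivative_Im[OF dy[of q x y]] by simp_all
  define A where "A z = (\<Sum>i\<in>I. (r (F i) z)^2 + (s (F i) z)^2)" for z
  define A1 where "A1 z = (\<Sum>i\<in>I. 2 * (r (F i) z * r (pderiv (F i)) z + s (F i) z * s (pderiv (F i)) z))" for z
  define A11 where "A11 z = (\<Sum>i\<in>I. 2 * ((r (pderiv (F i)) z)^2 + (s (pderiv (F i)) z)^2
      + (r (F i) z * r (pderiv (pderiv (F i))) z + s (F i) z * s (pderiv (pderiv (F i))) z)))" for z
  define A2 where "A2 z = (\<Sum>i\<in>I. 2 * (s (F i) z * r (pderiv (F i)) z - r (F i) z * s (pderiv (F i)) z))" for z
  define A22 where "A22 z = (\<Sum>i\<in>I. 2 * ((r (pderiv (F i)) z)^2 + (s (pderiv (F i)) z)^2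
      - (r (F i) z * r (pderiv (pderiv (F i))) z + s (F i) z * s (pderiv (pderiv (F i))) z)))" for z
  have nA: "(\<Sum>i\<in>I. (norm (poly (F i) z))^2) = A z" for z by (simp add: A_def r_def s_def cmod_power2)
  have Apos: "A z > 0" for z using pos[of z] by (simp add: nA)
  have cA: "continuous_on UNIV A" "continuous_on UNIV A1" "continuous_on UNIV A11" "continuous_on UNIV A2" "continuous_on UNIV A22"
    unfolding A_def A1_def A11_def A2_def A22_def
    by (intro continuous_on_sum continuous_on_mult continuous_on_add continuous_on_diff continuous_on_power continuous_on_const cr)+
  have d1: "((\<lambda>t. A (Complex t y)) has_real_derivative A1 (Complex x y)) (at x)" for x y
    unfolding A_def A1_def
    by (intro DERIV_sum DERIV_cong[OF DERIV_add[OF DERIV_power[OF D(1)] DERIV_power[OF D(2)]]]) (simp add: algebra_simps)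
  have d2: "((\<lambda>t. A (Complex x t)) has_real_derivative A2 (Complex x y)) (at y)" for x y
    unfolding A_def A2_def
    by (intro DERIV_sum DERIV_cong[OF DERIV_add[OF DERIV_power[OF D(3)] DERIV_power[OF D(4)]]]) (simp add: algebra_simps)
  have d11: "((\<lambda>t. A1 (Complex t y)) has_real_derivative A11 (Complex x y)) (at x)" for x y
    unfolding A1_def A11_def
    by (intro DERIV_sum DERIV_cong[OF DERIV_cmult[OF DERIV_add[OF DERIV_mult[OF D(1) D(1)] DERIV_mult[OF D(2) D(2)]]]])
      (simp add: algebra_simps power2_eq_square)
  have d22: "((\<lambda>t. A2 (Complex x t)) has_real_derivative A22 (Complex x y)) (at y)" for x y
    unfolding A2_def A22_def
    by (intro DERIV_sum DERIV_cong[OF DERIV_cmult[OF DERIV_diff[OF DERIV_mult[OF D(4) D(3)] DERIV_mult[OF D(3) D(4)]]]])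
      (simp add: algebra_simps power2_eq_square)
  have hp: "has_partials (\<lambda>z. ln (A z)) (\<lambda>z. A1 z / A z) (\<lambda>z. (A11 z * A z - A1 z * A1 z) / (A z * A z))
      (\<lambda>z. A2 z / A z) (\<lambda>z. (A22 z * A z - A2 z * A2 z) / (A z * A z))" unfolding has_partials_def
  proof (intro conjI allI)
    have nz: "\<forall>z\<in>UNIV. A z \<noteq> 0" "\<forall>z\<in>UNIV. A z * A z \<noteq> 0" using Apos by (auto simp: less_le)
    show "continuous_on UNIV (\<lambda>z. ln (A z))" by (rule continuous_on_ln[OF cA(1)]) (use Apos in \<open>auto simp: less_le\<close>)
    show "continuous_on UNIV (\<lambda>z. A1 z / A z)" "continuous_on UNIV (\<lambda>z. A2 z / A z)"
      "continuous_on UNIV (\<lambda>z. (A11 z * A z - A1 z * A1 z) / (A z * A z))"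
      "continuous_on UNIV (\<lambda>z. (A22 z * A z - A2 z * A2 z) / (A z * A z))"
      by (intro continuous_on_divide continuous_on_mult continuous_on_diff cA nz)+
    fix x y
    note nz' = Apos[of "Complex x y", THEN less_imp_neq, symmetric]
    show "((\<lambda>t. ln (A (Complex t y))) has_real_derivative A1 (Complex x y) / A (Complex x y)) (at x)"
      by (rule DERIV_cong[OF DERIV_chain2[OF DERIV_ln_divide[OF Apos] d1]]) simp
    show "((\<lambda>t. ln (A (Complex x t))) has_real_derivative A2 (Complex x y) / A (Complex x y)) (at y)"
      by (rule DERIV_cong[OF DERIV_chain2[OF DERIV_ln_divide[OF Apos] d2]]) simp
    show "((\<lambda>t. A1 (Complex t y) / A (Complex t y)) has_real_derivative
        (A11 (Complex x y) * A (Complex x y) - A1 (Complex x y) * A1 (Complex x y)) / (A (Complex x y) * A (Complex x y))) (at x)"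
      by (rule DERIV_divide[OF d11 d1 nz'])
    show "((\<lambda>t. A2 (Complex x t) / A (Complex x t)) has_real_derivative
        (A22 (Complex x y) * A (Complex x y) - A2 (Complex x y) * A2 (Complex x y)) / (A (Complex x y) * A (Complex x y))) (at y)"
      by (rule DERIV_divide[OF d22 d2 nz'])
  qed
  have "(A11 z * A z - A1 z * A1 z) / (A z * A z) + (A22 z * A z - A2 z * A2 z) / (A z * A z)
     = 4 * ((\<Sum>i\<in>I. (norm (poly (pderiv (F i)) z))^2) * A z
        - (norm (\<Sum>i\<in>I. cnj (poly (F i) z) * poly (pderiv (F i)) z))\<^sup>2) / (A z)^2" for z
  proof -
    define C where "C = (\<Sum>i\<in>I. cnj (poly (F i) z) * poly (pderiv (F i)) z)"
    have "A1 z = 2 * Re C" unfolding A1_def C_def by (simp add: r_def s_def sum_distrib_left)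
    moreover have "A2 z = - 2 * Im C" unfolding A2_def C_def
      by (simp add: r_def s_def sum_distrib_left sum_negf[symmetric] algebra_simps)
    moreover have "A11 z + A22 z = 4 * (\<Sum>i\<in>I. (norm (poly (pderiv (F i)) z))^2)"
      unfolding A11_def A22_def sum.distrib[symmetric] sum_distrib_left
      by (intro sum.cong refl) (simp add: r_def s_def cmod_power2)
    moreover have "(norm C)^2 = (Re C)^2 + (Im C)^2" by (rule cmod_power2)
    ultimately have *: "((A11 z + A22 z) * A z - (A1 z * A1 z + A2 z * A2 z))
        = 4 * ((\<Sum>i\<in>I. (norm (poly (pderiv (F i)) z))^2) * A z - (norm C)\<^sup>2)"
      by (simp only:) (simp add: power2_eq_square algebra_simps)
    have gen: "(a * x - b * b) / (x * x) + (c * x - d * d) / (x * x) = ((a + c) * x - (b * b + d * d)) / x^2" for a b c d x :: real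
      by (simp add: add_divide_distrib[symmetric] power2_eq_square algebra_simps)
    show ?thesis unfolding C_def[symmetric] gen * ..
  qed
  with has_laplacianI[OF hp] show ?thesis unfolding nA by simp
qed

text \<open>Lagrange's identity with weights. It turns the Laplacian of the soft maximum into a sum
  over pairs of sites, one for each possible Voronoi edge.\<close>

lemma weighted_variance:
  fixes x :: "nat \<Rightarrow> complex" and s :: "nat \<Rightarrow> real"
  shows "(\<Sum>i\<in>{1..N}. s i * (norm (x i))^2) * (\<Sum>i\<in>{1..N}. s i) - (norm (\<Sum>i\<in>{1..N}. s i * x i))\<^sup>2
    = (\<Sum>(i, j)\<in>{(i, j). 1 \<le> i \<and> i < j \<and> j \<le> N}. s i * s j * (norm (x i - x j))^2)"
proof (induction N)
  case 0
  have "{(i, j). 1 \<le> i \<and> i < j \<and> j \<le> (0 :: nat)} = {}" by auto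
  then show ?case by (simp only:) simp
next
  case (Suc N)
  define A B C where "A = (\<Sum>i\<in>{1..N}. s i * (norm (x i))^2)" and "B = (\<Sum>i\<in>{1..N}. s i)"
    and "C = (\<Sum>i\<in>{1..N}. s i * x i)"
  define y t where "y = x (Suc N)" and "t = s (Suc N)"
  have "{(i, j). 1 \<le> i \<and> i < j \<and> j \<le> Suc N} = {(i, j). 1 \<le> i \<and> i < j \<and> j \<le> N} \<union> (\<lambda>i. (i, Suc N)) ` {1..N}"
    by (auto simp: le_Suc_eq)
  moreover have "finite {(i, j). 1 \<le> i \<and> i < j \<and> j \<le> N}" by (rule finite_subset[of _ "{..N} \<times> {..N}"]) auto
  moreover have "(\<Sum>(i, j)\<in>(\<lambda>i. (i, Suc N)) ` {1..N}. s i * s j * (norm (x i - x j))^2)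
      = (\<Sum>i\<in>{1..N}. s i * t * (norm (x i - y))^2)"
    by (subst sum.reindex) (simp_all add: inj_on_def y_def t_def)
  moreover have "{(i, j). 1 \<le> i \<and> i < j \<and> j \<le> N} \<inter> (\<lambda>i. (i, Suc N)) ` {1..N} = {}" by auto
  ultimately have "(\<Sum>(i, j)\<in>{(i, j). 1 \<le> i \<and> i < j \<and> j \<le> Suc N}. s i * s j * (norm (x i - x j))^2)
     = (A * B - (norm C)\<^sup>2) + (\<Sum>i\<in>{1..N}. s i * t * (norm (x i - y))^2)"
    unfolding A_def B_def C_def Suc.IH by (simp only: sum.union_disjoint finite_imageI finite_atLeastAtMost)
  also have "(\<Sum>i\<in>{1..N}. s i * t * (norm (x i - y))^2) = t * (A + B * (norm y)^2 - 2 * Re (C * cnj y))"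
  proof -
    have *: "(norm (a - b))^2 = (norm a)^2 + (norm b)^2 - 2 * Re (a * cnj b)" for a b :: complex
      unfolding cmod_power2 by (simp add: power2_eq_square algebra_simps)
    have "Re (C * cnj y) = (\<Sum>i\<in>{1..N}. s i * Re (x i * cnj y))"
      unfolding C_def sum_distrib_right Re_sum by (intro sum.cong refl) (simp add: algebra_simps)
    then show ?thesis unfolding *
      by (simp add: A_def B_def sum_distrib_left sum_distrib_right sum.distrib sum_subtractf algebra_simps)
  qed
  finally have fin: "(\<Sum>(i, j)\<in>{(i, j). 1 \<le> i \<and> i < j \<and> j \<le> Suc N}. s i * s j * (norm (x i - x j))^2)
    = (A * B - (norm C)\<^sup>2) + t * (A + B * (norm y)^2 - 2 * Re (C * cnj y))" .
  have sq: "(norm (C + t * y))^2 = (norm C)^2 + t^2 * (norm y)^2 + 2 * t * Re (C * cnj y)"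
    unfolding cmod_power2 by (simp add: power2_eq_square algebra_simps)
  have S: "(\<Sum>i\<in>{1..Suc N}. s i * (norm (x i))^2) = A + t * (norm y)^2"
    "(\<Sum>i\<in>{1..Suc N}. s i) = B + t" "(\<Sum>i\<in>{1..Suc N}. s i * x i) = C + t * y"
    by (simp_all add: A_def B_def C_def y_def t_def)
  show ?case unfolding S sq fin by (simp add: power2_eq_square algebra_simps)
qed

lemma tendsto_power_exp:
  fixes y :: "nat \<Rightarrow> real"
  assumes "y \<longlonglongrightarrow> l"
  shows "(\<lambda>n. (1 + y n / real n) ^ n) \<longlonglongrightarrow> exp l"
proof -
  define \<phi> where "\<phi> x = (if x = 0 then 1 else ln (1 + x) / x)" for x :: real
  have "((\<lambda>x :: real. ln (1 + x) / x) \<longlongrightarrow> 1) (at 0)" using DERIV_ln_divide[of 1] by (simp add: DERIV_def)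
  then have "(\<phi> \<longlongrightarrow> 1) (at 0)"
    by (rule Lim_transform_eventually) (auto simp: \<phi>_def eventually_at intro!: exI[of _ 1])
  then have iso: "isCont \<phi> 0" by (simp add: isCont_def \<phi>_def)
  have x0: "(\<lambda>n. y n / real n) \<longlonglongrightarrow> 0" by (rule real_tendsto_divide_at_top[OF assms filterlim_real_sequentially])
  then have "(\<lambda>n. \<phi> (y n / real n)) \<longlonglongrightarrow> 1" using isCont_tendsto_compose[OF iso x0] by (simp add: \<phi>_def)
  then have "(\<lambda>n. exp (y n * \<phi> (y n / real n))) \<longlonglongrightarrow> exp (l * 1)" by (intro tendsto_intros assms)
  moreover have "\<forall>\<^sub>F n in sequentially. exp (y n * \<phi> (y n / real n)) = (1 + y n / real n) ^ n"
    using order_tendstoD(1)[OF x0, of "-1", simplified] eventually_gt_at_top[of 0]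
  proof eventually_elim
    case (elim n)
    have "y n * \<phi> (y n / real n) = real n * ln (1 + y n / real n)" using elim by (auto simp: \<phi>_def)
    then show ?case using elim by (simp add: exp_of_nat_mult)
  qed
  ultimately show ?thesis by (simp add: tendsto_cong)
qed

lemma tendsto_power_0:
  fixes x :: "nat \<Rightarrow> real"
  assumes "x \<longlonglongrightarrow> l" "l < 1" "\<And>n. x n \<ge> 0"
  shows "(\<lambda>n. x n ^ n) \<longlonglongrightarrow> 0"
proof -
  have l0: "l \<ge> 0" by (rule LIMSEQ_le_const[OF assms(1)]) (use assms(3) in blast)
  define q where "q = (1 + l) / 2"
  have q: "l < q" "q < 1" "0 \<le> q" using assms(2) l0 by (auto simp: q_def)
  have "\<forall>\<^sub>F n in sequentially. norm (x n ^ n) \<le> q ^ n"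
    using order_tendstoD(2)[OF assms(1) q(1)] proof eventually_elim
    case (elim n)
    then show ?case using assms(3)[of n] power_mono[of "x n" q n] by (simp add: power_abs)
  qed
  moreover have "(\<lambda>n. q ^ n) \<longlonglongrightarrow> 0" using q by (intro LIMSEQ_realpow_zero) auto
  ultimately show ?thesis by (rule Lim_null_comparison)
qed

section \<open>Soft and exact maximum over the sites\<close>

locale sites =
  fixes a :: "nat \<Rightarrow> complex" and N :: nat
  assumes inj: "inj_on a {1..N}" and N: "N \<ge> 1"
begin

text \<open>Up to the common factor \<open>\<Prod>j. |z - a j|^2\<close> this is
  \<open>1 / |z - a i|^2\<close>, so the nearest site maximizes it; the product form is finite at
  the sites and is the squared modulus of a polynomial.\<close>

definition side :: "nat \<Rightarrow> complex \<Rightarrow> real" where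
  "side i z = (\<Prod>j\<in>{1..N} - {i}. (norm (z - a j))^2)"

definition softpot :: "nat \<Rightarrow> complex \<Rightarrow> real" where
  "softpot p z = ln (\<Sum>i\<in>{1..N}. side i z ^ p) / (2 * real p)"

definition maxpot :: "complex \<Rightarrow> real" where
  "maxpot z = ln (Max ((\<lambda>i. side i z) ` {1..N})) / 2"

lemma side_nonneg: "side i z \<ge> 0" unfolding side_def by (intro prod_nonneg) auto

lemma side_mult: "i \<in> {1..N} \<Longrightarrow> side i z * (norm (z - a i))^2 = (\<Prod>j\<in>{1..N}. (norm (z - a j))^2)"
  unfolding side_def by (subst prod.remove[of "{1..N}" i]) (auto simp: mult.commute)

lemma side_pos: "z \<notin> a ` {1..N} \<Longrightarrow> side i z > 0" unfolding side_def by (intro prod_pos) auto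

lemma exists_side_pos: "\<exists>i\<in>{1..N}. side i z > 0"
proof (cases "z \<in> a ` {1..N}")
  case True
  then obtain i where i: "i \<in> {1..N}" "z = a i" by blast
  have "a j \<noteq> z" if "j \<in> {1..N} - {i}" for j using that i inj_onD[OF inj, of j i] by auto
  then have "side i z > 0" unfolding side_def by (intro prod_pos) auto
  then show ?thesis using i by blast
next
  case False
  then show ?thesis using side_pos[of z 1] N by (intro bexI[of _ 1]) simp_all
qed

lemma sum_side_pos: "(\<Sum>i\<in>{1..N}. side i z ^ p) > 0"
proof -
  obtain i where i: "i \<in> {1..N}" "side i z > 0" using exists_side_pos by blast
  have "0 < side i z ^ p" using i by simp
  also have "\<dots> \<le> (\<Sum>i\<in>{1..N}. side i z ^ p)" by (rule member_le_sum[OF i(1)]) (simp_all add: side_nonneg)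
  finally show ?thesis .
qed

text \<open>The largest of \<open>N\<close> nonnegative terms differs from their sum by a factor of
  at most \<open>N\<close>. The bound is uniform in \<open>z\<close>, so it yields the continuity of
  \<open>maxpot\<close> as well as the convergence of the integrals.\<close>

lemma softpot_maxpot:
  assumes p: "p \<ge> 1"
  shows "\<bar>softpot p z - maxpot z\<bar> \<le> ln (real N) / (2 * real p)"
proof -
  define m where "m = Max ((\<lambda>i. side i z) ` {1..N})"
  have fin: "finite ((\<lambda>i. side i z) ` {1..N})" "(\<lambda>i. side i z) ` {1..N} \<noteq> {}" using N by auto
  have le: "side i z \<le> m" if "i \<in> {1..N}" for i unfolding m_def using that by (intro Max_ge) auto
  have "m \<in> (\<lambda>i. side i z) ` {1..N}" unfolding m_def by (rule Max_in[OF fin])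
  then obtain i0 where i0: "i0 \<in> {1..N}" "m = side i0 z" by blast
  have m: "m > 0" using exists_side_pos[of z] le by (meson less_le_trans)
  define s where "s = (\<Sum>i\<in>{1..N}. side i z ^ p)"
  have "m ^ p \<le> s" unfolding i0(2) s_def by (rule member_le_sum[OF i0(1)]) (simp_all add: side_nonneg)
  moreover have "s \<le> real N * m ^ p"
  proof -
    have "s \<le> (\<Sum>i\<in>{1..N}. m ^ p)" unfolding s_def by (intro sum_mono power_mono le side_nonneg)
    then show ?thesis by simp
  qed
  moreover have "s > 0" unfolding s_def by (rule sum_side_pos)
  ultimately have "ln (m ^ p) \<le> ln s" "ln s \<le> ln (real N * m ^ p)" using m by (auto simp del: ln_mult)
  then have "real p * ln m \<le> ln s" "ln s \<le> ln (real N) + real p * ln m"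
    using m N by (simp_all add: ln_realpow ln_mult_pos)
  then have "\<bar>ln s - real p * ln m\<bar> \<le> ln (real N)" by linarith
  then have "\<bar>ln s - real p * ln m\<bar> / (2 * real p) \<le> ln (real N) / (2 * real p)"
    by (rule divide_right_mono) simp
  moreover have "softpot p z - maxpot z = (ln s - real p * ln m) / (2 * real p)"
    unfolding softpot_def maxpot_def s_def[symmetric] m_def[symmetric] using p by (simp add: diff_divide_distrib)
  ultimately show ?thesis by (simp add: abs_divide)
qed

text \<open>A polynomial with squared modulus \<open>side i z ^ p\<close>, which brings
  \<open>softpot\<close> under \<open>has_laplacian_ln_sum_sq\<close>.\<close>

definition F_poly :: "nat \<Rightarrow> nat \<Rightarrow> complex poly" where
  "F_poly p i = (\<Prod>j\<in>{1..N} - {i}. [:- a j, 1:]) ^ p"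

lemma norm_F_poly: "(norm (poly (F_poly p i) z))^2 = side i z ^ p"
proof -
  have "norm (poly (F_poly p i) z) = (\<Prod>j\<in>{1..N} - {i}. norm (z - a j)) ^ p"
    unfolding F_poly_def by (simp add: poly_power poly_prod norm_power prod_norm[symmetric])
  then have "(norm (poly (F_poly p i) z))^2 = ((\<Prod>j\<in>{1..N} - {i}. norm (z - a j))^2) ^ p"
    by (simp only: power_mult[symmetric] mult.commute)
  then show ?thesis unfolding side_def by (simp only: prod_power_distrib)
qed

lemma pderiv_F_poly:
  assumes z: "z \<notin> a ` {1..N}" and i: "i \<in> {1..N}"
  shows "poly (pderiv (F_poly p i)) z
     = poly (F_poly p i) z * (of_nat p * ((\<Sum>j\<in>{1..N}. 1 / (z - a j)) - 1 / (z - a i)))"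
proof -
  have log: "poly (pderiv (\<Prod>j\<in>J. [:- a j, 1:])) z = poly (\<Prod>j\<in>J. [:- a j, 1:]) z * (\<Sum>j\<in>J. 1 / (z - a j))"
    if "finite J" "J \<subseteq> {1..N}" for J using that
  proof (induction J)
    case (insert j J)
    have nz: "z - a j \<noteq> 0" using insert z by auto
    define q where "q = (\<Prod>k\<in>J. [:- a k, 1:])"
    have 1: "(\<Prod>k\<in>insert j J. [:- a k, 1:]) = [:- a j, 1:] * q"
      "(\<Sum>k\<in>insert j J. 1 / (z - a k)) = 1 / (z - a j) + (\<Sum>k\<in>J. 1 / (z - a k))"
      using insert.hyps by (simp_all add: q_def)
    have 2: "poly (pderiv ([:- a j, 1:] * q)) z = poly q z + (z - a j) * poly (pderiv q) z"
      "poly ([:- a j, 1:] * q) z = (z - a j) * poly q z"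
      by (simp only: pderiv_mult, simp add: pderiv_pCons algebra_simps) (simp add: algebra_simps)
    have 3: "poly (pderiv q) z = poly q z * (\<Sum>k\<in>J. 1 / (z - a k))" unfolding q_def using insert by blast
    show ?case unfolding 1 2 3 using nz by (simp add: distrib_left mult_ac)
  qed simp
  have "(\<Sum>j\<in>{1..N} - {i}. 1 / (z - a j)) = (\<Sum>j\<in>{1..N}. 1 / (z - a j)) - 1 / (z - a i)"
    using i by (subst sum.remove[of "{1..N}" i]) auto
  then have l: "poly (pderiv (\<Prod>j\<in>{1..N} - {i}. [:- a j, 1:])) z
    = poly (\<Prod>j\<in>{1..N} - {i}. [:- a j, 1:]) z * ((\<Sum>j\<in>{1..N}. 1 / (z - a j)) - 1 / (z - a i))"
    using log[of "{1..N} - {i}"] by auto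
  define q where "q = (\<Prod>j\<in>{1..N} - {i}. [:- a j, 1:])"
  show ?thesis
  proof (cases p)
    case (Suc m)
    have "poly (pderiv (q ^ Suc m)) z = of_nat (Suc m) * poly q z ^ m * poly (pderiv q) z"
      by (simp only: pderiv_power_Suc) (simp add: poly_power)
    also have "\<dots> = poly (q ^ Suc m) z * (of_nat (Suc m) * ((\<Sum>j\<in>{1..N}. 1 / (z - a j)) - 1 / (z - a i)))"
      by (simp only: l[folded q_def] power_Suc poly_mult poly_power mult_ac)
    finally show ?thesis unfolding F_poly_def q_def Suc .
  qed (simp add: F_poly_def)
qed

definition pairs :: "(nat \<times> nat) set" where
  "pairs = {(i, j). 1 \<le> i \<and> i < j \<and> j \<le> N}"

lemma finite_pairs: "finite pairs" unfolding pairs_def by (rule finite_subset[of _ "{..N} \<times> {..N}"]) auto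

text \<open>With \<open>s k = side k z ^ p\<close> this is \<open>s i s j / (\<Sum>k. s k)^2\<close>
  times \<open>|1 / (z - a i) - 1 / (z - a j)|^2\<close>. At \<open>a i\<close> and
  \<open>a j\<close> themselves it is 0 by division by zero.\<close>

definition pair_density :: "nat \<Rightarrow> nat \<Rightarrow> nat \<Rightarrow> complex \<Rightarrow> real" where
  "pair_density p i j z = side i z ^ p * side j z ^ p / (\<Sum>k\<in>{1..N}. side k z ^ p)^2 *
     ((norm (a i - a j))^2 / ((norm (z - a i))^2 * (norm (z - a j))^2))"

lemma measurable_side [measurable]: "side k \<in> borel_measurable borel"
  unfolding side_def[abs_def] by measurable

lemma measurable_pair_density [measurable]: "pair_density p k l \<in> borel_measurable borel"
  unfolding pair_density_def[abs_def] by measurable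

text \<open>The logarithmic derivative of \<open>F_poly p i\<close> is \<open>p x i\<close>, where
  \<open>x i\<close> is a sum common to all \<open>i\<close> minus \<open>1 / (z - a i)\<close>; the
  variance sees only the differences \<open>x i - x j\<close>. The factor \<open>2 p\<close> is the
  quotient of \<open>4 p^2\<close> by the normalization \<open>2 p\<close>.\<close>

lemma has_laplacian_softpot:
  assumes p: "p \<ge> 1"
  shows "\<exists>L. has_laplacian (softpot p) L \<and>
     (\<forall>z. z \<notin> a ` {1..N} \<longrightarrow> L z = (\<Sum>(i, j)\<in>pairs. 2 * real p * pair_density p i j z))"
proof -
  define L where "L z = 4 * ((\<Sum>i\<in>{1..N}. (norm (poly (pderiv (F_poly p i)) z))^2) * (\<Sum>i\<in>{1..N}. (norm (poly (F_poly p i) z))^2)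
        - (norm (\<Sum>i\<in>{1..N}. cnj (poly (F_poly p i) z) * poly (pderiv (F_poly p i)) z))\<^sup>2) / (\<Sum>i\<in>{1..N}. (norm (poly (F_poly p i) z))^2)^2" for z
  have hl: "has_laplacian (\<lambda>z. ln (\<Sum>i\<in>{1..N}. (norm (poly (F_poly p i) z))^2)) L"
    unfolding L_def by (rule has_laplacian_ln_sum_sq) (unfold norm_F_poly, rule sum_side_pos)
  have scale: "has_laplacian (\<lambda>z. g z / c) (\<lambda>z. G z / c)" if g: "has_laplacian g G" for g G and c :: real
  proof -
    from g obtain g1 g11 g2 g22 where pg: "has_partials g g1 g11 g2 g22"
      and G: "G = (\<lambda>z. g11 z + g22 z)" unfolding has_laplacian_def by blast
    note d = has_partialsD[OF pg]
    have "has_partials (\<lambda>z. g z / c) (\<lambda>z. g1 z / c) (\<lambda>z. g11 z / c) (\<lambda>z. g2 z / c) (\<lambda>z. g22 z / c)"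
      unfolding has_partials_def divide_inverse
      by (intro conjI allI continuous_on_mult continuous_on_const d DERIV_cmult_right)
    from has_laplacianI[OF this] show ?thesis by (simp add: G add_divide_distrib)
  qed
  have "has_laplacian (softpot p) (\<lambda>z. L z / (2 * real p))"
    using scale[OF hl, of "2 * real p"] unfolding norm_F_poly by (simp add: softpot_def[abs_def])
  moreover have "L z / (2 * real p) = (\<Sum>(i, j)\<in>pairs. 2 * real p * pair_density p i j z)" if z: "z \<notin> a ` {1..N}" for z
  proof -
    define x where "x i = (\<Sum>j\<in>{1..N}. 1 / (z - a j)) - 1 / (z - a i)" for i
    define s where "s i = side i z ^ p" for i
    have nF: "(norm (poly (F_poly p i) z))^2 = s i" for i by (simp add: norm_F_poly s_def)
    have 1: "(\<Sum>i\<in>{1..N}. (norm (poly (pderiv (F_poly p i)) z))^2) = (real p)^2 * (\<Sum>i\<in>{1..N}. s i * (norm (x i))^2)"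
      unfolding sum_distrib_left
    proof (rule sum.cong[OF refl])
      fix i assume i: "i \<in> {1..N}"
      show "(norm (poly (pderiv (F_poly p i)) z))^2 = (real p)^2 * (s i * (norm (x i))^2)"
        unfolding pderiv_F_poly[OF z i] x_def[symmetric] norm_mult power_mult_distrib nF by simp
    qed
    have 2: "(\<Sum>i\<in>{1..N}. cnj (poly (F_poly p i) z) * poly (pderiv (F_poly p i)) z) = of_nat p * (\<Sum>i\<in>{1..N}. s i * x i)"
      unfolding sum_distrib_left
    proof (rule sum.cong[OF refl])
      fix i assume i: "i \<in> {1..N}"
      have "cnj (poly (F_poly p i) z) * poly (F_poly p i) z = of_real (s i)"
        unfolding nF[symmetric] complex_norm_square by (rule mult.commute)
      then show "cnj (poly (F_poly p i) z) * poly (pderiv (F_poly p i)) z = of_nat p * (of_real (s i) * x i)"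
        unfolding pderiv_F_poly[OF z i] x_def[symmetric] by (simp add: mult.assoc[symmetric])
    qed
    have "(\<Sum>i\<in>{1..N}. s i * (norm (x i))^2) * (\<Sum>i\<in>{1..N}. s i) - (norm (\<Sum>i\<in>{1..N}. s i * x i))\<^sup>2
      = (\<Sum>(i, j)\<in>pairs. s i * s j * (norm (x i - x j))^2)" unfolding pairs_def by (rule weighted_variance)
    moreover have "L z = 4 * (real p)^2 * ((\<Sum>i\<in>{1..N}. s i * (norm (x i))^2) * (\<Sum>i\<in>{1..N}. s i)
        - (norm (\<Sum>i\<in>{1..N}. s i * x i))\<^sup>2) / (\<Sum>i\<in>{1..N}. s i)^2"
      unfolding L_def 1 2 nF norm_mult power_mult_distrib by (simp add: right_diff_distrib mult.assoc)
    ultimately have "L z = 4 * (real p)^2 * (\<Sum>(i, j)\<in>pairs. s i * s j * (norm (x i - x j))^2) / (\<Sum>i\<in>{1..N}. s i)^2"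
      by simp
    then have "L z / (2 * real p) = 2 * real p * ((\<Sum>(i, j)\<in>pairs. s i * s j * (norm (x i - x j))^2) / (\<Sum>i\<in>{1..N}. s i)^2)"
      using p by (simp add: power2_eq_square)
    also have "\<dots> = (\<Sum>(i, j)\<in>pairs. 2 * real p * pair_density p i j z)"
      unfolding sum_divide_distrib sum_distrib_left
    proof (intro sum.cong refl, clarify)
      fix i j assume ij: "(i, j) \<in> pairs"
      have nz: "z - a i \<noteq> 0" "z - a j \<noteq> 0" using ij z by (auto simp: pairs_def)
      have "x i - x j = 1 / (z - a j) - 1 / (z - a i)" by (simp add: x_def)
      also have "\<dots> = (a j - a i) / ((z - a i) * (z - a j))" using nz by (simp add: divide_simps)
      finally have "(norm (x i - x j))^2 = (norm (a i - a j))^2 / ((norm (z - a i))^2 * (norm (z - a j))^2)"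
        by (simp add: norm_divide norm_mult power_divide power_mult_distrib norm_minus_commute)
      then show "2 * real p * (s i * s j * (norm (x i - x j))^2 / (\<Sum>i\<in>{1..N}. s i)^2) = 2 * real p * pair_density p i j z"
        by (simp add: pair_density_def s_def)
    qed
    finally show ?thesis .
  qed
  ultimately show ?thesis by blast
qed

lemma continuous_softpot: "p \<ge> 1 \<Longrightarrow> continuous_on UNIV (softpot p)"
  using has_laplacian_softpot has_laplacian_continuous by blast

lemma continuous_maxpot: "continuous_on UNIV maxpot"
proof (rule uniform_limit_theorem[where F = sequentially])
  show "\<forall>\<^sub>F p in sequentially. continuous_on UNIV (softpot p)"
    using eventually_ge_at_top[of 1] by eventually_elim (rule continuous_softpot)
  show "uniform_limit UNIV softpot maxpot sequentially"
  proof (rule uniform_limitI)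
    fix e :: real assume "e > 0"
    have "(\<lambda>p. ln (real N) / (2 * real p)) \<longlonglongrightarrow> 0" by real_asymp
    from order_tendstoD(2)[OF this \<open>e > 0\<close>] eventually_ge_at_top[of 1]
    show "\<forall>\<^sub>F p in sequentially. \<forall>z\<in>UNIV. dist (softpot p z) (maxpot z) < e"
      by eventually_elim (use softpot_maxpot in \<open>auto simp: dist_real_def intro: le_less_trans\<close>)
  qed
qed simp

lemma integral_softpot_tendsto:
  assumes G: "continuous_on UNIV G" "\<And>z. R \<le> norm z \<Longrightarrow> G z = 0"
  shows "(\<lambda>p. \<integral>z. softpot p z * G z \<partial>lborel) \<longlonglongrightarrow> (LBINT z. maxpot z * G z)"
proof -
  have iG: "integrable lborel (\<lambda>z. \<bar>G z\<bar>)"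
    by (rule integrable_compact_support[where R = R]) (intro continuous_on_rabs G(1), simp add: G(2))
  have im: "integrable lborel (\<lambda>z. maxpot z * G z)"
    by (rule integrable_compact_support[where R = R]) (intro continuous_on_mult continuous_maxpot G(1), simp add: G(2))
  have "(\<lambda>p. (LBINT z. softpot p z * G z) - (LBINT z. maxpot z * G z)) \<longlonglongrightarrow> 0"
  proof (rule Lim_null_comparison)
    show "\<forall>\<^sub>F p in sequentially. norm ((LBINT z. softpot p z * G z) - (LBINT z. maxpot z * G z))
        \<le> ln (real N) / (2 * real p) * (LBINT z. \<bar>G z\<bar>)" using eventually_ge_at_top[of 1]
    proof eventually_elim
      case (elim p)
      have isf: "integrable lborel (\<lambda>z. softpot p z * G z)"
        by (rule integrable_compact_support[where R = R]) (intro continuous_on_mult continuous_softpot elim G(1), simp add: G(2))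
      have "norm ((LBINT z. softpot p z * G z) - (LBINT z. maxpot z * G z))
         = norm (LBINT z. softpot p z * G z - maxpot z * G z)" using isf im by simp
      also have "\<dots> \<le> (LBINT z. ln (real N) / (2 * real p) * \<bar>G z\<bar>)"
      proof (rule order_trans[OF integral_norm_bound Bochner_Integration.integral_mono])
        show "norm (softpot p z * G z - maxpot z * G z) \<le> ln (real N) / (2 * real p) * \<bar>G z\<bar>" for z
          unfolding left_diff_distrib[symmetric] real_norm_def abs_mult
          by (intro mult_right_mono softpot_maxpot elim) auto
      qed (use isf im iG in simp_all)
      finally show ?case by simp
    qed
    have "(\<lambda>p. ln (real N) / (2 * real p)) \<longlonglongrightarrow> 0" by real_asymp
    then show "(\<lambda>p. ln (real N) / (2 * real p) * (LBINT z. \<bar>G z\<bar>)) \<longlonglongrightarrow> 0" by (rule tendsto_mult_left_zero)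
  qed
  then show ?thesis by (rule LIM_zero_cancel)
qed

end

section \<open>The Laplacian of the maximum potential on Voronoi edges\<close>

lemma finite_if_at_most_one:
  assumes "\<And>x y. x \<in> S \<Longrightarrow> y \<in> S \<Longrightarrow> x = y"
  shows "finite S"
proof (cases "S = {}")
  case False
  then obtain x where "x \<in> S" by blast
  then have "S \<subseteq> {x}" using assms by blast
  then show ?thesis by (rule finite_subset) simp
qed simp

lemma AE_Im_not_in_finite:
  assumes "finite B" shows "AE w in lborel. Im w \<notin> B"
proof -
  have "AE w in lborel. \<forall>b\<in>B. Im w \<noteq> b"
  proof (rule AE_finite_allI[OF assms])
    fix b
    have "negligible {w :: complex. \<i> \<bullet> w = b}" by (rule negligible_hyperplane) simp
    then have "AE w in lebesgue. w \<notin> {w. Im w = b}"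
      by (intro AE_not_in) (simp add: negligible_iff_null_sets inner_complex_def)
    then have "AE w in lborel. w \<notin> {w. Im w = b}" by (simp only: AE_completion_iff)
    then show "AE w in lborel. Im w \<noteq> b" by simp
  qed
  then show ?thesis by eventually_elim blast
qed

lemma AE_real_not_in_finite:
  assumes "finite B" shows "AE t :: real in lborel. t \<notin> B"
  by (rule AE_not_in) (simp add: assms finite_imp_null_set_lborel)

lemma closed_voronoi_cell: "closed (voronoi_cell a N i)"
proof -
  have "voronoi_cell a N i = (\<Inter>j\<in>{1..N}. {z. norm (z - a i) \<le> norm (z - a j)})"
    by (auto simp: voronoi_cell_def)
  also have "closed \<dots>" by (intro closed_INT ballI closed_Collect_le continuous_intros)
  finally show ?thesis .
qed

lemma closed_voronoi_edge: "closed (voronoi_edge a N i j)"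
  unfolding voronoi_edge_def by (simp add: closed_Int closed_voronoi_cell)

section \<open>Coordinates on the bisector of one pair of sites\<close>

locale site_pair = sites +
  fixes i j :: nat
  assumes ij: "(i, j) \<in> pairs"
begin

definition d :: real where "d = norm (a i - a j)"
definition mid :: complex where "mid = (a i + a j) / 2"
definition dir :: complex where "dir = sgn (a j - a i)"
definition z0 :: "real \<Rightarrow> complex" where "z0 t = mid + of_real t * (\<i> * dir)"
text \<open>The squared distance from \<open>z0 t\<close> to either of the two sites.\<close>

definition rho2 :: "real \<Rightarrow> real" where "rho2 t = d^2 / 4 + t^2"
definition on_edge :: "real set" where "on_edge = {t. \<forall>k\<in>{1..N}. norm (z0 t - a i) \<le> norm (z0 t - a k)}"

lemma ij': "i \<in> {1..N}" "j \<in> {1..N}" "i \<noteq> j" using ij by (auto simp: pairs_def)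

lemma ai_ne_aj: "a i \<noteq> a j" using ij' inj by (auto simp: inj_on_eq_iff)

lemma d_pos: "d > 0" using ai_ne_aj by (simp add: d_def)

lemma norm_dir: "norm dir = 1" using ai_ne_aj by (simp add: dir_def norm_sgn)

lemma rho2_pos: "rho2 t > 0" using d_pos by (simp add: rho2_def add_pos_nonneg)

lemma ends: "a i = mid - dir * of_real (d / 2)" "a j = mid + dir * of_real (d / 2)"
proof -
  have "dir * of_real d = a j - a i" using ai_ne_aj by (simp add: dir_def d_def sgn_eq norm_minus_commute)
  then have h: "dir * of_real (d / 2) = (a j - a i) / 2" by simp
  show "a i = mid - dir * of_real (d / 2)" "a j = mid + dir * of_real (d / 2)"
    unfolding h by (simp_all add: mid_def field_simps)
qed

lemma norm_coords:
  "(norm (mid + dir * Complex s t - a i))^2 = (s + d / 2)^2 + t^2"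
  "(norm (mid + dir * Complex s t - a j))^2 = (s - d / 2)^2 + t^2"
proof -
  have "mid + dir * Complex s t - a i = dir * Complex (s + d / 2) t"
    unfolding ends(1) by (simp add: complex_eq_iff algebra_simps)
  then show "(norm (mid + dir * Complex s t - a i))^2 = (s + d / 2)^2 + t^2"
    by (simp add: norm_mult norm_dir cmod_power2)
  have "mid + dir * Complex s t - a j = dir * Complex (s - d / 2) t"
    unfolding ends(2) by (simp add: complex_eq_iff algebra_simps)
  then show "(norm (mid + dir * Complex s t - a j))^2 = (s - d / 2)^2 + t^2"
    by (simp add: norm_mult norm_dir cmod_power2)
qed

lemma z0_eq: "z0 t = mid + dir * Complex 0 t" by (simp add: z0_def complex_eq_iff)

lemma norm_z0: "(norm (z0 t - a i))^2 = rho2 t" "(norm (z0 t - a j))^2 = rho2 t"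
  unfolding z0_eq norm_coords rho2_def by (simp_all add: power_divide)

lemma norm_z0': "norm (z0 t - a i) = sqrt (rho2 t)" "norm (z0 t - a j) = sqrt (rho2 t)"
  using norm_z0[of t] by (metis norm_ge_zero real_sqrt_abs abs_of_nonneg)+

lemma continuous_z0: "continuous_on A z0" unfolding z0_def by (intro continuous_intros)

lemma measurable_z0 [measurable]: "z0 \<in> borel_measurable borel"
  using continuous_z0 by (rule borel_measurable_continuous_onI)

text \<open>The tie condition is the linear equation \<open>x^2 + y^2 - 2 t y = d^2 / 4\<close> in
  \<open>t\<close>, where \<open>x\<close> and \<open>y\<close> are the coordinates of
  \<open>a k\<close> along the segment and along the bisector. It has more than one solution only if
  \<open>y = 0\<close> and \<open>x = \<plusminus> d / 2\<close>, that is, if \<open>a k\<close> is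
  one of the two sites.\<close>

lemma finite_ties: "finite {t. \<exists>k\<in>{1..N} - {i, j}. norm (z0 t - a k) = norm (z0 t - a i)}"
proof -
  have "finite {t. norm (z0 t - a k) = norm (z0 t - a i)}" if k: "k \<in> {1..N} - {i, j}" for k
  proof (rule finite_if_at_most_one)
    define b where "b = (a k - mid) * cnj dir"
    define x y where "x = Re b" and "y = Im b"
    have dd: "dir * cnj dir = 1" using norm_dir by (metis complex_norm_square of_real_1 power_one)
    have "Complex x y = b" by (simp add: x_def y_def)
    then have "dir * Complex x y = (a k - mid) * (dir * cnj dir)" by (simp only: b_def mult_ac)
    then have ak: "a k = mid + dir * Complex x y" using dd by simp
    have ne: "a k \<noteq> a i" "a k \<noteq> a j" using k ij' inj by (auto simp: inj_on_eq_iff)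
    have eqn: "x^2 + y^2 - 2 * t * y = d^2 / 4" if t: "norm (z0 t - a k) = norm (z0 t - a i)" for t
    proof -
      have "z0 t - a k = dir * Complex (- x) (t - y)" unfolding z0_eq ak by (simp add: complex_eq_iff algebra_simps)
      then have "(norm (z0 t - a k))^2 = x^2 + (t - y)^2" by (simp add: norm_mult norm_dir cmod_power2)
      then have "x^2 + (t - y)^2 = d^2 / 4 + t^2" using t norm_z0(1)[of t] by (simp add: rho2_def)
      then show ?thesis by (simp add: power2_eq_square algebra_simps)
    qed
    fix s t assume "s \<in> {t. norm (z0 t - a k) = norm (z0 t - a i)}" "t \<in> {t. norm (z0 t - a k) = norm (z0 t - a i)}"
    then have e: "x^2 + y^2 - 2 * s * y = d^2 / 4" "x^2 + y^2 - 2 * t * y = d^2 / 4" using eqn by auto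
    then have "s * y = t * y" by linarith
    moreover have "y \<noteq> 0"
    proof
      assume y: "y = 0"
      then have "x^2 = (d / 2)^2" using e(1) by (simp add: power_divide)
      then have "x = d / 2 \<or> x = - (d / 2)" by (rule power2_eq_iff[THEN iffD1])
      then have "Complex x y = of_real (d / 2) \<or> Complex x y = - of_real (d / 2)" using y by (auto simp: complex_eq_iff)
      then show False using ak ends ne by auto
    qed
    ultimately show "s = t" by simp
  qed
  then have "finite (\<Union>k\<in>{1..N} - {i, j}. {t. norm (z0 t - a k) = norm (z0 t - a i)})" by blast
  moreover have "{t. \<exists>k\<in>{1..N} - {i, j}. norm (z0 t - a k) = norm (z0 t - a i)} =
    (\<Union>k\<in>{1..N} - {i, j}. {t. norm (z0 t - a k) = norm (z0 t - a i)})" by blast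
  ultimately show ?thesis by simp
qed

lemma on_edge_iff: "t \<in> on_edge \<longleftrightarrow> z0 t \<in> voronoi_cell a N i \<inter> voronoi_cell a N j"
  unfolding on_edge_def voronoi_cell_def by (auto simp: norm_z0')

lemma cells_subset_bisector:
  assumes "z \<in> voronoi_cell a N i \<inter> voronoi_cell a N j"
  obtains t where "z = z0 t"
proof -
  have eq: "norm (z - a i) = norm (z - a j)" using assms ij' unfolding voronoi_cell_def by (auto intro: antisym)
  define b where "b = (z - mid) * cnj dir"
  have dd: "dir * cnj dir = 1" using norm_dir by (metis complex_norm_square of_real_1 power_one)
  have "Complex (Re b) (Im b) = b" by simp
  then have "dir * Complex (Re b) (Im b) = (z - mid) * (dir * cnj dir)" by (simp only: b_def mult_ac)
  then have z: "z = mid + dir * Complex (Re b) (Im b)" using dd by simp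
  have "(norm (z - a i))^2 = (norm (z - a j))^2" using eq by simp
  then have "(Re b + d / 2)^2 = (Re b - d / 2)^2" by (subst (asm) (1 2) z) (simp only: norm_coords add_right_cancel)
  then have "Re b * d = 0" by (simp add: power2_eq_square algebra_simps)
  then have "Re b = 0" using d_pos by simp
  then have "z = z0 (Im b)" using z by (simp add: z0_eq)
  then show ?thesis by (rule that)
qed

lemma z0_inj: "z0 s = z0 t \<Longrightarrow> s = t" using norm_dir by (auto simp: z0_def)

text \<open>If the cells do not meet in dimension one, the edge is empty by definition while
  \<open>on_edge\<close> may still contain a parameter. Two distinct parameters would force
  dimension one, so there is at most one, which is a null set.\<close>

lemma AE_edge: "AE t in lborel. indicator (voronoi_edge a N i j) (z0 t) = (indicator on_edge t :: real)"
proof (cases "aff_dim (voronoi_cell a N i \<inter> voronoi_cell a N j) = 1")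
  case True
  then show ?thesis by (simp add: voronoi_edge_def indicator_def on_edge_iff)
next
  case False
  have "s = t" if s: "s \<in> on_edge" and t: "t \<in> on_edge" for s t
  proof (rule ccontr)
    assume "s \<noteq> t"
    let ?C = "voronoi_cell a N i \<inter> voronoi_cell a N j"
    have "aff_dim {z0 s, z0 t} \<le> aff_dim ?C" by (rule aff_dim_subset) (use s t on_edge_iff in blast)
    moreover have "aff_dim {z0 s, z0 t} = 1" using z0_inj \<open>s \<noteq> t\<close> by (simp add: aff_dim_2) blast?
    moreover have "aff_dim ?C \<le> 1"
    proof -
      have "?C \<subseteq> affine hull {z0 0, z0 1}"
      proof
        fix z assume "z \<in> ?C"
        then obtain r where "z = z0 r" by (rule cells_subset_bisector)
        then have "z = (1 - r) *\<^sub>R z0 0 + r *\<^sub>R z0 1" by (simp add: z0_def scaleR_conv_of_real algebra_simps)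
        then show "z \<in> affine hull {z0 0, z0 1}" unfolding affine_hull_2
          by (intro CollectI exI[of _ "1 - r"] exI[of _ r] conjI) simp_all
      qed
      then have "aff_dim ?C \<le> aff_dim (affine hull {z0 0, z0 1})" by (rule aff_dim_subset)
      also have "\<dots> = aff_dim {z0 0, z0 1}" by (rule aff_dim_affine_hull)
      also have "\<dots> \<le> 1" by (simp add: aff_dim_2)
      finally show ?thesis .
    qed
    ultimately show False using False by linarith
  qed
  then have "finite on_edge" by (rule finite_if_at_most_one)
  from AE_real_not_in_finite[OF this] show ?thesis
    by eventually_elim (use False in \<open>simp add: voronoi_edge_def\<close>)
qed

lemma closed_on_edge: "closed on_edge"
proof -
  have "on_edge = z0 -` (voronoi_cell a N i \<inter> voronoi_cell a N j)" using on_edge_iff by blast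
  also have "closed \<dots>" by (intro continuous_closed_vimage closed_Int closed_voronoi_cell)
      (use continuous_z0[of UNIV] in \<open>simp add: continuous_on_eq_continuous_at\<close>)
  finally show ?thesis .
qed

text \<open>The primitive is \<open>2 arctan (2 t / d)\<close>. The total \<open>2 pi\<close> over
  the whole bisector makes every edge measure finite, also for unbounded edges.\<close>

lemma integrable_edge_weight: "has_bochner_integral lborel (\<lambda>t. d / rho2 t) (2 * pi)"
proof -
  have "has_bochner_integral lborel (\<lambda>t. d / rho2 t) (pi - (- pi))"
  proof (rule has_bochner_integral_real_line)
    show "((\<lambda>t. 2 * arctan (2 / d * t)) has_real_derivative d / rho2 t) (at t)" for t
    proof -
      have "((\<lambda>t. 2 * arctan (2 / d * t)) has_real_derivative 2 * (inverse (1 + (2 / d * t)^2) * (2 / d))) (at t)"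
        by (intro DERIV_cmult DERIV_chain2[OF DERIV_arctan]) (use d_pos in \<open>auto intro!: derivative_eq_intros\<close>)
      also have "2 * (inverse (1 + (2 / d * t)^2) * (2 / d)) = d / rho2 t"
      proof -
        have "1 + (2 / d * t)^2 = rho2 t * (4 / d^2)"
          using d_pos by (simp add: rho2_def field_simps power2_eq_square)
        then have "2 * (inverse (1 + (2 / d * t)^2) * (2 / d)) = 2 * (d^2 / (4 * rho2 t) * (2 / d))"
          using d_pos by (simp add: field_simps)
        also have "\<dots> = d / rho2 t" using d_pos by (simp add: power2_eq_square)
        finally show ?thesis .
      qed
      finally show ?thesis .
    qed
    show "isCont (\<lambda>t. d / rho2 t) t" for t
      unfolding rho2_def using rho2_pos[of t] by (intro continuous_intros) (simp add: rho2_def)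
    have f: "filterlim (\<lambda>t. 2 / d * t) at_top at_top" "filterlim (\<lambda>t. 2 / d * t) at_bot at_bot"
      using d_pos by (intro filterlim_tendsto_pos_mult_at_top[OF tendsto_const _ filterlim_ident]
          filterlim_tendsto_pos_mult_at_bot[OF tendsto_const _ filterlim_ident]; simp)+
    show "((\<lambda>t. 2 * arctan (2 / d * t)) \<longlongrightarrow> pi) at_top"
      using tendsto_mult[OF tendsto_const[of 2] filterlim_compose[OF tendsto_arctan_at_top f(1)]] by simp
    show "((\<lambda>t. 2 * arctan (2 / d * t)) \<longlongrightarrow> - pi) at_bot"
      using tendsto_mult[OF tendsto_const[of 2] filterlim_compose[OF tendsto_arctan_at_bot f(2)]] by simp
  qed (use d_pos rho2_pos in \<open>auto intro: less_imp_le\<close>)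
  then show ?thesis by simp
qed

lemma measurable_rho2 [measurable]: "rho2 \<in> borel_measurable borel" unfolding rho2_def[abs_def] by measurable

definition weight :: "complex \<Rightarrow> real" where
  "weight z = norm (a i - a j) / (norm (z - a i) * norm (z - a j)) * indicator (voronoi_edge a N i j) z"

lemma measurable_weight [measurable]: "weight \<in> borel_measurable borel"
proof -
  have [measurable]: "voronoi_edge a N i j \<in> sets borel" using closed_voronoi_edge by (rule borel_closed)
  show ?thesis unfolding weight_def by measurable
qed

lemma weight_nonneg: "weight z \<ge> 0" by (simp add: weight_def)

lemma edge_measure_eq: "edge_measure a N i j = density (distr lborel borel z0) (\<lambda>z. ennreal (weight z))"
proof -
  have "bisector_arclength (a i) (a j) = distr lborel borel z0"
    unfolding bisector_arclength_def z0_def[abs_def] mid_def dir_def ..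
  moreover have "(\<lambda>z. ennreal (norm (a i - a j) / (norm (z - a i) * norm (z - a j))) * indicator (voronoi_edge a N i j) z)
     = (\<lambda>z. ennreal (weight z))" by (auto simp: fun_eq_iff weight_def indicator_def)
  ultimately show ?thesis unfolding edge_measure_def by simp
qed

lemma AE_weight: "AE t in lborel. weight (z0 t) = d / rho2 t * indicator on_edge t" using AE_edge
proof eventually_elim
  case (elim t)
  have "norm (z0 t - a i) * norm (z0 t - a j) = rho2 t" using rho2_pos[of t] by (simp add: norm_z0')
  then show ?case unfolding weight_def elim by (simp add: d_def)
qed

lemma integral_edge_measure:
  fixes g :: "complex \<Rightarrow> real"
  assumes [measurable]: "g \<in> borel_measurable borel"
  shows "(\<integral>z. g z \<partial>edge_measure a N i j) = (LBINT t. d / rho2 t * indicator on_edge t * g (z0 t))"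
proof -
  have [measurable]: "on_edge \<in> sets borel" using closed_on_edge by (rule borel_closed)
  have "(\<integral>z. g z \<partial>edge_measure a N i j) = (\<integral>z. weight z * g z \<partial>distr lborel borel z0)"
    unfolding edge_measure_eq by (subst integral_density) (auto simp: weight_nonneg)
  also have "\<dots> = (LBINT t. weight (z0 t) * g (z0 t))" by (subst integral_distr) auto
  also have "\<dots> = (LBINT t. d / rho2 t * indicator on_edge t * g (z0 t))"
    by (rule integral_cong_AE) (measurable, use AE_weight in eventually_elim, simp)
  finally show ?thesis .
qed

lemma sets_edge_measure: "sets (edge_measure a N i j) = sets borel" by (simp add: edge_measure_eq)

lemma finite_measure_edge: "finite_measure (edge_measure a N i j)"
proof
  have "emeasure (edge_measure a N i j) UNIV = (\<integral>\<^sup>+z. ennreal (weight z) \<partial>distr lborel borel z0)"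
    unfolding edge_measure_eq by (subst emeasure_density) auto
  also have "\<dots> = (\<integral>\<^sup>+t. ennreal (weight (z0 t)) \<partial>lborel)" by (subst nn_integral_distr) auto
  also have "\<dots> \<le> (\<integral>\<^sup>+t. ennreal (d / rho2 t) \<partial>lborel)"
  proof (rule nn_integral_mono_AE)
    show "AE t in lborel. ennreal (weight (z0 t)) \<le> ennreal (d / rho2 t)" using AE_weight
    proof eventually_elim
      case (elim t)
      have "0 \<le> d / rho2 t" using d_pos rho2_pos[of t] by simp
      then show ?case unfolding elim by (intro ennreal_leI) (simp add: indicator_def)
    qed
  qed
  also have "\<dots> = ennreal (2 * pi)" using integrable_edge_weight d_pos rho2_pos
    by (subst nn_integral_eq_integral)
      (auto simp: has_bochner_integral_iff intro!: AE_I2 divide_nonneg_nonneg intro: less_imp_le)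
  finally have "emeasure (edge_measure a N i j) UNIV < \<infinity>" by (rule le_less_trans) simp
  then show "emeasure (edge_measure a N i j) (space (edge_measure a N i j)) \<noteq> \<infinity>"
    by (simp add: edge_measure_eq)
qed

section \<open>Concentration of the soft Laplacian along the bisector\<close>

lemma pair_density_nonneg: "pair_density p k l z \<ge> 0"
  unfolding pair_density_def by (intro mult_nonneg_nonneg divide_nonneg_nonneg zero_le_power side_nonneg)
    (simp_all add: sum_nonneg side_nonneg)

lemma pair_density_commute: "pair_density p k l z = pair_density p l k z"
  unfolding pair_density_def by (simp add: norm_minus_commute mult.commute)

lemma side_power_ratio:
  assumes "k \<in> {1..N}" "l \<in> {1..N}" "z \<noteq> a k"
  shows "side k z ^ p = side l z ^ p * ((norm (z - a l))^2 / (norm (z - a k))^2) ^ p"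
proof -
  have "side k z * (norm (z - a k))^2 = side l z * (norm (z - a l))^2"
    using side_mult[OF assms(1), of z] side_mult[OF assms(2), of z] by simp
  then have "side k z = side l z * ((norm (z - a l))^2 / (norm (z - a k))^2)"
    using assms(3) by (simp add: field_simps)
  then show ?thesis by (simp only: power_mult_distrib)
qed

text \<open>Bounding the sum below by its \<open>l\<close>-th term leaves
  \<open>(y / x) ^ p\<close>, with \<open>x\<close> and \<open>y\<close> the squared distances to
  \<open>a k\<close> and \<open>a l\<close>. One of the \<open>p\<close> factors is spent on the
  pole \<open>1 / y\<close> at \<open>a l\<close>; the remaining \<open>1 / x^2\<close> is bounded
  by the hypothesis on the distance to \<open>a k\<close>.\<close>

lemma pair_density_le:
  assumes kl: "k \<in> {1..N}" "l \<in> {1..N}" and p: "p \<ge> 2"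
    and A: "(norm (a k - a l))^2 / 4 \<le> (norm (z - a k))^2" "a k \<noteq> a l"
  shows "pair_density p k l z \<le> 16 / (norm (a k - a l))^2 * ((norm (z - a l))^2 / (norm (z - a k))^2) ^ (p - 1)"
proof (cases "z = a l")
  case True
  then show ?thesis by (simp add: pair_density_def)
next
  case False
  define D2 where "D2 = (norm (a k - a l))^2"
  define x y where "x = (norm (z - a k))^2" and "y = (norm (z - a l))^2"
  define S where "S = (\<Sum>k\<in>{1..N}. side k z ^ p)"
  have D2: "D2 > 0" using A by (simp add: D2_def)
  have x: "x > 0" "D2 / 4 \<le> x" using A D2 by (auto simp: x_def D2_def)
  have y: "y > 0" using False by (simp add: y_def)
  have zk: "z \<noteq> a k" using x by (auto simp: x_def)
  have S: "S > 0" unfolding S_def by (rule sum_side_pos)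
  have sl: "side l z ^ p \<le> S" unfolding S_def by (rule member_le_sum[OF kl(2)]) (simp_all add: side_nonneg)
  have "side k z ^ p = side l z ^ p * (y / x) ^ p" unfolding x_def y_def by (rule side_power_ratio[OF kl zk])
  then have "side k z ^ p * side l z ^ p / S^2 = (side l z ^ p / S)^2 * (y / x) ^ p"
    by (simp add: power2_eq_square)
  also have "\<dots> \<le> 1 * (y / x) ^ p"
  proof (rule mult_right_mono)
    have "side l z ^ p / S \<le> 1" "0 \<le> side l z ^ p / S" using sl S side_nonneg[of l z] by simp_all
    then show "(side l z ^ p / S)^2 \<le> 1" by (intro power_le_one)
  qed (use x y in simp)
  finally have "pair_density p k l z \<le> (y / x) ^ p * (D2 / (x * y))"
    unfolding pair_density_def S_def[symmetric] D2_def[symmetric] x_def[symmetric] y_def[symmetric]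
    using D2 x y by (intro mult_right_mono) simp_all
  also have "\<dots> = (y / x) ^ (p - 1) * (D2 / x^2)"
  proof -
    obtain q where "p = Suc q" using p by (cases p) auto
    then show ?thesis using x y by (simp add: power2_eq_square)
  qed
  also have "\<dots> \<le> (y / x) ^ (p - 1) * (16 / D2)"
  proof (rule mult_left_mono)
    have "D2 * D2 \<le> (4 * x) * (4 * x)" using x D2 by (intro mult_mono) auto
    then show "D2 / x^2 \<le> 16 / D2" using D2 x by (simp add: field_simps power2_eq_square)
  qed (use x y in simp)
  finally show ?thesis unfolding D2_def x_def y_def by (simp add: mult.commute)
qed

text \<open>
  The soft maximum switches from one site to the other within distance \<open>O(1/p)\<close> of their
  bisector; \<open>pt\<close> rescales the normal coordinate accordingly.
\<close>

definition pt :: "nat \<Rightarrow> complex \<Rightarrow> complex" where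
  "pt p w = mid + dir * Complex (1 / real p * Re w) (1 * Im w)"

lemma pt_coords:
  "(norm (pt p w - a i))^2 = (Re w / real p + d / 2)^2 + (Im w)^2"
  "(norm (pt p w - a j))^2 = (Re w / real p - d / 2)^2 + (Im w)^2" unfolding pt_def norm_coords by simp_all

text \<open>An integrable majorant independent of \<open>p\<close>. On the side of
  \<open>a j\<close>, which is \<open>Re w \<ge> 0\<close>, one has
  \<open>x - y = 2 d (Re w) / p\<close>, so \<open>(y / x) ^ (p - 1)\<close> is at most
  \<open>exp (- d (Re w) / L^2)\<close>, where \<open>L\<close> enters through
  \<open>x \<le> L^2\<close>. The other side follows by exchanging the two sites.\<close>

lemma pair_density_decay:
  assumes p: "p \<ge> 2" and L: "norm (pt p w - a i) \<le> L" "norm (pt p w - a j) \<le> L"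
  shows "pair_density p i j (pt p w) \<le> 16 / d^2 * inverse (1 + (d / (2 * L^2) * Re w)^2)"
proof -
  have key: "pair_density p k l (pt p w) \<le> 16 / d^2 * inverse (1 + (d / (2 * L^2) * \<sigma>)^2)"
    if kl: "k \<in> {1..N}" "l \<in> {1..N}" "norm (a k - a l) = d" "norm (pt p w - a k) \<le> L"
      and k2: "(norm (pt p w - a k))^2 = (\<sigma> / real p + d / 2)^2 + (Im w)^2"
      and l2: "(norm (pt p w - a l))^2 = (\<sigma> / real p - d / 2)^2 + (Im w)^2"
      and \<sigma>: "\<sigma> \<ge> 0" for k l \<sigma>
  proof -
    define x y where "x = (norm (pt p w - a k))^2" and "y = (norm (pt p w - a l))^2"
    have "(d / 2)^2 \<le> (\<sigma> / real p + d / 2)^2" using \<sigma> d_pos by (intro power_mono) auto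
    then have x4: "d^2 / 4 \<le> x" unfolding x_def k2 by (simp add: power_divide add_increasing2)
    have x: "x > 0" using x4 d_pos by (smt (verit) zero_less_divide_iff zero_less_power)
    have xL: "x \<le> L^2" unfolding x_def using kl(4) by (intro power_mono) auto
    have L2: "L^2 > 0" using x xL by linarith
    have xy: "x - y = 2 * d * \<sigma> / real p" unfolding x_def y_def k2 l2 by (simp add: power2_eq_square algebra_simps)
    define \<eta> where "\<eta> = 2 * d * \<sigma> / (real p * L^2)"
    have "y / x = 1 - (x - y) / x" using x by (simp add: field_simps)
    also have "\<dots> = 1 - 2 * d * \<sigma> / (real p * x)" by (simp add: xy)
    also have "\<dots> \<le> 1 - \<eta>"
      unfolding \<eta>_def using \<sigma> d_pos p x xL L2 by (intro diff_left_mono divide_left_mono mult_left_mono mult_pos_pos) auto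
    also have "\<dots> \<le> exp (- \<eta>)" using exp_ge_add_one_self[of "- \<eta>"] by simp
    finally have "(y / x) ^ (p - 1) \<le> exp (- \<eta>) ^ (p - 1)" using x by (intro power_mono) (auto simp: y_def)
    also have "\<dots> = exp (- (real (p - 1) * \<eta>))" by (simp flip: exp_of_nat_mult)
    also have "\<dots> \<le> exp (- (d / L^2 * \<sigma>))"
    proof -
      \<comment> \<open>Here \<open>p \<ge> 2\<close> compensates for the factor
        \<open>y / x\<close> spent on the pole.\<close>
      have "1 \<le> 2 * (real (p - 1) / real p)" using p by (simp add: field_simps of_nat_diff)
      then have "1 * (d * \<sigma> / L^2) \<le> 2 * (real (p - 1) / real p) * (d * \<sigma> / L^2)"
        using d_pos \<sigma> p by (intro mult_right_mono) simp_all
      also have "2 * (real (p - 1) / real p) * (d * \<sigma> / L^2) = real (p - 1) * \<eta>" by (simp add: \<eta>_def)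
      finally show ?thesis by simp
    qed
    \<comment> \<open>The exponential is weakened to a function that is even in \<open>Re w\<close>,
      hence one formula for both sides, and that has an arctangent as primitive.\<close>
    also have "\<dots> \<le> inverse (1 + (d / (2 * L^2) * \<sigma>)^2)"
    proof -
      define q where "q = d / L^2 * \<sigma>"
      have q: "q \<ge> 0" using d_pos \<sigma> by (simp add: q_def)
      have "1 + (q / 2)^2 \<le> 1 + q + q^2 / 2" using q by (simp add: power_divide)
      also have "\<dots> \<le> exp q" by (rule exp_lower_Taylor_quadratic[OF q])
      finally have "inverse (exp q) \<le> inverse (1 + (q / 2)^2)"
        by (intro le_imp_inverse_le) (auto simp: add_pos_nonneg)
      then show ?thesis by (simp add: exp_minus q_def mult_ac)
    qed
    finally have pw: "(y / x) ^ (p - 1) \<le> inverse (1 + (d / (2 * L^2) * \<sigma>)^2)" .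
    have "a k \<noteq> a l" using kl(3) d_pos by auto
    then have "pair_density p k l (pt p w) \<le> 16 / d^2 * (y / x) ^ (p - 1)"
      using pair_density_le[OF kl(1,2) p, of "pt p w"] x4 unfolding kl(3) x_def y_def by blast
    also have "\<dots> \<le> 16 / d^2 * inverse (1 + (d / (2 * L^2) * \<sigma>)^2)" using pw by (intro mult_left_mono) auto
    finally show ?thesis .
  qed
  show ?thesis
  proof (cases "Re w \<ge> 0")
    case True
    show ?thesis by (rule key[OF ij'(1,2) _ L(1) pt_coords True]) (simp add: d_def)
  next
    case False
    have d': "norm (a j - a i) = d" unfolding d_def by (rule norm_minus_commute)
    have e: "(Re w / real p - d / 2)^2 = (- Re w / real p + d / 2)^2"
      "(Re w / real p + d / 2)^2 = (- Re w / real p - d / 2)^2"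
      by (simp_all add: power2_eq_square algebra_simps)
    have "pair_density p j i (pt p w) \<le> 16 / d^2 * inverse (1 + (d / (2 * L^2) * (- Re w))^2)"
      by (rule key[OF ij'(2,1) d' L(2) pt_coords(2)[of p w, unfolded e(1)] pt_coords(1)[of p w, unfolded e(2)]]) (use False in simp)
    then show ?thesis by (simp add: pair_density_commute[of p i j])
  qed
qed

lemma decay_integrable:
  assumes k: "k > 0"
  shows "integrable lborel (\<lambda>w. inverse (1 + (k * Re w)^2) * indicator {- T..T} (Im w))"
proof (rule integrableI_nonneg)
  have b: "has_bochner_integral lborel (\<lambda>x. inverse (1 + (k * x)^2)) (pi / 2 / k - (- (pi / 2) / k))"
  proof (rule has_bochner_integral_real_line)
    show "((\<lambda>x. arctan (k * x) / k) has_real_derivative inverse (1 + (k * x)^2)) (at x)" for x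
      by (rule DERIV_cong[OF DERIV_cdivide[OF DERIV_chain2[OF DERIV_arctan DERIV_cmult[OF DERIV_ident]]]]) (use k in simp)
    show "((\<lambda>x. arctan (k * x) / k) \<longlongrightarrow> pi / 2 / k) at_top" using k by (real_asymp simp: field_simps)
    show "((\<lambda>x. arctan (k * x) / k) \<longlongrightarrow> - (pi / 2) / k) at_bot" using k by (real_asymp simp: field_simps)
    show "isCont (\<lambda>x. inverse (1 + (k * x)^2)) x" for x
    proof -
      have "1 + (k * x)^2 > 0" by (intro add_pos_nonneg) simp_all
      then show ?thesis by (intro continuous_intros) simp
    qed
  qed simp
  have "(\<integral>\<^sup>+w. ennreal (inverse (1 + (k * Re w)^2) * indicator {- T..T} (Im w)) \<partial>lborel)
     = (\<integral>\<^sup>+y. \<integral>\<^sup>+x. ennreal (inverse (1 + (k * x)^2)) * indicator {- T..T} y \<partial>lborel \<partial>lborel)"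
    by (subst nn_integral_complex(2), measurable) (simp add: ennreal_mult'' ennreal_indicator)
  also have "\<dots> = (\<integral>\<^sup>+y\<in>{- T..T}. ennreal (pi / 2 / k - (- (pi / 2) / k)) \<partial>lborel)"
    using b by (simp add: nn_integral_multc nn_integral_eq_integral has_bochner_integral_iff)
  also have "\<dots> < \<infinity>"
    using emeasure_bounded_finite[of "{- T..T}"] by (simp add: nn_integral_cmult_indicator ennreal_mult_less_top)
  finally show "(\<integral>\<^sup>+w. ennreal (inverse (1 + (k * Re w)^2) * indicator {- T..T} (Im w)) \<partial>lborel) < \<infinity>" .
qed auto

text \<open>On the edge the ratios \<open>side k ^ p / side i ^ p\<close> tend to 1,
  \<open>exp c\<close> and 0 for \<open>k = i\<close>, \<open>k = j\<close> and all others, which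
  gives the logistic expression. Off the edge some third site is strictly closer and its term
  outweighs both numerators. Ties are excluded because there a third ratio may survive in the
  limit.\<close>

lemma pair_density_pt_tendsto:
  assumes t: "t = Im w" and no_tie: "\<And>k. k \<in> {1..N} - {i, j} \<Longrightarrow> norm (z0 t - a k) \<noteq> norm (z0 t - a i)"
  shows "(\<lambda>p. pair_density p i j (pt p w)) \<longlonglongrightarrow>
    exp (2 * d / rho2 t * Re w) / (1 + exp (2 * d / rho2 t * Re w))^2 * (d^2 / (rho2 t * rho2 t)) * indicator on_edge t"
proof -
  define c where "c = 2 * d / rho2 t * Re w"
  define A where "A k p = (norm (pt p w - a k))^2" for k p
  have "(\<lambda>p. 1 / real p) \<longlonglongrightarrow> 0" by (rule lim_1_over_n)
  then have "(\<lambda>p. mid + dir * (of_real (1 / real p * Re w) + \<i> * of_real (Im w))) \<longlonglongrightarrow> mid + dir * (of_real (0 * Re w) + \<i> * of_real (Im w))"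
    by (intro tendsto_intros)
  then have ptl: "(\<lambda>p. pt p w) \<longlonglongrightarrow> z0 t" by (simp add: pt_def z0_eq t Complex_eq)
  have Al: "(\<lambda>p. A k p) \<longlonglongrightarrow> (norm (z0 t - a k))\<^sup>2" for k unfolding A_def by (intro tendsto_intros ptl)
  have Ai: "(\<lambda>p. A i p) \<longlonglongrightarrow> rho2 t" and Aj: "(\<lambda>p. A j p) \<longlonglongrightarrow> rho2 t"
    using Al[of i] Al[of j] by (simp_all add: norm_z0)
  have r0: "rho2 t > 0" "rho2 t \<noteq> 0" using rho2_pos[of t] by simp_all
  have A0: "A k p \<ge> 0" for k p by (simp add: A_def)
  have evA: "\<forall>\<^sub>F p in sequentially. pt p w \<noteq> a k" if "norm (z0 t - a k) > 0" for k
    using order_tendstoD(1)[OF Al[of k], of 0] that by (auto elim!: eventually_mono simp: A_def)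
  have Dl: "(\<lambda>p. d^2 / (A i p * A j p)) \<longlonglongrightarrow> d\<^sup>2 / (rho2 t * rho2 t)"
    by (intro tendsto_intros Ai Aj) (use r0 in simp)
  define X where "X p = side i (pt p w) ^ p * side j (pt p w) ^ p / (\<Sum>k\<in>{1..N}. side k (pt p w) ^ p)^2" for p
  have pd: "pair_density p i j (pt p w) = X p * (d^2 / (A i p * A j p))" for p
    by (simp add: pair_density_def X_def d_def A_def)
  have "X \<longlonglongrightarrow> exp c / (1 + exp c)^2 * indicator on_edge t"
  proof (cases "t \<in> on_edge")
    case True
    have far: "rho2 t < (norm (z0 t - a k))^2" if k: "k \<in> {1..N} - {i, j}" for k
    proof -
      have "norm (z0 t - a i) \<le> norm (z0 t - a k)" using True k by (auto simp: on_edge_def)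
      then have "norm (z0 t - a i) < norm (z0 t - a k)" using no_tie[OF k] by simp
      then have "(norm (z0 t - a i))^2 < (norm (z0 t - a k))^2" by (intro power_strict_mono) auto
      then show ?thesis by (simp add: norm_z0)
    qed
    have ge: "rho2 t \<le> (norm (z0 t - a k))^2" if "k \<in> {1..N}" for k
      using far[of k] norm_z0[of t] that by (cases "k = i \<or> k = j") auto
    define r where "r k p = (A i p / A k p) ^ p" for k p
    define l where "l k = (if k = i then 1 else if k = j then exp c else 0)" for k
    have ev: "\<forall>\<^sub>F p in sequentially. \<forall>k\<in>{1..N}. pt p w \<noteq> a k"
    proof (rule eventually_ball_finite)
      show "\<forall>k\<in>{1..N}. \<forall>\<^sub>F p in sequentially. pt p w \<noteq> a k"
        using ge r0(1) by (intro ballI evA) (metis less_le_trans norm_ge_zero less_eq_real_def power_zero_numeral less_irrefl)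
    qed simp
    have rl: "(\<lambda>p. r k p) \<longlonglongrightarrow> l k" if k: "k \<in> {1..N}" for k
    proof -
      consider "k = i" | "k = j" | "k \<in> {1..N} - {i, j}" using k by blast
      then show ?thesis
      proof cases
        case 1
        have "\<forall>\<^sub>F p in sequentially. r k p = 1"
          using ev by eventually_elim (use ij' 1 in \<open>auto simp: r_def A_def\<close>)
        then show ?thesis using 1 by (simp add: l_def tendsto_eventually)
      next
        case 2
        \<comment> \<open>As \<open>A i p - A j p = 2 d (Re w) / p\<close> exactly, the ratio is
          \<open>(1 + y p / p) ^ p\<close> with convergent \<open>y p\<close>.\<close>
        have "(\<lambda>p. 2 * d * Re w / A j p) \<longlonglongrightarrow> 2 * d * Re w / rho2 t" by (intro tendsto_intros Aj r0)
        then have "(\<lambda>p. (1 + 2 * d * Re w / A j p / real p) ^ p) \<longlonglongrightarrow> exp (2 * d * Re w / rho2 t)"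
          by (rule tendsto_power_exp)
        moreover have "\<forall>\<^sub>F p in sequentially. (1 + 2 * d * Re w / A j p / real p) ^ p = r k p" using ev
        proof eventually_elim
          case (elim p)
          have "A i p - A j p = 2 * d * Re w / real p"
            unfolding A_def pt_coords by (simp add: power2_eq_square algebra_simps)
          moreover have "A j p \<noteq> 0" using elim ij' by (auto simp: A_def)
          ultimately have "A i p / A j p = 1 + 2 * d * Re w / A j p / real p" by (simp add: field_simps)
          then show ?case using 2 by (simp add: r_def)
        qed
        ultimately have "(\<lambda>p. r k p) \<longlonglongrightarrow> exp (2 * d * Re w / rho2 t)" by (rule Lim_transform_eventually)
        then show ?thesis using 2 ij'(3) by (simp add: l_def c_def)
      next
        case 3
        have "(norm (z0 t - a k))^2 > 0" using far[OF 3] r0(1) by linarith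
        then have "(\<lambda>p. A i p / A k p) \<longlonglongrightarrow> rho2 t / (norm (z0 t - a k))^2" by (intro tendsto_intros Ai Al) simp
        moreover have "rho2 t / (norm (z0 t - a k))^2 < 1" using far[OF 3] \<open>(norm (z0 t - a k))\<^sup>2 > 0\<close>
          by (simp only: divide_less_eq_1_pos)
        ultimately show ?thesis using 3 A0 unfolding r_def l_def by (auto intro!: tendsto_power_0)
      qed
    qed
    have suml: "(\<Sum>k\<in>{1..N}. l k) = 1 + exp c"
    proof -
      have "(\<Sum>k\<in>{1..N}. l k) = (\<Sum>k\<in>{i, j}. l k)"
        by (rule sum.mono_neutral_right) (use ij' in \<open>auto simp: l_def\<close>)
      then show ?thesis using ij'(3) by (simp add: l_def)
    qed
    have "1 + exp c > 0" by (simp add: add_pos_pos)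
    then have nz: "(\<Sum>k\<in>{1..N}. l k)^2 \<noteq> 0" unfolding suml by simp
    have "(\<lambda>p. r j p / (\<Sum>k\<in>{1..N}. r k p)^2) \<longlonglongrightarrow> l j / (\<Sum>k\<in>{1..N}. l k)^2"
      by (intro tendsto_divide tendsto_power tendsto_sum rl ij'(2) nz)
    moreover have "\<forall>\<^sub>F p in sequentially. r j p / (\<Sum>k\<in>{1..N}. r k p)^2 = X p" using ev
    proof eventually_elim
      case (elim p)
      have s: "side k (pt p w) ^ p = side i (pt p w) ^ p * r k p" if "k \<in> {1..N}" for k
        unfolding r_def A_def using elim that ij' by (intro side_power_ratio) auto
      have si: "side i (pt p w) ^ p > 0" using elim by (intro zero_less_power side_pos) auto
      have S: "(\<Sum>k\<in>{1..N}. side k (pt p w) ^ p) = side i (pt p w) ^ p * (\<Sum>k\<in>{1..N}. r k p)"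
        unfolding sum_distrib_left by (intro sum.cong refl s)
      have cancel: "u / v^2 = x * (x * u) / (x * v)^2" if "x > 0" for x u v :: real
        using that by (simp add: power2_eq_square)
      show ?case unfolding X_def S s[OF ij'(2)] by (rule cancel[OF si])
    qed
    ultimately have "X \<longlonglongrightarrow> l j / (\<Sum>k\<in>{1..N}. l k)^2" by (rule Lim_transform_eventually)
    then show ?thesis using True ij'(3) suml by (simp add: l_def)
  next
    case False
    then obtain k where k: "k \<in> {1..N}" "norm (z0 t - a k) < norm (z0 t - a i)"
      by (auto simp: on_edge_def not_le)
    then have kr: "(norm (z0 t - a k))^2 < rho2 t"
      unfolding norm_z0(1)[symmetric] by (intro power_strict_mono) auto
    have q: "(\<lambda>p. (A k p / A i p) ^ p) \<longlonglongrightarrow> 0" "(\<lambda>p. (A k p / A j p) ^ p) \<longlonglongrightarrow> 0"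
    proof -
      have "(\<lambda>p. A k p / A i p) \<longlonglongrightarrow> (norm (z0 t - a k))\<^sup>2 / rho2 t" "(\<lambda>p. A k p / A j p) \<longlonglongrightarrow> (norm (z0 t - a k))\<^sup>2 / rho2 t"
        by (intro tendsto_intros Al Ai Aj r0)+
      moreover have "(norm (z0 t - a k))^2 / rho2 t < 1" using kr r0(1) by (simp only: divide_less_eq_1_pos)
      ultimately show "(\<lambda>p. (A k p / A i p) ^ p) \<longlonglongrightarrow> 0" "(\<lambda>p. (A k p / A j p) ^ p) \<longlonglongrightarrow> 0"
        using A0 by (auto intro!: tendsto_power_0)
    qed
    have "X \<longlonglongrightarrow> 0"
    proof (rule Lim_null_comparison)
      show "(\<lambda>p. (A k p / A i p) ^ p * (A k p / A j p) ^ p) \<longlonglongrightarrow> 0" using tendsto_mult[OF q] by simp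
      have "norm (z0 t - a i) > 0" "norm (z0 t - a j) > 0" using r0 by (simp_all add: norm_z0')
      from evA[OF this(1)] evA[OF this(2)]
      show "\<forall>\<^sub>F p in sequentially. norm (X p) \<le> (A k p / A i p) ^ p * (A k p / A j p) ^ p"
      proof eventually_elim
        case (elim p)
        define S where "S = (\<Sum>k\<in>{1..N}. side k (pt p w) ^ p)"
        have S: "S > 0" unfolding S_def by (rule sum_side_pos)
        have sk: "side k (pt p w) ^ p \<le> S" unfolding S_def
          by (rule member_le_sum[OF k(1)]) (simp_all add: side_nonneg)
        have si: "side i (pt p w) ^ p = side k (pt p w) ^ p * (A k p / A i p) ^ p"
          "side j (pt p w) ^ p = side k (pt p w) ^ p * (A k p / A j p) ^ p"
          unfolding A_def by (rule side_power_ratio[OF ij'(1) k(1) elim(1)] side_power_ratio[OF ij'(2) k(1) elim(2)])+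
        have X0: "X p \<ge> 0" unfolding X_def by (intro divide_nonneg_nonneg mult_nonneg_nonneg zero_le_power side_nonneg sum_nonneg)
        have "X p = (side k (pt p w) ^ p / S)^2 * ((A k p / A i p) ^ p * (A k p / A j p) ^ p)"
          unfolding X_def S_def[symmetric] si by (simp add: power2_eq_square)
        also have "\<dots> \<le> 1 * ((A k p / A i p) ^ p * (A k p / A j p) ^ p)"
        proof (rule mult_right_mono)
          have "side k (pt p w) ^ p / S \<le> 1" "0 \<le> side k (pt p w) ^ p / S" using sk S side_nonneg[of k "pt p w"] by simp_all
          then show "(side k (pt p w) ^ p / S)^2 \<le> 1" by (intro power_le_one)
        qed (use A0 in \<open>simp add: mult_nonneg_nonneg\<close>)
        finally show ?case using X0 by simp
      qed
    qed
    then show ?thesis using False by simp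
  qed
  from tendsto_mult[OF this Dl] show ?thesis unfolding pd c_def by (simp add: mult_ac)
qed

text \<open>The integrand is \<open>d / rho2 t\<close> times the derivative of a logistic function
  that rises from 0 to 1, because \<open>2 d^2 / rho2^2 = (d / rho2) (2 d / rho2)\<close>. This is
  the origin of the density of the edge measure with respect to arclength.\<close>

lemma logistic_integral:
  "has_bochner_integral lborel (\<lambda>\<sigma>. 2 * (exp (2 * d / rho2 t * \<sigma>) / (1 + exp (2 * d / rho2 t * \<sigma>))^2 * (d^2 / (rho2 t * rho2 t)))) (d / rho2 t)"
proof -
  define q where "q = 2 * d / rho2 t"
  have q: "q > 0" using d_pos rho2_pos by (simp add: q_def)
  define K where "K = d / rho2 t"
  have K: "K \<ge> 0" using d_pos rho2_pos[of t] by (simp add: K_def)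
  have qK: "2 * (d^2 / (rho2 t * rho2 t)) = K * q" by (simp add: q_def K_def power2_eq_square)
  have e: "1 + exp (q * x) > 0" for x by (simp add: add_pos_pos)
  have "has_bochner_integral lborel (\<lambda>\<sigma>. K * (q * exp (q * \<sigma>) / (1 + exp (q * \<sigma>))^2)) (K - 0)"
  proof (rule has_bochner_integral_real_line)
    show "((\<lambda>\<sigma>. K * (1 - 1 / (1 + exp (q * \<sigma>)))) has_real_derivative K * (q * exp (q * x) / (1 + exp (q * x))^2)) (at x)" for x
    proof (rule DERIV_cmult)
      have "((\<lambda>\<sigma>. 1 + exp (q * \<sigma>)) has_real_derivative exp (q * x) * q) (at x)"
        by (auto intro!: derivative_eq_intros)
      from DERIV_diff[OF DERIV_const[of 1] DERIV_divide[OF DERIV_const[of 1] this less_imp_neq[OF e, symmetric]]]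
      show "((\<lambda>\<sigma>. 1 - 1 / (1 + exp (q * \<sigma>))) has_real_derivative q * exp (q * x) / (1 + exp (q * x))^2) (at x)"
        by (rule DERIV_cong) (simp add: power2_eq_square mult.commute)
    qed
    show "isCont (\<lambda>\<sigma>. K * (q * exp (q * \<sigma>) / (1 + exp (q * \<sigma>))^2)) x" for x
      using e[of x] by (intro continuous_intros) simp
    show "0 \<le> K * (q * exp (q * x) / (1 + exp (q * x))^2)" for x using K q by simp
    show "((\<lambda>\<sigma>. K * (1 - 1 / (1 + exp (q * \<sigma>)))) \<longlongrightarrow> 0) at_bot" using q by real_asymp
    show "((\<lambda>\<sigma>. K * (1 - 1 / (1 + exp (q * \<sigma>)))) \<longlongrightarrow> K) at_top"
    proof -
      have "((\<lambda>\<sigma>. 1 - 1 / (1 + exp (q * \<sigma>))) \<longlongrightarrow> 1) at_top" using q by real_asymp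
      from tendsto_mult[OF tendsto_const[of K] this] show ?thesis by simp
    qed
  qed
  moreover have "2 * (exp (2 * d / rho2 t * \<sigma>) / (1 + exp (2 * d / rho2 t * \<sigma>))^2 * (d^2 / (rho2 t * rho2 t)))
      = K * (q * exp (q * \<sigma>) / (1 + exp (q * \<sigma>))^2)" for \<sigma>
  proof -
    have "2 * (x * y) = K * (q * x)" if "2 * y = K * q" for x y :: real
    proof -
      have "2 * (x * y) = x * (2 * y)" by simp
      then show ?thesis unfolding that by (simp only: mult_ac)
    qed
    from this[OF qK, of "exp (q * \<sigma>) / (1 + exp (q * \<sigma>))^2"] show ?thesis unfolding q_def[symmetric] by simp
  qed
  ultimately show ?thesis unfolding K_def by simp
qed

text \<open>Rescaling the normal coordinate by \<open>1 / p\<close> produces a Jacobian that cancels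
  the factor \<open>p\<close> of the Laplacian. Dominated convergence then applies off the finitely
  many lines given by tie parameters, and Fubini integrates out the normal coordinate first.\<close>

proposition pair_density_tendsto_edge:
  assumes g: "continuous_on UNIV g" and z: "\<And>z. R \<le> norm z \<Longrightarrow> g z = 0"
  shows "p \<ge> 2 \<Longrightarrow> integrable lborel (\<lambda>z. 2 * real p * pair_density p i j z * g z)"
    and "(\<lambda>p. \<integral>z. 2 * real p * pair_density p i j z * g z \<partial>lborel) \<longlonglongrightarrow> (\<integral>z. g z \<partial>edge_measure a N i j)"
proof -
  have [measurable]: "g \<in> borel_measurable borel" using g by (rule borel_measurable_continuous_onI)
  have [measurable]: "on_edge \<in> sets borel" using closed_on_edge by (rule borel_closed)
  obtain M where M: "M \<ge> 0" "\<And>z. norm (z - 0) \<le> R \<Longrightarrow> \<bar>g z\<bar> \<le> M" using continuous_bounded_ball[OF g] by blast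
  \<comment> \<open>Where \<open>g\<close> is nonzero, \<open>T\<close> bounds the distance to
    \<open>mid\<close>, hence \<open>|Im w|\<close>, and \<open>L\<close> the distances to the two
    sites. No bound on \<open>Re w\<close> is uniform in \<open>p\<close>, so decay in that
    direction has to come from the density.\<close>
  define T where "T = \<bar>R\<bar> + norm mid + 1"
  define L where "L = T + d"
  have T: "T > 0" by (simp add: T_def add_nonneg_pos)
  have L: "L > 0" using T d_pos by (simp add: L_def)
  define k where "k = d / (2 * L^2)"
  have k: "k > 0" using d_pos L by (simp add: k_def)
  have [measurable]: "pt p \<in> borel_measurable borel" for p unfolding pt_def[abs_def] Complex_eq by measurable
  define \<Phi> where "\<Phi> p w = 2 * pair_density p i j (pt p w) * g (pt p w)" for p w
  have \<Phi>m[measurable]: "\<Phi> p \<in> borel_measurable borel" for p unfolding \<Phi>_def by measurable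
  define dom where "dom w = 2 * (16 / d^2) * M * (inverse (1 + (k * Re w)^2) * indicator {- T..T} (Im w))" for w
  have domi: "integrable lborel dom" unfolding dom_def by (intro integrable_mult_right decay_integrable k)
  have bound: "norm (\<Phi> p w) \<le> dom w" if p: "p \<ge> 2" for p w
  proof (cases "norm (pt p w) < R")
    case False
    then have "g (pt p w) = 0" using z by simp
    then show ?thesis unfolding \<Phi>_def dom_def using M(1) by simp
  next
    case True
    have e: "norm (pt p w - mid) \<le> T" using True norm_triangle_ineq4[of "pt p w" mid] by (simp add: T_def)
    have "norm (a i - mid) \<le> d" "norm (a j - mid) \<le> d"
      using d_pos unfolding ends by (simp_all add: norm_mult norm_dir norm_divide)
    then have n: "norm (pt p w - a i) \<le> L" "norm (pt p w - a j) \<le> L"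
      using e norm_triangle_ineq4[of "pt p w - mid" "a i - mid"] norm_triangle_ineq4[of "pt p w - mid" "a j - mid"]
      by (simp_all add: L_def)
    have "norm (pt p w - mid) = norm (Complex (1 / real p * Re w) (1 * Im w))" by (simp add: pt_def norm_mult norm_dir)
    then have "\<bar>Im w\<bar> \<le> T" using e abs_Im_le_cmod[of "Complex (1 / real p * Re w) (1 * Im w)"] by simp
    then have im: "Im w \<in> {- T..T}" by auto
    have gM: "\<bar>g (pt p w)\<bar> \<le> M" using M(2) True by simp
    have "norm (\<Phi> p w) = 2 * pair_density p i j (pt p w) * \<bar>g (pt p w)\<bar>"
      unfolding \<Phi>_def by (simp add: abs_mult pair_density_nonneg)
    also have "\<dots> \<le> 2 * (16 / d^2 * inverse (1 + (k * Re w)^2)) * M"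
      unfolding k_def using pair_density_decay[OF p n] gM pair_density_nonneg[of p i j "pt p w"]
      by (intro mult_mono mult_left_mono) simp_all
    also have "\<dots> = dom w" using im by (simp add: dom_def)
    finally show ?thesis .
  qed
  have \<Phi>i: "integrable lborel (\<Phi> p)" if "p \<ge> 2" for p
  proof (rule Bochner_Integration.integrable_bound[OF domi])
    show "AE w in lborel. norm (\<Phi> p w) \<le> norm (dom w)"
    proof (rule AE_I2)
      fix w show "norm (\<Phi> p w) \<le> norm (dom w)" using bound[OF that, of w] by (rule order_trans) simp
    qed
  qed measurable
  have sim: "(LBINT z. 2 * real p * pair_density p i j z * g z) = (LBINT w. \<Phi> p w)"
    "integrable lborel (\<lambda>z. 2 * real p * pair_density p i j z * g z) \<longleftrightarrow> integrable lborel (\<Phi> p)"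
    if p: "p \<ge> 2" for p
  proof -
    have p0: "1 / real p > 0" using p by simp
    have eq: "2 * real p * pair_density p i j (mid + dir * Complex (1 / real p * Re w) (1 * Im w)) *
        g (mid + dir * Complex (1 / real p * Re w) (1 * Im w)) = real p * \<Phi> p w" for w
      by (simp only: \<Phi>_def pt_def mult_ac)
    show "(LBINT z. 2 * real p * pair_density p i j z * g z) = (LBINT w. \<Phi> p w)"
      using p by (subst integral_complex_similarity(1)[OF norm_dir p0 zero_less_one, of _ mid], measurable) (simp only: eq, simp)
    show "integrable lborel (\<lambda>z. 2 * real p * pair_density p i j z * g z) \<longleftrightarrow> integrable lborel (\<Phi> p)"
      using p by (subst integral_complex_similarity(2)[OF norm_dir p0 zero_less_one, of _ mid], measurable) (simp only: eq, simp)
  qed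
  show "p \<ge> 2 \<Longrightarrow> integrable lborel (\<lambda>z. 2 * real p * pair_density p i j z * g z)" using sim(2) \<Phi>i by blast
  define \<Psi> where "\<Psi> w = 2 * (exp (2 * d / rho2 (Im w) * Re w) / (1 + exp (2 * d / rho2 (Im w) * Re w))^2 *
      (d^2 / (rho2 (Im w) * rho2 (Im w)))) * (indicator on_edge (Im w) * g (z0 (Im w)))" for w
  have \<Psi>m[measurable]: "\<Psi> \<in> borel_measurable borel" unfolding \<Psi>_def by measurable
  \<comment> \<open>Shifted by 2 because the majorant holds from \<open>p = 2\<close> on.\<close>
  have AEl: "AE w in lborel. (\<lambda>p. \<Phi> (p + 2) w) \<longlonglongrightarrow> \<Psi> w" using AE_Im_not_in_finite[OF finite_ties]
  proof eventually_elim
    case (elim w)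
    have no_tie: "norm (z0 (Im w) - a k) \<noteq> norm (z0 (Im w) - a i)" if "k \<in> {1..N} - {i, j}" for k
      using elim that by blast
    note pl = pair_density_pt_tendsto[OF refl no_tie]
    have "(\<lambda>p. 1 / real p) \<longlonglongrightarrow> 0" by (rule lim_1_over_n)
    then have "(\<lambda>p. mid + dir * (of_real (1 / real p * Re w) + \<i> * of_real (Im w))) \<longlonglongrightarrow> mid + dir * (of_real (0 * Re w) + \<i> * of_real (Im w))"
      by (intro tendsto_intros)
    then have ptl: "(\<lambda>p. pt p w) \<longlonglongrightarrow> z0 (Im w)" by (simp add: pt_def z0_eq Complex_eq)
    have "isCont g (z0 (Im w))" using g by (simp add: continuous_on_eq_continuous_at)
    then have gl: "(\<lambda>p. g (pt p w)) \<longlonglongrightarrow> g (z0 (Im w))" using ptl by (rule isCont_tendsto_compose)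
    have "(\<lambda>p. \<Phi> p w) \<longlonglongrightarrow> \<Psi> w"
      unfolding \<Phi>_def \<Psi>_def using tendsto_mult[OF tendsto_mult[OF tendsto_const[of 2] pl] gl] by (simp only: mult.assoc)
    then show ?case by (rule LIMSEQ_ignore_initial_segment)
  qed
  have AEb: "AE w in lborel. norm (\<Phi> (p + 2) w) \<le> dom w" for p using bound[of "p + 2"] by (intro AE_I2) simp
  have lim: "(\<lambda>p. \<integral>w. \<Phi> (p + 2) w \<partial>lborel) \<longlonglongrightarrow> (LBINT w. \<Psi> w)"
    by (rule integral_dominated_convergence[OF _ _ domi AEl AEb]) measurable
  have \<Psi>i: "integrable lborel \<Psi>" by (rule integrable_dominated_convergence[OF _ _ domi AEl AEb]) measurable
  have "(LBINT w. \<Psi> w) = (\<integral>y. \<integral>x. \<Psi> (Complex x y) \<partial>lborel \<partial>lborel)" by (rule integral_complex(2)[OF \<Psi>i])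
  also have "\<dots> = (LBINT t. d / rho2 t * indicator on_edge t * g (z0 t))"
  proof (rule Bochner_Integration.integral_cong[OF refl])
    fix t
    have "(LBINT x. \<Psi> (Complex x t)) = d / rho2 t * (indicator on_edge t * g (z0 t))"
      unfolding \<Psi>_def complex.sel
      by (rule has_bochner_integral_integral_eq[OF has_bochner_integral_mult_left[OF logistic_integral]])
    then show "(LBINT x. \<Psi> (Complex x t)) = d / rho2 t * indicator on_edge t * g (z0 t)"
      by (simp only: mult.assoc)
  qed
  also have "\<dots> = (\<integral>z. g z \<partial>edge_measure a N i j)" by (rule integral_edge_measure[symmetric]) measurable
  finally have "(\<lambda>p. \<integral>w. \<Phi> (p + 2) w \<partial>lborel) \<longlonglongrightarrow> (\<integral>z. g z \<partial>edge_measure a N i j)" using lim by simp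
  then have "(\<lambda>p. \<integral>z. 2 * real (p + 2) * pair_density (p + 2) i j z * g z \<partial>lborel) \<longlonglongrightarrow> (\<integral>z. g z \<partial>edge_measure a N i j)"
    by (simp only: sim(1) le_add2)
  then show "(\<lambda>p. \<integral>z. 2 * real p * pair_density p i j z * g z \<partial>lborel) \<longlonglongrightarrow> (\<integral>z. g z \<partial>edge_measure a N i j)"
    by (rule LIMSEQ_offset)
qed

end

section \<open>The Laplacian of the maximum as the sum of the edge measures\<close>

context sites
begin

lemma site_pairI: "(i, j) \<in> pairs \<Longrightarrow> site_pair a N i j" by unfold_locales

text \<open>The maximum is not differentiable on the edges, so Green's identity is used for the soft
  maxima and both of its sides pass to the limit. The pair formula for their Laplacians is available
  off the sites, hence almost everywhere.\<close>

proposition integral_maxpot_laplacian: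
  assumes g: "has_laplacian g G" and z: "\<And>z. R \<le> norm z \<Longrightarrow> g z = 0"
  shows "(LBINT z. maxpot z * G z) = (\<Sum>(i, j)\<in>pairs. \<integral>z. g z \<partial>edge_measure a N i j)"
proof -
  have cg: "continuous_on UNIV g" and cG: "continuous_on UNIV G"
    using g by (rule has_laplacian_continuous, rule has_laplacian_continuous')
  have G0: "G z = 0" if "R \<le> norm z" for z using has_laplacian_vanishes[OF g z that] .
  have l1: "(\<lambda>p. \<integral>z. softpot p z * G z \<partial>lborel) \<longlonglongrightarrow> (LBINT z. maxpot z * G z)"
    by (rule integral_softpot_tendsto[OF cG G0])
  have "(\<lambda>p. \<Sum>q\<in>pairs. \<integral>z. 2 * real p * pair_density p (fst q) (snd q) z * g z \<partial>lborel)
     \<longlonglongrightarrow> (\<Sum>q\<in>pairs. \<integral>z. g z \<partial>edge_measure a N (fst q) (snd q))"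
  proof (rule tendsto_sum)
    fix q assume "q \<in> pairs"
    then interpret site_pair a N "fst q" "snd q" by (intro site_pairI) simp
    show "(\<lambda>p. \<integral>z. 2 * real p * pair_density p (fst q) (snd q) z * g z \<partial>lborel) \<longlonglongrightarrow> (\<integral>z. g z \<partial>edge_measure a N (fst q) (snd q))"
      by (rule pair_density_tendsto_edge(2)[OF cg z])
  qed
  moreover have "\<forall>\<^sub>F p in sequentially. (\<Sum>q\<in>pairs. \<integral>z. 2 * real p * pair_density p (fst q) (snd q) z * g z \<partial>lborel)
      = (LBINT z. softpot p z * G z)" using eventually_ge_at_top[of 2]
  proof eventually_elim
    case (elim p)
    then have p1: "p \<ge> 1" by simp
    obtain L where L: "has_laplacian (softpot p) L"
      "\<forall>z. z \<notin> a ` {1..N} \<longrightarrow> L z = (\<Sum>(i, j)\<in>pairs. 2 * real p * pair_density p i j z)"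
      using has_laplacian_softpot[OF p1] by blast
    have int: "integrable lborel (\<lambda>z. 2 * real p * pair_density p (fst q) (snd q) z * g z)" if "q \<in> pairs" for q
    proof -
      interpret site_pair a N "fst q" "snd q" using that by (intro site_pairI) simp
      show ?thesis by (rule pair_density_tendsto_edge(1)[OF cg z elim])
    qed
    have [measurable]: "L \<in> borel_measurable borel" "g \<in> borel_measurable borel"
      using has_laplacian_continuous'[OF L(1)] cg by (auto intro: borel_measurable_continuous_onI)
    have "(LBINT z. softpot p z * G z) = (LBINT z. L z * g z)" by (rule green_identity[OF L(1) g z])
    also have "\<dots> = (LBINT z. (\<Sum>q\<in>pairs. 2 * real p * pair_density p (fst q) (snd q) z * g z))"
    proof (rule integral_cong_AE)
      have "AE z in lborel. z \<notin> a ` {1..N}" by (rule AE_not_in) (simp add: finite_imp_null_set_lborel)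
      then show "AE z in lborel. L z * g z = (\<Sum>q\<in>pairs. 2 * real p * pair_density p (fst q) (snd q) z * g z)"
      proof eventually_elim
        case (elim z)
        then have "L z = (\<Sum>q\<in>pairs. 2 * real p * pair_density p (fst q) (snd q) z)"
          using L(2) by (simp add: case_prod_unfold)
        then show ?case by (simp add: sum_distrib_right)
      qed
    qed measurable
    also have "\<dots> = (\<Sum>q\<in>pairs. \<integral>z. 2 * real p * pair_density p (fst q) (snd q) z * g z \<partial>lborel)"
      by (rule Bochner_Integration.integral_sum) (rule int)
    finally show ?case ..
  qed
  ultimately have "(\<lambda>p. \<integral>z. softpot p z * G z \<partial>lborel) \<longlonglongrightarrow> (\<Sum>q\<in>pairs. \<integral>z. g z \<partial>edge_measure a N (fst q) (snd q))"
    by (rule Lim_transform_eventually)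
  from LIMSEQ_unique[OF l1 this] show ?thesis by (simp add: case_prod_unfold)
qed

end

section \<open>Convergence of the potentials\<close>

text \<open>Bisectors as affine lines: cells become intersections of half-planes, hence open and
  convex, and what lies between the cells is contained in finitely many lines, hence null.\<close>

lemma closer_iff_inner:
  fixes p q z :: complex
  shows "norm (z - p) < norm (z - q) \<longleftrightarrow> inner (2 * (q - p)) z < inner q q - inner p p"
    and "norm (z - p) = norm (z - q) \<longleftrightarrow> inner (2 * (q - p)) z = inner q q - inner p p"
proof -
  have "norm (z - p) < norm (z - q) \<longleftrightarrow> (norm (z - p))^2 < (norm (z - q))^2"
    by (simp only: not_le[symmetric] abs_le_square_iff[symmetric] abs_norm_cancel)
  also have "\<dots> \<longleftrightarrow> inner (2 * (q - p)) z < inner q q - inner p p"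
    unfolding cmod_power2 by (simp add: inner_complex_def power2_eq_square algebra_simps)
  finally show "norm (z - p) < norm (z - q) \<longleftrightarrow> inner (2 * (q - p)) z < inner q q - inner p p" .
  have "norm (z - p) = norm (z - q) \<longleftrightarrow> (norm (z - p))^2 = (norm (z - q))^2" by simp
  also have "\<dots> \<longleftrightarrow> inner (2 * (q - p)) z = inner q q - inner p p"
    unfolding cmod_power2 by (simp add: inner_complex_def power2_eq_square algebra_simps)
  finally show "norm (z - p) = norm (z - q) \<longleftrightarrow> inner (2 * (q - p)) z = inner q q - inner p p" .
qed

context sites
begin

text \<open>The open counterpart of \<open>voronoi_cell\<close>: it omits every point with two
  nearest sites, in particular all edges.\<close>

definition cell :: "nat \<Rightarrow> complex set" where
  "cell i = {z. \<forall>j\<in>{1..N} - {i}. norm (z - a i) < norm (z - a j)}"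

lemma cell_eq: "cell i = (\<Inter>j\<in>{1..N} - {i}. {z. inner (2 * (a j - a i)) z < inner (a j) (a j) - inner (a i) (a i)})"
  unfolding cell_def closer_iff_inner(1) by blast

lemma open_cell: "open (cell i)"
  unfolding cell_eq by (intro open_INT finite_Diff finite_atLeastAtMost ballI open_halfspace_lt)

lemma convex_cell: "convex (cell i)" unfolding cell_eq by (intro convex_INT convex_halfspace_lt)

lemma site_in_cell: "i \<in> {1..N} \<Longrightarrow> a i \<in> cell i" unfolding cell_def using inj_onD[OF inj, of i] by force

lemma cell_avoids_sites: "z \<in> cell i \<Longrightarrow> z \<noteq> a i \<Longrightarrow> z \<notin> a ` {1..N}"
proof
  assume z: "z \<in> cell i" "z \<noteq> a i" "z \<in> a ` {1..N}"
  then obtain j where j: "j \<in> {1..N}" "z = a j" by blast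
  then have "j \<in> {1..N} - {i}" using z(2) by blast
  then have "norm (z - a i) < norm (z - a j)" using z(1) unfolding cell_def by blast
  then show False using j(2) by simp
qed

lemma infdist_cell:
  assumes i: "i \<in> {1..N}" and z: "z \<in> cell i"
  shows "infdist z (a ` {1..N}) = norm (z - a i)"
proof (rule antisym)
  show "infdist z (a ` {1..N}) \<le> norm (z - a i)"
    using infdist_le[of "a i" "a ` {1..N}" z] i by (simp add: dist_norm)
  have ne: "a ` {1..N} \<noteq> {}" using i by auto
  have "norm (z - a i) \<le> dist z w" if "w \<in> a ` {1..N}" for w
  proof -
    from that obtain j where j: "j \<in> {1..N}" "w = a j" by auto
    show ?thesis using z j by (cases "j = i") (auto simp: cell_def dist_norm less_imp_le)
  qed
  then show "norm (z - a i) \<le> infdist z (a ` {1..N})"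
    unfolding infdist_notempty[OF ne] by (intro cINF_greatest ne)
qed

text \<open>In the cell the \<open>i\<close>-th product is the largest, and it is the one without
  the factor \<open>|z - a i|\<close>; so \<open>maxpot\<close> is harmonic there, even at
  \<open>a i\<close>.\<close>

lemma maxpot_cell:
  assumes i: "i \<in> {1..N}" and z: "z \<in> cell i"
  shows "maxpot z = (\<Sum>j\<in>{1..N} - {i}. ln (norm (z - a j)))"
proof -
  have pos: "norm (z - a j) > 0" if "j \<in> {1..N} - {i}" for j
    using z that unfolding cell_def by (intro le_less_trans[OF norm_ge_zero]) auto
  have "side j z \<le> side i z" if j: "j \<in> {1..N}" for j
  proof (cases "j = i")
    case False
    have l: "norm (z - a i) < norm (z - a j)" using z j False by (auto simp: cell_def)
    have "side j z * (norm (z - a j))^2 = side i z * (norm (z - a i))^2"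
      unfolding side_mult[OF i] side_mult[OF j] ..
    also have "\<dots> \<le> side i z * (norm (z - a j))^2"
      by (intro mult_left_mono power_mono side_nonneg) (use l in auto)
    finally show ?thesis by (rule mult_right_le_imp_le) (use pos[of j] j False in auto)
  qed simp
  then have "Max ((\<lambda>i. side i z) ` {1..N}) = side i z" using i by (intro Max_eqI) auto
  moreover have "ln (side i z) = (\<Sum>j\<in>{1..N} - {i}. 2 * ln (norm (z - a j)))"
    unfolding side_def using pos by (subst ln_prod) (auto simp: ln_realpow intro!: sum.cong)
  ultimately show ?thesis unfolding maxpot_def by (simp add: sum_distrib_left[symmetric])
qed

lemma emeasure_off_cells: "emeasure lborel (- (\<Union>i\<in>{1..N}. cell i - {a i})) = 0"
proof -
  define H where "H i j = {z. inner (2 * (a j - a i)) z = inner (a j) (a j) - inner (a i) (a i)}" for i j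
  define E where "E = a ` {1..N} \<union> (\<Union>i\<in>{1..N}. \<Union>j\<in>{1..N} - {i}. H i j)"
  have nH: "negligible (H i j)" if "i \<in> {1..N}" "j \<in> {1..N} - {i}" for i j
  proof -
    have "a j - a i \<noteq> 0" using inj_onD[OF inj, of i j] that by force
    then show ?thesis unfolding H_def by (intro negligible_hyperplane) simp
  qed
  have n1: "negligible (\<Union>j\<in>{1..N} - {i}. H i j)" if "i \<in> {1..N}" for i
    by (intro negligible_Union finite_imageI finite_Diff finite_atLeastAtMost ballI) (use nH[OF that] in blast)
  have n2: "negligible (\<Union>i\<in>{1..N}. \<Union>j\<in>{1..N} - {i}. H i j)"
    by (intro negligible_Union finite_imageI finite_atLeastAtMost ballI) (use n1 in blast)
  have nE: "negligible E"
    unfolding E_def by (intro negligible_Un negligible_finite finite_imageI finite_atLeastAtMost n2)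
  have sub: "- (\<Union>i\<in>{1..N}. cell i - {a i}) \<subseteq> E"
  proof
    fix z assume z: "z \<in> - (\<Union>i\<in>{1..N}. cell i - {a i})"
    show "z \<in> E"
    proof (rule ccontr)
      assume n: "z \<notin> E"
      have fin: "finite ((\<lambda>i. norm (z - a i)) ` {1..N})" "(\<lambda>i. norm (z - a i)) ` {1..N} \<noteq> {}" using N by auto
      from Min_in[OF this] obtain i where i: "i \<in> {1..N}" "Min ((\<lambda>i. norm (z - a i)) ` {1..N}) = norm (z - a i)"
        by (elim imageE)
      have "norm (z - a i) < norm (z - a j)" if j: "j \<in> {1..N} - {i}" for j
      proof -
        have "norm (z - a i) \<le> norm (z - a j)"
          unfolding i(2)[symmetric] using j by (intro Min_le fin(1) imageI) blast
        moreover have "norm (z - a i) \<noteq> norm (z - a j)"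
          unfolding closer_iff_inner(2) using n i(1) j unfolding E_def H_def by blast
        ultimately show ?thesis by simp
      qed
      then have "z \<in> cell i" by (simp add: cell_def)
      moreover have "z \<noteq> a i" using n i(1) unfolding E_def by blast
      ultimately show False using z i(1) by blast
    qed
  qed
  have "open (\<Union>i\<in>{1..N}. cell i - {a i})" by (intro open_UN ballI open_Diff open_cell) simp_all
  then have meas: "- (\<Union>i\<in>{1..N}. cell i - {a i}) \<in> sets lborel"
    unfolding sets_lborel by (intro borel_closed closed_Compl)
  have "negligible (- (\<Union>i\<in>{1..N}. cell i - {a i}))" by (rule negligible_subset[OF nE sub])
  then have "- (\<Union>i\<in>{1..N}. cell i - {a i}) \<in> null_sets lborel"
    using meas by (simp only: negligible_iff_null_sets null_sets_completion_iff)
  then show ?thesis by (rule null_setsD1)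
qed

end

section \<open>The limit potential and the potentials of the zeros\<close>

locale hyperexponential_sites = hyperexponential P Q S T + sites a N
  for P Q S T :: "complex poly" and a :: "nat \<Rightarrow> complex" and N :: nat +
  assumes sites_eq: "a ` {1..N} = sing Q T"
begin

definition limit_pot :: "complex \<Rightarrow> real" where
  "limit_pot z = (\<Sum>c\<in>zeros T. real (order c T) * ln (norm (z - c))) + maxpot z"

lemma borel_measurable_limit_pot [measurable]: "limit_pot \<in> borel_measurable borel"
proof -
  have [measurable]: "maxpot \<in> borel_measurable borel"
    using continuous_maxpot by (rule borel_measurable_continuous_onI)
  have "(\<lambda>z. real (order c T) * ln (norm (z - c))) \<in> borel_measurable borel" for c by measurable
  then show ?thesis unfolding limit_pot_def[abs_def]
    by (intro borel_measurable_add borel_measurable_sum \<open>maxpot \<in> borel_measurable borel\<close>)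
qed

lemma limit_pot_sq_integral:
  "(\<integral>\<^sup>+z\<in>ball 0 R. ennreal ((limit_pot z)^2) \<partial>lborel) < \<infinity>"
proof -
  have fT: "finite (zeros T)" by (rule finite_zeros[OF T_nz])
  have "bdd_above (norm ` zeros T)" using fT by simp
  then obtain K where K: "\<And>c. c \<in> zeros T \<Longrightarrow> norm c \<le> K" unfolding bdd_above_def by blast
  define r where "r = max R K"
  obtain Bd where Bd: "Bd \<ge> 0" "\<And>z. norm (z - 0) \<le> r \<Longrightarrow> \<bar>maxpot z\<bar> \<le> Bd"
    using continuous_bounded_ball[OF continuous_maxpot] by blast
  define w where "w = (\<Sum>c\<in>zeros T. real (order c T))"
  define g where "g z = 2 * (w * (\<Sum>c\<in>zeros T. real (order c T) * (indicator (ball 0 r) z * (ln (norm (z - c)))^2)))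
      + 2 * (Bd^2 * indicator (ball 0 r) z)" for z
  have ind: "integrable lborel (indicator (ball (0::complex) r) :: complex \<Rightarrow> real)"
    by (rule integrable_real_indicator[OF _ emeasure_lborel_ball_finite]) simp
  have "integrable lborel (\<lambda>z. indicator (ball 0 r) z * (ln (norm (z - c)))^2)" if "c \<in> zeros T" for c
  proof -
    from ln_sq_local_bound[of r] obtain M where
      "\<forall>\<zeta>. norm \<zeta> \<le> r \<longrightarrow> integrable lborel (\<lambda>z. indicator (ball 0 r) z * (ln (norm (z - \<zeta>)))^2) \<and>
        (\<integral>z. indicator (ball 0 r) z * (ln (norm (z - \<zeta>)))^2 \<partial>(lborel :: complex measure)) \<le> M" by (elim exE)
    from this[rule_format, THEN conjunct1, of c] K[OF that] show ?thesis unfolding r_def by simp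
  qed
  then have gi: "integrable lborel g"
    unfolding g_def by (intro Bochner_Integration.integrable_add Bochner_Integration.integrable_mult_right
        Bochner_Integration.integrable_sum ind)
  have g0: "g z \<ge> 0" for z unfolding g_def w_def by (intro add_nonneg_nonneg mult_nonneg_nonneg sum_nonneg) simp_all
  have le: "(limit_pot z)^2 * indicator (ball 0 R) z \<le> g z" for z
  proof (cases "z \<in> ball 0 R")
    case True
    then have zr: "z \<in> ball 0 r" by (auto simp: r_def)
    define x where "x = (\<Sum>c\<in>zeros T. real (order c T) * ln (norm (z - c)))"
    have "x^2 \<le> w * (\<Sum>c\<in>zeros T. real (order c T) * (ln (norm (z - c)))^2)"
      unfolding x_def w_def by (rule sum_weighted_sq_le) simp
    moreover have "(maxpot z)^2 \<le> Bd^2"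
      unfolding abs_le_square_iff[symmetric] using Bd(1) Bd(2)[of z] zr by simp
    moreover have "(x + maxpot z)^2 \<le> 2 * x^2 + 2 * (maxpot z)^2"
      using sum_squares_bound[of x "maxpot z"] by (simp add: power2_sum)
    ultimately show ?thesis using True zr by (simp add: g_def limit_pot_def x_def[symmetric])
  next
    case False
    then show ?thesis using g0[of z] by simp
  qed
  have "(\<integral>\<^sup>+z\<in>ball 0 R. ennreal ((limit_pot z)^2) \<partial>lborel) \<le> (\<integral>\<^sup>+z. ennreal (g z) \<partial>lborel)"
  proof (rule nn_integral_mono)
    fix z :: complex
    have "ennreal ((limit_pot z)^2) * indicator (ball 0 R) z = ennreal ((limit_pot z)^2 * indicator (ball 0 R) z)"
      by (simp add: indicator_def)
    then show "ennreal ((limit_pot z)^2) * indicator (ball 0 R) z \<le> ennreal (g z)"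
      using le[of z] by (simp add: ennreal_leI)
  qed
  also have "\<dots> < \<infinity>" unfolding nn_integral_eq_integral[OF gi AE_I2[OF g0]] by simp
  finally show ?thesis .
qed

lemma ln_norm_W:
  assumes z: "z \<notin> sing Q T"
  shows "ln (norm (poly W z)) = (\<Sum>c\<in>zeros T. real (order c T) * ln (norm (z - c))) + (\<Sum>b\<in>sing Q T. ln (norm (z - b)))"
proof -
  have fin: "finite (zeros T)" "finite (zeros Q - zeros T)"
    using finite_zeros[OF T_nz] finite_zeros[OF Q_nz] by auto
  have pos: "norm (z - b) > 0" if "b \<in> zeros T \<or> b \<in> zeros Q - zeros T" for b
    using z that by (auto simp: sing_def)
  have "norm (poly W z) = (\<Prod>c\<in>zeros T. norm (z - c) ^ (order c T + 1)) * (\<Prod>b\<in>zeros Q - zeros T. norm (z - b))"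
    unfolding W_poly_def by (simp add: poly_prod norm_mult prod_norm[symmetric] norm_power del: power_Suc)
  also have "ln \<dots> = ln (\<Prod>c\<in>zeros T. norm (z - c) ^ (order c T + 1)) + ln (\<Prod>b\<in>zeros Q - zeros T. norm (z - b))"
    using pos by (intro ln_mult_pos prod_pos zero_less_power) auto
  also have "ln (\<Prod>c\<in>zeros T. norm (z - c) ^ (order c T + 1)) = (\<Sum>c\<in>zeros T. ln (norm (z - c) ^ (order c T + 1)))"
    using pos by (intro ln_prod fin zero_less_power) auto
  also have "\<dots> = (\<Sum>c\<in>zeros T. real (order c T) * ln (norm (z - c)) + ln (norm (z - c)))"
  proof (rule sum.cong[OF refl])
    fix c assume "c \<in> zeros T"
    have "ln (norm (z - c) ^ (order c T + 1)) = real (order c T + 1) * ln (norm (z - c))" by (rule ln_realpow)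
    then show "ln (norm (z - c) ^ (order c T + 1)) = real (order c T) * ln (norm (z - c)) + ln (norm (z - c))"
      by (simp add: algebra_simps del: power_Suc)
  qed
  also have "ln (\<Prod>b\<in>zeros Q - zeros T. norm (z - b)) = (\<Sum>b\<in>zeros Q - zeros T. ln (norm (z - b)))"
    using pos by (intro ln_prod fin) auto
  finally have "ln (norm (poly W z)) = (\<Sum>c\<in>zeros T. real (order c T) * ln (norm (z - c)))
      + ((\<Sum>c\<in>zeros T. ln (norm (z - c))) + (\<Sum>b\<in>zeros Q - zeros T. ln (norm (z - b))))"
    by (simp add: sum.distrib)
  also have "(\<Sum>c\<in>zeros T. ln (norm (z - c))) + (\<Sum>b\<in>zeros Q - zeros T. ln (norm (z - b))) = (\<Sum>b\<in>sing Q T. ln (norm (z - b)))"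
    unfolding sing_def using fin by (subst sum.union_disjoint[symmetric]) (auto simp: Un_Diff_cancel)
  finally show ?thesis .
qed

text \<open>Two forms for two purposes: the sum of logarithms with poles on the singular set is what
  \<open>l1_on_connected\<close> expects on the punctured cell, and the second is the growth rate
  suggested by \<open>B n = Q W^n f^(n) / (PT exp (S / T))\<close>.\<close>

lemma limit_pot_cell:
  assumes i: "i \<in> {1..N}" and z: "z \<in> cell i"
  shows "limit_pot z = (\<Sum>b\<in>sing Q T. ((if b \<in> zeros T then real (order b T) else 0) + (if b = a i then 0 else 1)) * ln (norm (z - b)))"
    and "z \<noteq> a i \<Longrightarrow> limit_pot z = ln (norm (poly W z)) - ln (norm (z - a i))"
proof -
  have ai: "a i \<in> sing Q T" using i sites_eq by auto
  have inj': "inj_on a ({1..N} - {i})" using inj by (rule inj_on_subset) auto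
  have im: "a ` ({1..N} - {i}) = sing Q T - {a i}"
    unfolding sites_eq[symmetric] using inj_on_image_set_diff[OF inj, of "{1..N}" "{i}"] i by simp
  have mp: "maxpot z = (\<Sum>b\<in>sing Q T - {a i}. ln (norm (z - b)))"
    unfolding maxpot_cell[OF i z] im[symmetric] by (subst sum.reindex[OF inj']) simp
  have "(\<Sum>c\<in>zeros T. real (order c T) * ln (norm (z - c))) = (\<Sum>b\<in>sing Q T. (if b \<in> zeros T then real (order b T) else 0) * ln (norm (z - b)))"
    by (rule sum.mono_neutral_cong_left) (auto simp: finite_sing, auto simp: sing_def)
  moreover have "(\<Sum>b\<in>sing Q T - {a i}. ln (norm (z - b))) = (\<Sum>b\<in>sing Q T. (if b = a i then 0 else 1) * ln (norm (z - b)))"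
    by (rule sum.mono_neutral_cong_left) (auto simp: finite_sing)
  ultimately show "limit_pot z = (\<Sum>b\<in>sing Q T. ((if b \<in> zeros T then real (order b T) else 0) + (if b = a i then 0 else 1)) * ln (norm (z - b)))"
    unfolding limit_pot_def mp by (simp only: distrib_right sum.distrib)
  assume "z \<noteq> a i"
  then have "z \<notin> sing Q T" using cell_avoids_sites[OF z] sites_eq by simp
  from ln_norm_W[OF this] show "limit_pot z = ln (norm (poly W z)) - ln (norm (z - a i))"
    unfolding limit_pot_def mp sum.remove[OF finite_sing ai] by simp
qed

text \<open>The polynomial is replaced by 1 at \<open>n = 0\<close> so that its degree is at most
  \<open>C n\<close> for every \<open>n\<close>; \<open>B 0\<close> may have positive
  degree.\<close>

definition zero_pot :: "nat \<Rightarrow> complex \<Rightarrow> real" where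
  "zero_pot n z = 1 / real n * ln (norm (poly (if n = 0 then 1 else B n) z)) + (- ln (fact n) / real n)"

abbreviation "f \<equiv> hyp_f P Q S T"

text \<open>The part of \<open>ln |B n|\<close> that does not depend on \<open>n\<close>; bounded on
  compact sets off the singularities, it disappears after division by \<open>n\<close>.\<close>

definition prefactor :: "complex \<Rightarrow> real" where
  "prefactor z = ln (norm (poly Q z / poly PT z * exp (- (poly S z / poly T z))))"

lemma continuous_prefactor: "continuous_on (- sing Q T) prefactor"
proof -
  have "poly T z \<noteq> 0" "poly Q z \<noteq> 0" "poly PT z \<noteq> 0" if "z \<in> - sing Q T" for z
    using that poly_PT_nz[of z] by (auto simp: sing_def zeros_def)
  then show ?thesis unfolding prefactor_def[abs_def] by (intro continuous_intros) auto
qed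

lemma zero_pot_cell:
  assumes i: "i \<in> {1..N}" and z: "z \<in> cell i" "z \<noteq> a i" and n: "n > 0" and nz: "poly (B n) z \<noteq> 0"
  shows "(deriv ^^ n) f z \<noteq> 0"
    and "zero_pot n z = limit_pot z + (prefactor z + ln (norm ((deriv ^^ n) f z) / fact n * norm (z - a i) ^ n)) / real n"
proof -
  have s: "z \<notin> sing Q T" using cell_avoids_sites[OF z] sites_eq by simp
  have nz': "poly T z \<noteq> 0" "poly Q z \<noteq> 0" "poly PT z \<noteq> 0" "poly W z \<noteq> 0"
    using s poly_PT_nz[of z] poly_W_eq_0_iff[of z] by (auto simp: sing_def zeros_def)
  define E where "E = poly S z / poly T z"
  have d: "(deriv ^^ n) f z = poly PT z * poly (B n) z / (poly Q z * poly W z ^ n) * exp E"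
    unfolding higher_deriv_hyp_f[OF s] E_def ..
  show d0: "(deriv ^^ n) f z \<noteq> 0" unfolding d using nz nz' by simp
  have "poly (B n) z = poly Q z / poly PT z * exp (- E) * (deriv ^^ n) f z * poly W z ^ n"
    unfolding d using nz' by (simp add: field_simps exp_minus)
  then have "norm (poly (B n) z) = norm (poly Q z / poly PT z * exp (- E)) * norm ((deriv ^^ n) f z) * norm (poly W z) ^ n"
    by (simp only: norm_mult norm_power)
  also have "ln \<dots> = prefactor z + ln (norm ((deriv ^^ n) f z)) + real n * ln (norm (poly W z))"
    using nz' d0 by (simp add: prefactor_def E_def ln_mult_pos ln_realpow del: exp_minus norm_mult norm_divide norm_exp_eq_Re)
  finally have L: "ln (norm (poly (B n) z)) = \<dots>" .
  have q: "ln (norm ((deriv ^^ n) f z) / fact n * norm (z - a i) ^ n)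
      = ln (norm ((deriv ^^ n) f z)) - ln (fact n) + real n * ln (norm (z - a i))"
    using d0 z(2) by (subst ln_mult_pos) (simp_all add: ln_div ln_realpow)
  show "zero_pot n z = limit_pot z + (prefactor z + ln (norm ((deriv ^^ n) f z) / fact n * norm (z - a i) ^ n)) / real n"
    unfolding zero_pot_def limit_pot_cell(2)[OF i z] q using n by (simp add: L field_simps)
qed

lemma prefactor_bounded:
  assumes K: "compact K" "K \<inter> sing Q T = {}"
  obtains C where "\<And>z. z \<in> K \<Longrightarrow> \<bar>prefactor z\<bar> \<le> C"
proof -
  have "compact (prefactor ` K)"
    using K by (intro compact_continuous_image continuous_on_subset[OF continuous_prefactor]) auto
  then have "bounded (prefactor ` K)" by (rule compact_imp_bounded)
  then show thesis using that by (auto simp: bounded_iff)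
qed

text \<open>In the cell the distance to the singular set is \<open>|z - a i|\<close>, so the Cauchy
  bound exceeds the rate in \<open>limit_pot\<close> by \<open>\<epsilon> / 2\<close> only; the
  other half absorbs the prefactor and \<open>ln M\<close>, divided by \<open>n\<close>.\<close>

lemma zero_pot_upper:
  assumes i: "i \<in> {1..N}" and K: "compact K" "K \<subseteq> cell i - {a i}" and e: "\<epsilon> > 0"
  shows "\<forall>\<^sub>F n in sequentially. \<forall>z\<in>K. poly (if n = 0 then 1 else B n) z \<noteq> 0 \<longrightarrow> zero_pot n z \<le> limit_pot z + \<epsilon>"
proof -
  have Ks: "K \<inter> sing Q T = {}" using K(2) cell_avoids_sites sites_eq by blast
  obtain C where C: "\<And>z. z \<in> K \<Longrightarrow> \<bar>prefactor z\<bar> \<le> C" using prefactor_bounded[OF K(1) Ks] by blast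
  have "sing Q T \<noteq> {}" using i sites_eq by auto
  from higher_deriv_bound_compact[OF hyp_f_holomorphic finite_sing this K(1) Ks, of "\<epsilon> / 2"] e
  obtain M where M: "M > 0"
    "\<And>n z. z \<in> K \<Longrightarrow> norm ((deriv ^^ n) f z) / fact n \<le> M * (exp (\<epsilon> / 2) / infdist z (sing Q T)) ^ n"
    by (metis half_gt_zero)
  have "(\<lambda>n. (C + ln M) / real n) \<longlonglongrightarrow> 0" by real_asymp
  from order_tendstoD(2)[OF this, of "\<epsilon> / 2"] e
  have "\<forall>\<^sub>F n in sequentially. (C + ln M) / real n < \<epsilon> / 2" by simp
  then show ?thesis using eventually_gt_at_top[of 0]
  proof eventually_elim
    case (elim n)
    show ?case
    proof (intro ballI impI)
      fix z assume zK: "z \<in> K" and nz: "poly (if n = 0 then 1 else B n) z \<noteq> 0"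
      have z: "z \<in> cell i" "z \<noteq> a i" using zK K(2) by auto
      have nz': "poly (B n) z \<noteq> 0" using nz elim by simp
      define q where "q = norm ((deriv ^^ n) f z) / fact n * norm (z - a i) ^ n"
      have pos: "norm (z - a i) > 0" using z by simp
      have q0: "q > 0" unfolding q_def using zero_pot_cell(1)[OF i z elim(2) nz'] pos by simp
      have "q \<le> M * (exp (\<epsilon> / 2) / norm (z - a i)) ^ n * norm (z - a i) ^ n"
        unfolding q_def using M(2)[OF zK, of n] infdist_cell[OF i z(1)] sites_eq by (intro mult_right_mono) auto
      also have "\<dots> = M * exp (\<epsilon> / 2) ^ n" using pos by (simp add: power_divide)
      finally have "ln q \<le> ln (M * exp (\<epsilon> / 2) ^ n)" using q0 M(1) by (intro ln_mono) auto
      also have "\<dots> = ln M + real n * (\<epsilon> / 2)" using M(1) by (simp add: ln_mult_pos ln_realpow)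
      finally have lq: "ln q \<le> ln M + real n * (\<epsilon> / 2)" .
      have "zero_pot n z = limit_pot z + (prefactor z + ln q) / real n"
        unfolding q_def by (rule zero_pot_cell(2)[OF i z elim(2) nz'])
      also have "\<dots> \<le> limit_pot z + (C + (ln M + real n * (\<epsilon> / 2))) / real n"
        using C[OF zK] lq by (intro add_left_mono divide_right_mono add_mono) auto
      also have "(C + (ln M + real n * (\<epsilon> / 2))) / real n = (C + ln M) / real n + \<epsilon> / 2"
        using elim(2) by (simp add: field_simps)
      finally show "zero_pot n z \<le> limit_pot z + \<epsilon>" using elim(1) by linarith
    qed
  qed
qed

text \<open>The compact set is a small circle about \<open>a i\<close>. On it
  \<open>|z - a i|\<close> is the constant radius \<open>s\<close>, so the lower bound
  \<open>c / s ^ n\<close> for the derivative cancels against \<open>|z - a i| ^ n\<close> and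
  leaves only a term of order \<open>1 / n\<close>.\<close>

lemma zero_pot_lower:
  assumes i: "i \<in> {1..N}"
  shows "\<exists>K y. compact K \<and> K \<subseteq> cell i - {a i} \<and> (\<forall>n. y n \<in> K) \<and>
    (\<forall>\<epsilon>>0. \<forall>\<^sub>F n in sequentially. poly (if n = 0 then 1 else B n) (y n) \<noteq> 0 \<and> limit_pot (y n) - \<epsilon> \<le> zero_pot n (y n))"
proof -
  obtain r where r: "r > 0" "ball (a i) r \<subseteq> cell i" using open_cell site_in_cell[OF i] by (meson openE)
  have ai: "a i \<in> sing Q T" using i sites_eq by auto
  have rs: "ball (a i) r \<inter> sing Q T = {a i}"
  proof (intro equalityI subsetI)
    fix x assume x: "x \<in> ball (a i) r \<inter> sing Q T"
    then have "x \<in> cell i" "x \<in> a ` {1..N}" using r(2) sites_eq by blast+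
    then show "x \<in> {a i}" using cell_avoids_sites[of x i] by blast
  qed (use ai r(1) in auto)
  define s where "s = r / 2"
  have s: "0 < s" "s < r" using r by (simp_all add: s_def)
  have hol: "f holomorphic_on ball (a i) r - {a i}"
    by (rule holomorphic_on_subset[OF hyp_f_holomorphic]) (use rs in blast)
  have "\<exists>k. contour_integral (circlepath (a i) s) (\<lambda>w. f w * (w - a i) ^ k) \<noteq> 0"
  proof (rule ccontr)
    assume "\<not> ?thesis"
    then have "\<And>k. contour_integral (circlepath (a i) s) (\<lambda>w. f w * (w - a i) ^ k) = 0" by simp
    from extends_if_moments_vanish[OF hol s this]
    have ext: "\<exists>F. F holomorphic_on ball (a i) s \<and> (\<forall>z\<in>ball (a i) s - {a i}. F z = f z)" .
    have "ball (a i) s \<subseteq> ball (a i) r" using s by (intro subset_ball) simp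
    then have "ball (a i) s \<inter> sing Q T = {a i}" using rs s(1) ai by auto
    from hyp_f_not_extendable[OF ai s(1) this] ext show False by (rule notE)
  qed
  then obtain k where k: "contour_integral (circlepath (a i) s) (\<lambda>w. f w * (w - a i) ^ k) \<noteq> 0" ..
  obtain c where c: "c > 0" "\<forall>n. \<exists>w\<in>sphere (a i) s. c / s ^ n \<le> norm ((deriv ^^ n) f w) / fact n"
    using higher_deriv_lower_bound_circle[OF hol s k] by (elim exE conjE)
  from bchoice[of UNIV "\<lambda>n w. w \<in> sphere (a i) s \<and> c / s ^ n \<le> norm ((deriv ^^ n) f w) / fact n"] c(2)
  obtain y where y: "\<And>n. y n \<in> sphere (a i) s" "\<And>n. c / s ^ n \<le> norm ((deriv ^^ n) f (y n)) / fact n"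
    by (auto simp: Bex_def)
  have sub: "sphere (a i) s \<subseteq> cell i - {a i}" using r(2) s by (auto simp: subset_iff)
  then have sph: "sphere (a i) s \<inter> sing Q T = {}" using cell_avoids_sites sites_eq by blast
  obtain C where C: "\<And>z. z \<in> sphere (a i) s \<Longrightarrow> \<bar>prefactor z\<bar> \<le> C"
    using prefactor_bounded[OF compact_sphere sph] by blast
  have ev: "\<forall>\<^sub>F n in sequentially. poly (if n = 0 then 1 else B n) (y n) \<noteq> 0 \<and> limit_pot (y n) - \<epsilon> \<le> zero_pot n (y n)"
    if e: "\<epsilon> > 0" for \<epsilon>
  proof -
    have "(\<lambda>n. (- C + ln c) / real n) \<longlonglongrightarrow> 0" by real_asymp
    from order_tendstoD(1)[OF this, of "- \<epsilon>"] e
    have "\<forall>\<^sub>F n in sequentially. - \<epsilon> < (- C + ln c) / real n" by simp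
    then show ?thesis using eventually_gt_at_top[of 0]
    proof eventually_elim
      case (elim n)
      have z: "y n \<in> cell i" "y n \<noteq> a i" using y(1)[of n] sub by auto
      have zs: "y n \<notin> sing Q T" using y(1)[of n] sph by blast
      have "0 < c / s ^ n" using c(1) s(1) by simp
      also have "\<dots> \<le> norm ((deriv ^^ n) f (y n)) / fact n" by (rule y(2))
      finally have "(deriv ^^ n) f (y n) \<noteq> 0" by auto
      then have nz: "poly (B n) (y n) \<noteq> 0" unfolding higher_deriv_hyp_f[OF zs] by auto
      define q where "q = norm ((deriv ^^ n) f (y n)) / fact n * norm (y n - a i) ^ n"
      have "norm (y n - a i) = s" using y(1)[of n] by (simp add: dist_norm norm_minus_commute)
      then have "c \<le> q" unfolding q_def using y(2)[of n] s(1) by (simp add: pos_divide_le_eq)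
      then have "ln c \<le> ln q" using c(1) by (intro ln_mono) auto
      then have "(- C + ln c) / real n \<le> (prefactor (y n) + ln q) / real n"
        using C[OF y(1)[of n]] by (intro divide_right_mono add_mono) auto
      moreover have "zero_pot n (y n) = limit_pot (y n) + (prefactor (y n) + ln q) / real n"
        unfolding q_def by (rule zero_pot_cell(2)[OF i z elim(2) nz])
      ultimately show ?case using elim nz by simp
    qed
  qed
  show ?thesis by (intro exI[of _ "sphere (a i) s"] exI[of _ y] conjI compact_sphere sub allI impI y(1) ev)
qed

text \<open>Cells are open and convex, and removing one point from such a set in the plane keeps it
  connected, so each punctured cell is a domain for the propagation. Together they have full
  measure.\<close>

proposition zero_pot_tendsto_limit_pot:
  "(\<lambda>n. l1_on (ball 0 R) (zero_pot n) limit_pot) \<longlonglongrightarrow> 0"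
proof -
  define p where "p n = (if n = 0 then 1 else B n)" for n
  define D where "D = (\<Union>i\<in>{1..N}. cell i - {a i})"
  have zp: "zero_pot n = (\<lambda>z. 1 / real n * ln (norm (poly (p n) z)) + (- ln (fact n) / real n))" for n
    unfolding zero_pot_def p_def ..
  have p0: "p n \<noteq> 0" for n using B_nz by (simp add: p_def)
  have loc: "\<exists>r>0. (\<lambda>n. l1_on (ball z r) (zero_pot n) limit_pot) \<longlonglongrightarrow> 0" if zD: "z \<in> D" for z
  proof -
    obtain i where i: "i \<in> {1..N}" and z: "z \<in> cell i - {a i}" using zD unfolding D_def by blast
    have op: "open (cell i - {a i})" using open_cell by (intro open_Diff) auto
    have con: "connected (cell i - {a i})"
      by (intro connected_open_delete open_cell convex_connected convex_cell) simp
    obtain r where r: "r > 0" "cball z r \<subseteq> cell i - {a i}" using op z by (meson open_contains_cball)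
    obtain K y where K: "compact K" "K \<subseteq> cell i - {a i}" "\<And>n. y n \<in> K"
      and low: "\<And>\<epsilon>. \<epsilon> > 0 \<Longrightarrow> \<forall>\<^sub>F n in sequentially. poly (p n) (y n) \<noteq> 0 \<and> limit_pot (y n) - \<epsilon> \<le> zero_pot n (y n)"
      using zero_pot_lower[OF i] unfolding p_def by blast
    have sg: "sing Q T \<inter> (cell i - {a i}) = {}" using cell_avoids_sites sites_eq by blast
    have "(\<lambda>n. l1_on (ball z (r / 4)) (\<lambda>z. 1 / real n * ln (norm (poly (p n) z)) + (- ln (fact n) / real n)) limit_pot) \<longlonglongrightarrow> 0"
    proof (rule l1_on_connected[OF _ p0 borel_measurable_limit_pot op con finite_sing sg _ _ K _ r(2,1)])
      show "limit_pot z = (\<Sum>b\<in>sing Q T. ((if b \<in> zeros T then real (order b T) else 0) + (if b = a i then 0 else 1)) * ln (norm (z - b)))"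
        if "z \<in> cell i - {a i}" for z using that by (intro limit_pot_cell(1)[OF i]) simp
      show "\<forall>\<^sub>F n in sequentially. \<forall>z\<in>K. poly (p n) z \<noteq> 0 \<longrightarrow> 1 / real n * ln (norm (poly (p n) z)) + (- ln (fact n) / real n) \<le> limit_pot z + \<epsilon>"
        if "compact K" "K \<subseteq> cell i - {a i}" "\<epsilon> > 0" for K \<epsilon>
        using zero_pot_upper[OF i that] unfolding zp p_def .
      show "\<forall>\<^sub>F n in sequentially. poly (p n) (y n) \<noteq> 0 \<and> limit_pot (y n) - \<epsilon> \<le> 1 / real n * ln (norm (poly (p n) (y n))) + (- ln (fact n) / real n)"
        if "\<epsilon> > 0" for \<epsilon> using low[OF that] unfolding zp .
    qed simp
    then show ?thesis unfolding zp using r(1) by (intro exI[of _ "r / 4"] conjI) simp_all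
  qed
  have op: "open D" unfolding D_def by (intro open_UN ballI open_Diff open_cell) simp_all
  have ne: "D \<noteq> {}"
  proof
    assume "D = {}"
    then have "emeasure lborel (UNIV :: complex set) = 0"
      using emeasure_off_cells unfolding D_def[symmetric] by simp
    then show False by simp
  qed
  have deg: "real (degree (p n)) \<le> (real \<kappa> + real (degree Psh)) * real n" for n
  proof (cases "n = 0")
    case False
    have "degree (B n) \<le> \<kappa> * n + degree Psh * 1" using degree_B_le[of n] by simp
    also have "\<dots> \<le> \<kappa> * n + degree Psh * n" using False by (intro add_left_mono mult_left_mono) auto
    finally have "real (degree (B n)) \<le> real (\<kappa> * n + degree Psh * n)" by (simp only: of_nat_le_iff)
    then show ?thesis using False by (simp add: p_def algebra_simps)
  qed (simp add: p_def)
  show ?thesis unfolding zp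
  proof (rule l1_on_ball_tendsto_0[OF p0 deg _ borel_measurable_limit_pot limit_pot_sq_integral op ne])
    show "emeasure lborel (- D) = 0" unfolding D_def by (rule emeasure_off_cells)
    show "\<exists>r>0. (\<lambda>n. l1_on (ball z r) (\<lambda>z. 1 / real n * ln (norm (poly (p n) z)) + - ln (fact n) / real n) limit_pot) \<longlonglongrightarrow> 0"
      if "z \<in> D" for z using loc[OF that] unfolding zp .
  qed simp
qed

end

section \<open>Integration against sums of measures\<close>

text \<open>The combined measures are given by their values on sets, which yields identities for
  nonnegative integrands; splitting into positive and negative parts carries these over to real
  ones. Finite sums and scalar multiples are both instances.\<close>

lemma integral_linear_combination:
  fixes c :: "'i \<Rightarrow> real" and g :: "'a \<Rightarrow> real"
  assumes nn: "\<And>f. f \<in> borel_measurable M \<Longrightarrow> (\<integral>\<^sup>+x. f x \<partial>M) = (\<Sum>i\<in>I. ennreal (c i) * (\<integral>\<^sup>+x. f x \<partial>M' i))"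
    and I: "finite I" and c: "\<And>i. i \<in> I \<Longrightarrow> c i \<ge> 0"
    and g: "g \<in> borel_measurable M" "\<And>i. i \<in> I \<Longrightarrow> integrable (M' i) g"
  shows "integrable M g" "(\<integral>x. g x \<partial>M) = (\<Sum>i\<in>I. c i * (\<integral>x. g x \<partial>M' i))"
proof -
  note [measurable] = g(1)
  have fin: "(\<integral>\<^sup>+x. ennreal (norm (g x)) \<partial>M' i) < top" if "i \<in> I" for i
    using g(2)[OF that] by (simp add: integrable_iff_bounded)
  have fin': "(\<integral>\<^sup>+x. ennreal (g x) \<partial>M' i) < top" "(\<integral>\<^sup>+x. ennreal (- g x) \<partial>M' i) < top" if "i \<in> I" for i
    by (rule le_less_trans[OF nn_integral_mono fin[OF that]], simp add: ennreal_leI)+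
  have "(\<integral>\<^sup>+x. ennreal (norm (g x)) \<partial>M) < \<infinity>"
    by (subst nn, measurable) (use fin I in \<open>auto simp: ennreal_mult_less_top\<close>)
  then show int: "integrable M g" using g(1) by (simp add: integrable_iff_bounded)
  have e: "enn2real (\<Sum>i\<in>I. ennreal (c i) * X i) = (\<Sum>i\<in>I. c i * enn2real (X i))"
    if "\<And>i. i \<in> I \<Longrightarrow> X i < top" for X
  proof -
    have "enn2real (\<Sum>i\<in>I. ennreal (c i) * X i) = (\<Sum>i\<in>I. enn2real (ennreal (c i) * X i))"
      by (subst enn2real_sum) (use that in \<open>auto simp: ennreal_mult_less_top\<close>)
    then show ?thesis using c by (simp add: enn2real_mult)
  qed
  have "(\<integral>x. g x \<partial>M) = enn2real (\<integral>\<^sup>+x. ennreal (g x) \<partial>M) - enn2real (\<integral>\<^sup>+x. ennreal (- g x) \<partial>M)"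
    by (rule real_lebesgue_integral_def[OF int])
  also have "(\<integral>\<^sup>+x. ennreal (g x) \<partial>M) = (\<Sum>i\<in>I. ennreal (c i) * (\<integral>\<^sup>+x. ennreal (g x) \<partial>M' i))"
    by (rule nn) measurable
  also have "(\<integral>\<^sup>+x. ennreal (- g x) \<partial>M) = (\<Sum>i\<in>I. ennreal (c i) * (\<integral>\<^sup>+x. ennreal (- g x) \<partial>M' i))"
    by (rule nn) measurable
  also have "enn2real (\<Sum>i\<in>I. ennreal (c i) * (\<integral>\<^sup>+x. ennreal (g x) \<partial>M' i)) -
      enn2real (\<Sum>i\<in>I. ennreal (c i) * (\<integral>\<^sup>+x. ennreal (- g x) \<partial>M' i))
    = (\<Sum>i\<in>I. c i * enn2real (\<integral>\<^sup>+x. ennreal (g x) \<partial>M' i)) - (\<Sum>i\<in>I. c i * enn2real (\<integral>\<^sup>+x. ennreal (- g x) \<partial>M' i))"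
    using fin' by (simp only: e)
  also have "\<dots> = (\<Sum>i\<in>I. c i * (\<integral>x. g x \<partial>M' i))"
    using g(2) by (simp add: sum_subtractf[symmetric] right_diff_distrib[symmetric] real_lebesgue_integral_def)
  finally show "(\<integral>x. g x \<partial>M) = (\<Sum>i\<in>I. c i * (\<integral>x. g x \<partial>M' i))" .
qed

lemma sets_sum_measure [simp]: "sets (sum_measure I M0 M) = sets M0" by (simp add: sum_measure_def)

lemma space_sum_measure [simp]: "space (sum_measure I M0 M) = space M0" by (simp add: sum_measure_def)

lemma nn_integral_sum_measure:
  assumes I: "finite I" and s: "\<And>i. i \<in> I \<Longrightarrow> sets (M i) = sets M0" and f: "f \<in> borel_measurable M0"
  shows "(\<integral>\<^sup>+x. f x \<partial>sum_measure I M0 M) = (\<Sum>i\<in>I. \<integral>\<^sup>+x. f x \<partial>M i)" using f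
proof (induction rule: borel_measurable_induct)
  note m = measurable_cong_sets[OF sets_sum_measure refl, of I M0 M] measurable_cong_sets[OF s refl]
  note sp = sets_eq_imp_space_eq[OF s]
  {
    case (cong f g)
    have "(\<integral>\<^sup>+x. f x \<partial>sum_measure I M0 M) = (\<integral>\<^sup>+x. g x \<partial>sum_measure I M0 M)"
      by (rule nn_integral_cong) (simp add: cong(3))
    moreover have "(\<Sum>i\<in>I. \<integral>\<^sup>+x. f x \<partial>M i) = (\<Sum>i\<in>I. \<integral>\<^sup>+x. g x \<partial>M i)"
      by (intro sum.cong refl nn_integral_cong) (simp add: cong(3) sp)
    ultimately show ?case using cong(4) by simp
  next
    case (set A)
    then have "(\<integral>\<^sup>+x. indicator A x \<partial>sum_measure I M0 M) = (\<Sum>i\<in>I. emeasure (M i) A)"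
      by (simp add: emeasure_sum_measure[OF s])
    also have "\<dots> = (\<Sum>i\<in>I. \<integral>\<^sup>+x. indicator A x \<partial>M i)" using set by (intro sum.cong refl) (simp add: s)
    finally show ?case .
  next
    case (mult u c)
    then show ?case by (simp add: nn_integral_cmult m sum_distrib_left)
  next
    case (add u v)
    then show ?case by (simp add: nn_integral_add m sum.distrib)
  next
    case (seq U)
    have "(\<integral>\<^sup>+x. (SUP i. U i) x \<partial>sum_measure I M0 M) = (SUP i. \<integral>\<^sup>+x. U i x \<partial>sum_measure I M0 M)"
      unfolding SUP_apply using seq(1,3) by (intro nn_integral_monotone_convergence_SUP) (simp_all add: m)
    also have "\<dots> = (SUP n. \<Sum>i\<in>I. \<integral>\<^sup>+x. U n x \<partial>M i)" using seq.IH by simp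
    also have "\<dots> = (\<Sum>i\<in>I. SUP n. \<integral>\<^sup>+x. U n x \<partial>M i)"
      by (rule ennreal_SUP_sum) (intro incseq_nn_integral seq.hyps)
    also have "\<dots> = (\<Sum>i\<in>I. \<integral>\<^sup>+x. (SUP i. U i) x \<partial>M i)"
      unfolding SUP_apply using seq(1,3) by (intro sum.cong refl nn_integral_monotone_convergence_SUP[symmetric]) (simp_all add: m)
    finally show ?case .
  }
qed

text \<open>Addition as a sum over \<open>bool\<close> becomes an instance of finite sums.\<close>

lemma add_measure_eq: "add_measure M M' = sum_measure UNIV M (\<lambda>b. if b then M else M')"
  by (simp add: add_measure_def sum_measure_def UNIV_bool add.commute)

lemma sets_add_measure [simp]: "sets (add_measure M M') = sets M" by (simp add: add_measure_eq)

lemma integral_sum_measure: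
  fixes g :: "'a \<Rightarrow> real"
  assumes I: "finite I" and s: "\<And>i. i \<in> I \<Longrightarrow> sets (M i) = sets M0"
    and g: "g \<in> borel_measurable M0" "\<And>i. i \<in> I \<Longrightarrow> integrable (M i) g"
  shows "integrable (sum_measure I M0 M) g" "(\<integral>x. g x \<partial>sum_measure I M0 M) = (\<Sum>i\<in>I. \<integral>x. g x \<partial>M i)"
proof -
  note m = measurable_cong_sets[OF sets_sum_measure refl, of I M0 M]
  have nn: "(\<integral>\<^sup>+x. f x \<partial>sum_measure I M0 M) = (\<Sum>i\<in>I. ennreal 1 * (\<integral>\<^sup>+x. f x \<partial>M i))"
    if "f \<in> borel_measurable (sum_measure I M0 M)" for f :: "'a \<Rightarrow> ennreal"
  proof -
    have "f \<in> borel_measurable M0" using that by (simp add: m)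
    from nn_integral_sum_measure[OF I s this] show ?thesis by simp
  qed
  have gm: "g \<in> borel_measurable (sum_measure I M0 M)" using g(1) by (simp add: m)
  show "integrable (sum_measure I M0 M) g"
    by (rule integral_linear_combination(1)[OF nn I _ gm g(2)]) simp_all
  have "(\<integral>x. g x \<partial>sum_measure I M0 M) = (\<Sum>i\<in>I. 1 * (\<integral>x. g x \<partial>M i))"
    by (rule integral_linear_combination(2)[OF nn I _ gm g(2)]) simp_all
  then show "(\<integral>x. g x \<partial>sum_measure I M0 M) = (\<Sum>i\<in>I. \<integral>x. g x \<partial>M i)" by simp
qed

lemma integral_add_measure:
  fixes g :: "'a \<Rightarrow> real"
  assumes s: "sets M' = sets M" and g: "integrable M g" "integrable M' g"
  shows "integrable (add_measure M M') g" "(\<integral>x. g x \<partial>add_measure M M') = (\<integral>x. g x \<partial>M) + (\<integral>x. g x \<partial>M')"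
proof -
  have i: "integrable (if b then M else M') g" and s': "sets (if b then M else M') = sets M" for b
    using g s by simp_all
  show "integrable (add_measure M M') g"
    unfolding add_measure_eq by (rule integral_sum_measure(1)[OF _ s' _ i]) (use g in simp_all)
  have "(\<integral>x. g x \<partial>add_measure M M') = (\<Sum>b\<in>UNIV. \<integral>x. g x \<partial>(if b then M else M'))"
    unfolding add_measure_eq by (rule integral_sum_measure(2)[OF _ s' _ i]) (use g in simp_all)
  then show "(\<integral>x. g x \<partial>add_measure M M') = (\<integral>x. g x \<partial>M) + (\<integral>x. g x \<partial>M')" by (simp add: UNIV_bool)
qed

lemma integral_scale_measure':
  fixes g :: "'a \<Rightarrow> real"
  assumes r: "r \<ge> 0" and g: "integrable M g"
  shows "integrable (scale_measure (ennreal r) M) g"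
    "(\<integral>x. g x \<partial>scale_measure (ennreal r) M) = r * (\<integral>x. g x \<partial>M)"
proof -
  have m: "borel_measurable (scale_measure (ennreal r) M) = borel_measurable M"
    by (rule measurable_cong_sets) simp_all
  have nn: "(\<integral>\<^sup>+x. f x \<partial>scale_measure (ennreal r) M) = (\<Sum>i\<in>(UNIV :: unit set). ennreal r * (\<integral>\<^sup>+x. f x \<partial>M))"
    if "f \<in> borel_measurable (scale_measure (ennreal r) M)" for f :: "'a \<Rightarrow> ennreal"
    using that by (simp add: m nn_integral_scale_measure UNIV_unit)
  have gm: "g \<in> borel_measurable (scale_measure (ennreal r) M)" using g by (simp add: m)
  show "integrable (scale_measure (ennreal r) M) g"
    by (rule integral_linear_combination(1)[OF nn finite r gm g])
  have "(\<integral>x. g x \<partial>scale_measure (ennreal r) M) = (\<Sum>i\<in>(UNIV :: unit set). r * (\<integral>x. g x \<partial>M))"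
    by (rule integral_linear_combination(2)[OF nn finite r gm g])
  then show "(\<integral>x. g x \<partial>scale_measure (ennreal r) M) = r * (\<integral>x. g x \<partial>M)" by (simp add: UNIV_unit)
qed

lemma atomic_measure_cong:
  assumes "\<And>z. z \<in> Z \<Longrightarrow> w z = w' z"
  shows "atomic_measure M Z w = atomic_measure M Z w'"
proof -
  have "point_measure Z (\<lambda>z. ennreal (w z)) = point_measure Z (\<lambda>z. ennreal (w' z))"
    unfolding point_measure_def by (rule density_cong) (simp_all add: AE_count_space assms)
  then show ?thesis by (simp add: atomic_measure_def)
qed

lemma sets_atomic_measure [simp]: "sets (atomic_measure M Z w) = sets M" by (simp add: atomic_measure_def)

lemma integral_atomic_measure:
  fixes g :: "'a \<Rightarrow> real"
  assumes Z: "finite Z" "Z \<subseteq> space M" and w: "\<And>z. z \<in> Z \<Longrightarrow> w z \<ge> 0" and g: "g \<in> borel_measurable M"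
  shows "integrable (atomic_measure M Z w) g" "(\<integral>x. g x \<partial>atomic_measure M Z w) = (\<Sum>z\<in>Z. w z * g z)"
proof -
  have id: "(\<lambda>z. z) \<in> point_measure Z (\<lambda>z. ennreal (w z)) \<rightarrow>\<^sub>M M" using Z by auto
  have "integrable (point_measure Z (\<lambda>z. ennreal (w z))) g"
    by (rule integrable_point_measure_finite) (use Z w in auto)
  then show "integrable (atomic_measure M Z w) g"
    unfolding atomic_measure_def by (subst integrable_distr_eq[OF id g])
  show "(\<integral>x. g x \<partial>atomic_measure M Z w) = (\<Sum>z\<in>Z. w z * g z)" unfolding atomic_measure_def
    by (subst integral_distr[OF id g], subst lebesgue_integral_point_measure_finite) (use Z w in auto)
qed

lemma finite_measureI_integrable:
  assumes "integrable M (\<lambda>_. 1 :: real)" shows "finite_measure M"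
proof (rule finite_measureI)
  have "(\<integral>\<^sup>+x. 1 \<partial>M) < \<infinity>" using assms by (simp add: integrable_iff_bounded)
  then show "emeasure M (space M) \<noteq> \<infinity>" by simp
qed

lemma finite_atomic_measure:
  assumes "finite Z" "Z \<subseteq> space M" "\<And>z. z \<in> Z \<Longrightarrow> w z \<ge> 0"
  shows "finite_measure (atomic_measure M Z w)"
  using integral_atomic_measure(1)[OF assms, where g = "\<lambda>_. 1"] by (intro finite_measureI_integrable) auto

lemma integrable_continuous_bounded:
  fixes g :: "complex \<Rightarrow> real"
  assumes M: "finite_measure M" "sets M = sets borel" and g: "continuous_on UNIV g" "\<And>z. \<bar>g z\<bar> \<le> C"
  shows "integrable M g"
proof -
  interpret finite_measure M by fact
  have "g \<in> borel_measurable M"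
    using borel_measurable_continuous_onI[OF g(1)] by (simp add: measurable_cong_sets[OF M(2) refl])
  then show ?thesis by (intro integrable_const_bound[of _ C]) (use g(2) in auto)
qed

lemma compact_support_iff:
  fixes g :: "complex \<Rightarrow> real"
  shows "compact (closure {z. g z \<noteq> 0}) \<longleftrightarrow> (\<exists>R. \<forall>z. R \<le> norm z \<longrightarrow> g z = 0)"
proof -
  have "compact (closure {z. g z \<noteq> 0}) \<longleftrightarrow> bounded {z. g z \<noteq> 0}"
    by (auto simp: compact_eq_bounded_closed intro: bounded_closure elim!: bounded_subset[OF _ closure_subset])
  also have "\<dots> \<longleftrightarrow> (\<exists>R. \<forall>z. R \<le> norm z \<longrightarrow> g z = 0)"
  proof
    assume "bounded {z. g z \<noteq> 0}"
    then obtain R where R: "\<And>z. g z \<noteq> 0 \<Longrightarrow> norm z \<le> R" unfolding bounded_iff by blast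
    have "g z = 0" if "R + 1 \<le> norm z" for z using R[of z] that by (cases "g z = 0") auto
    then show "\<exists>R. \<forall>z. R \<le> norm z \<longrightarrow> g z = 0" by blast
  next
    assume "\<exists>R. \<forall>z. R \<le> norm z \<longrightarrow> g z = 0"
    then obtain R where R: "\<And>z. R \<le> norm z \<Longrightarrow> g z = 0" by blast
    have "norm z \<le> R" if "g z \<noteq> 0" for z using R[of z] that by (cases "R \<le> norm z") auto
    then show "bounded {z. g z \<noteq> 0}" unfolding bounded_iff by blast
  qed
  finally show ?thesis .
qed

lemma integral_tendsto_approximation:
  fixes g :: "'a \<Rightarrow> real" and M :: "nat \<Rightarrow> 'a measure"
  assumes "\<And>e. e > 0 \<Longrightarrow> \<exists>q. (\<lambda>n. \<integral>z. q z \<partial>M n) \<longlonglongrightarrow> (\<integral>z. q z \<partial>M') \<and>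
    (\<forall>\<^sub>F n in sequentially. \<bar>(\<integral>z. q z \<partial>M n) - (\<integral>z. g z \<partial>M n)\<bar> \<le> e) \<and> \<bar>(\<integral>z. q z \<partial>M') - (\<integral>z. g z \<partial>M')\<bar> \<le> e"
  shows "(\<lambda>n. \<integral>z. g z \<partial>M n) \<longlonglongrightarrow> (\<integral>z. g z \<partial>M')"
proof (rule tendstoI)
  fix e :: real assume e: "e > 0"
  obtain q where q: "(\<lambda>n. \<integral>z. q z \<partial>M n) \<longlonglongrightarrow> (\<integral>z. q z \<partial>M')"
    "\<forall>\<^sub>F n in sequentially. \<bar>(\<integral>z. q z \<partial>M n) - (\<integral>z. g z \<partial>M n)\<bar> \<le> e / 3"
    "\<bar>(\<integral>z. q z \<partial>M') - (\<integral>z. g z \<partial>M')\<bar> \<le> e / 3" using assms[of "e / 3"] e by auto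
  have "\<forall>\<^sub>F n in sequentially. dist (\<integral>z. q z \<partial>M n) (\<integral>z. q z \<partial>M') < e / 3"
    using tendstoD[OF q(1), of "e / 3"] e by simp
  with q(2) show "\<forall>\<^sub>F n in sequentially. dist (\<integral>z. g z \<partial>M n) (\<integral>z. g z \<partial>M') < e"
    by eventually_elim (use q(3) in \<open>unfold dist_real_def, linarith\<close>)
qed

text \<open>The error of cutting off is bounded by the mass that \<open>X\<close> misses, a quantity
  that itself converges, so tightness reduces to the convergence of total masses.\<close>

lemma integral_cutoff_diff:
  fixes g X :: "complex \<Rightarrow> real"
  assumes N: "finite_measure N" "sets N = sets borel"
    and g: "continuous_on UNIV g" "\<And>z. \<bar>g z\<bar> \<le> C"
    and X: "continuous_on UNIV X" "\<And>z. 0 \<le> X z" "\<And>z. X z \<le> 1"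
  shows "\<bar>(\<integral>z. g z * X z \<partial>N) - (\<integral>z. g z \<partial>N)\<bar> \<le> C * ((\<integral>z. 1 \<partial>N) - (\<integral>z. X z \<partial>N))"
proof -
  interpret finite_measure N by fact
  have C: "C \<ge> 0" using g(2)[of 0] by linarith
  have "\<bar>g z\<bar> * X z \<le> C * 1" for z using g(2)[of z] X(2,3)[of z] C by (intro mult_mono) auto
  then have gX: "\<bar>g z * X z\<bar> \<le> C" for z using X(2)[of z] by (simp add: abs_mult)
  have "\<bar>X z\<bar> \<le> 1" for z using X(2,3)[of z] by simp
  note i = integrable_continuous_bounded[OF N g] integrable_continuous_bounded[OF N X(1) this]
    integrable_continuous_bounded[OF N continuous_on_mult[OF g(1) X(1)] gX]
  have "norm (g z * X z - g z) \<le> C * (1 - X z)" for z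
  proof -
    have "g z * X z - g z = - (g z * (1 - X z))" by (simp add: algebra_simps)
    then show ?thesis using mult_right_mono[OF g(2), of "1 - X z" z] X(3)[of z] by (simp add: abs_mult)
  qed
  then have "norm (\<integral>z. g z * X z - g z \<partial>N) \<le> (\<integral>z. C * (1 - X z) \<partial>N)"
    by (intro Bochner_Integration.integral_norm_bound_integral) (use i in auto)
  then show ?thesis using i by (simp add: Bochner_Integration.integral_diff)
qed

section \<open>Continuous functions on the Riemann sphere\<close>

lemma topspace_riemann_sphere: "topspace riemann_sphere = UNIV"
  by (auto simp: riemann_sphere_def) (metis option.exhaust rangeI)

lemma space_sphere_borel: "space sphere_borel = UNIV"
  by (simp add: sphere_borel_def topspace_riemann_sphere space_measure_of_conv)

lemma continuous_sphere_measurable: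
  assumes "continuous_map riemann_sphere euclideanreal g"
  shows "g \<in> borel_measurable sphere_borel"
proof (rule borel_measurableI)
  fix S :: "real set" assume "open S"
  then have "openin riemann_sphere {x \<in> topspace riemann_sphere. g x \<in> S}"
    using assms by (intro openin_continuous_map_preimage[of _ euclideanreal]) auto
  moreover have "{x \<in> topspace riemann_sphere. g x \<in> S} = g -` S \<inter> space sphere_borel"
    by (auto simp: topspace_riemann_sphere space_sphere_borel)
  ultimately show "g -` S \<inter> space sphere_borel \<in> sets sphere_borel"
    unfolding sphere_borel_def by (subst sets_measure_of) (auto dest: openin_subset)
qed

text \<open>Open neighbourhoods of \<open>None\<close> are complements of compact sets, so
  continuity there means a limit at infinity.\<close>

lemma continuous_sphere_plane:
  assumes g: "continuous_map riemann_sphere euclideanreal g"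
  shows "continuous_on UNIV (\<lambda>z. g (Some z))" "((\<lambda>z. g (Some z)) \<longlongrightarrow> g None) at_infinity"
proof -
  have op: "openin (Alexandroff_compactification euclidean) {x. g x \<in> S}" if "open S" for S
    using openin_continuous_map_preimage[OF g, of S] that by (simp add: topspace_riemann_sphere) (simp add: riemann_sphere_def)
  have "open ((\<lambda>z. g (Some z)) -` S)" if "open S" for S
    using op[OF that] unfolding openin_Alexandroff_compactification
    by (auto simp: vimage_def image_iff Compl_eq[symmetric] compact_imp_closed open_Compl set_eq_iff)
  then show "continuous_on UNIV (\<lambda>z. g (Some z))" by (simp add: continuous_on_open_vimage)
  show "((\<lambda>z. g (Some z)) \<longlongrightarrow> g None) at_infinity"
  proof (rule topological_tendstoI)
    fix S :: "real set" assume S: "open S" "g None \<in> S"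
    have "None \<in> {x. g x \<in> S}" using S by simp
    then obtain C where C: "compact C" "{x. g x \<in> S} = insert None (Some ` (UNIV - C))"
      using op[OF S(1)] unfolding openin_Alexandroff_compactification by auto
    obtain b where b: "\<And>z. z \<in> C \<Longrightarrow> norm z \<le> b" using compact_imp_bounded[OF C(1)] unfolding bounded_iff by blast
    have "g (Some z) \<in> S" if "b + 1 \<le> norm z" for z
    proof -
      have "z \<notin> C" using b[of z] that by auto
      then have "Some z \<in> insert None (Some ` (UNIV - C))" by simp
      then show ?thesis unfolding C(2)[symmetric] by simp
    qed
    then show "\<forall>\<^sub>F z in at_infinity. g (Some z) \<in> S" unfolding eventually_at_infinity by blast
  qed
qed

section \<open>Test functions and the behaviour at infinity\<close>

lemma has_laplacian_add:
  assumes "has_laplacian f F" "has_laplacian g G"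
  shows "has_laplacian (\<lambda>z. f z + g z) (\<lambda>z. F z + G z)"
proof -
  from assms obtain f1 f11 f2 f22 g1 g11 g2 g22 where
    f: "has_partials f f1 f11 f2 f22" "F = (\<lambda>z. f11 z + f22 z)" and
    g: "has_partials g g1 g11 g2 g22" "G = (\<lambda>z. g11 z + g22 z)" unfolding has_laplacian_def by blast
  note df = has_partialsD[OF f(1)] and dg = has_partialsD[OF g(1)]
  have "has_partials (\<lambda>z. f z + g z) (\<lambda>z. f1 z + g1 z) (\<lambda>z. f11 z + g11 z) (\<lambda>z. f2 z + g2 z) (\<lambda>z. f22 z + g22 z)"
    unfolding has_partials_def by (intro conjI allI continuous_on_add DERIV_add df dg)
  from has_laplacianI[OF this] show ?thesis unfolding f(2) g(2) by (simp only: add_ac)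
qed

lemma has_laplacian_mult:
  assumes "has_laplacian f F" "has_laplacian g G"
  shows "\<exists>L. has_laplacian (\<lambda>z. f z * g z) L"
proof -
  from assms obtain f1 f11 f2 f22 g1 g11 g2 g22 where
    f: "has_partials f f1 f11 f2 f22" and g: "has_partials g g1 g11 g2 g22"
    unfolding has_laplacian_def by blast
  note df = has_partialsD[OF f(1)] and dg = has_partialsD[OF g(1)]
  have "has_partials (\<lambda>z. f z * g z) (\<lambda>z. f1 z * g z + g1 z * f z)
      (\<lambda>z. (f11 z * g z + g1 z * f1 z) + (g11 z * f z + f1 z * g1 z))
      (\<lambda>z. f2 z * g z + g2 z * f z)
      (\<lambda>z. (f22 z * g z + g2 z * f2 z) + (g22 z * f z + f2 z * g2 z))" unfolding has_partials_def
    by (intro conjI allI continuous_on_add continuous_on_mult DERIV_add DERIV_mult df dg)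
  from has_laplacianI[OF this] show ?thesis by blast
qed

lemma has_laplacian_real_polynomial:
  fixes p :: "complex \<Rightarrow> real"
  assumes "real_polynomial_function p"
  shows "\<exists>L. has_laplacian p L" using assms
proof induction
  case (linear f)
  interpret f: bounded_linear f by fact
  have e: "f (Complex x y) = x * f 1 + y * f \<i>" for x y
  proof -
    have "f (Complex x y) = f (x *\<^sub>R 1 + y *\<^sub>R \<i>)" by (rule arg_cong[of _ _ f]) (simp add: complex_eq_iff)
    then show ?thesis by (simp only: f.add f.scaleR real_scaleR_def)
  qed
  have "has_partials f (\<lambda>_. f 1) (\<lambda>_. 0) (\<lambda>_. f \<i>) (\<lambda>_. 0)" unfolding has_partials_def e
    by (intro conjI allI continuous_on_const f.continuous_on continuous_on_id; (auto intro!: derivative_eq_intros)?)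
  from has_laplacianI[OF this] show ?case by blast
next
  case (const c)
  show ?case using has_laplacian_const by blast
next
  case (add f g)
  then show ?case using has_laplacian_add by blast
next
  case (mult f g)
  then show ?case using has_laplacian_mult by blast
qed

text \<open>A cutoff at scale \<open>R\<close>; the cube is the smallest integer power for which
  clamping leaves continuous second derivatives.\<close>

definition mollifier :: "real \<Rightarrow> complex \<Rightarrow> real" where
  "mollifier R z = (max 0 (1 - (norm z)\<^sup>2 / R^2)) ^ 3"

definition mollifier_laplacian :: "real \<Rightarrow> complex \<Rightarrow> real" where
  "mollifier_laplacian R z = 4 * (- 3 / R^2 * (max 0 (1 - (norm z)\<^sup>2 / R^2))^2
     + (norm z)^2 * (6 / R ^ 4 * max 0 (1 - (norm z)\<^sup>2 / R^2)))"

lemma mollifier_bounds: "0 \<le> mollifier R z" "mollifier R z \<le> 1"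
  unfolding mollifier_def by (auto intro!: power_le_one)

lemma mollifier_eq_0: "R > 0 \<Longrightarrow> R \<le> norm z \<Longrightarrow> mollifier R z = 0"
  unfolding mollifier_def by (simp add: max_def field_simps power_mono)

lemma mollifier_tendsto: "(\<lambda>n. mollifier (real (Suc n)) z) \<longlonglongrightarrow> 1"
proof -
  have "(\<lambda>n. (norm z)^2 / (real (Suc n))^2) \<longlonglongrightarrow> 0" by real_asymp
  then have "(\<lambda>n. (max 0 (1 - (norm z)\<^sup>2 / (real (Suc n))^2)) ^ 3) \<longlonglongrightarrow> (max 0 (1 - 0)) ^ 3"
    by (intro tendsto_intros)
  then show ?thesis by (simp add: mollifier_def)
qed

lemma has_laplacian_mollifier:
  assumes R: "R > 0"
  shows "has_laplacian (mollifier R) (mollifier_laplacian R)"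
proof -
  define y where "y w = max 0 (1 - w / R^2)" for w :: real
  have D: "((\<lambda>w. \<Psi> (y w)) has_real_derivative \<Psi>' (y w) * (- 1 / R^2)) (at w)"
    if "\<And>t. (\<Psi> has_real_derivative \<Psi>' t) (at t)" "\<Psi>' 0 = 0" for \<Psi> \<Psi>' w
  proof -
    have a: "((\<lambda>t. \<Psi> (max 0 t)) has_real_derivative \<Psi>' (max 0 (1 - w / R^2))) (at (1 - w / R^2))"
      by (rule DERIV_comp_max_0[where b = "\<bar>1 - w / R^2\<bar> + 1"]) (use that in auto)
    have b: "((\<lambda>w. 1 - w / R^2) has_real_derivative (- 1 / R^2)) (at w)"
      by (rule DERIV_cong[OF DERIV_diff[OF DERIV_const DERIV_cdivide[OF DERIV_ident]]]) simp
    show ?thesis unfolding y_def by (rule DERIV_chain2[OF a b])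
  qed
  have d3: "((\<lambda>t. t ^ 3) has_real_derivative 3 * t^2) (at t)" for t :: real
    by (auto intro!: derivative_eq_intros)
  have d2: "((\<lambda>t. 3 * t^2) has_real_derivative 6 * t) (at t)" for t :: real
    by (auto intro!: derivative_eq_intros)
  have "has_laplacian (\<lambda>z. (y ((norm (z - 0))^2)) ^ 3)
    (\<lambda>z. 4 * (3 * (y ((norm (z - 0))^2))^2 * (- 1 / R^2) + (norm (z - 0))^2 * (6 * y ((norm (z - 0))^2) * (- 1 / R^2) * (- 1 / R^2))))"
  proof (rule has_laplacian_radial)
    show "((\<lambda>w. y w ^ 3) has_real_derivative 3 * (y w)^2 * (- 1 / R^2)) (at w)" for w by (rule D[OF d3]) simp
    show "((\<lambda>w. 3 * (y w)^2 * (- 1 / R^2)) has_real_derivative 6 * y w * (- 1 / R^2) * (- 1 / R^2)) (at w)" for w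
      by (rule DERIV_cmult_right[OF D[OF d2]]) simp
    show "continuous_on {0..} (\<lambda>w. 6 * y w * (- 1 / R^2) * (- 1 / R^2))"
      unfolding y_def by (intro continuous_intros) (use R in auto)
  qed
  moreover have "4 * (3 * (y ((norm z)^2))^2 * (- 1 / R^2) + (norm z)^2 * (6 * y ((norm z)^2) * (- 1 / R^2) * (- 1 / R^2)))
      = mollifier_laplacian R z" for z
    unfolding mollifier_laplacian_def y_def using R by (simp add: field_simps power2_eq_square power4_eq_xxxx)
  ultimately show ?thesis by (simp add: mollifier_def[abs_def] y_def)
qed

text \<open>The Laplacian scales like \<open>1 / R^2\<close>, which the area factor compensates:
  after rescaling, integrals against it become integrals against one fixed function.\<close>

lemma mollifier_laplacian_scaled:
  assumes "R > 0"
  shows "R * R * mollifier_laplacian R (of_real R * w) = mollifier_laplacian 1 w"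
  using assms unfolding mollifier_laplacian_def
  by (simp add: norm_mult power_mult_distrib field_simps power2_eq_square power4_eq_xxxx)

text \<open>A polynomial approximates \<open>g / mollifier\<close> on a disc, and multiplying back
  by the mollifier gives compact support. The denominator has the floor \<open>\<delta>\<close>: for
  \<open>|z| \<le> R0\<close> this changes nothing, and beyond, where the mollifier may fall below
  \<open>\<delta>\<close>, \<open>g\<close> itself is small.\<close>

proposition approximation_by_test_function:
  fixes g :: "complex \<Rightarrow> real"
  assumes g: "continuous_on UNIV g" "(g \<longlongrightarrow> 0) at_infinity" and e: "\<epsilon> > 0"
  shows "\<exists>q L R. has_laplacian q L \<and> (\<forall>z. R \<le> norm z \<longrightarrow> q z = 0) \<and> (\<forall>z. \<bar>q z - g z\<bar> \<le> \<epsilon>)"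
proof -
  obtain b where b: "\<And>z. b \<le> norm z \<Longrightarrow> \<bar>g z\<bar> < \<epsilon> / 2"
    using tendstoD[OF g(2), of "\<epsilon> / 2"] e unfolding eventually_at_infinity by auto
  define R0 R1 where "R0 = max b 0" and "R1 = max b 0 + 1"
  have R1: "R1 > 0" "R0 \<ge> 0" "R0 < R1" by (simp_all add: R0_def R1_def)
  \<comment> \<open>The value of the mollifier on the circle \<open>|z| = R0\<close>, hence its
    minimum on the disc inside.\<close>
  define \<delta> where "\<delta> = (1 - R0^2 / R1^2) ^ 3"
  have R01: "R0^2 < R1^2" using R1 by (intro power_strict_mono) auto
  then have \<delta>: "\<delta> > 0" unfolding \<delta>_def using R1 by (intro zero_less_power) simp
  define g2 where "g2 z = g z / max (mollifier R1 z) \<delta>" for z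
  have cm: "continuous_on A (mollifier R1)" for A
    using has_laplacian_continuous[OF has_laplacian_mollifier[OF R1(1)]] by (rule continuous_on_subset) simp
  have c2: "continuous_on (cball 0 R1) g2"
    unfolding g2_def by (intro continuous_intros cm continuous_on_subset[OF g(1)]) (use \<delta> in auto)
  obtain p where p: "polynomial_function p" "\<And>z. z \<in> cball 0 R1 \<Longrightarrow> norm (g2 z - p z) < \<epsilon> / 2"
    using Stone_Weierstrass_polynomial_function[OF compact_cball c2, of "\<epsilon> / 2"] e by auto
  have rp: "real_polynomial_function p" using p(1) by (simp add: real_polynomial_function_eq)
  obtain L1 where "has_laplacian p L1" using has_laplacian_real_polynomial[OF rp] by blast
  from has_laplacian_mult[OF this has_laplacian_mollifier[OF R1(1)]]
  obtain L where L: "has_laplacian (\<lambda>z. p z * mollifier R1 z) L" by blast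
  have near: "\<bar>g2 z * mollifier R1 z - g z\<bar> \<le> \<epsilon> / 2" for z
  proof (cases "R0 \<le> norm z")
    case True
    define x where "x = mollifier R1 z / max (mollifier R1 z) \<delta>"
    have "0 \<le> x" "x \<le> 1" using mollifier_bounds(1)[of R1 z] \<delta> by (auto simp: x_def divide_le_eq_1)
    then have "\<bar>g z\<bar> * (1 - x) \<le> \<epsilon> / 2 * 1" using b[of z] True by (intro mult_mono) (auto simp: R0_def)
    moreover have "g2 z * mollifier R1 z - g z = - (g z * (1 - x))" by (simp add: g2_def x_def algebra_simps)
    ultimately show ?thesis using \<open>x \<le> 1\<close> by (simp add: abs_mult)
  next
    case False
    then have "(norm z)^2 \<le> R0^2" by (intro power_mono) auto
    then have "1 - R0^2 / R1^2 \<le> 1 - (norm z)^2 / R1^2" using R1 by (simp add: divide_right_mono)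
    moreover have "0 \<le> 1 - R0^2 / R1^2" using R01 R1 by simp
    ultimately have "\<delta> \<le> mollifier R1 z" unfolding \<delta>_def mollifier_def by (intro power_mono) auto
    then have "max (mollifier R1 z) \<delta> = mollifier R1 z" "mollifier R1 z \<noteq> 0" using \<delta> by auto
    then show ?thesis using e by (simp add: g2_def)
  qed
  have "\<bar>p z * mollifier R1 z - g z\<bar> \<le> \<epsilon>" for z
  proof (cases "norm z \<le> R1")
    case True
    then have "\<bar>p z - g2 z\<bar> * mollifier R1 z \<le> \<epsilon> / 2 * 1"
      using p(2)[of z] mollifier_bounds[of R1 z] e by (intro mult_mono) (auto simp: abs_minus_commute)
    then have "\<bar>p z * mollifier R1 z - g2 z * mollifier R1 z\<bar> \<le> \<epsilon> / 2"
      using mollifier_bounds(1)[of R1 z] by (simp add: left_diff_distrib[symmetric] abs_mult)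
    then show ?thesis using near[of z] by linarith
  next
    case False
    then have "mollifier R1 z = 0" using mollifier_eq_0[OF R1(1)] by simp
    then show ?thesis using near[of z] e by simp
  qed
  moreover have "p z * mollifier R1 z = 0" if "R1 \<le> norm z" for z using mollifier_eq_0[OF R1(1) that] by simp
  ultimately show ?thesis using L by blast
qed

lemma vanishing_at_infinity_bounded:
  fixes g :: "complex \<Rightarrow> real"
  assumes g: "continuous_on UNIV g" and lim: "(g \<longlongrightarrow> 0) at_infinity"
  obtains C where "\<And>z. \<bar>g z\<bar> \<le> C"
proof -
  obtain b where b: "\<And>z. b \<le> norm z \<Longrightarrow> \<bar>g z\<bar> < 1"
    using tendstoD[OF lim, of 1] unfolding eventually_at_infinity by auto
  obtain C where C: "C \<ge> 0" "\<And>z. norm (z - 0) \<le> b \<Longrightarrow> \<bar>g z\<bar> \<le> C" using continuous_bounded_ball[OF g] by blast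
  have "\<bar>g z\<bar> \<le> C + 1" for z using b[of z] C(2)[of z] C(1) by (cases "b \<le> norm z") auto
  then show thesis by (rule that)
qed

lemma compact_support_tendsto:
  fixes g :: "complex \<Rightarrow> real"
  assumes "\<And>z. R \<le> norm z \<Longrightarrow> g z = 0"
  shows "(g \<longlongrightarrow> 0) at_infinity"
  using assms by (intro tendsto_eventually) (auto simp: eventually_at_infinity)

text \<open>\<open>ln (|z|^2 + 1) / 2\<close> stands in for \<open>ln |z|\<close>: it is smooth on
  the plane and its Laplacian \<open>poisson_kernel 1\<close> has mass \<open>2 pi\<close>.\<close>

lemma ln_norm_diff_tendsto:
  "((\<lambda>z. ln (norm (z - b)) - ln ((norm z)^2 + 1) / 2) \<longlongrightarrow> 0) (at_infinity :: complex filter)"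
proof -
  define \<beta> where "\<beta> = norm b"
  have lo: "((\<lambda>x. ln (x - \<beta>) - ln (x^2 + 1) / 2) \<longlongrightarrow> 0) at_top"
    and hi: "((\<lambda>x. ln (x + \<beta>) - ln (x^2 + 1) / 2) \<longlongrightarrow> 0) at_top" by real_asymp+
  have n: "filterlim norm at_top (at_infinity :: complex filter)" by (rule filterlim_norm_at_top)
  have ev: "\<forall>\<^sub>F z :: complex in at_infinity. \<beta> + 1 \<le> norm z" unfolding eventually_at_infinity by blast
  show ?thesis
  proof (rule tendsto_sandwich)
    show "\<forall>\<^sub>F z in at_infinity. ln (norm z - \<beta>) - ln ((norm z)^2 + 1) / 2 \<le> ln (norm (z - b)) - ln ((norm z)^2 + 1) / 2"
      using ev
    proof eventually_elim
      case (elim z)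
      then have "ln (norm z - \<beta>) \<le> ln (norm (z - b))"
        using norm_triangle_ineq2[of z b] by (intro ln_mono) (auto simp: \<beta>_def)
      then show ?case by simp
    qed
    show "\<forall>\<^sub>F z in at_infinity. ln (norm (z - b)) - ln ((norm z)^2 + 1) / 2 \<le> ln (norm z + \<beta>) - ln ((norm z)^2 + 1) / 2"
      using ev
    proof eventually_elim
      case (elim z)
      have "norm (z - b) > 0" using elim norm_triangle_ineq2[of z b] unfolding \<beta>_def by linarith
      then have "ln (norm (z - b)) \<le> ln (norm z + \<beta>)"
        using norm_triangle_ineq4[of z b] by (intro ln_mono) (auto simp: \<beta>_def)
      then show ?case by simp
    qed
    show "((\<lambda>z. ln (norm z - \<beta>) - ln ((norm z)^2 + 1) / 2) \<longlongrightarrow> 0) (at_infinity :: complex filter)"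
      by (rule filterlim_compose[OF lo n])
    show "((\<lambda>z. ln (norm z + \<beta>) - ln ((norm z)^2 + 1) / 2) \<longlongrightarrow> 0) (at_infinity :: complex filter)"
      by (rule filterlim_compose[OF hi n])
  qed
qed

section \<open>Growth of the maximum and the mass of its Laplacian\<close>

context sites
begin

text \<open>Which site attains the maximum depends on \<open>z\<close>, so the error is bounded by
  the sum of the errors for all \<open>N\<close> candidates, each of which tends to 0.\<close>

lemma maxpot_growth:
  "((\<lambda>z. maxpot z - real (N - 1) * (ln ((norm z)^2 + 1) / 2)) \<longlongrightarrow> 0) at_infinity"
proof (rule Lim_null_comparison)
  define l where "l z = ln ((norm z)^2 + 1) / 2" for z :: complex
  define D where "D i z = (\<Sum>j\<in>{1..N} - {i}. ln (norm (z - a j)) - l z)" for i z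
  have Dl: "(D i \<longlongrightarrow> 0) at_infinity" for i
    using tendsto_sum[of "{1..N} - {i}" "\<lambda>j z. ln (norm (z - a j)) - l z" "\<lambda>_. 0" at_infinity] ln_norm_diff_tendsto
    unfolding D_def[abs_def] l_def by simp
  have "((\<lambda>z. \<Sum>i\<in>{1..N}. \<bar>D i z\<bar>) \<longlongrightarrow> (\<Sum>i\<in>{1..N}. \<bar>0\<bar>)) at_infinity" by (intro tendsto_sum tendsto_rabs Dl)
  then show "((\<lambda>z. \<Sum>i\<in>{1..N}. \<bar>D i z\<bar>) \<longlongrightarrow> 0) at_infinity" by simp
  have "bounded (a ` {1..N})" by (intro finite_imp_bounded) simp
  then obtain b where b: "\<And>i. i \<in> {1..N} \<Longrightarrow> norm (a i) \<le> b" unfolding bounded_iff by blast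
  have main: "norm (maxpot z - real (N - 1) * l z) \<le> (\<Sum>i\<in>{1..N}. \<bar>D i z\<bar>)" if z: "b + 1 \<le> norm z" for z
  proof -
    have fin: "finite ((\<lambda>i. side i z) ` {1..N})" "(\<lambda>i. side i z) ` {1..N} \<noteq> {}" using N by auto
    from Max_in[OF this] obtain i where i: "i \<in> {1..N}" "Max ((\<lambda>i. side i z) ` {1..N}) = side i z"
      by (elim imageE)
    have pos: "norm (z - a j) > 0" if "j \<in> {1..N} - {i}" for j
      using b[of j] that z norm_triangle_ineq2[of z "a j"] by (simp del: zero_less_norm_iff)
    have "ln (side i z) = (\<Sum>j\<in>{1..N} - {i}. 2 * ln (norm (z - a j)))"
      unfolding side_def using pos by (subst ln_prod) (auto simp: ln_realpow intro!: sum.cong)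
    then have "maxpot z = (\<Sum>j\<in>{1..N} - {i}. ln (norm (z - a j)))"
      unfolding maxpot_def i(2) by (simp add: sum_distrib_left[symmetric])
    moreover have "card ({1..N} - {i}) = N - 1" using i(1) by simp
    ultimately have "maxpot z - real (N - 1) * l z = D i z" by (simp add: D_def sum_subtractf)
    also have "norm \<dots> \<le> (\<Sum>i\<in>{1..N}. \<bar>D i z\<bar>)"
      unfolding real_norm_def by (rule member_le_sum[OF i(1)]) simp_all
    finally show ?thesis .
  qed
  then show "\<forall>\<^sub>F z in at_infinity. norm (maxpot z - real (N - 1) * (ln ((norm z)^2 + 1) / 2)) \<le> (\<Sum>i\<in>{1..N}. \<bar>D i z\<bar>)"
    unfolding eventually_at_infinity l_def by blast
qed

text \<open>The maximum is \<open>(N - 1) l\<close> plus a remainder \<open>w\<close> that vanishes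
  at infinity. Rescaling turns the integral of \<open>w\<close> into one of
  \<open>w (R \<zeta>)\<close> against a fixed function, so it tends to 0; for \<open>l\<close>,
  Green's identity moves the Laplacian onto \<open>l\<close>, where it has mass
  \<open>2 pi\<close>.\<close>

lemma integral_maxpot_mollifier_tendsto:
  "(\<lambda>n. \<integral>z. maxpot z * mollifier_laplacian (real (Suc n)) z \<partial>lborel) \<longlonglongrightarrow> 2 * pi * real (N - 1)"
proof -
  define l where "l z = ln ((norm z)^2 + 1) / 2" for z :: complex
  define w where "w z = maxpot z - real (N - 1) * l z" for z
  define R where "R n = real (Suc n)" for n
  have R: "R n > 0" for n by (simp add: R_def)
  have lapl: "has_laplacian l (poisson_kernel 1)"
    using has_laplacian_log[of 1 0] by (simp add: l_def[abs_def])
  have cl: "continuous_on UNIV l" using lapl by (rule has_laplacian_continuous)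
  have cw: "continuous_on UNIV w" unfolding w_def[abs_def] by (intro continuous_intros continuous_maxpot cl)
  have wlim: "(w \<longlongrightarrow> 0) at_infinity" using maxpot_growth unfolding w_def[abs_def] l_def .
  obtain B where wB: "\<And>z. \<bar>w z\<bar> \<le> B" using vanishing_at_infinity_bounded[OF cw wlim] by blast
  have hm: "has_laplacian (mollifier (R n)) (mollifier_laplacian (R n))" for n
    using R by (rule has_laplacian_mollifier)
  have cL: "continuous_on UNIV (mollifier_laplacian (R n))" for n using hm by (rule has_laplacian_continuous')
  have cM: "continuous_on UNIV (mollifier (R n))" for n using hm by (rule has_laplacian_continuous)
  have m0: "mollifier (R n) z = 0" if "R n \<le> norm z" for n z by (rule mollifier_eq_0[OF R that])
  have L0: "mollifier_laplacian (R n) z = 0" if "R n \<le> norm z" for n z by (rule has_laplacian_vanishes[OF hm m0 that])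
  have h1: "has_laplacian (mollifier 1) (mollifier_laplacian 1)" by (rule has_laplacian_mollifier) simp
  have i1: "integrable lborel (mollifier_laplacian 1)"
    by (rule integrable_compact_support[OF has_laplacian_continuous'[OF h1], of 1],
        rule has_laplacian_vanishes[OF h1 mollifier_eq_0[OF zero_less_one]])
  have [measurable]: "w \<in> borel_measurable borel" "\<And>n. mollifier_laplacian (R n) \<in> borel_measurable borel"
    "\<And>n. mollifier (R n) \<in> borel_measurable borel" "mollifier_laplacian 1 \<in> borel_measurable borel"
    by (intro borel_measurable_continuous_onI cw cL cM has_laplacian_continuous'[OF h1])+
  have A: "(\<lambda>n. \<integral>z. w z * mollifier_laplacian (R n) z \<partial>lborel) \<longlonglongrightarrow> 0"
  proof -
    have "(LBINT z. w z * mollifier_laplacian (R n) z)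
        = (LBINT \<zeta>. w (of_real (R n) * \<zeta>) * mollifier_laplacian 1 \<zeta>)" for n
    proof -
      have c: "0 + 1 * Complex (R n * Re \<zeta>) (R n * Im \<zeta>) = of_real (R n) * \<zeta>" for \<zeta>
        by (simp add: complex_eq_iff)
      have "(LBINT z. w z * mollifier_laplacian (R n) z)
          = R n * R n * (LBINT \<zeta>. w (of_real (R n) * \<zeta>) * mollifier_laplacian (R n) (of_real (R n) * \<zeta>))"
        by (subst integral_complex_similarity(1)[OF norm_one R R, of _ n n 0], measurable) (simp only: c)
      also have "\<dots> = (LBINT \<zeta>. w (of_real (R n) * \<zeta>) * (R n * R n * mollifier_laplacian (R n) (of_real (R n) * \<zeta>)))"
        by (subst Bochner_Integration.integral_mult_right_zero[symmetric]) (simp only: mult_ac)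
      finally show ?thesis by (simp only: mollifier_laplacian_scaled[OF R])
    qed
    moreover have "(\<lambda>n. \<integral>\<zeta>. w (of_real (R n) * \<zeta>) * mollifier_laplacian 1 \<zeta> \<partial>lborel) \<longlonglongrightarrow> (\<integral>\<zeta>. 0 \<partial>(lborel :: complex measure))"
    proof (rule integral_dominated_convergence)
      show "integrable lborel (\<lambda>\<zeta>. B * \<bar>mollifier_laplacian 1 \<zeta>\<bar>)"
        using i1 by (intro Bochner_Integration.integrable_mult_right Bochner_Integration.integrable_abs)
      have "AE \<zeta> in lborel. \<zeta> \<notin> {0 :: complex}" by (rule AE_not_finite) simp
      then show "AE \<zeta> in lborel. (\<lambda>n. w (of_real (R n) * \<zeta>) * mollifier_laplacian 1 \<zeta>) \<longlonglongrightarrow> 0"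
      proof eventually_elim
        case (elim \<zeta>)
        then have p: "norm \<zeta> > 0" by simp
        have "filterlim (\<lambda>n. R n * norm \<zeta>) at_top sequentially" unfolding R_def using p by real_asymp
        then have "filterlim (\<lambda>n. of_real (R n) * \<zeta>) at_infinity sequentially"
          unfolding filterlim_at_infinity_conv_norm_at_top using R by (simp add: norm_mult less_imp_le)
        from filterlim_compose[OF wlim this] have "(\<lambda>n. w (of_real (R n) * \<zeta>)) \<longlonglongrightarrow> 0" .
        from tendsto_mult_left_zero[OF this] show ?case .
      qed
      show "AE \<zeta> in lborel. norm (w (of_real (R n) * \<zeta>) * mollifier_laplacian 1 \<zeta>) \<le> B * \<bar>mollifier_laplacian 1 \<zeta>\<bar>" for n
        by (rule AE_I2) (simp add: abs_mult mult_right_mono wB)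
    qed measurable
    ultimately show ?thesis by simp
  qed
  have P: "(\<lambda>n. \<integral>z. l z * mollifier_laplacian (R n) z \<partial>lborel) \<longlonglongrightarrow> 2 * pi"
  proof -
    have "(LBINT z. l z * mollifier_laplacian (R n) z) = (LBINT z. poisson_kernel 1 z * mollifier (R n) z)" for n
      by (rule green_identity[OF lapl hm m0])
    moreover have "(\<lambda>n. \<integral>z. poisson_kernel 1 z * mollifier (R n) z \<partial>lborel) \<longlonglongrightarrow> (LBINT z. poisson_kernel 1 z)"
    proof (rule integral_dominated_convergence)
      have pi: "integrable lborel (poisson_kernel 1)" using integral_poisson_kernel by (simp add: has_bochner_integral_iff)
      then show "integrable lborel (poisson_kernel 1)" .
      show "(poisson_kernel 1) \<in> borel_measurable lborel" using pi by (rule borel_measurable_integrable)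
      then have [measurable]: "(poisson_kernel 1) \<in> borel_measurable borel" by simp
      show "(\<lambda>z. poisson_kernel 1 z * mollifier (R n) z) \<in> borel_measurable lborel" for n by measurable
      show "AE z in lborel. (\<lambda>n. poisson_kernel 1 z * mollifier (R n) z) \<longlonglongrightarrow> poisson_kernel 1 z"
      proof (rule AE_I2)
        fix z show "(\<lambda>n. poisson_kernel 1 z * mollifier (R n) z) \<longlonglongrightarrow> poisson_kernel 1 z"
          using tendsto_mult[OF tendsto_const mollifier_tendsto[of z], of "poisson_kernel 1 z"] by (simp add: R_def)
      qed
      show "AE z in lborel. norm (poisson_kernel 1 z * mollifier (R n) z) \<le> poisson_kernel 1 z" for n
      proof (rule AE_I2)
        fix z
        have "poisson_kernel 1 z * mollifier (R n) z \<le> poisson_kernel 1 z * 1"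
          by (intro mult_left_mono mollifier_bounds poisson_kernel_nonneg) simp
        moreover have "0 \<le> poisson_kernel 1 z * mollifier (R n) z"
          by (intro mult_nonneg_nonneg mollifier_bounds poisson_kernel_nonneg) simp
        ultimately show "norm (poisson_kernel 1 z * mollifier (R n) z) \<le> poisson_kernel 1 z" by simp
      qed
    qed
    ultimately show ?thesis using integral_poisson_kernel by (simp add: has_bochner_integral_iff)
  qed
  have "(LBINT z. maxpot z * mollifier_laplacian (R n) z)
      = (LBINT z. w z * mollifier_laplacian (R n) z) + real (N - 1) * (LBINT z. l z * mollifier_laplacian (R n) z)" for n
  proof -
    have iw: "integrable lborel (\<lambda>z. w z * mollifier_laplacian (R n) z)"
      by (rule integrable_compact_support[of _ "R n"]) (intro continuous_on_mult cw cL, simp add: L0)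
    have il: "integrable lborel (\<lambda>z. l z * mollifier_laplacian (R n) z)"
      by (rule integrable_compact_support[of _ "R n"]) (intro continuous_on_mult cl cL, simp add: L0)
    have "maxpot z * mollifier_laplacian (R n) z = w z * mollifier_laplacian (R n) z + real (N - 1) * (l z * mollifier_laplacian (R n) z)" for z
      by (simp add: w_def algebra_simps)
    then show ?thesis
      using Bochner_Integration.integral_add[OF iw Bochner_Integration.integrable_mult_right[OF il, of "real (N - 1)"]] by simp
  qed
  moreover have "(\<lambda>n. (LBINT z. w z * mollifier_laplacian (R n) z) + real (N - 1) * (LBINT z. l z * mollifier_laplacian (R n) z))
      \<longlonglongrightarrow> 0 + real (N - 1) * (2 * pi)" by (intro tendsto_add tendsto_mult tendsto_const A P)
  ultimately show ?thesis by (simp add: R_def mult_ac)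
qed

end

section \<open>Convergence of the zero measures\<close>

lemma integral_uniform_diff:
  fixes g q :: "complex \<Rightarrow> real"
  assumes N: "finite_measure N" "sets N = sets borel"
    and g: "continuous_on UNIV g" "\<And>z. \<bar>g z\<bar> \<le> C" and q: "continuous_on UNIV q" "\<And>z. \<bar>q z\<bar> \<le> C'"
    and e: "\<And>z. \<bar>q z - g z\<bar> \<le> \<epsilon>"
  shows "\<bar>(\<integral>z. q z \<partial>N) - (\<integral>z. g z \<partial>N)\<bar> \<le> \<epsilon> * (\<integral>z. 1 \<partial>N)"
proof -
  interpret finite_measure N by fact
  have i: "integrable N g" "integrable N q"
    by (rule integrable_continuous_bounded[OF N g] integrable_continuous_bounded[OF N q])+
  have "\<bar>\<integral>z. q z - g z \<partial>N\<bar> \<le> (\<integral>z. \<epsilon> \<partial>N)" unfolding real_norm_def[symmetric]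
    by (rule Bochner_Integration.integral_norm_bound_integral) (use i e in auto)
  then show ?thesis using i by (simp add: Bochner_Integration.integral_diff mult.commute)
qed

section \<open>Limits of the zero measures and their masses\<close>

context hyperexponential_sites
begin

abbreviation "\<mu>\<^sub>f \<equiv> mu_fix Q S T a N"

lemma nu_eq_mu: "nu P Q S T n = mu P Q S T n" unfolding nu_def mu_def zeros_higher_deriv
proof (rule atomic_measure_cong)
  fix z assume "z \<in> zeros (B n)"
  then have "z \<notin> sing Q T" using poly_B_sing[of z n] unfolding zeros_def by blast
  from zorder_higher_deriv_hyp_f[OF this, of n]
  show "real_of_int (zorder ((deriv ^^ n) f) z) / real (degree (B n)) = real (order z (B n)) / real (degree (B n))"
    by simp
qed

lemma sets_mu [simp]: "sets (mu P Q S T n) = sets borel" by (simp add: mu_def)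

lemma finite_mu: "finite_measure (mu P Q S T n)"
  unfolding mu_def by (rule finite_atomic_measure) (auto simp: finite_zeros B_nz)

lemma integral_mu:
  assumes "g \<in> borel_measurable borel"
  shows "(\<integral>z. g z \<partial>mu P Q S T n) = (\<Sum>\<zeta>\<in>zeros (B n). real (order \<zeta> (B n)) * g \<zeta>) / real (degree (B n))"
  unfolding mu_def
  by (subst integral_atomic_measure(2)) (auto simp: finite_zeros B_nz assms sum_divide_distrib)

text \<open>The quotient is left as it stands: it is 1 for positive degree and 0 by convention for a
  constant \<open>B n\<close>, so it is always at most 1.\<close>

lemma mass_mu: "(\<integral>z. 1 \<partial>mu P Q S T n) = real (degree (B n)) / real (degree (B n))"
proof -
  have "(\<integral>z. 1 \<partial>mu P Q S T n) = (\<Sum>\<zeta>\<in>zeros (B n). real (order \<zeta> (B n)) * 1) / real (degree (B n))"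
    by (rule integral_mu) simp
  also have "(\<Sum>\<zeta>\<in>zeros (B n). real (order \<zeta> (B n)) * 1) = real (\<Sum>\<zeta>\<in>zeros (B n). order \<zeta> (B n))" by simp
  also have "(\<Sum>\<zeta>\<in>zeros (B n). order \<zeta> (B n)) = degree (B n)" by (rule degree_eq_sum_order[OF B_nz])
  finally show ?thesis .
qed

lemma mass_mu_tendsto: "(\<lambda>n. \<integral>z. (1 :: real) \<partial>mu P Q S T n) \<longlonglongrightarrow> 1"
  unfolding mass_mu by (rule tendsto_eventually, rule eventually_mono[OF degree_B_pos]) simp

lemma edge_facts:
  assumes "q \<in> pairs"
  shows "sets (case q of (i, j) \<Rightarrow> edge_measure a N i j) = sets borel"
    "finite_measure (case q of (i, j) \<Rightarrow> edge_measure a N i j)"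
proof -
  obtain i j where q: "q = (i, j)" by (cases q)
  interpret site_pair a N i j using assms q by (intro site_pairI) simp
  show "sets (case q of (i, j) \<Rightarrow> edge_measure a N i j) = sets borel"
    "finite_measure (case q of (i, j) \<Rightarrow> edge_measure a N i j)"
    unfolding q prod.case by (rule sets_edge_measure finite_measure_edge)+
qed

lemma mu_fix_eq:
  "\<mu>\<^sub>f = add_measure (atomic_measure borel (zeros T) (\<lambda>c. real (order c T) / real \<kappa>))
     (scale_measure (ennreal (1 / (2 * pi * real \<kappa>))) (sum_measure pairs borel (\<lambda>(i, j). edge_measure a N i j)))"
  unfolding mu_fix_def pairs_def ..

lemma sets_mu_fix [simp]: "sets \<mu>\<^sub>f = sets borel" by (simp add: mu_fix_eq)

lemma integral_mu_fix:
  fixes g :: "complex \<Rightarrow> real"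
  assumes g: "continuous_on UNIV g" "\<And>z. \<bar>g z\<bar> \<le> C"
  shows "integrable \<mu>\<^sub>f g"
    and "2 * pi * real \<kappa> * (\<integral>z. g z \<partial>\<mu>\<^sub>f) = 2 * pi * (\<Sum>c\<in>zeros T. real (order c T) * g c)
       + (\<Sum>(i, j)\<in>pairs. \<integral>z. g z \<partial>edge_measure a N i j)"
proof -
  let ?A = "atomic_measure borel (zeros T) (\<lambda>c. real (order c T) / real \<kappa>)"
  let ?E = "\<lambda>(i, j). edge_measure a N i j"
  let ?S = "sum_measure pairs borel ?E"
  have gm: "g \<in> borel_measurable borel" using g(1) by (rule borel_measurable_continuous_onI)
  have A: "integrable ?A g" "(\<integral>z. g z \<partial>?A) = (\<Sum>c\<in>zeros T. real (order c T) / real \<kappa> * g c)"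
    by (rule integral_atomic_measure; simp add: finite_zeros T_nz gm)+
  have ei: "integrable (?E q) g" if "q \<in> pairs" for q
    by (rule integrable_continuous_bounded[OF edge_facts(2,1)[OF that] g])
  have S: "integrable ?S g" "(\<integral>z. g z \<partial>?S) = (\<Sum>q\<in>pairs. \<integral>z. g z \<partial>?E q)"
    by (rule integral_sum_measure[OF finite_pairs edge_facts(1) gm ei]; assumption)+
  have k: "1 / (2 * pi * real \<kappa>) \<ge> 0" by simp
  note sc = integral_scale_measure'[OF k S(1)]
  have st: "sets (scale_measure (ennreal (1 / (2 * pi * real \<kappa>))) ?S) = sets ?A" by simp
  show "integrable \<mu>\<^sub>f g" unfolding mu_fix_eq by (rule integral_add_measure(1)[OF st A(1) sc(1)])
  have "(\<integral>z. g z \<partial>\<mu>\<^sub>f) = (\<Sum>c\<in>zeros T. real (order c T) / real \<kappa> * g c) + 1 / (2 * pi * real \<kappa>) * (\<Sum>q\<in>pairs. \<integral>z. g z \<partial>?E q)"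
    unfolding mu_fix_eq integral_add_measure(2)[OF st A(1) sc(1)] A(2) sc(2) S(2) ..
  also have "(\<Sum>c\<in>zeros T. real (order c T) / real \<kappa> * g c) = (\<Sum>c\<in>zeros T. real (order c T) * g c) / real \<kappa>"
    by (simp add: sum_divide_distrib)
  also have "(\<Sum>q\<in>pairs. \<integral>z. g z \<partial>?E q) = (\<Sum>(i, j)\<in>pairs. \<integral>z. g z \<partial>edge_measure a N i j)"
    by (intro sum.cong refl) (simp add: case_prod_unfold)
  finally show "2 * pi * real \<kappa> * (\<integral>z. g z \<partial>\<mu>\<^sub>f) = 2 * pi * (\<Sum>c\<in>zeros T. real (order c T) * g c)
       + (\<Sum>(i, j)\<in>pairs. \<integral>z. g z \<partial>edge_measure a N i j)" using kappa_pos by (simp add: field_simps)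
qed

lemma finite_mu_fix: "finite_measure \<mu>\<^sub>f"
  by (rule finite_measureI_integrable, rule integral_mu_fix(1)[where C = 1]) simp_all

text \<open>In the sense of distributions the limit potential has the Laplacian
  \<open>2 pi \<kappa>\<close> times the limit measure: the zeros of \<open>T\<close> contribute the
  point masses and the maximum the edges.\<close>

lemma integral_limit_pot_laplacian:
  assumes g: "has_laplacian g G" and z: "\<And>z. R \<le> norm z \<Longrightarrow> g z = 0"
  shows "integrable lborel (\<lambda>z. limit_pot z * G z)"
    "(LBINT z. limit_pot z * G z) = 2 * pi * real \<kappa> * (\<integral>z. g z \<partial>\<mu>\<^sub>f)"
proof -
  have cg: "continuous_on UNIV g" and cG: "continuous_on UNIV G"
    using g by (rule has_laplacian_continuous, rule has_laplacian_continuous')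
  have G0: "G z = 0" if "R \<le> norm z" for z by (rule has_laplacian_vanishes[OF g z that])
  obtain C where C: "\<And>z. \<bar>g z\<bar> \<le> C"
    using vanishing_at_infinity_bounded[OF cg compact_support_tendsto[OF z]] by blast
  have il: "integrable lborel (\<lambda>z. real (order c T) * (ln (norm (z - c)) * G z))" for c
    by (intro Bochner_Integration.integrable_mult_right integrable_ln_times(1)[OF cG G0])
  have isum: "integrable lborel (\<lambda>z. \<Sum>c\<in>zeros T. real (order c T) * (ln (norm (z - c)) * G z))"
    by (intro Bochner_Integration.integrable_sum il)
  have im: "integrable lborel (\<lambda>z. maxpot z * G z)"
    by (rule integrable_compact_support[of _ R]) (intro continuous_on_mult continuous_maxpot cG, simp add: G0)
  have mp: "(LBINT z. maxpot z * G z) = (\<Sum>(i, j)\<in>pairs. \<integral>z. g z \<partial>edge_measure a N i j)"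
    by (rule integral_maxpot_laplacian[OF g z])
  have e: "limit_pot z * G z = (\<Sum>c\<in>zeros T. real (order c T) * (ln (norm (z - c)) * G z)) + maxpot z * G z" for z
    by (simp add: limit_pot_def distrib_right sum_distrib_right mult.assoc)
  show "integrable lborel (\<lambda>z. limit_pot z * G z)" unfolding e by (rule Bochner_Integration.integrable_add[OF isum im])
  have "(LBINT z. limit_pot z * G z) = (LBINT z. (\<Sum>c\<in>zeros T. real (order c T) * (ln (norm (z - c)) * G z))) + (LBINT z. maxpot z * G z)"
    unfolding e by (rule Bochner_Integration.integral_add[OF isum im])
  also have "(LBINT z. (\<Sum>c\<in>zeros T. real (order c T) * (ln (norm (z - c)) * G z)))
      = (\<Sum>c\<in>zeros T. \<integral>z. real (order c T) * (ln (norm (z - c)) * G z) \<partial>lborel)"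
    by (rule Bochner_Integration.integral_sum) (rule il)
  also have "\<dots> = (\<Sum>c\<in>zeros T. real (order c T) * (2 * pi * g c))"
    by (simp only: Bochner_Integration.integral_mult_right_zero integral_ln_laplacian[OF g z])
  also have "\<dots> = 2 * pi * (\<Sum>c\<in>zeros T. real (order c T) * g c)" by (simp add: sum_distrib_left mult_ac)
  finally show "(LBINT z. limit_pot z * G z) = 2 * pi * real \<kappa> * (\<integral>z. g z \<partial>\<mu>\<^sub>f)"
    unfolding integral_mu_fix(2)[OF cg C] mp .
qed

lemma integral_zero_pot_laplacian:
  assumes g: "has_laplacian g G" and z: "\<And>z. R \<le> norm z \<Longrightarrow> g z = 0"
  shows "integrable lborel (\<lambda>z. zero_pot n z * G z)"
    "n > 0 \<Longrightarrow> (LBINT z. zero_pot n z * G z) = 2 * pi / real n * (\<Sum>\<zeta>\<in>zeros (B n). real (order \<zeta> (B n)) * g \<zeta>)"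
proof -
  define p where "p = (if n = 0 then 1 else B n)"
  have p0: "p \<noteq> 0" using B_nz by (simp add: p_def)
  have cG: "continuous_on UNIV G" using g by (rule has_laplacian_continuous')
  have G0: "G z = 0" if "R \<le> norm z" for z by (rule has_laplacian_vanishes[OF g z that])
  define K where "K = 1 / real n * ln (norm (lead_coeff p)) - ln (fact n) / real n"
  define w where "w z = K * G z + 1 / real n * (\<Sum>\<zeta>\<in>zeros p. real (order \<zeta> p) * (ln (norm (z - \<zeta>)) * G z))" for z
  have [measurable]: "G \<in> borel_measurable borel" using cG by (rule borel_measurable_continuous_onI)
  have "AE z in lborel. z \<notin> zeros p" by (rule AE_not_finite[OF finite_zeros[OF p0]])
  then have AE: "AE z in lborel. w z = zero_pot n z * G z"
  proof eventually_elim
    case (elim z)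
    then have "poly p z \<noteq> 0" by (simp add: zeros_def)
    note l = ln_norm_poly[OF this]
    have "zero_pot n z = K + 1 / real n * (\<Sum>\<zeta>\<in>zeros p. real (order \<zeta> p) * ln (norm (z - \<zeta>)))"
      unfolding zero_pot_def p_def[symmetric] l K_def by (simp add: algebra_simps add_divide_distrib)
    then show ?case by (simp add: w_def distrib_right sum_distrib_right mult.assoc)
  qed
  have iG: "integrable lborel G" by (rule integrable_compact_support[OF cG G0])
  have il: "integrable lborel (\<lambda>z. real (order \<zeta> p) * (ln (norm (z - \<zeta>)) * G z))" for \<zeta>
    by (intro Bochner_Integration.integrable_mult_right integrable_ln_times(1)[OF cG G0])
  have isum: "integrable lborel (\<lambda>z. \<Sum>\<zeta>\<in>zeros p. real (order \<zeta> p) * (ln (norm (z - \<zeta>)) * G z))"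
    by (intro Bochner_Integration.integrable_sum il)
  have iK: "integrable lborel (\<lambda>z. K * G z)" using iG by (rule Bochner_Integration.integrable_mult_right)
  have iS: "integrable lborel (\<lambda>z. 1 / real n * (\<Sum>\<zeta>\<in>zeros p. real (order \<zeta> p) * (ln (norm (z - \<zeta>)) * G z)))"
    using isum by (rule Bochner_Integration.integrable_mult_right)
  have iw: "integrable lborel w" unfolding w_def[abs_def] by (rule Bochner_Integration.integrable_add[OF iK iS])
  have zm: "(\<lambda>z. zero_pot n z * G z) \<in> borel_measurable lborel" unfolding zero_pot_def by measurable
  show "integrable lborel (\<lambda>z. zero_pot n z * G z)" by (rule integrable_cong_AE_imp[OF iw zm AE])
  \<comment> \<open>A constant has Laplacian 0, so the leading coefficient and
    \<open>ln (fact n)\<close> leave no trace in the zero measure.\<close>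
  have "(LBINT z. 1 * G z) = (LBINT z. 0 * g z)" by (rule green_identity[OF has_laplacian_const g z])
  then have G00: "(LBINT z. G z) = 0" by simp
  assume n: "n > 0"
  have "(LBINT z. zero_pot n z * G z) = (LBINT z. w z)"
    using AE by (intro integral_cong_AE zm borel_measurable_integrable[OF iw]) (auto elim: eventually_mono)
  also have "\<dots> = (LBINT z. K * G z) + (LBINT z. 1 / real n * (\<Sum>\<zeta>\<in>zeros p. real (order \<zeta> p) * (ln (norm (z - \<zeta>)) * G z)))"
    unfolding w_def by (rule Bochner_Integration.integral_add[OF iK iS])
  also have "\<dots> = 1 / real n * (LBINT z. (\<Sum>\<zeta>\<in>zeros p. real (order \<zeta> p) * (ln (norm (z - \<zeta>)) * G z)))"
    by (simp only: Bochner_Integration.integral_mult_right_zero G00)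
  also have "(LBINT z. (\<Sum>\<zeta>\<in>zeros p. real (order \<zeta> p) * (ln (norm (z - \<zeta>)) * G z)))
      = (\<Sum>\<zeta>\<in>zeros p. \<integral>z. real (order \<zeta> p) * (ln (norm (z - \<zeta>)) * G z) \<partial>lborel)"
    by (rule Bochner_Integration.integral_sum) (rule il)
  also have "\<dots> = (\<Sum>\<zeta>\<in>zeros p. real (order \<zeta> p) * (2 * pi * g \<zeta>))"
    by (simp only: Bochner_Integration.integral_mult_right_zero integral_ln_laplacian[OF g z])
  also have "\<dots> = 2 * pi * (\<Sum>\<zeta>\<in>zeros p. real (order \<zeta> p) * g \<zeta>)" by (simp add: sum_distrib_left mult_ac)
  finally show "(LBINT z. zero_pot n z * G z) = 2 * pi / real n * (\<Sum>\<zeta>\<in>zeros (B n). real (order \<zeta> (B n)) * g \<zeta>)"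
    using n by (simp add: p_def)
qed

text \<open>Dividing by \<open>degree (B n) / n\<close>, which tends to \<open>\<kappa>\<close>,
  converts the normalization of the potentials by \<open>n\<close> into that of the measures by the
  degree.\<close>

lemma integral_mu_tendsto_test:
  assumes g: "has_laplacian g G" and z: "\<And>z. R \<le> norm z \<Longrightarrow> g z = 0"
  shows "(\<lambda>n. \<integral>z. g z \<partial>mu P Q S T n) \<longlonglongrightarrow> (\<integral>z. g z \<partial>\<mu>\<^sub>f)"
proof -
  have cG: "continuous_on UNIV G" using g by (rule has_laplacian_continuous')
  have gm: "g \<in> borel_measurable borel" using has_laplacian_continuous[OF g] by (rule borel_measurable_continuous_onI)
  have G0: "G z = 0" if "R \<le> norm z" for z by (rule has_laplacian_vanishes[OF g z that])
  have zm: "zero_pot n \<in> borel_measurable borel" for n unfolding zero_pot_def[abs_def] by measurable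
  have "(\<lambda>n. \<integral>z. zero_pot n z * G z \<partial>lborel) \<longlonglongrightarrow> (LBINT z. limit_pot z * G z)"
    by (rule integral_tendsto_of_l1_on[OF zero_pot_tendsto_limit_pot cG G0 integral_zero_pot_laplacian(1)[OF g z]
          integral_limit_pot_laplacian(1)[OF g z] zm borel_measurable_limit_pot])
  then have L: "(\<lambda>n. \<integral>z. zero_pot n z * G z \<partial>lborel) \<longlonglongrightarrow> 2 * pi * real \<kappa> * (\<integral>z. g z \<partial>\<mu>\<^sub>f)"
    using integral_limit_pot_laplacian(2)[OF g z] by simp
  have k: "2 * pi * real \<kappa> \<noteq> 0" using kappa_pos by simp
  have "(\<lambda>n. (LBINT z. zero_pot n z * G z) / (2 * pi * (real (degree (B n)) / real n)))
      \<longlonglongrightarrow> 2 * pi * real \<kappa> * (\<integral>z. g z \<partial>\<mu>\<^sub>f) / (2 * pi * real \<kappa>)"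
    by (intro tendsto_divide L tendsto_mult tendsto_const degree_B_tendsto k)
  moreover have "2 * pi * real \<kappa> * (\<integral>z. g z \<partial>\<mu>\<^sub>f) / (2 * pi * real \<kappa>) = (\<integral>z. g z \<partial>\<mu>\<^sub>f)" using k by simp
  moreover have "\<forall>\<^sub>F n in sequentially. (LBINT z. zero_pot n z * G z) / (2 * pi * (real (degree (B n)) / real n)) = (\<integral>z. g z \<partial>mu P Q S T n)"
    using degree_B_pos eventually_gt_at_top[of 0]
  proof eventually_elim
    case (elim n)
    have "(LBINT z. zero_pot n z * G z) = 2 * pi / real n * (\<Sum>\<zeta>\<in>zeros (B n). real (order \<zeta> (B n)) * g \<zeta>)"
      by (rule integral_zero_pot_laplacian(2)[OF g z elim(2)])
    then show ?case using elim(2) unfolding integral_mu[OF gm] by simp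
  qed
  ultimately show ?thesis by (simp only: Lim_transform_eventually)
qed

text \<open>The class of functions vanishing at infinity, larger than that of compact support, is
  what the sphere asks for. The measures \<open>mu\<close> have mass at most 1 and the limit has
  mass \<open>m\<close>, so the uniform error \<open>\<epsilon> = e / (m + 1)\<close> is small
  enough on both sides.\<close>

proposition integral_mu_tendsto:
  fixes g :: "complex \<Rightarrow> real"
  assumes g: "continuous_on UNIV g" "(g \<longlongrightarrow> 0) at_infinity"
  shows "(\<lambda>n. \<integral>z. g z \<partial>mu P Q S T n) \<longlonglongrightarrow> (\<integral>z. g z \<partial>\<mu>\<^sub>f)"
proof (rule integral_tendsto_approximation)
  fix e :: real assume e: "e > 0"
  define m where "m = (\<integral>z. (1 :: real) \<partial>\<mu>\<^sub>f)"
  have m: "m \<ge> 0" unfolding m_def by (rule Bochner_Integration.integral_nonneg) simp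
  define \<epsilon> where "\<epsilon> = e / (m + 1)"
  have \<epsilon>: "\<epsilon> > 0" "\<epsilon> \<le> e" "\<epsilon> * m \<le> e" unfolding \<epsilon>_def using e m by (simp_all add: field_simps)
  obtain q L R where q: "has_laplacian q L" "\<And>z. R \<le> norm z \<Longrightarrow> q z = 0" "\<And>z. \<bar>q z - g z\<bar> \<le> \<epsilon>"
    using approximation_by_test_function[OF g \<epsilon>(1)] by blast
  have cq: "continuous_on UNIV q" using q(1) by (rule has_laplacian_continuous)
  obtain C where C: "\<And>z. \<bar>g z\<bar> \<le> C" using vanishing_at_infinity_bounded[OF g] by blast
  obtain C' where C': "\<And>z. \<bar>q z\<bar> \<le> C'"
    using vanishing_at_infinity_bounded[OF cq compact_support_tendsto[OF q(2)]] by blast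
  show "\<exists>q. (\<lambda>n. \<integral>z. q z \<partial>mu P Q S T n) \<longlonglongrightarrow> (\<integral>z. q z \<partial>\<mu>\<^sub>f) \<and>
    (\<forall>\<^sub>F n in sequentially. \<bar>(\<integral>z. q z \<partial>mu P Q S T n) - (\<integral>z. g z \<partial>mu P Q S T n)\<bar> \<le> e) \<and> \<bar>(\<integral>z. q z \<partial>\<mu>\<^sub>f) - (\<integral>z. g z \<partial>\<mu>\<^sub>f)\<bar> \<le> e"
  proof (intro exI[of _ q] conjI always_eventually allI)
    show "(\<lambda>n. \<integral>z. q z \<partial>mu P Q S T n) \<longlonglongrightarrow> (\<integral>z. q z \<partial>\<mu>\<^sub>f)" by (rule integral_mu_tendsto_test[OF q(1,2)])
    show "\<bar>(\<integral>z. q z \<partial>mu P Q S T n) - (\<integral>z. g z \<partial>mu P Q S T n)\<bar> \<le> e" for n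
    proof -
      have "\<bar>(\<integral>z. q z \<partial>mu P Q S T n) - (\<integral>z. g z \<partial>mu P Q S T n)\<bar> \<le> \<epsilon> * (\<integral>z. 1 \<partial>mu P Q S T n)"
        by (rule integral_uniform_diff[OF finite_mu sets_mu g(1) C cq C' q(3)])
      also have "\<dots> \<le> \<epsilon> * 1" unfolding mass_mu using \<epsilon>(1) by (intro mult_left_mono) (auto simp: divide_le_eq_1)
      finally show ?thesis using \<epsilon>(2) by simp
    qed
    show "\<bar>(\<integral>z. q z \<partial>\<mu>\<^sub>f) - (\<integral>z. g z \<partial>\<mu>\<^sub>f)\<bar> \<le> e"
      using integral_uniform_diff[OF finite_mu_fix sets_mu_fix g(1) C cq C' q(3)] \<epsilon>(3) unfolding m_def by linarith
  qed
qed

lemma continuous_mollifier: "continuous_on UNIV (mollifier (real (Suc n)))"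
  by (rule has_laplacian_continuous[OF has_laplacian_mollifier]) simp

lemma mass_mollifier_tendsto: "(\<lambda>n. \<integral>z. mollifier (real (Suc n)) z \<partial>\<mu>\<^sub>f) \<longlonglongrightarrow> (\<integral>z. 1 \<partial>\<mu>\<^sub>f)"
proof (rule integral_dominated_convergence[OF _ _ finite_measure.integrable_const[OF finite_mu_fix, of 1]])
  have b: "\<bar>mollifier (real (Suc n)) z\<bar> \<le> 1" for n z using mollifier_bounds[of "real (Suc n)" z] by simp
  show "mollifier (real (Suc n)) \<in> borel_measurable \<mu>\<^sub>f" for n
    using integral_mu_fix(1)[OF continuous_mollifier b] by (rule borel_measurable_integrable)
  show "AE z in \<mu>\<^sub>f. norm (mollifier (real (Suc n)) z) \<le> 1" for n using b by simp
qed (use mollifier_tendsto in auto)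

lemma card_sing: "card (sing Q T) = N" unfolding sites_eq[symmetric] using card_image[OF inj] by simp

text \<open>Testing with mollifiers of growing radius gives \<open>degree T\<close> from the point
  masses and \<open>N - 1\<close> from the edges; their sum is
  \<open>degree W - 1 = \<kappa> - h\<close>.\<close>

proposition mass_mu_fix: "real \<kappa> * (\<integral>z. 1 \<partial>\<mu>\<^sub>f) = real \<kappa> - real h"
proof -
  define X where "X n = mollifier (real (Suc n))" for n
  have hm: "has_laplacian (X n) (mollifier_laplacian (real (Suc n)))" for n
    unfolding X_def by (rule has_laplacian_mollifier) simp
  have m0: "X n z = 0" if "real (Suc n) \<le> norm z" for n z
    unfolding X_def by (rule mollifier_eq_0[OF _ that]) simp
  have c: "continuous_on UNIV (X n)" for n using hm by (rule has_laplacian_continuous)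
  have b: "\<bar>X n z\<bar> \<le> 1" for n z unfolding X_def using mollifier_bounds[of "real (Suc n)" z] by simp
  have l: "(\<lambda>n. X n z) \<longlonglongrightarrow> 1" for z unfolding X_def by (rule mollifier_tendsto)
  have "(\<lambda>n. \<integral>z. X n z \<partial>\<mu>\<^sub>f) \<longlonglongrightarrow> (\<integral>z. 1 \<partial>\<mu>\<^sub>f)" unfolding X_def by (rule mass_mollifier_tendsto)
  from tendsto_mult[OF tendsto_const[of "2 * pi * real \<kappa>"] this]
  have L1: "(\<lambda>n. 2 * pi * real \<kappa> * (\<integral>z. X n z \<partial>\<mu>\<^sub>f)) \<longlonglongrightarrow> 2 * pi * real \<kappa> * (\<integral>z. 1 \<partial>\<mu>\<^sub>f)" .
  have "2 * pi * real \<kappa> * (\<integral>z. X n z \<partial>\<mu>\<^sub>f) = 2 * pi * (\<Sum>c\<in>zeros T. real (order c T) * X n c)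
      + (LBINT z. maxpot z * mollifier_laplacian (real (Suc n)) z)" for n
  proof -
    have "(LBINT z. maxpot z * mollifier_laplacian (real (Suc n)) z) = (\<Sum>(i, j)\<in>pairs. \<integral>z. X n z \<partial>edge_measure a N i j)"
      by (rule integral_maxpot_laplacian[OF hm m0])
    then show ?thesis unfolding integral_mu_fix(2)[OF c b] by simp
  qed
  moreover have "(\<lambda>n. 2 * pi * (\<Sum>c\<in>zeros T. real (order c T) * X n c) + (LBINT z. maxpot z * mollifier_laplacian (real (Suc n)) z))
     \<longlonglongrightarrow> 2 * pi * (\<Sum>c\<in>zeros T. real (order c T) * 1) + 2 * pi * real (N - 1)"
    by (intro tendsto_add tendsto_mult tendsto_const tendsto_sum l integral_maxpot_mollifier_tendsto)
  ultimately have "(\<lambda>n. 2 * pi * real \<kappa> * (\<integral>z. X n z \<partial>\<mu>\<^sub>f))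
     \<longlonglongrightarrow> 2 * pi * (\<Sum>c\<in>zeros T. real (order c T) * 1) + 2 * pi * real (N - 1)" by simp
  from LIMSEQ_unique[OF L1 this]
  have "2 * pi * (real \<kappa> * (\<integral>z. 1 \<partial>\<mu>\<^sub>f)) = 2 * pi * (real (\<Sum>c\<in>zeros T. order c T) + real (N - 1))"
    by (simp add: distrib_left mult.assoc)
  then have "real \<kappa> * (\<integral>z. 1 \<partial>\<mu>\<^sub>f) = real (\<Sum>c\<in>zeros T. order c T) + real (N - 1)"
    by (simp only: mult_cancel_left) simp
  also have "\<dots> = real \<kappa> - real h"
    unfolding degree_eq_sum_order[OF T_nz] using kappa_eq degree_W card_sing N by (simp add: of_nat_diff)
  finally show ?thesis .
qed

lemma vaguely_converges_mu: "vaguely_converges (mu P Q S T) \<mu>\<^sub>f"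
proof -
  have f: "emeasure M K < \<infinity>" if "finite_measure M" for M :: "complex measure" and K
    using finite_measure.emeasure_finite[OF that] by (simp add: less_top)
  show ?thesis unfolding vaguely_converges_def
  proof (intro conjI always_eventually allI impI sets_mu sets_mu_fix f finite_mu finite_mu_fix)
    fix g :: "complex \<Rightarrow> real"
    assume g: "continuous_on UNIV g" "compact (closure {z. g z \<noteq> 0})"
    from g(2) obtain R where "\<And>z. R \<le> norm z \<Longrightarrow> g z = 0" unfolding compact_support_iff by blast
    from integral_mu_tendsto[OF g(1) compact_support_tendsto[OF this]] show "(\<lambda>n. integral\<^sup>L (mu P Q S T n) g) \<longlonglongrightarrow> integral\<^sup>L \<mu>\<^sub>f g" .
  qed
qed

text \<open>For \<open>h = 0\<close> the limit has mass 1, like \<open>mu\<close> for large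
  \<open>n\<close>. A mollifier that misses little of the limit mass therefore misses little of
  \<open>mu\<close> for large \<open>n\<close>, so no mass escapes and cutting off \<open>g\<close>
  costs at most \<open>e\<close>.\<close>

lemma weakly_converges_mu:
  assumes h0: "h = 0" shows "weakly_converges (mu P Q S T) \<mu>\<^sub>f" unfolding weakly_converges_def
proof (intro conjI always_eventually allI impI sets_mu sets_mu_fix finite_mu finite_mu_fix)
  fix g :: "complex \<Rightarrow> real"
  assume g: "continuous_on UNIV g" "bounded (range g)"
  from g(2) obtain C where C: "\<And>z. \<bar>g z\<bar> \<le> C" unfolding bounded_iff by auto
  have mf: "(\<integral>z. (1 :: real) \<partial>\<mu>\<^sub>f) = 1" using mass_mu_fix h0 kappa_pos by simp
  show "(\<lambda>n. integral\<^sup>L (mu P Q S T n) g) \<longlonglongrightarrow> integral\<^sup>L \<mu>\<^sub>f g"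
  proof (rule integral_tendsto_approximation)
    fix e :: real assume e: "e > 0"
    have "(\<lambda>k. C * ((\<integral>z. 1 \<partial>\<mu>\<^sub>f) - (\<integral>z. mollifier (real (Suc k)) z \<partial>\<mu>\<^sub>f))) \<longlonglongrightarrow> C * ((\<integral>z. 1 \<partial>\<mu>\<^sub>f) - (\<integral>z. 1 \<partial>\<mu>\<^sub>f))"
      by (intro tendsto_mult tendsto_diff tendsto_const mass_mollifier_tendsto)
    then have "(\<lambda>k. C * ((\<integral>z. 1 \<partial>\<mu>\<^sub>f) - (\<integral>z. mollifier (real (Suc k)) z \<partial>\<mu>\<^sub>f))) \<longlonglongrightarrow> 0" by simp
    from eventually_happens'[OF sequentially_bot order_tendstoD(2)[OF this e]]
    obtain k where k: "C * ((\<integral>z. 1 \<partial>\<mu>\<^sub>f) - (\<integral>z. mollifier (real (Suc k)) z \<partial>\<mu>\<^sub>f)) < e" ..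
    define X where "X = mollifier (real (Suc k))"
    have X: "continuous_on UNIV X" "\<And>z. 0 \<le> X z" "\<And>z. X z \<le> 1" "\<And>z. real (Suc k) \<le> norm z \<Longrightarrow> X z = 0"
      unfolding X_def by (rule continuous_mollifier mollifier_bounds mollifier_eq_0; simp)+
    have "(\<lambda>n. C * ((\<integral>z. 1 \<partial>mu P Q S T n) - (\<integral>z. X z \<partial>mu P Q S T n))) \<longlonglongrightarrow> C * (1 - (\<integral>z. X z \<partial>\<mu>\<^sub>f))"
      by (intro tendsto_mult tendsto_diff tendsto_const mass_mu_tendsto integral_mu_tendsto X compact_support_tendsto[of "real (Suc k)"])
    from order_tendstoD(2)[OF this k[folded X_def, unfolded mf]]
    have ev: "\<forall>\<^sub>F n in sequentially. C * ((\<integral>z. 1 \<partial>mu P Q S T n) - (\<integral>z. X z \<partial>mu P Q S T n)) < e" .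
    have "(\<lambda>n. \<integral>z. g z * X z \<partial>mu P Q S T n) \<longlonglongrightarrow> (\<integral>z. g z * X z \<partial>\<mu>\<^sub>f)"
      by (intro integral_mu_tendsto continuous_on_mult g(1) X(1) compact_support_tendsto[of "real (Suc k)"]) (simp add: X(4))
    moreover have "\<forall>\<^sub>F n in sequentially. \<bar>(\<integral>z. g z * X z \<partial>mu P Q S T n) - (\<integral>z. g z \<partial>mu P Q S T n)\<bar> \<le> e"
      using ev
    proof eventually_elim
      case (elim n)
      then show ?case using integral_cutoff_diff[OF finite_mu sets_mu g(1) C X(1-3), of n] by linarith
    qed
    moreover have "\<bar>(\<integral>z. g z * X z \<partial>\<mu>\<^sub>f) - (\<integral>z. g z \<partial>\<mu>\<^sub>f)\<bar> \<le> e"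
      using integral_cutoff_diff[OF finite_mu_fix sets_mu_fix g(1) C X(1-3)] k unfolding X_def by linarith
    ultimately show "\<exists>q. (\<lambda>n. \<integral>z. q z \<partial>mu P Q S T n) \<longlonglongrightarrow> (\<integral>z. q z \<partial>\<mu>\<^sub>f) \<and>
      (\<forall>\<^sub>F n in sequentially. \<bar>(\<integral>z. q z \<partial>mu P Q S T n) - (\<integral>z. g z \<partial>mu P Q S T n)\<bar> \<le> e) \<and> \<bar>(\<integral>z. q z \<partial>\<mu>\<^sub>f) - (\<integral>z. g z \<partial>\<mu>\<^sub>f)\<bar> \<le> e"
      by blast
  qed
qed

text \<open>Subtracting the value at infinity leaves a function vanishing there, to which the
  convergence in the plane applies; the constant sees only total masses. These are eventually 1
  along the sequence and \<open>1 - h / \<kappa>\<close> for the planar limit, and the atom at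
  \<open>None\<close> makes up the difference.\<close>

lemma sphere_weakly_converges_mu:
  "sphere_weakly_converges (\<lambda>n. sphere_measure (mu P Q S T n)) (mu_fix_sphere Q S T a N)"
proof -
  have sets_sm: "sets (sphere_measure M) = sets sphere_borel" for M by (simp add: sphere_measure_def)
  have some: "Some \<in> M \<rightarrow>\<^sub>M sphere_borel" if "sets M = sets borel" for M
    using measurable_Some_sphere unfolding measurable_cong_sets[OF that refl] .
  have fin: "finite_measure (sphere_measure M)" if "finite_measure M" "sets M = sets borel" for M
    unfolding sphere_measure_def by (rule finite_measure.finite_measure_distr[OF that(1) some[OF that(2)]])
  let ?A = "atomic_measure sphere_borel {None} (\<lambda>_. real h / real \<kappa>)"
  have A: "integrable ?A g" "(\<integral>x. g x \<partial>?A) = real h / real \<kappa> * g None"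
    if "g \<in> borel_measurable sphere_borel" for g :: "complex option \<Rightarrow> real"
    using integral_atomic_measure[OF _ _ _ that, of "{None}" "\<lambda>_. real h / real \<kappa>"] by (simp_all add: space_sphere_borel)
  have st: "sets ?A = sets (sphere_measure \<mu>\<^sub>f)" by (simp add: sets_sm)
  have sf: "sets (mu_fix_sphere Q S T a N) = sets sphere_borel" by (simp add: mu_fix_sphere_def sets_sm)
  have fsf: "finite_measure (mu_fix_sphere Q S T a N)"
  proof (rule finite_measureI_integrable)
    have "integrable (sphere_measure \<mu>\<^sub>f) (\<lambda>_. 1 :: real)"
      by (rule finite_measure.integrable_const[OF fin[OF finite_mu_fix sets_mu_fix]])
    then show "integrable (mu_fix_sphere Q S T a N) (\<lambda>_. 1 :: real)"
      unfolding mu_fix_sphere_def by (rule integral_add_measure(1)[OF st _ A(1)]) simp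
  qed
  have conv: "(\<lambda>n. integral\<^sup>L (sphere_measure (mu P Q S T n)) g) \<longlonglongrightarrow> integral\<^sup>L (mu_fix_sphere Q S T a N) g"
    if g: "continuous_map riemann_sphere euclideanreal g" for g
  proof -
    have gm: "g \<in> borel_measurable sphere_borel" using g by (rule continuous_sphere_measurable)
    define u where "u z = g (Some z) - g None" for z
    have cu: "continuous_on UNIV u" unfolding u_def[abs_def] by (intro continuous_intros continuous_sphere_plane(1)[OF g])
    have ul: "(u \<longlongrightarrow> 0) at_infinity"
      using tendsto_diff[OF continuous_sphere_plane(2)[OF g] tendsto_const[of "g None"]] by (simp add: u_def[abs_def])
    obtain C where uC: "\<And>z. \<bar>u z\<bar> \<le> C" using vanishing_at_infinity_bounded[OF cu ul] by blast
    have int: "integrable (sphere_measure M) g"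
      "integral\<^sup>L (sphere_measure M) g = (\<integral>z. u z \<partial>M) + g None * (\<integral>z. 1 \<partial>M)"
      if M: "finite_measure M" "sets M = sets borel" for M
    proof -
      have iu: "integrable M u" by (rule integrable_continuous_bounded[OF M cu uC])
      have i1: "integrable M (\<lambda>_. g None * 1)" by (rule finite_measure.integrable_const[OF M(1)])
      have e: "g (Some z) = u z + g None * 1" for z by (simp add: u_def)
      show "integrable (sphere_measure M) g"
        unfolding sphere_measure_def by (subst integrable_distr_eq[OF some[OF M(2)] gm]) (unfold e, rule Bochner_Integration.integrable_add[OF iu i1])
      have "integral\<^sup>L (sphere_measure M) g = (\<integral>z. g (Some z) \<partial>M)"
        unfolding sphere_measure_def by (rule integral_distr[OF some[OF M(2)] gm])
      also have "\<dots> = (\<integral>z. u z \<partial>M) + (\<integral>z. g None * 1 \<partial>M)"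
        unfolding e by (rule Bochner_Integration.integral_add[OF iu i1])
      finally show "integral\<^sup>L (sphere_measure M) g = (\<integral>z. u z \<partial>M) + g None * (\<integral>z. 1 \<partial>M)"
        by (simp only: Bochner_Integration.integral_mult_right_zero)
    qed
    have "(\<lambda>n. \<integral>z. u z \<partial>mu P Q S T n) \<longlonglongrightarrow> (\<integral>z. u z \<partial>\<mu>\<^sub>f)" by (rule integral_mu_tendsto[OF cu ul])
    from tendsto_add[OF this tendsto_mult[OF tendsto_const[of "g None"] mass_mu_tendsto]]
    have "(\<lambda>n. integral\<^sup>L (sphere_measure (mu P Q S T n)) g) \<longlonglongrightarrow> (\<integral>z. u z \<partial>\<mu>\<^sub>f) + g None * 1"
      unfolding int(2)[OF finite_mu sets_mu] .
    moreover have "integral\<^sup>L (mu_fix_sphere Q S T a N) g = (\<integral>z. u z \<partial>\<mu>\<^sub>f) + g None * 1"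
    proof -
      have "integral\<^sup>L (mu_fix_sphere Q S T a N) g = (\<integral>z. u z \<partial>\<mu>\<^sub>f) + g None * (\<integral>z. 1 \<partial>\<mu>\<^sub>f) + real h / real \<kappa> * g None"
        unfolding mu_fix_sphere_def integral_add_measure(2)[OF st int(1)[OF finite_mu_fix sets_mu_fix] A(1)[OF gm]]
          int(2)[OF finite_mu_fix sets_mu_fix] A(2)[OF gm] ..
      also have "(\<integral>z. (1 :: real) \<partial>\<mu>\<^sub>f) = 1 - real h / real \<kappa>"
        using mass_mu_fix kappa_pos by (simp add: field_simps)
      finally show ?thesis by (simp add: algebra_simps)
    qed
    ultimately show ?thesis by simp
  qed
  show ?thesis unfolding sphere_weakly_converges_def
    by (intro conjI always_eventually allI impI sets_sm sf fsf fin finite_mu sets_mu conv)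
qed

end

theorem corollary21:
  fixes P Q S T :: "complex poly" and a :: "nat \<Rightarrow> complex" and N :: nat
  assumes "hyperexponential P Q S T"
    and "bij_betw a {1..N} (sing Q T)"
  shows "(\<forall>\<^sub>F n in sequentially. degree (B_poly P Q S T n) > 0 \<and> nu P Q S T n = mu P Q S T n)
    \<and> vaguely_converges (nu P Q S T) (mu_fix Q S T a N)
    \<and> (h_deg S T = 0 \<longrightarrow> weakly_converges (nu P Q S T) (mu_fix Q S T a N))
    \<and> (h_deg S T > 0 \<longrightarrow> sphere_weakly_converges
          (\<lambda>n. sphere_measure (nu P Q S T n)) (mu_fix_sphere Q S T a N))"
proof -
  interpret hyperexponential P Q S T by (rule assms(1))
  have inj: "inj_on a {1..N}" and im: "a ` {1..N} = sing Q T" using assms(2) by (simp_all add: bij_betw_def)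
  have "N \<ge> 1" using card_sing_pos card_image[OF inj] im by (cases N) auto
  then interpret hyperexponential_sites P Q S T a N by unfold_locales (use inj im in auto)
  have nu: "nu P Q S T = mu P Q S T" by (rule ext) (rule nu_eq_mu)
  show ?thesis unfolding nu
    using degree_B_pos vaguely_converges_mu weakly_converges_mu sphere_weakly_converges_mu by simp
qed

end
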